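(* Let $\mathcal{K}$ be a finite connected simplicial complex with $n$ simplices, let $p\ge 0$ be an integer, and let $g=\dim\mathsf{H}_p(\mathcal{K})$ (homology with $\mathbb{Z}_2$ coefficients). After a preprocessing of $\mathcal{K}$ taking $O(n^{\omega})$ time (the computation of an annotation for the $p$-simplices), the following query can be answered: given $p$-cycles $z_1,\dots,z_k$ containing $t$ simplices altogether, a maximal homology independent subset of $\{z_1,\dots,z_k\}$ can be computed in $O(tg+(g+k)g^{\omega-1})$ time.
   Context: All homology is simplicial with $\mathbb{Z}_2$ coefficients. A $p$-cycle is identified with (and given as a list of) the $p$-simplices having coefficient $1$ in it; $t$ is the sum over $i$ of the number of $p$-simplices in $z_i$. A set of $p$-cycles is homology independent if the cycles represent a linearly independent set of homology classes in the $\mathbb{Z}_2$-vector space $\mathsf{H}_p(\mathcal{K})$. Annotation: an annotation for $p$-simplices is a function $\mathrm{a}$ from the set of $p$-simplices of $\mathcal{K}$ to $(\mathbb{Z}_2)^g$ such that any two $p$-cycles $z,z'$ belong to the same homology class if and only if $\sum_{\sigma\in z}\mathrm{a}(\sigma)=\sum_{\sigma\in z'}\mathrm{a}(\sigma)$. $\omega>2$ denotes a real number such that two $n\times n$ matrices (over $\mathbb{Z}_2$) can be multiplied in $O(n^{\omega})$ time. Time is counted in unit-cost elementary operations. *)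

theory Defs
  imports "Jordan_Normal_Form.VS_Connect" "HOL-Library.Z2"
begin

section \<open>Simplicial homology with coefficients in the two-element field\<close>

text \<open>Vertices are natural numbers, because complexes are inputs of a machine.
  A chain is identified with the set of simplices having coefficient 1 in it,
  so addition of chains is symmetric difference.\<close>

definition simplicial_complex :: "nat set set \<Rightarrow> bool" where
  "simplicial_complex K \<longleftrightarrow> finite K \<and> (\<forall>\<sigma>\<in>K. finite \<sigma> \<and> \<sigma> \<noteq> {}) \<and>
     (\<forall>\<sigma>\<in>K. \<forall>\<tau>. \<tau> \<subseteq> \<sigma> \<and> \<tau> \<noteq> {} \<longrightarrow> \<tau> \<in> K)"

definition connected_complex :: "nat set set \<Rightarrow> bool" where
  "connected_complex K \<longleftrightarrow> K \<noteq> {} \<and>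
     (\<forall>u v. {u} \<in> K \<and> {v} \<in> K \<longrightarrow> (u, v) \<in> {(x, y). {x, y} \<in> K}\<^sup>*)"

definition simplices :: "nat set set \<Rightarrow> nat \<Rightarrow> nat set set" where
  "simplices K p = {\<sigma> \<in> K. card \<sigma> = Suc p}"

text \<open>Boundary of a \<open>p\<close>-chain. Since \<open>K\<close> does not contain the empty set,
  the boundary of a 0-chain is zero (unreduced homology).\<close>

definition bd :: "nat set set \<Rightarrow> nat \<Rightarrow> nat set set \<Rightarrow> nat set set" where
  "bd K p c = {\<tau> \<in> K. card \<tau> = p \<and> odd (card {\<sigma> \<in> c. \<tau> \<subseteq> \<sigma>})}"

definition cycles :: "nat set set \<Rightarrow> nat \<Rightarrow> nat set set set" where
  "cycles K p = {z. z \<subseteq> simplices K p \<and> bd K p z = {}}"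

definition boundaries :: "nat set set \<Rightarrow> nat \<Rightarrow> nat set set set" where
  "boundaries K p = bd K (Suc p) ` Pow (simplices K (Suc p))"

definition hom_class :: "nat set set \<Rightarrow> nat \<Rightarrow> nat set set \<Rightarrow> nat set set set" where
  "hom_class K p z = sym_diff z ` boundaries K p"

text \<open>Addition of classes is addition of cosets. The ring multiplication that the
  record type carries along plays no role in a module.\<close>

definition homology :: "nat set set \<Rightarrow> nat \<Rightarrow> (bit, nat set set set) module" where
  "homology K p =
     \<lparr>carrier = hom_class K p ` cycles K p,
      mult = undefined, one = undefined,
      zero = boundaries K p,
      add = (\<lambda>X Y. {sym_diff x y | x y. x \<in> X \<and> y \<in> Y}),
      smult = (\<lambda>c X. if c = 0 then boundaries K p else X)\<rparr>"

definition betti :: "nat set set \<Rightarrow> nat \<Rightarrow> nat" where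
  "betti K p = vectorspace.dim class_ring (homology K p)"

text \<open>Distinct cycles of an independent set have distinct classes: two homologous cycles
  are dependent.\<close>

definition homology_independent :: "nat set set \<Rightarrow> nat \<Rightarrow> nat set set set \<Rightarrow> bool" where
  "homology_independent K p S \<longleftrightarrow>
     S \<subseteq> cycles K p \<and> inj_on (hom_class K p) S \<and>
     \<not> LinearCombinations.module.lin_dep class_ring (homology K p) (hom_class K p ` S)"

definition annotation :: "nat set set \<Rightarrow> nat \<Rightarrow> (nat set \<Rightarrow> bit vec) \<Rightarrow> bool" where
  "annotation K p a \<longleftrightarrow>
     (\<forall>\<sigma>\<in>simplices K p. a \<sigma> \<in> carrier_vec (betti K p)) \<and>
     (\<forall>z\<in>cycles K p. \<forall>z'\<in>cycles K p.
        hom_class K p z = hom_class K p z' \<longleftrightarrow>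
        finsum_vec TYPE(bit) (betti K p) a z = finsum_vec TYPE(bit) (betti K p) a z')"


subsection \<open>The homology classes form a vector space\<close>

lemma odd_card_sym_diff:
  assumes "finite A" "finite B"
  shows "odd (card (sym_diff A B)) \<longleftrightarrow> odd (card A) \<noteq> odd (card B)"
proof -
  have "card (sym_diff A B) = card (A - B) + card (B - A)"
    using assms by (intro card_Un_disjoint) auto
  moreover have "card A = card (A - B) + card (A \<inter> B)"
    using card_Int_Diff[OF assms(1), of B] by simp
  moreover have "card B = card (B - A) + card (A \<inter> B)"
    using card_Int_Diff[OF assms(2), of A] by (simp add: Int_commute)
  ultimately show ?thesis by auto
qed

lemma bd_sym_diff:
  assumes "finite c" "finite d"
  shows "bd K p (sym_diff c d) = sym_diff (bd K p c) (bd K p d)"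
proof -
  have "{\<sigma> \<in> sym_diff c d. \<tau> \<subseteq> \<sigma>} = sym_diff {\<sigma> \<in> c. \<tau> \<subseteq> \<sigma>} {\<sigma> \<in> d. \<tau> \<subseteq> \<sigma>}" for \<tau>
    by blast
  then have "odd (card {\<sigma> \<in> sym_diff c d. \<tau> \<subseteq> \<sigma>}) \<longleftrightarrow>
      odd (card {\<sigma> \<in> c. \<tau> \<subseteq> \<sigma>}) \<noteq> odd (card {\<sigma> \<in> d. \<tau> \<subseteq> \<sigma>})" for \<tau>
    using assms by (simp only: odd_card_sym_diff finite_Collect_conjI Collect_mem_eq simp_thms)
  then show ?thesis unfolding bd_def by blast
qed

lemma finite_simplices: "simplicial_complex K \<Longrightarrow> finite (simplices K p)"
  by (simp add: simplicial_complex_def simplices_def)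

lemma sym_diff_cycles:
  assumes "simplicial_complex K" "x \<in> cycles K p" "y \<in> cycles K p"
  shows "sym_diff x y \<in> cycles K p"
proof -
  have "finite x" "finite y"
    using assms finite_simplices[OF assms(1), of p] by (auto simp: cycles_def intro: finite_subset)
  then have "bd K p (sym_diff x y) = {}"
    using assms by (simp add: cycles_def bd_sym_diff)
  moreover have "sym_diff x y \<subseteq> simplices K p"
    using assms unfolding cycles_def by blast
  ultimately show ?thesis by (simp add: cycles_def)
qed

lemma sym_diff_boundaries:
  assumes "simplicial_complex K" "x \<in> boundaries K p" "y \<in> boundaries K p"
  shows "sym_diff x y \<in> boundaries K p"
proof -
  obtain c d where cd: "c \<subseteq> simplices K (Suc p)" "d \<subseteq> simplices K (Suc p)"
    "x = bd K (Suc p) c" "y = bd K (Suc p) d"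
    using assms by (auto simp: boundaries_def)
  then have "finite c" "finite d"
    using finite_simplices[OF assms(1), of "Suc p"] by (auto intro: finite_subset)
  then have "sym_diff x y = bd K (Suc p) (sym_diff c d)"
    unfolding cd(3,4) by (rule bd_sym_diff[symmetric])
  moreover have "sym_diff c d \<in> Pow (simplices K (Suc p))" using cd(1,2) by blast
  ultimately show ?thesis unfolding boundaries_def by (rule image_eqI)
qed

lemma empty_cycle: "{} \<in> cycles K p"
  by (simp add: cycles_def bd_def)

lemma empty_boundary: "{} \<in> boundaries K p"
proof -
  have "bd K (Suc p) {} = {}" by (simp add: bd_def)
  then show ?thesis unfolding boundaries_def by (metis Pow_bottom imageI)
qed

lemma hom_class_empty: "hom_class K p {} = boundaries K p"
  by (simp add: hom_class_def)

lemma hom_class_add: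
  assumes "simplicial_complex K"
  shows "hom_class K p x \<oplus>\<^bsub>homology K p\<^esub> hom_class K p y = hom_class K p (sym_diff x y)"
proof -
  have "{sym_diff u v | u v. u \<in> hom_class K p x \<and> v \<in> hom_class K p y} =
      hom_class K p (sym_diff x y)" (is "?L = ?R")
  proof
    show "?L \<subseteq> ?R"
    proof
      fix w assume "w \<in> ?L"
      then obtain u v where w: "w = sym_diff u v"
        and uv: "u \<in> hom_class K p x" "v \<in> hom_class K p y"
        by (elim CollectE exE conjE)
      from uv(1) obtain b where b: "u = sym_diff x b" "b \<in> boundaries K p"
        unfolding hom_class_def by (rule imageE)
      from uv(2) obtain c where c: "v = sym_diff y c" "c \<in> boundaries K p"
        unfolding hom_class_def by (rule imageE)
      have "w = sym_diff (sym_diff x y) (sym_diff b c)" unfolding w b(1) c(1) by blast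
      then show "w \<in> ?R"
        unfolding hom_class_def using sym_diff_boundaries[OF assms b(2) c(2)] by (rule image_eqI)
    qed
    show "?R \<subseteq> ?L"
    proof
      fix w assume "w \<in> ?R"
      then obtain b where b: "w = sym_diff (sym_diff x y) b" "b \<in> boundaries K p"
        unfolding hom_class_def by (rule imageE)
      have w: "w = sym_diff (sym_diff x b) (sym_diff y {})" unfolding b(1) by blast
      have "sym_diff x b \<in> hom_class K p x" "sym_diff y {} \<in> hom_class K p y"
        unfolding hom_class_def by (rule imageI, rule b(2), rule imageI, rule empty_boundary)
      then show "w \<in> ?L" using w by (intro CollectI exI conjI)
    qed
  qed
  then show ?thesis by (simp only: homology_def ring_record_simps)
qed

lemma vectorspace_homology:
  assumes K: "simplicial_complex K"
  shows "vectorspace class_ring (homology K p)"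
proof -
  let ?H = "homology K p" and ?h = "hom_class K p"
  have carr: "carrier ?H = ?h ` cycles K p" by (simp add: homology_def)
  have zero: "\<zero>\<^bsub>?H\<^esub> = ?h {}" by (simp add: homology_def hom_class_empty)
  note add = hom_class_add[OF K, of p]
  have grp: "abelian_group ?H"
  proof (rule abelian_groupI)
    show "\<zero>\<^bsub>?H\<^esub> \<in> carrier ?H" unfolding carr zero by (rule imageI) (rule empty_cycle)
  next
    fix X assume "X \<in> carrier ?H"
    then obtain x where x: "x \<in> cycles K p" "X = ?h x" unfolding carr by blast
    show "\<zero>\<^bsub>?H\<^esub> \<oplus>\<^bsub>?H\<^esub> X = X" unfolding zero x(2) add by simp
    have "X \<oplus>\<^bsub>?H\<^esub> X = \<zero>\<^bsub>?H\<^esub>" unfolding x(2) add zero by simp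
    then show "\<exists>Y\<in>carrier ?H. Y \<oplus>\<^bsub>?H\<^esub> X = \<zero>\<^bsub>?H\<^esub>" using \<open>X \<in> carrier ?H\<close> by blast
  next
    fix X Y assume "X \<in> carrier ?H" "Y \<in> carrier ?H"
    then obtain x y where xy: "x \<in> cycles K p" "X = ?h x" "y \<in> cycles K p" "Y = ?h y"
      unfolding carr by blast
    show "X \<oplus>\<^bsub>?H\<^esub> Y \<in> carrier ?H"
      unfolding carr xy(2,4) add using xy(1,3) by (intro imageI sym_diff_cycles[OF K])
    show "X \<oplus>\<^bsub>?H\<^esub> Y = Y \<oplus>\<^bsub>?H\<^esub> X" unfolding xy(2,4) add by (simp only: Un_commute)
  next
    fix X Y Z assume "X \<in> carrier ?H" "Y \<in> carrier ?H" "Z \<in> carrier ?H"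
    then obtain x y z where xyz: "X = ?h x" "Y = ?h y" "Z = ?h z" unfolding carr by blast
    have "sym_diff (sym_diff x y) z = sym_diff x (sym_diff y z)" by blast
    then show "X \<oplus>\<^bsub>?H\<^esub> Y \<oplus>\<^bsub>?H\<^esub> Z = X \<oplus>\<^bsub>?H\<^esub> (Y \<oplus>\<^bsub>?H\<^esub> Z)"
      unfolding xyz add by (rule arg_cong)
  qed
  interpret H: abelian_group ?H by (rule grp)
  have self: "X \<oplus>\<^bsub>?H\<^esub> X = \<zero>\<^bsub>?H\<^esub>" if X: "X \<in> carrier ?H" for X
  proof -
    obtain x where "X = ?h x" using X unfolding carr by blast
    then show ?thesis unfolding zero by (simp only: add Diff_cancel Un_empty_left)
  qed
  have sm: "c \<odot>\<^bsub>?H\<^esub> X = (if c = 0 then \<zero>\<^bsub>?H\<^esub> else X)" for c X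
    by (simp add: homology_def)
  have fld: "field (class_ring :: bit ring)" by (rule class_field.field_axioms)
  then have cr: "cring (class_ring :: bit ring)" by (simp add: field_def domain_def)
  have "module (class_ring :: bit ring) ?H"
  proof (rule moduleI[OF cr grp])
    fix c d :: bit and X Y assume XY: "X \<in> carrier ?H" "Y \<in> carrier ?H"
    show "c \<odot>\<^bsub>?H\<^esub> X \<in> carrier ?H"
      using XY by (simp add: sm)
    show "(c \<oplus>\<^bsub>class_ring\<^esub> d) \<odot>\<^bsub>?H\<^esub> X = c \<odot>\<^bsub>?H\<^esub> X \<oplus>\<^bsub>?H\<^esub> d \<odot>\<^bsub>?H\<^esub> X"
      using XY by (cases c; cases d) (simp_all add: sm self)
    show "c \<odot>\<^bsub>?H\<^esub> (X \<oplus>\<^bsub>?H\<^esub> Y) = c \<odot>\<^bsub>?H\<^esub> X \<oplus>\<^bsub>?H\<^esub> c \<odot>\<^bsub>?H\<^esub> Y"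
      using XY by (simp add: sm)
    show "(c \<otimes>\<^bsub>class_ring\<^esub> d) \<odot>\<^bsub>?H\<^esub> X = c \<odot>\<^bsub>?H\<^esub> (d \<odot>\<^bsub>?H\<^esub> X)"
      by (cases c; cases d) (simp_all add: sm)
    show "\<one>\<^bsub>class_ring\<^esub> \<odot>\<^bsub>?H\<^esub> X = X" by (simp add: sm)
  qed
  then show ?thesis using fld by (simp add: vectorspace_def)
qed


section \<open>Machine model\<close>

text \<open>A word RAM with a structured control flow: finitely many registers and arrays are
  named by a program, array cells are addressed by computed indices. Every occurrence of a
  constant, register, array access or operator, and every command or test executed, costs
  one time unit. In \<open>exec W c s t s'\<close> the number \<open>W\<close> is the largest value a machine word can
  hold: the execution of \<open>c\<close> from \<open>s\<close> ends in \<open>s'\<close> after \<open>t\<close> time units, and all values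
  computed on the way are at most \<open>W\<close>; on overflow there is no execution. Without such a
  bound, unit-cost arithmetic on huge numbers would count as an elementary operation.\<close>

datatype binop = Add | Sub | Mul | Quo | Rem | Less | Eq

datatype expr = Const nat | Reg nat | Cell nat expr | Bin binop expr expr

datatype com =
    Skip
  | Assign nat expr
  | Store nat expr expr
  | Seq com com
  | If expr com com
  | While expr com

record ram =
  reg :: "nat \<Rightarrow> nat"
  arr :: "nat \<Rightarrow> nat \<Rightarrow> nat"

fun apply_op :: "binop \<Rightarrow> nat \<Rightarrow> nat \<Rightarrow> nat" where
  "apply_op Add x y = x + y"
| "apply_op Sub x y = x - y"
| "apply_op Mul x y = x * y"
| "apply_op Quo x y = x div y"
| "apply_op Rem x y = x mod y"
| "apply_op Less x y = of_bool (x < y)"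
| "apply_op Eq x y = of_bool (x = y)"

fun val :: "ram \<Rightarrow> expr \<Rightarrow> nat" where
  "val s (Const k) = k"
| "val s (Reg r) = reg s r"
| "val s (Cell a e) = arr s a (val s e)"
| "val s (Bin f e1 e2) = apply_op f (val s e1) (val s e2)"

fun fits :: "nat \<Rightarrow> ram \<Rightarrow> expr \<Rightarrow> bool" where
  "fits W s (Const k) \<longleftrightarrow> k \<le> W"
| "fits W s (Reg r) \<longleftrightarrow> reg s r \<le> W"
| "fits W s (Cell a e) \<longleftrightarrow> fits W s e \<and> val s (Cell a e) \<le> W"
| "fits W s (Bin f e1 e2) \<longleftrightarrow> fits W s e1 \<and> fits W s e2 \<and> val s (Bin f e1 e2) \<le> W"

fun cost :: "expr \<Rightarrow> nat" where
  "cost (Const k) = 1"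
| "cost (Reg r) = 1"
| "cost (Cell a e) = 1 + cost e"
| "cost (Bin f e1 e2) = 1 + cost e1 + cost e2"

inductive exec :: "nat \<Rightarrow> com \<Rightarrow> ram \<Rightarrow> nat \<Rightarrow> ram \<Rightarrow> bool" for W where
  Skip: "exec W Skip s 1 s"
| Assign: "fits W s e \<Longrightarrow>
    exec W (Assign r e) s (1 + cost e) (s\<lparr>reg := (reg s)(r := val s e)\<rparr>)"
| Store: "fits W s i \<Longrightarrow> fits W s e \<Longrightarrow>
    exec W (Store a i e) s (1 + cost i + cost e)
      (s\<lparr>arr := (arr s)(a := (arr s a)(val s i := val s e))\<rparr>)"
| Seq: "exec W c1 s t1 s1 \<Longrightarrow> exec W c2 s1 t2 s2 \<Longrightarrow> exec W (Seq c1 c2) s (t1 + t2) s2"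
| IfTrue: "fits W s e \<Longrightarrow> val s e \<noteq> 0 \<Longrightarrow> exec W c1 s t s' \<Longrightarrow>
    exec W (If e c1 c2) s (1 + cost e + t) s'"
| IfFalse: "fits W s e \<Longrightarrow> val s e = 0 \<Longrightarrow> exec W c2 s t s' \<Longrightarrow>
    exec W (If e c1 c2) s (1 + cost e + t) s'"
| WhileFalse: "fits W s e \<Longrightarrow> val s e = 0 \<Longrightarrow> exec W (While e c) s (1 + cost e) s"
| WhileTrue: "fits W s e \<Longrightarrow> val s e \<noteq> 0 \<Longrightarrow> exec W c s t1 s1 \<Longrightarrow>
    exec W (While e c) s1 t2 s2 \<Longrightarrow> exec W (While e c) s (1 + cost e + t1 + t2) s2"

text \<open>The input lists are loaded into the arrays 1, 2, \dots; all other memory is zero.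
  The output is left in array 0.\<close>

definition init :: "nat list list \<Rightarrow> ram" where
  "init ins = \<lparr>reg = (\<lambda>_. 0),
     arr = (\<lambda>a i. if 1 \<le> a \<and> a \<le> length ins \<and> i < length (ins ! (a - 1))
                 then ins ! (a - 1) ! i else 0)\<rparr>"

text \<open>A polynomial bound on the word values in terms of the number and the size of the input
  words means words of logarithmically many bits. \<open>input_size\<close> is polynomially related
  to the maximum of the number of input words and their values.\<close>

definition input_size :: "nat list list \<Rightarrow> nat" where
  "input_size ins = (\<Sum>x\<leftarrow>concat ins. Suc x)"

definition computes_within ::
    "com \<Rightarrow> nat \<Rightarrow> nat list list \<Rightarrow> real \<Rightarrow> nat list \<Rightarrow> bool" where
  "computes_within c C ins T out \<longleftrightarrow>
     (\<exists>t s. exec (C * input_size ins ^ C) c (init ins) t s \<and> real t \<le> T \<and>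
        (\<forall>i<length out. arr s 0 i = out ! i))"


section \<open>Encodings of inputs and outputs\<close>

definition bit_code :: "bit \<Rightarrow> nat" where
  "bit_code b = (if b = 1 then 1 else 0)"

definition vec_code :: "bit vec \<Rightarrow> nat list" where
  "vec_code v = map bit_code (list_of_vec v)"

text \<open>Row-major order.\<close>

definition mat_code :: "bit mat \<Rightarrow> nat list" where
  "mat_code A = concat (map vec_code (rows A))"

definition matrix_mult_in_time :: "real \<Rightarrow> bool" where
  "matrix_mult_in_time \<omega> \<longleftrightarrow> (\<exists>c C. \<forall>n\<ge>1. \<forall>A\<in>carrier_mat n n. \<forall>B\<in>carrier_mat n n.
     computes_within c C [[n], mat_code A, mat_code B] (real C * real n powr \<omega>) (mat_code (A * B)))"

text \<open>A complex is given by an enumeration \<open>\<sigma>s\<close> of its simplices, each as the list of its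
  vertices. From then on a simplex is represented by its position in the enumeration.\<close>

definition complex_input :: "nat \<Rightarrow> nat set list \<Rightarrow> nat list list" where
  "complex_input p \<sigma>s =
     [[p, length \<sigma>s], concat (map (\<lambda>\<sigma>. card \<sigma> # sorted_list_of_set \<sigma>) \<sigma>s)]"

text \<open>The number \<open>g\<close> followed by a table with \<open>g\<close> bits for each simplex, where
  the entries for simplices of dimension other than \<open>p\<close> are zero.\<close>

definition annotation_code ::
    "nat \<Rightarrow> nat \<Rightarrow> nat set list \<Rightarrow> (nat set \<Rightarrow> bit vec) \<Rightarrow> nat list" where
  "annotation_code g p \<sigma>s a =
     g # concat (map (\<lambda>\<sigma>. if card \<sigma> = Suc p then vec_code (a \<sigma>) else replicate g 0) \<sigma>s)"

text \<open>Lists are stored with their length in front.\<close>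

definition list_code :: "nat list \<Rightarrow> nat list" where
  "list_code xs = length xs # xs"

definition query_code :: "nat list list \<Rightarrow> nat list" where
  "query_code zs = length zs # concat (map list_code zs)"

definition chain_of :: "nat set list \<Rightarrow> nat list \<Rightarrow> nat set set" where
  "chain_of \<sigma>s is = (!) \<sigma>s ` set is"

text \<open>\<open>zs\<close> is a list of \<open>p\<close>-cycles, each given as a repetition-free list of \<open>p\<close>-simplices.\<close>

definition valid_query :: "nat set set \<Rightarrow> nat \<Rightarrow> nat set list \<Rightarrow> nat list list \<Rightarrow> bool" where
  "valid_query K p \<sigma>s zs \<longleftrightarrow>
     (\<forall>is\<in>set zs. distinct is \<and> set is \<subseteq> {..<length \<sigma>s} \<and> chain_of \<sigma>s is \<in> cycles K p)"

text \<open>The list \<open>js\<close> of positions in \<open>zs\<close> lists, without repetition, a maximal homology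
  independent subset of the given cycles.\<close>

definition correct_answer ::
    "nat set set \<Rightarrow> nat \<Rightarrow> nat set list \<Rightarrow> nat list list \<Rightarrow> nat list \<Rightarrow> bool" where
  "correct_answer K p \<sigma>s zs js \<longleftrightarrow>
     (let z = (\<lambda>j. chain_of \<sigma>s (zs ! j)) in
      set js \<subseteq> {..<length zs} \<and> distinct (map z js) \<and>
      maximal (z ` set js) (\<lambda>S. S \<subseteq> z ` {..<length zs} \<and> homology_independent K p S))"

end

theory Submission
  imports Defs
begin

text \<open>Gauss-Jordan elimination of an \<open>N\<close> by \<open>N\<close> matrix is organised by recursion on halves of
  column blocks. When a block of \<open>m\<close> columns has been eliminated, the next \<open>m\<close> columns are brought
  up to date by \<open>N / m\<close> products of \<open>m\<close> by \<open>m\<close> matrices. The blocks of size \<open>m\<close> cost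
  \<open>(N / m)\<^sup>2 m\<^sup>\<omega>\<close> in total, and since \<open>\<omega> > 2\<close> these costs form a geometric series with sum
  \<open>O(N\<^sup>\<omega>)\<close>.

  Let \<open>F\<close> be the set of non-pivot columns of the boundary matrix of the \<open>p\<close>-simplices. A
  \<open>p\<close>-cycle is determined by its coefficients in \<open>F\<close>, and these are arbitrary. Hence the cokernel
  of the next boundary matrix, restricted to the rows in \<open>F\<close>, is the homology: if \<open>U\<close> transforms
  the restricted matrix into reduced form, the annotation of the simplex \<open>j \<in> F\<close> consists of the
  entries of the column \<open>j\<close> of \<open>U\<close> in the non-pivot rows, and the annotation of all other simplices
  is zero. Setting up the boundary matrices costs a factor \<open>p\<close> in addition to \<open>n\<^sup>2\<close>, which is
  absorbed because a complex with a \<open>p\<close>-simplex has at least \<open>2\<^sup>p\<close> simplices.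

  A query sums the annotations over each cycle, and then maintains a basis, of at most \<open>g\<close> cycles,
  of the span of the cycles seen so far. Each of the \<open>\<lfloor>k / g\<rfloor> + 1\<close> rounds eliminates a matrix
  formed by the basis and the next \<open>g\<close> cycles. The pivot columns are the new basis.\<close>

text \<open>The only fast operation available is the product of two square matrices, through a
  program known solely by its input, output and time. Clearing a column as soon as its pivot is
  found is a rank-one change and involves no product, so pivots act lazily: they accumulate in a
  stored transformation, and a column receives a whole batch of them at once. A batch of m columns
  is an N by m times m by m product; cutting the N rows into blocks of m makes the factors square,
  which is why N is a power of two. All operations multiply from the left by an invertible U. This
  keeps the linear relations among the columns, so the pivot columns are a basis of the original
  column space, and the entries of U y outside the pivot rows are coordinates on the cokernel. The
  annotation consists of entries of U, so it is U that must survive the elimination, not the reduced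
  matrix. Overflow means that there is no execution. Hence time, result and absence of overflow are
  proved together, and the program lemmas carry lower bounds on \<open>W\<close>.\<close>

section \<open>Program verification on the word RAM\<close>

text \<open>\<open>t\<close> is the time elapsed before \<open>c\<close> starts, and \<open>Q\<close> receives the time elapsed at its end.\<close>

definition wp :: "nat \<Rightarrow> com \<Rightarrow> (ram \<Rightarrow> nat \<Rightarrow> bool) \<Rightarrow> ram \<Rightarrow> nat \<Rightarrow> bool" where
  "wp W c Q s t \<longleftrightarrow> (\<exists>t' s'. exec W c s t' s' \<and> Q s' (t + t'))"

lemma wp_Skip: "Q s (t + 1) \<Longrightarrow> wp W Skip Q s t"
  unfolding wp_def using exec.Skip by blast

lemma wp_Assign:
  "\<lbrakk>fits W s e; Q (s\<lparr>reg := (reg s)(r := val s e)\<rparr>) (t + (1 + cost e))\<rbrakk> \<Longrightarrow> wp W (Assign r e) Q s t"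
  unfolding wp_def using exec.Assign by blast

lemma wp_Store:
  "\<lbrakk>fits W s i; fits W s e;
    Q (s\<lparr>arr := (arr s)(a := (arr s a)(val s i := val s e))\<rparr>) (t + (1 + cost i + cost e))\<rbrakk>
   \<Longrightarrow> wp W (Store a i e) Q s t"
  unfolding wp_def using exec.Store by blast

lemma wp_Seq: "wp W c1 (wp W c2 Q) s t \<Longrightarrow> wp W (Seq c1 c2) Q s t"
  unfolding wp_def by (metis add.assoc exec.Seq)

lemma wp_If:
  assumes "fits W s e"
    and "val s e \<noteq> 0 \<Longrightarrow> wp W c1 Q s (t + (1 + cost e))"
    and "val s e = 0 \<Longrightarrow> wp W c2 Q s (t + (1 + cost e))"
  shows "wp W (If e c1 c2) Q s t"
proof (cases "val s e = 0")
  case True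
  from assms(3)[OF True] obtain t' s' where "exec W c2 s t' s'" "Q s' (t + (1 + cost e) + t')"
    unfolding wp_def by blast
  then show ?thesis unfolding wp_def using exec.IfFalse[OF assms(1) True] by (metis add.assoc)
next
  case False
  from assms(2)[OF False] obtain t' s' where "exec W c1 s t' s'" "Q s' (t + (1 + cost e) + t')"
    unfolding wp_def by blast
  then show ?thesis unfolding wp_def using exec.IfTrue[OF assms(1) False] by (metis add.assoc)
qed

lemma wp_While_done:
  "\<lbrakk>fits W s e; val s e = 0; Q s (t + (1 + cost e))\<rbrakk> \<Longrightarrow> wp W (While e c) Q s t"
  unfolding wp_def using exec.WhileFalse by blast

lemma wp_While_step:
  assumes "fits W s e" "val s e \<noteq> 0" "wp W c (wp W (While e c) Q) s (t + (1 + cost e))"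
  shows "wp W (While e c) Q s t"
proof -
  obtain t1 s1 t2 s2 where "exec W c s t1 s1" "exec W (While e c) s1 t2 s2"
    "Q s2 (t + (1 + cost e) + t1 + t2)"
    using assms(3) unfolding wp_def by blast
  moreover have "t + (1 + cost e) + t1 + t2 = t + (1 + cost e + t1 + t2)" by simp
  ultimately show ?thesis unfolding wp_def using exec.WhileTrue[OF assms(1,2)] by metis
qed

lemma wp_mono: "\<lbrakk>wp W c Q s t; \<And>s' t'. Q s' t' \<Longrightarrow> Q' s' t'\<rbrakk> \<Longrightarrow> wp W c Q' s t"
  unfolding wp_def by blast

text \<open>The word bound of a run depends on its input. This brings all runs of the multiplication
  program on matrices of one size under a bound that depends on the size only.\<close>

lemma exec_mono_word:
  assumes "exec W c s t s'" "W \<le> W'" shows "exec W' c s t s'"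
proof -
  have f: "fits W s e \<Longrightarrow> fits W' s e" for s e
    by (induction e) (use assms(2) in auto)
  from assms(1) show ?thesis
    by induction (blast intro: exec.intros f)+
qed

subsection \<open>Frames\<close>

fun wregs :: "com \<Rightarrow> nat set" where
  "wregs Skip = {}"
| "wregs (Assign r e) = {r}"
| "wregs (Store a i e) = {}"
| "wregs (Seq c1 c2) = wregs c1 \<union> wregs c2"
| "wregs (If e c1 c2) = wregs c1 \<union> wregs c2"
| "wregs (While e c) = wregs c"

fun warrs :: "com \<Rightarrow> nat set" where
  "warrs Skip = {}"
| "warrs (Assign r e) = {}"
| "warrs (Store a i e) = {a}"
| "warrs (Seq c1 c2) = warrs c1 \<union> warrs c2"
| "warrs (If e c1 c2) = warrs c1 \<union> warrs c2"
| "warrs (While e c) = warrs c"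

definition agree :: "nat set \<Rightarrow> nat set \<Rightarrow> ram \<Rightarrow> ram \<Rightarrow> bool" where
  "agree R A s s' \<longleftrightarrow> (\<forall>r. r \<notin> R \<longrightarrow> reg s' r = reg s r) \<and> (\<forall>a. a \<notin> A \<longrightarrow> arr s' a = arr s a)"

lemma agree_mono: "\<lbrakk>agree R A s s'; R \<subseteq> R'; A \<subseteq> A'\<rbrakk> \<Longrightarrow> agree R' A' s s'"
  unfolding agree_def by blast

lemma agree_trans: "\<lbrakk>agree R A s s'; agree R A s' s''\<rbrakk> \<Longrightarrow> agree R A s s''"
  by (simp add: agree_def)

lemma exec_agree: "exec W c s t s' \<Longrightarrow> agree (wregs c) (warrs c) s s'"
  by (induction rule: exec.induct) (auto simp: agree_def)

text \<open>A run can change only memory that its program text names as a target. Postconditions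
  therefore describe what is written, and everything else is recovered through \<open>agree\<close>
  from the syntax.\<close>

lemma wp_frame:
  "wp W c (\<lambda>s' t'. agree (wregs c) (warrs c) s s' \<longrightarrow> Q s' t') s t \<Longrightarrow> wp W c Q s t"
  unfolding wp_def using exec_agree by blast

subsection \<open>Counting loops\<close>

definition For :: "nat \<Rightarrow> nat \<Rightarrow> com \<Rightarrow> com" where
  "For r b c = Seq (Assign r (Const 0))
     (While (Bin Less (Reg r) (Reg b)) (Seq c (Assign r (Bin Add (Reg r) (Const 1)))))"

lemma wregs_For [simp]: "wregs (For r b c) = insert r (wregs c)"
  and warrs_For [simp]: "warrs (For r b c) = warrs c"
  by (auto simp: For_def)

text \<open>Each round costs 4 for the test and 4 for the increment besides \<open>B i\<close>; the
  initial assignment and the final test add 2 and 4. \<open>Ireg\<close> lets the invariant survive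
  the increment, which happens after the body has already established
  \<open>I (Suc i)\<close>.\<close>

lemma wp_For_sum:
  assumes b: "reg s b = n" "r \<noteq> b" "r \<notin> wregs c" "b \<notin> wregs c" "n \<le> W" "1 \<le> W"
    and I0: "I 0 s"
    and Ireg: "\<And>i s' x. I i s' \<Longrightarrow> I i (s'\<lparr>reg := (reg s')(r := x)\<rparr>)"
    and body: "\<And>i s1 t1. \<lbrakk>i < n; agree (insert r (wregs c)) (warrs c) s s1; reg s1 r = i; I i s1\<rbrakk>
      \<Longrightarrow> wp W c (\<lambda>s2 t2. I (Suc i) s2 \<and> t2 \<le> t1 + B i) s1 t1"
    and Q: "\<And>s' t'. \<lbrakk>agree (insert r (wregs c)) (warrs c) s s'; reg s' r = n; I n s';
        t' \<le> t + (\<Sum>i<n. B i + 8) + 6\<rbrakk> \<Longrightarrow> Q s' t'"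
  shows "wp W (For r b c) Q s t"
proof -
  let ?R = "insert r (wregs c)" and ?A = "warrs c"
  let ?g = "Bin Less (Reg r) (Reg b)" and ?c = "Seq c (Assign r (Bin Add (Reg r) (Const 1)))"
  have loop: "wp W (While ?g ?c) Q s1 t1"
    if "agree ?R ?A s s1" "reg s1 r = i" "I i s1" "t1 \<le> t + (\<Sum>i<i. B i + 8) + 2" "i \<le> n" for i s1 t1
    using that
  proof (induction "n - i" arbitrary: i s1 t1)
    case 0
    then have "i = n" by simp
    moreover have "reg s1 b = n" using 0 b by (simp add: agree_def)
    ultimately show ?case using 0 b by (intro wp_While_done Q) auto
  next
    case (Suc d)
    then have i: "i < n" by simp
    have rb: "reg s1 b = n" using Suc b by (simp add: agree_def)
    show ?case
    proof (rule wp_While_step)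
      show "fits W s1 ?g" "val s1 ?g \<noteq> 0" using Suc.prems b i rb by auto
      have w: "wp W c (\<lambda>s2 t2. I (Suc i) s2 \<and> t2 \<le> (t1 + (1 + cost ?g)) + B i) s1 (t1 + (1 + cost ?g))"
        using body[OF i Suc.prems(1-3)] .
      show "wp W ?c (wp W (While ?g ?c) Q) s1 (t1 + (1 + cost ?g))"
      proof (rule wp_Seq, rule wp_frame, rule wp_mono[OF w], intro impI)
        fix s2 t2 assume 2: "I (Suc i) s2 \<and> t2 \<le> (t1 + (1 + cost ?g)) + B i"
          and a: "agree (wregs c) (warrs c) s1 s2"
        have r2: "reg s2 r = i" using a b Suc.prems by (simp add: agree_def)
        have a2: "agree ?R ?A s s2"
          using a Suc.prems(1) by (auto simp: agree_def)
        show "wp W (Assign r (Bin Add (Reg r) (Const 1))) (wp W (While ?g ?c) Q) s2 t2"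
        proof (rule wp_Assign)
          show "fits W s2 (Bin Add (Reg r) (Const 1))" using r2 i b by simp
          show "wp W (While ?g ?c) Q
              (s2\<lparr>reg := (reg s2)(r := val s2 (Bin Add (Reg r) (Const 1)))\<rparr>)
              (t2 + (1 + cost (Bin Add (Reg r) (Const 1))))"
            by (rule Suc.hyps(1)[of "Suc i"])
               (use 2 a2 Ireg Suc r2 i in \<open>auto simp: agree_def\<close>)
        qed
      qed
    qed
  qed
  show ?thesis unfolding For_def
    by (rule wp_Seq, rule wp_Assign, simp, rule loop[of _ 0]) (auto simp: agree_def I0 Ireg)
qed

lemmas wp_For = wp_For_sum[where B = "\<lambda>_. B" for B, unfolded sum_constant card_lessThan of_nat_id]

text \<open>When entry (i, j) is computed, its target cell still has its initial value, since
  \<open>idx\<close> is injective and no earlier round wrote there. The hypothesis \<open>ev\<close>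
  may use this, so the rule also covers updates in place. A row adds 6 for its inner loop and 8 for
  the outer round, hence the 14.\<close>

lemma wp_For_fill:
  assumes r: "reg s rR = R" "reg s rS = S" "ri \<noteq> rj \<and> ri \<notin> {rR, rS} \<and> rj \<notin> {rR, rS}" "R \<le> W" "S \<le> W" "1 \<le> W"
    and idx: "inj_on (\<lambda>(i, j). idx i j) ({..<R} \<times> {..<S})"
    and ev: "\<And>s1 i j. \<lbrakk>agree {ri, rj} {A} s s1; reg s1 ri = i; reg s1 rj = j; i < R; j < S;
        arr s1 A (idx i j) = arr s A (idx i j)\<rbrakk>
      \<Longrightarrow> val s1 e = idx i j \<and> val s1 f = v i j \<and> fits W s1 e \<and> fits W s1 f"
    and Q: "\<And>s' t'. \<lbrakk>agree {ri, rj} {A} s s'; \<And>i j. \<lbrakk>i < R; j < S\<rbrakk> \<Longrightarrow> arr s' A (idx i j) = v i j;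
        \<And>x. (\<And>i j. \<lbrakk>i < R; j < S\<rbrakk> \<Longrightarrow> x \<noteq> idx i j) \<Longrightarrow> arr s' A x = arr s A x;
        t' \<le> t + R * (S * (cost e + cost f + 9) + 14) + 6\<rbrakk> \<Longrightarrow> Q s' t'"
  shows "wp W (For ri rR (For rj rS (Store A e f))) Q s t"
proof -
  define F where "F D (s' :: ram) \<longleftrightarrow> (\<forall>(i, j)\<in>D. arr s' A (idx i j) = v i j) \<and>
      (\<forall>x. x \<notin> (\<lambda>(i, j). idx i j) ` D \<longrightarrow> arr s' A x = arr s A x)" for D s'
  define B where "B = S * (cost e + cost f + 9) + 6"
  have F_reg: "F D (s'\<lparr>reg := q\<rparr>) \<longleftrightarrow> F D s'" for D s' q by (simp add: F_def)
  \<comment> \<open>The index pairs already visited when the loops are at (i, j).\<close>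
  let ?D = "\<lambda>i j. {..<i} \<times> {..<S} \<union> {i} \<times> {..<j}"
  have "wp W (For ri rR (For rj rS (Store A e f))) (\<lambda>s' t'. Q s' t') s t"
  proof (rule wp_For[where I = "\<lambda>i. F ({..<i} \<times> {..<S})" and B = B])
    show "F ({..<0} \<times> {..<S}) s" by (simp add: F_def)
    fix i s1 t1
    assume i: "i < R" and a: "agree (insert ri (wregs (For rj rS (Store A e f)))) (warrs (For rj rS (Store A e f))) s s1"
      "reg s1 ri = i" and F1: "F ({..<i} \<times> {..<S}) s1"
    show "wp W (For rj rS (Store A e f)) (\<lambda>s2 t2. F ({..<Suc i} \<times> {..<S}) s2 \<and> t2 \<le> t1 + B) s1 t1"
    proof (rule wp_For[where I = "\<lambda>j. F (?D i j)" and B = "1 + cost e + cost f"])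
      show "F (?D i 0) s1" using F1 by simp
      show "reg s1 rS = S" using a r by (simp add: agree_def)
      fix j s2 t2
      assume j: "j < S" and b: "agree (insert rj (wregs (Store A e f))) (warrs (Store A e f)) s1 s2"
        "reg s2 rj = j" and F2: "F (?D i j) s2"
      have old: "(\<lambda>(i, j). idx i j) (i, j) \<notin> (\<lambda>(i, j). idx i j) ` ?D i j"
        using i j by (subst inj_on_image_mem_iff[OF idx]) auto
      have ag: "agree {ri, rj} {A} s s2" using a b by (auto simp: agree_def)
      moreover have "reg s2 ri = i" using a b r by (auto simp: agree_def)
      moreover have "arr s2 A (idx i j) = arr s A (idx i j)" using F2 old unfolding F_def by auto
      ultimately have ev: "val s2 e = idx i j" "val s2 f = v i j" "fits W s2 e" "fits W s2 f"
        using ev[of s2 i j] i j b by auto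
      show "wp W (Store A e f) (\<lambda>s2 t2a. F (?D i (Suc j)) s2 \<and> t2a \<le> t2 + (1 + cost e + cost f)) s2 t2"
      proof (rule wp_Store[OF ev(3,4)], rule conjI)
        have "F (?D i (Suc j)) (s2\<lparr>arr := (arr s2)(A := (arr s2 A)(idx i j := v i j))\<rparr>)"
          unfolding F_def
        proof (intro conjI ballI allI impI)
          fix p assume p: "p \<in> ?D i (Suc j)"
          have "p = (i, j) \<or> p \<in> ?D i j" using p by (auto simp: less_Suc_eq)
          moreover have "p \<in> ?D i j \<Longrightarrow> (case p of (i', j') \<Rightarrow> idx i' j') \<noteq> idx i j"
            using old by (metis (no_types, lifting) image_eqI prod.case)
          ultimately show "case p of (ia, ja) \<Rightarrow>
             arr (s2\<lparr>arr := (arr s2)(A := (arr s2 A)(idx i j := v i j))\<rparr>) A (idx ia ja) = v ia ja"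
            using F2 unfolding F_def by force
        next
          fix x assume "x \<notin> (\<lambda>(i, j). idx i j) ` ?D i (Suc j)"
          then have "x \<notin> (\<lambda>(i, j). idx i j) ` ?D i j" "x \<noteq> idx i j"
            by (auto simp: image_Un image_iff less_Suc_eq)
          then show "arr (s2\<lparr>arr := (arr s2)(A := (arr s2 A)(idx i j := v i j))\<rparr>) A x = arr s A x"
            using F2 unfolding F_def by simp
        qed
        then show "F (?D i (Suc j)) (s2\<lparr>arr := (arr s2)(A := (arr s2 A)(val s2 e := val s2 f))\<rparr>)"
          using ev by simp
      qed simp
    next
      fix s' t' assume "F (?D i S) s'" "t' \<le> t1 + S * (1 + cost e + cost f + 8) + 6"
      moreover have "?D i S = {..<Suc i} \<times> {..<S}" by (auto simp: less_Suc_eq)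
      ultimately show "F ({..<Suc i} \<times> {..<S}) s' \<and> t' \<le> t1 + B"
        by (simp add: B_def algebra_simps)
    qed (use r in \<open>auto simp: F_reg\<close>)
  next
    fix s' t' assume "agree (insert ri (wregs (For rj rS (Store A e f)))) (warrs (For rj rS (Store A e f))) s s'"
      "F ({..<R} \<times> {..<S}) s'" "t' \<le> t + R * (B + 8) + 6"
    then show "Q s' t'"
      by (intro Q) (auto simp: F_def agree_def B_def algebra_simps image_iff)
  qed (use r in \<open>auto simp: F_reg\<close>)
  then show ?thesis .
qed

lemma wp_For_fill1:
  assumes r: "reg s rS = S" "rj \<noteq> rS" "S \<le> W" "1 \<le> W"
    and idx: "inj_on idx {..<S}"
    and ev: "\<And>s1 j. \<lbrakk>agree {rj} {A} s s1; reg s1 rj = j; j < S; arr s1 A (idx j) = arr s A (idx j)\<rbrakk>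
      \<Longrightarrow> val s1 e = idx j \<and> val s1 f = v j \<and> fits W s1 e \<and> fits W s1 f"
    and Q: "\<And>s' t'. \<lbrakk>agree {rj} {A} s s'; \<And>j. j < S \<Longrightarrow> arr s' A (idx j) = v j;
        \<And>x. (\<And>j. j < S \<Longrightarrow> x \<noteq> idx j) \<Longrightarrow> arr s' A x = arr s A x;
        t' \<le> t + S * (cost e + cost f + 9) + 6\<rbrakk> \<Longrightarrow> Q s' t'"
  shows "wp W (For rj rS (Store A e f)) Q s t"
proof (rule wp_For[where B = "1 + cost e + cost f" and
      I = "\<lambda>j s'. (\<forall>j'<j. arr s' A (idx j') = v j') \<and>
        (\<forall>x. x \<notin> idx ` {..<j} \<longrightarrow> arr s' A x = arr s A x)"])
  fix j s2 t2
  assume j: "j < S" and b: "agree (insert rj (wregs (Store A e f))) (warrs (Store A e f)) s s2"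
    "reg s2 rj = j" and I: "(\<forall>j'<j. arr s2 A (idx j') = v j') \<and>
        (\<forall>x. x \<notin> idx ` {..<j} \<longrightarrow> arr s2 A x = arr s A x)"
  have old: "idx j \<notin> idx ` {..<j}" using j by (subst inj_on_image_mem_iff[OF idx]) auto
  have ev: "val s2 e = idx j" "val s2 f = v j" "fits W s2 e" "fits W s2 f"
    using ev[of s2 j] I old j b by auto
  show "wp W (Store A e f) (\<lambda>s2 t2a. ((\<forall>j'<Suc j. arr s2 A (idx j') = v j') \<and>
        (\<forall>x. x \<notin> idx ` {..<Suc j} \<longrightarrow> arr s2 A x = arr s A x)) \<and> t2a \<le> t2 + (1 + cost e + cost f)) s2 t2"
  proof (rule wp_Store[OF ev(3,4)], intro conjI allI impI, goal_cases)
    case (1 j')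
    show ?case
    proof (cases "j' = j")
      case False
      then have "j' < j" using 1 by simp
      then have "idx j' \<noteq> idx j" using old by (metis imageI lessThan_iff)
      then show ?thesis using ev I \<open>j' < j\<close> by simp
    qed (use ev in simp)
  next
    case (2 x)
    then show ?case using ev I by (auto simp: lessThan_Suc)
  qed simp
next
  fix s' t' assume "agree (insert rj (wregs (Store A e f))) (warrs (Store A e f)) s s'"
    "(\<forall>j'<S. arr s' A (idx j') = v j') \<and> (\<forall>x. x \<notin> idx ` {..<S} \<longrightarrow> arr s' A x = arr s A x)"
    "t' \<le> t + S * (1 + cost e + cost f + 8) + 6"
  then show "Q s' t'" by (intro Q) (auto simp: image_iff algebra_simps)
qed (use r in auto)

subsection \<open>Reusable copies of a program\<close>

text \<open>A program can only be called repeatedly if its memory is zero again before each call.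
  The copy uses the registers and arrays from 100 on and records the index of every store
  in array 7, with register 12 as the top of this log, so that undoing the stores takes no
  longer than the run itself.\<close>

fun sh :: "expr \<Rightarrow> expr" where
  "sh (Const k) = Const k"
| "sh (Reg r) = Reg (100 + r)"
| "sh (Cell a e) = Cell (100 + a) (sh e)"
| "sh (Bin f e1 e2) = Bin f (sh e1) (sh e2)"

fun instr :: "com \<Rightarrow> com" where
  "instr Skip = Skip"
| "instr (Assign r e) = Assign (100 + r) (sh e)"
| "instr (Store a i e) = Seq (Store 7 (Reg 12) (sh i))
     (Seq (Assign 12 (Bin Add (Reg 12) (Const 1))) (Store (100 + a) (sh i) (sh e)))"
| "instr (Seq c1 c2) = Seq (instr c1) (instr c2)"
| "instr (If e c1 c2) = If (sh e) (instr c1) (instr c2)"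
| "instr (While e c) = While (sh e) (instr c)"

definition sim :: "ram \<Rightarrow> ram \<Rightarrow> bool" where
  "sim s S \<longleftrightarrow> (\<forall>r. reg S (100 + r) = reg s r) \<and> (\<forall>a. arr S (100 + a) = arr s a)"

lemma val_sh: "sim s S \<Longrightarrow> val S (sh e) = val s e"
  by (induction e) (auto simp: sim_def)

lemma fits_sh: "\<lbrakk>sim s S; W \<le> W'; fits W s e\<rbrakk> \<Longrightarrow> fits W' S (sh e)"
  by (induction e) (auto simp: val_sh, auto simp: sim_def)

lemma cost_sh [simp]: "cost (sh e) = cost e"
  by (induction e) auto

lemma cost_pos: "0 < cost e"
  by (cases e) auto

lemma wregs_instr: "wregs (instr c) \<subseteq> insert 12 {100..}"
  and warrs_instr: "warrs (instr c) \<subseteq> insert 7 {100..}"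
  by (induction c) auto

lemma fits_val: "fits W s e \<Longrightarrow> val s e \<le> W"
  by (cases e) auto

text \<open>The log keeps indices without the array they belong to: any index at which some array
  changed occurs among the new entries, and undoing clears it in all arrays. The bound
  \<open>W\<close> on the entries makes it possible to read them back.\<close>

definition logged :: "nat \<Rightarrow> ram \<Rightarrow> ram \<Rightarrow> ram \<Rightarrow> ram \<Rightarrow> bool" where
  "logged W s s' S S' \<longleftrightarrow> reg S 12 \<le> reg S' 12 \<and> (\<forall>x\<in>{reg S 12..<reg S' 12}. arr S' 7 x \<le> W) \<and> (\<forall>x<reg S 12. arr S' 7 x = arr S 7 x) \<and>
     (\<forall>a i. arr s' a i \<noteq> arr s a i \<longrightarrow> (\<exists>x\<in>{reg S 12..<reg S' 12}. arr S' 7 x = i))"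

lemma logged_trans:
  assumes "logged W s s1 S S1" "logged W s1 s2 S1 S2" shows "logged W s s2 S S2"
  unfolding logged_def
proof (intro conjI allI impI)
  show "reg S 12 \<le> reg S2 12" using assms by (simp add: logged_def)
  show "\<forall>x\<in>{reg S 12..<reg S2 12}. arr S2 7 x \<le> W"
  proof
    fix x assume "x \<in> {reg S 12..<reg S2 12}"
    then show "arr S2 7 x \<le> W" using assms by (cases "x < reg S1 12") (auto simp: logged_def)
  qed
  show "arr S2 7 x = arr S 7 x" if "x < reg S 12" for x
    using assms that by (simp add: logged_def)
  fix a i assume ne: "arr s2 a i \<noteq> arr s a i"
  show "\<exists>x\<in>{reg S 12..<reg S2 12}. arr S2 7 x = i"
  proof (cases "arr s1 a i = arr s a i")
    case True
    then have "arr s2 a i \<noteq> arr s1 a i" using ne by simp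
    then obtain x where "x \<in> {reg S1 12..<reg S2 12}" "arr S2 7 x = i"
      using assms(2) unfolding logged_def by blast
    then show ?thesis using assms(1) by (auto simp: logged_def)
  next
    case False
    then obtain x where "x \<in> {reg S 12..<reg S1 12}" "arr S1 7 x = i"
      using assms(1) unfolding logged_def by blast
    then show ?thesis using assms(2) by (auto simp: logged_def intro!: bexI[of _ x])
  qed
qed

text \<open>Only stores get slower: logging evaluates the index a second time and adds two commands,
  which the factor 6 covers because expressions have positive cost. Every store adds one log entry
  and takes at least one time unit, so the log grows by at most \<open>t\<close>; this is the origin
  of the bound on \<open>reg S 12 + t\<close>.\<close>

lemma instr_exec:
  assumes "exec W0 c s t s'" "sim s S" "W0 \<le> W" "reg S 12 + t \<le> W"
  shows "\<exists>t' S'. exec W (instr c) S t' S' \<and> t' \<le> 6 * t \<and> sim s' S' \<and>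
      reg S' 12 \<le> reg S 12 + t \<and> logged W s s' S S'"
  using assms
proof (induction arbitrary: S)
  case (Skip s)
  then show ?case
    by (intro exI[of _ 1] exI[of _ S]) (auto intro: exec.Skip[simplified] simp: logged_def)
next
  case (Assign s e r)
  let ?S = "S\<lparr>reg := (reg S)(100 + r := val S (sh e))\<rparr>"
  have "exec W (instr (Assign r e)) S (1 + cost (sh e)) ?S"
    unfolding instr.simps by (rule exec.Assign, rule fits_sh[OF Assign.prems(1,2) Assign.hyps])
  moreover have "sim (s\<lparr>reg := (reg s)(r := val s e)\<rparr>) ?S"
    using Assign val_sh by (auto simp: sim_def)
  ultimately show ?case by (intro exI[of _ "1 + cost (sh e)"] exI[of _ ?S]) (auto simp: logged_def)
next
  case (Store s i e a)
  note f = fits_sh[OF Store.prems(1,2)]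
  let ?h = "reg S 12"
  let ?S1 = "S\<lparr>arr := (arr S)(7 := (arr S 7)(?h := val S (sh i)))\<rparr>"
  let ?S2 = "?S1\<lparr>reg := (reg ?S1)(12 := ?h + 1)\<rparr>"
  let ?S3 = "?S2\<lparr>arr := (arr ?S2)(100 + a := (arr ?S2 (100 + a))(val ?S2 (sh i) := val ?S2 (sh e)))\<rparr>"
  have h: "Suc ?h \<le> W" using Store.prems by simp
  have "exec W (Store 7 (Reg 12) (sh i)) S (1 + cost (Reg 12) + cost (sh i))
      (S\<lparr>arr := (arr S)(7 := (arr S 7)(val S (Reg 12) := val S (sh i)))\<rparr>)"
    using h f Store by (intro exec.Store) auto
  then have e1: "exec W (Store 7 (Reg 12) (sh i)) S (1 + 1 + cost i) ?S1" by simp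
  have "exec W (Assign 12 (Bin Add (Reg 12) (Const 1))) ?S1 (1 + cost (Bin Add (Reg 12) (Const 1)))
     (?S1\<lparr>reg := (reg ?S1)(12 := val ?S1 (Bin Add (Reg 12) (Const 1)))\<rparr>)"
    by (rule exec.Assign) (use h in auto)
  then have e2: "exec W (Assign 12 (Bin Add (Reg 12) (Const 1))) ?S1 (Suc (Suc (Suc (Suc 0)))) ?S2" by simp
  have s2: "sim s ?S2" using Store.prems by (auto simp: sim_def)
  have e3: "exec W (Store (100 + a) (sh i) (sh e)) ?S2 (1 + cost (sh i) + cost (sh e)) ?S3"
    using fits_sh[OF s2 Store.prems(2)] Store by (intro exec.Store) auto
  have ex: "exec W (instr (Store a i e)) S ((1 + 1 + cost i) + (Suc (Suc (Suc (Suc 0))) + (1 + cost (sh i) + cost (sh e)))) ?S3"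
    unfolding instr.simps by (rule exec.Seq[OF e1 exec.Seq[OF e2 e3]])
  have v: "val ?S2 (sh i) = val s i" "val ?S2 (sh e) = val s e" "val S (sh i) = val s i"
    by (rule val_sh[OF s2] val_sh[OF Store.prems(1)])+
  have sm: "sim (s\<lparr>arr := (arr s)(a := (arr s a)(val s i := val s e))\<rparr>) ?S3"
    using s2 v(1,2) by (auto simp: sim_def)
  have lg: "logged W s (s\<lparr>arr := (arr s)(a := (arr s a)(val s i := val s e))\<rparr>) S ?S3"
    using v fits_val[OF f[OF Store.hyps(1)]] unfolding logged_def by (auto simp: less_Suc_eq_le)
  have T: "(1 + 1 + cost i) + (Suc (Suc (Suc (Suc 0))) + (1 + cost (sh i) + cost (sh e)))
      \<le> 6 * (1 + cost i + cost e)"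
    using cost_pos[of i] cost_pos[of e] by simp
  have R: "reg ?S3 12 \<le> reg S 12 + (1 + cost i + cost e)" by simp
  show ?case by (rule exI, rule exI, intro conjI, rule ex, rule T, rule sm, rule R, rule lg)
next
  case (Seq c1 s t1 s1 c2 t2 s2)
  from Seq.IH(1)[OF Seq.prems(1,2)] Seq.prems obtain t1' S1 where 1:
    "exec W (instr c1) S t1' S1" "t1' \<le> 6 * t1" "sim s1 S1" "reg S1 12 \<le> reg S 12 + t1" "logged W s s1 S S1"
    by auto
  from Seq.IH(2)[OF 1(3) Seq.prems(2)] Seq.prems 1 obtain t2' S2 where 2:
    "exec W (instr c2) S1 t2' S2" "t2' \<le> 6 * t2" "sim s2 S2" "reg S2 12 \<le> reg S1 12 + t2" "logged W s1 s2 S1 S2"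
    by auto
  show ?case using exec.Seq[OF 1(1) 2(1)] 1 2 logged_trans[OF 1(5) 2(5)]
    by (intro exI[of _ "t1' + t2'"] exI[of _ S2]) auto
next
  case (IfTrue s e c1 t s' c2)
  from IfTrue.IH[OF IfTrue.prems(1,2)] IfTrue.prems obtain t' S1 where 1:
    "exec W (instr c1) S t' S1" "t' \<le> 6 * t" "sim s' S1" "reg S1 12 \<le> reg S 12 + t" "logged W s s' S S1"
    by auto
  have "exec W (instr (If e c1 c2)) S (1 + cost (sh e) + t') S1"
    unfolding instr.simps using IfTrue.hyps val_sh[OF IfTrue.prems(1)] fits_sh[OF IfTrue.prems(1,2)]
    by (intro exec.IfTrue 1(1)) auto
  then show ?case using 1 by (intro exI[of _ "1 + cost (sh e) + t'"] exI[of _ S1]) auto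
next
  case (IfFalse s e c2 t s' c1)
  from IfFalse.IH[OF IfFalse.prems(1,2)] IfFalse.prems obtain t' S1 where 1:
    "exec W (instr c2) S t' S1" "t' \<le> 6 * t" "sim s' S1" "reg S1 12 \<le> reg S 12 + t" "logged W s s' S S1"
    by auto
  have "exec W (instr (If e c1 c2)) S (1 + cost (sh e) + t') S1"
    unfolding instr.simps using IfFalse.hyps val_sh[OF IfFalse.prems(1)] fits_sh[OF IfFalse.prems(1,2)]
    by (intro exec.IfFalse 1(1)) auto
  then show ?case using 1 by (intro exI[of _ "1 + cost (sh e) + t'"] exI[of _ S1]) auto
next
  case (WhileFalse s e c)
  have "exec W (instr (While e c)) S (1 + cost (sh e)) S"
    unfolding instr.simps using WhileFalse.hyps val_sh[OF WhileFalse.prems(1)] fits_sh[OF WhileFalse.prems(1,2)]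
    by (intro exec.WhileFalse) auto
  then show ?case using WhileFalse by (intro exI[of _ "1 + cost (sh e)"] exI[of _ S]) (auto simp: logged_def)
next
  case (WhileTrue s e c t1 s1 t2 s2)
  from WhileTrue.IH(1)[OF WhileTrue.prems(1,2)] WhileTrue.prems obtain t1' S1 where 1:
    "exec W (instr c) S t1' S1" "t1' \<le> 6 * t1" "sim s1 S1" "reg S1 12 \<le> reg S 12 + t1" "logged W s s1 S S1"
    by auto
  from WhileTrue.IH(2)[OF 1(3) WhileTrue.prems(2)] WhileTrue.prems 1 obtain t2' S2 where 2:
    "exec W (instr (While e c)) S1 t2' S2" "t2' \<le> 6 * t2" "sim s2 S2" "reg S2 12 \<le> reg S1 12 + t2" "logged W s1 s2 S1 S2"
    by auto
  have "exec W (instr (While e c)) S (1 + cost (sh e) + t1' + t2') S2"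
    using WhileTrue.hyps val_sh[OF WhileTrue.prems(1)] fits_sh[OF WhileTrue.prems(1,2)] 1(1) 2(1)
    unfolding instr.simps by (intro exec.WhileTrue[of W S "sh e" _ t1' S1 t2' S2]) auto
  then show ?case using 1 2 logged_trans[OF 1(5) 2(5)]
    by (intro exI[of _ "1 + cost (sh e) + t1' + t2'"] exI[of _ S2]) auto
qed

fun clear_regs :: "nat \<Rightarrow> com" where
  "clear_regs 0 = Skip"
| "clear_regs (Suc n) = Seq (clear_regs n) (Assign (100 + n) (Const 0))"

fun clear_cells :: "nat \<Rightarrow> expr \<Rightarrow> com" where
  "clear_cells 0 e = Skip"
| "clear_cells (Suc n) e = Seq (clear_cells n e) (Store (100 + n) e (Const 0))"

lemma wregs_clear [simp]: "wregs (clear_regs n) = {100..<100 + n}" "warrs (clear_regs n) = {}"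
  by (induction n) auto

lemma warrs_clear [simp]: "wregs (clear_cells n e) = {}" "warrs (clear_cells n e) = {100..<100 + n}"
  by (induction n) auto

lemma wp_clear_regs:
  "\<lbrakk>\<And>s' t'. \<lbrakk>agree {100..<100 + n} {} s s'; \<And>r. r < n \<Longrightarrow> reg s' (100 + r) = 0; t' \<le> t + (2 * n + 1)\<rbrakk> \<Longrightarrow> Q s' t'\<rbrakk>
   \<Longrightarrow> wp W (clear_regs n) Q s t"
proof (induction n arbitrary: Q)
  case 0
  show ?case unfolding clear_regs.simps by (rule wp_Skip, rule "0.prems") (auto simp: agree_def)
next
  case (Suc n)
  show ?case unfolding clear_regs.simps
    by (rule wp_Seq, rule Suc.IH, rule wp_Assign, simp, rule Suc.prems)
       (auto simp: agree_def less_Suc_eq)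
qed

text \<open>The index expression is evaluated anew for each array, so it must not depend on the
  cells being cleared; in its use it is a log entry, stored outside the memory of the copy.\<close>

lemma wp_clear_cells:
  "\<lbrakk>val s e = x; fits W s e; \<And>s'. agree {} {100..} s s' \<Longrightarrow> val s' e = val s e \<and> fits W s' e;
    \<And>s' t'. \<lbrakk>agree {} {100..<100 + n} s s';
      \<And>a. a < n \<Longrightarrow> arr s' (100 + a) = (arr s (100 + a))(x := 0); t' \<le> t + (n * (cost e + 2) + 1)\<rbrakk> \<Longrightarrow> Q s' t'\<rbrakk>
   \<Longrightarrow> wp W (clear_cells n e) Q s t"
proof (induction n arbitrary: Q)
  case 0
  show ?case unfolding clear_cells.simps by (rule wp_Skip, rule "0.prems") (auto simp: agree_def)
next
  case (Suc n)
  show ?case unfolding clear_cells.simps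
  proof (rule wp_Seq, rule Suc.IH[OF Suc.prems(1-3)])
    fix s1 t1
    assume 1: "agree {} {100..<100 + n} s s1" "\<And>a. a < n \<Longrightarrow> arr s1 (100 + a) = (arr s (100 + a))(x := 0)"
      "t1 \<le> t + (n * (cost e + 2) + 1)"
    have "agree {} {100..} s s1" using 1(1) by (rule agree_mono) auto
    from Suc.prems(3)[OF this] have v: "val s1 e = x" "fits W s1 e" using Suc.prems(1) by auto
    show "wp W (Store (100 + n) e (Const 0)) Q s1 t1"
    proof (rule wp_Store[OF v(2)], simp, rule Suc.prems(4), goal_cases)
      case 1
      show ?case using \<open>agree {} {100..<100 + n} s s1\<close> unfolding agree_def by auto
    next
      case (2 a)
      then show ?case using 1(1,2) v(1) by (auto simp: agree_def less_Suc_eq)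
    next
      case 3
      then show ?case using 1(3) by (simp add: algebra_simps)
    qed
  qed
qed

text \<open>The clean-up is a fixed program text and can name only finitely many targets. The memory
  written by a given program lies below these bounds, in the numbering before the shift by
  100.\<close>

fun max_reg :: "com \<Rightarrow> nat" where
  "max_reg Skip = 0"
| "max_reg (Assign r e) = Suc r"
| "max_reg (Store a i e) = 0"
| "max_reg (Seq c1 c2) = max (max_reg c1) (max_reg c2)"
| "max_reg (If e c1 c2) = max (max_reg c1) (max_reg c2)"
| "max_reg (While e c) = max_reg c"

fun max_arr :: "com \<Rightarrow> nat" where
  "max_arr Skip = 0"
| "max_arr (Assign r e) = 0"
| "max_arr (Store a i e) = Suc a"
| "max_arr (Seq c1 c2) = max (max_arr c1) (max_arr c2)"
| "max_arr (If e c1 c2) = max (max_arr c1) (max_arr c2)"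
| "max_arr (While e c) = max_arr c"

lemma wregs_max: "wregs c \<subseteq> {..<max_reg c}" and warrs_max: "warrs c \<subseteq> {..<max_arr c}"
  by (induction c) auto

section \<open>Lazy in-place Gauss-Jordan elimination\<close>

text \<open>Eliminating with a pivot in row \<open>\<rho>\<close> changes, of the transformation matrix, only column
  \<open>\<rho>\<close>. This column, minus the unit vector, is stored in place of the eliminated column \<open>k\<close> of
  the matrix, with \<open>piv k = \<rho> + 1\<close>, or \<open>piv k = 0\<close> if there is no pivot in column \<open>k\<close>.\<close>

definition piv_cols :: "(nat \<Rightarrow> nat) \<Rightarrow> nat \<Rightarrow> nat \<Rightarrow> nat set" where
  "piv_cols piv c s = {k \<in> {c..<c + s}. piv k \<noteq> 0}"

text \<open>This is x multiplied by the identity plus the sum over the pivot columns k of V_k e^T,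
  where e is the unit vector of the pivot row of k. Vectors are functions on all naturals which the
  map leaves alone from \<open>N\<close> on, so equality of vectors is equality of
  functions.\<close>

definition tr :: "nat \<Rightarrow> nat \<Rightarrow> nat \<Rightarrow> (nat \<Rightarrow> nat \<Rightarrow> 'a) \<Rightarrow> (nat \<Rightarrow> nat) \<Rightarrow> (nat \<Rightarrow> 'a) \<Rightarrow> nat \<Rightarrow> 'a::comm_ring_1" where
  "tr N c s V piv x i = x i + (if i < N then \<Sum>k\<in>piv_cols piv c s. V i k * x (piv k - 1) else 0)"

definition colv :: "nat \<Rightarrow> (nat \<Rightarrow> nat \<Rightarrow> 'a) \<Rightarrow> nat \<Rightarrow> nat \<Rightarrow> 'a::comm_ring_1" where
  "colv N M k i = (if i < N then M i k else 0)"

definition unitv :: "nat \<Rightarrow> nat \<Rightarrow> 'a::comm_ring_1" where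
  "unitv j i = of_bool (i = j)"

text \<open>A non-pivot column has to vanish only outside \<open>used'\<close>, that is, it is
  reduced modulo all pivot rows found so far, including those of earlier blocks. The final clause
  says that a zero row of the block takes no part in the elimination; it lets zero padding and
  deleted rows be ignored later.\<close>

definition eliminated ::
    "nat \<Rightarrow> nat \<Rightarrow> nat \<Rightarrow> (nat \<Rightarrow> nat \<Rightarrow> 'a::comm_ring_1) \<Rightarrow> nat set \<Rightarrow> (nat \<Rightarrow> nat) \<Rightarrow>
     (nat \<Rightarrow> nat \<Rightarrow> 'a) \<Rightarrow> nat set \<Rightarrow> (nat \<Rightarrow> nat) \<Rightarrow> bool" where
  "eliminated N c s M used piv M' used' piv' \<longleftrightarrow>
     (\<forall>k. k \<notin> {c..<c + s} \<longrightarrow> piv' k = piv k) \<and>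
     (\<forall>i<N. \<forall>k<N. k \<notin> {c..<c + s} \<longrightarrow> M' i k = M i k) \<and>
     (\<forall>k\<in>piv_cols piv' c s. piv' k \<le> N \<and> piv' k - 1 \<notin> used) \<and>
     inj_on piv' (piv_cols piv' c s) \<and>
     used' = used \<union> (\<lambda>k. piv' k - 1) ` piv_cols piv' c s \<and>
     (\<forall>k\<in>piv_cols piv' c s. tr N c s M' piv' (colv N M k) = unitv (piv' k - 1)) \<and>
     (\<forall>k\<in>{c..<c + s} - piv_cols piv' c s. \<forall>i<N. i \<notin> used' \<longrightarrow> tr N c s M' piv' (colv N M k) i = 0) \<and>
     bij (tr N c s M' piv') \<and>
     (\<forall>i<N. (\<forall>k\<in>{c..<c + s}. M i k = 0) \<longrightarrow> (\<forall>k\<in>piv_cols piv' c s. M' i k = 0))"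

lemma finite_piv_cols [simp]: "finite (piv_cols piv c s)"
  by (simp add: piv_cols_def)

lemma tr_sum: "tr N c s V piv (\<lambda>i. \<Sum>k\<in>A. f k i) i = (\<Sum>k\<in>A. tr N c s V piv (f k) i)"
proof -
  have "(\<Sum>k\<in>piv_cols piv c s. V i k * (\<Sum>a\<in>A. f a (piv k - 1))) =
      (\<Sum>a\<in>A. \<Sum>k\<in>piv_cols piv c s. V i k * f a (piv k - 1))"
    unfolding sum_distrib_left by (rule sum.swap)
  then show ?thesis unfolding tr_def sum.distrib by simp
qed

lemma tr_add: "tr N c s V piv (\<lambda>i. x i + y i) i = tr N c s V piv x i + tr N c s V piv y i"
  unfolding tr_def by (simp add: sum.distrib algebra_simps)

lemma tr_scale: "tr N c s V piv (\<lambda>i. x i * b) i = tr N c s V piv x i * b"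
  unfolding tr_def by (simp add: sum_distrib_left algebra_simps)

lemma tr_zero [simp]: "tr N c s V piv (\<lambda>_. 0) = (\<lambda>_. 0)"
  unfolding tr_def by auto

lemma tr_fix: "(\<And>k. k \<in> piv_cols piv c s \<Longrightarrow> x (piv k - 1) = 0) \<Longrightarrow> tr N c s V piv x = x"
  unfolding tr_def by auto

lemma tr_unit_fix: "j \<notin> (\<lambda>k. piv k - 1) ` piv_cols piv c s \<Longrightarrow> tr N c s V piv (unitv j) = unitv j"
  by (rule tr_fix) (auto simp: unitv_def)

lemma sum_single: "(\<Sum>k\<in>{c}. f k) = (f c :: 'b::comm_monoid_add)"
  by simp

lemma eliminated_no_pivot:
  assumes "\<And>i. i < N \<Longrightarrow> i \<notin> used \<Longrightarrow> M i c = 0" "piv c = 0"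
  shows "eliminated N c 1 M used piv M used piv"
proof -
  have P: "piv_cols piv c 1 = {}" using assms(2) by (auto simp: piv_cols_def)
  then have t: "tr N c 1 M piv = id" unfolding tr_def P by (simp add: fun_eq_iff)
  show ?thesis
    unfolding eliminated_def P t using assms(1) by (auto simp: colv_def)
qed

text \<open>Row \<open>r\<close> is added to every other row with a one in column \<open>c\<close>.
  Over F_2 the corresponding column of the transformation, minus the unit vector, is column
  \<open>c\<close> itself with the entry at \<open>r\<close> set to zero, so storing it means
  clearing a single cell.\<close>

lemma eliminated_pivot:
  fixes M :: "nat \<Rightarrow> nat \<Rightarrow> bit"
  assumes r: "r < N" "r \<notin> used" "M r c = 1"
    and M': "M' r c = 0" "\<And>i k. i < N \<Longrightarrow> k < N \<Longrightarrow> (i, k) \<noteq> (r, c) \<Longrightarrow> M' i k = M i k" and c: "c < N"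
  shows "eliminated N c 1 M used piv M' (insert r used) (piv(c := Suc r))"
proof -
  let ?piv = "piv(c := Suc r)"
  have P: "piv_cols ?piv c 1 = {c}" by (auto simp: piv_cols_def)
  have t: "tr N c 1 M' ?piv x i = x i + (if i < N then M' i c * x r else 0)" for x i
    unfolding tr_def P sum_single by simp
  have M'2: "i < N \<Longrightarrow> i \<noteq> r \<Longrightarrow> M' i c = M i c" for i using M'(2) c by auto
  have e: "tr N c 1 M' ?piv (colv N M c) i = unitv r i" for i
    unfolding t using r M' M'2[of i] by (cases "i = r") (auto simp: colv_def unitv_def)
  \<comment> \<open>Row \<open>r\<close> itself is not changed, so a second application adds the
    same multiples again and they cancel in characteristic 2.\<close>
  have "tr N c 1 M' ?piv (tr N c 1 M' ?piv x) = x" for x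
  proof
    fix i
    have "b + b = 0" for b :: bit by (cases b) auto
    then show "tr N c 1 M' ?piv (tr N c 1 M' ?piv x) i = x i"
      unfolding t M'(1) by (simp only: mult_zero_left if_cancel add_0_right add.assoc)
  qed
  then have b: "bij (tr N c 1 M' ?piv)" by (rule involuntory_imp_bij)
  have z: "M' i c = 0" if "i < N" "M i c = 0" for i
    using that M'(1) M'2[of i] by (cases "i = r") auto
  show ?thesis
    unfolding eliminated_def P
  proof (intro conjI)
    show "\<forall>i<N. \<forall>k<N. k \<notin> {c..<c + 1} \<longrightarrow> M' i k = M i k" using M'(2) by simp
    show "\<forall>k\<in>{c}. tr N c 1 M' ?piv (colv N M k) = unitv (?piv k - 1)"
      using ext[of "tr N c 1 M' ?piv (colv N M c)", OF e] by simp
  qed (use r b z in simp_all)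
qed

text \<open>The update \<open>M1 \<rightarrow> M2\<close> brings the right half up to date, and the update \<open>M3 \<rightarrow> M4\<close> turns the
  stored transformation of the left half into one that includes the right half.\<close>

lemma eliminated_compose:
  assumes 1: "eliminated N c s M used piv M1 used1 piv1"
    and M2: "\<And>k. k \<in> {c + s..<c + s + s} \<Longrightarrow> colv N M2 k = tr N c s M1 piv1 (colv N M1 k)"
      "\<And>i k. i < N \<Longrightarrow> k < N \<Longrightarrow> k \<notin> {c + s..<c + s + s} \<Longrightarrow> M2 i k = M1 i k"
    and 3: "eliminated N (c + s) s M2 used1 piv1 M3 used2 piv2"
    and M4: "\<And>k. k \<in> {c..<c + s} \<Longrightarrow> colv N M4 k = tr N (c + s) s M3 piv2 (colv N M3 k)"
      "\<And>i k. i < N \<Longrightarrow> k < N \<Longrightarrow> k \<notin> {c..<c + s} \<Longrightarrow> M4 i k = M3 i k"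
    and le: "c + s + s \<le> N"
  shows "eliminated N c (s + s) M used piv M4 used2 piv2"
proof -
  note d1 = 1[unfolded eliminated_def] and d3 = 3[unfolded eliminated_def]
  let ?P1 = "piv_cols piv1 c s" and ?P2 = "piv_cols piv2 (c + s) s" and ?P = "piv_cols piv2 c (s + s)"
  let ?U1 = "tr N c s M1 piv1" and ?U2 = "tr N (c + s) s M3 piv2" and ?U = "tr N c (s + s) M4 piv2"
  let ?r1 = "\<lambda>k. piv1 k - 1" and ?r2 = "\<lambda>k. piv2 k - 1"
  have p21: "piv2 k = piv1 k" if "k \<notin> {c + s..<c + s + s}" for k using d3 that by blast
  have P: "?P = ?P1 \<union> ?P2" using p21 by (force simp: piv_cols_def)
  have dis: "?P1 \<inter> ?P2 = {}" by (auto simp: piv_cols_def)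
  have r21: "?r2 k = ?r1 k" if "k \<in> ?P1" for k using p21[of k] that by (auto simp: piv_cols_def)
  have p1: "piv2 k = piv1 k" if "k \<in> ?P1" for k using p21[of k] that by (auto simp: piv_cols_def)
  have used1: "used1 = used \<union> ?r1 ` ?P1" and used2: "used2 = used1 \<union> ?r2 ` ?P2"
    using d1 d3 by blast+
  have sep: "?r2 k2 \<notin> used" "?r2 k2 \<notin> ?r1 ` ?P1" if "k2 \<in> ?P2" for k2
    using d3 that used1 by blast+
  have M13: "M3 i k = M1 i k" if "i < N" "k \<in> {c..<c + s}" for i k
  proof -
    have "M3 i k = M2 i k" using d3 that le by auto
    then show ?thesis using M2(2)[of i k] that le by auto
  qed
  have col13: "colv N M3 k = colv N M1 k" if "k \<in> {c..<c + s}" for k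
    using M13 that by (auto simp: colv_def)
  have in1: "k \<in> ?P1 \<Longrightarrow> k \<in> {c..<c + s}" and in2: "k \<in> ?P2 \<Longrightarrow> k \<in> {c + s..<c + s + s}" for k
    by (auto simp: piv_cols_def)
  \<comment> \<open>Expanding \<open>?U1 x\<close> by linearity, the stored columns of the left half
    appear as arguments of \<open>?U2\<close>; replacing them by their images, as the second update
    does, leaves a single transformation of the same form.\<close>
  have U: "?U x = ?U2 (?U1 x)" for x
  proof
    fix i
    have x1: "?U1 x = (\<lambda>i. x i + (\<Sum>k\<in>?P1. colv N M1 k i * x (?r1 k)))"
      by (rule ext) (simp add: tr_def colv_def)
    have "?U2 (?U1 x) i = ?U2 x i + (\<Sum>k\<in>?P1. ?U2 (colv N M1 k) i * x (?r1 k))"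
      unfolding x1 tr_add tr_sum tr_scale ..
    also have "(\<Sum>k\<in>?P1. ?U2 (colv N M1 k) i * x (?r1 k)) = (\<Sum>k\<in>?P1. colv N M4 k i * x (?r2 k))"
    proof (rule sum.cong[OF refl])
      fix k assume k: "k \<in> ?P1"
      show "?U2 (colv N M1 k) i * x (?r1 k) = colv N M4 k i * x (?r2 k)"
        unfolding M4(1)[OF in1[OF k]] col13[OF in1[OF k]] r21[OF k] ..
    qed
    also have "?U2 x i = x i + (\<Sum>k\<in>?P2. colv N M4 k i * x (?r2 k))"
    proof -
      have "(\<Sum>k\<in>?P2. M3 i k * x (?r2 k)) = (\<Sum>k\<in>?P2. M4 i k * x (?r2 k))" if "i < N"
        using M4(2)[OF that] in2 le by (intro sum.cong[OF refl]) force
      then show ?thesis by (simp add: tr_def colv_def)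
    qed
    also have "x i + (\<Sum>k\<in>?P2. colv N M4 k i * x (?r2 k)) + (\<Sum>k\<in>?P1. colv N M4 k i * x (?r2 k)) = ?U x i"
      unfolding tr_def P by (simp add: sum.union_disjoint[OF _ _ dis] colv_def)
    finally show "?U x i = ?U2 (?U1 x) i" ..
  qed
  have colM1: "colv N M1 k = colv N M k" if "k \<in> {c + s..<c + s + s}" for k
    using d1 that le by (auto simp: colv_def)
  have colM2: "colv N M2 k = ?U1 (colv N M k)" if "k \<in> {c + s..<c + s + s}" for k
    using M2(1)[OF that] colM1[OF that] by simp
  \<comment> \<open>The right half takes its pivots outside \<open>used1\<close>. A vector supported
    on \<open>used1\<close> has zeros in these rows and is fixed, so the left half stays
    reduced.\<close>
  have U2_fix: "?U2 x = x" if "\<And>i. i < N \<Longrightarrow> i \<notin> used1 \<Longrightarrow> x i = 0" for x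
  proof (rule tr_fix)
    fix k assume k: "k \<in> ?P2"
    then have "piv2 k \<le> N" "piv2 k \<noteq> 0" "?r2 k \<notin> used1" using d3 by (auto simp: piv_cols_def)
    then show "x (?r2 k) = 0" using that[of "?r2 k"] by simp
  qed
  show ?thesis
    unfolding eliminated_def
  proof (intro conjI allI impI ballI)
    fix k assume "k \<notin> {c..<c + (s + s)}"
    then have "k \<notin> {c..<c + s}" "k \<notin> {c + s..<c + s + s}" by auto
    then show "piv2 k = piv k" using d1 p21[of k] by presburger
  next
    fix i k assume ik: "i < N" "k < N" "k \<notin> {c..<c + (s + s)}"
    then have "M4 i k = M3 i k" "M3 i k = M2 i k" "M2 i k = M1 i k" "M1 i k = M i k"
      using M4(2) M2(2) d3[THEN conjunct2, THEN conjunct1] d1[THEN conjunct2, THEN conjunct1] by auto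
    then show "M4 i k = M i k" by simp
  next
    fix k assume "k \<in> ?P"
    then consider "k \<in> ?P1" | "k \<in> ?P2" unfolding P by blast
    then show "piv2 k \<le> N"
      by cases (use d1 d3 p21[of k] in \<open>auto simp: piv_cols_def\<close>)
  next
    fix k assume "k \<in> ?P"
    then consider "k \<in> ?P1" | "k \<in> ?P2" unfolding P by blast
    then show "?r2 k \<notin> used"
      by cases (use d1 r21[of k] sep in auto)
  next
    have "inj_on piv2 ?P1"
      using d1 p1 inj_on_cong[of ?P1 piv2 piv1] by blast
    moreover have "inj_on piv2 ?P2" using d3 by blast
    moreover have False if "k1 \<in> ?P1" "k2 \<in> ?P2" "piv2 k1 = piv2 k2" for k1 k2
      using sep(2)[OF that(2)] r21[OF that(1)] that by force
    ultimately show "inj_on piv2 ?P" unfolding P by (fastforce simp: inj_on_Un)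
  next
    have "?r2 ` ?P1 = ?r1 ` ?P1" using r21 by (rule image_cong[OF refl])
    then show "used2 = used \<union> ?r2 ` ?P" unfolding used2 used1 P image_Un by blast
  next
    fix k assume "k \<in> ?P"
    then consider "k \<in> ?P1" | "k \<in> ?P2" unfolding P by blast
    then show "?U (colv N M k) = unitv (?r2 k)"
    proof cases
      case 1
      then have "?U1 (colv N M k) = unitv (?r1 k)" using d1 by blast
      moreover have "?U2 (unitv (?r1 k)) = unitv (?r1 k)"
        by (rule tr_unit_fix) (use sep 1 in force)
      ultimately show ?thesis unfolding U r21[OF 1] by simp
    next
      case 2
      then have "?U2 (colv N M2 k) = unitv (?r2 k)" using d3 by blast
      then show ?thesis unfolding U colM2[OF in2[OF 2]] .
    qed
  next
    fix k i assume k: "k \<in> {c..<c + (s + s)} - ?P" and i: "i < N" "i \<notin> used2"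
    show "?U (colv N M k) i = 0"
    proof (cases "k < c + s")
      case True
      then have k1: "k \<in> {c..<c + s} - ?P1" using k P by auto
      then have z: "j < N \<Longrightarrow> j \<notin> used1 \<Longrightarrow> ?U1 (colv N M k) j = 0" for j using d1 by blast
      have "?U (colv N M k) = ?U1 (colv N M k)" unfolding U by (rule U2_fix) (rule z)
      then show ?thesis using z i used2 by simp
    next
      case False
      then have k2: "k \<in> {c + s..<c + s + s} - ?P2" using k P by auto
      then have "?U2 (colv N M2 k) i = 0" using d3 i by blast
      then show ?thesis unfolding U using colM2 k2 by auto
    qed
  next
    have "?U = ?U2 \<circ> ?U1" using U by (auto simp: fun_eq_iff)
    then show "bij ?U" using d1 d3 by (auto intro: bij_comp)
  next
    fix i k assume i: "i < N" and z: "\<forall>k\<in>{c..<c + (s + s)}. M i k = 0" and "k \<in> ?P"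
    then consider "k \<in> ?P1" | "k \<in> ?P2" unfolding P by blast
    moreover have z1: "M1 i k = 0" if "k \<in> ?P1" for k using d1 z i that by auto
    \<comment> \<open>The first update adds to row \<open>i\<close> multiples of the entries stored
      in this row for the left half, all of which are zero.\<close>
    have z2: "M2 i k = 0" if k: "k \<in> {c + s..<c + s + s}" for k
    proof -
      have "M2 i k = colv N M2 k i" using i by (simp add: colv_def)
      also have "\<dots> = M i k" unfolding colM2[OF k] tr_def using z1 i by (simp add: colv_def)
      finally show ?thesis using z k by auto
    qed
    have z3: "M3 i k = 0" if "k \<in> ?P2" for k using d3 z2 i that by blast
    ultimately show "M4 i k = 0"
    proof cases
      case 1
      have "M4 i k = ?U2 (colv N M3 k) i" using M4(1)[OF in1[OF 1]] i by (metis colv_def)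
      also have "\<dots> = M3 i k" unfolding tr_def using z3 i by (simp add: colv_def)
      finally show ?thesis using M13[OF i in1[OF 1]] z1[OF 1] by simp
    next
      case 2
      then show ?thesis using M4(2)[OF i, of k] in2[OF 2] le z3 by auto
    qed
  qed
qed

text \<open>What remains of the elimination of a whole matrix: a column basis \<open>P\<close>, and an invertible
  transformation \<open>U\<close>.\<close>

locale eliminated_matrix =
  fixes N :: nat and M V :: "nat \<Rightarrow> nat \<Rightarrow> bit" and piv :: "nat \<Rightarrow> nat" and used :: "nat set"
  assumes elim: "eliminated N 0 N M {} (\<lambda>_. 0) V used piv"
begin

abbreviation "P \<equiv> piv_cols piv 0 N"
abbreviation "U \<equiv> tr N 0 N V piv"
abbreviation "\<rho> k \<equiv> piv k - 1"

lemma used: "used = \<rho> ` P"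
  and U_pivot: "k \<in> P \<Longrightarrow> U (colv N M k) = unitv (\<rho> k)"
  and U_nonpivot: "\<lbrakk>k < N; k \<notin> P; i < N; i \<notin> used\<rbrakk> \<Longrightarrow> U (colv N M k) i = 0"
  and bij_U: "bij U"
  and P_less: "k \<in> P \<Longrightarrow> k < N"
  and rho_less: "k \<in> P \<Longrightarrow> \<rho> k < N"
  and inj_piv: "inj_on piv P"
  using elim unfolding eliminated_def piv_cols_def by auto

text \<open>Pivot columns have a nonzero value of \<open>piv\<close>, so the truncated subtraction
  loses no information on them.\<close>

lemma inj_rho: "inj_on \<rho> P"
proof (rule inj_onI)
  fix k k' assume "k \<in> P" "k' \<in> P" "\<rho> k = \<rho> k'"
  moreover from this have "piv k = piv k'" unfolding piv_cols_def by (simp, arith)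
  ultimately show "k = k'" using inj_piv by (simp add: inj_on_def)
qed

lemma U_col_outside: "\<lbrakk>k < N; i \<notin> used\<rbrakk> \<Longrightarrow> U (colv N M k) i = 0"
proof -
  assume k: "k < N" "i \<notin> used"
  consider "k \<in> P" | "k \<notin> P" "i < N" | "i \<ge> N" by linarith
  then show ?thesis
  proof cases
    case 1
    then have "i \<noteq> \<rho> k" using k used by blast
    then show ?thesis unfolding U_pivot[OF 1] unitv_def by simp
  next
    case 2
    then show ?thesis using U_nonpivot k by blast
  next
    case 3
    then show ?thesis unfolding tr_def colv_def by simp
  qed
qed

text \<open>\<open>U\<close> maps the columns of \<open>S\<close> to distinct unit vectors, so a
  vanishing sum of columns would be a vanishing sum of distinct unit vectors.\<close>

lemma pivots_independent:
  assumes S: "S \<subseteq> P" and z: "\<And>i. i < N \<Longrightarrow> (\<Sum>k\<in>S. M i k) = 0"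
  shows "S = {}"
proof (rule ccontr)
  assume "S \<noteq> {}"
  then obtain k0 where k0: "k0 \<in> S" by blast
  have fin: "finite S" using S finite_subset by fastforce
  have "(\<Sum>k\<in>S. colv N M k i) = 0" for i
    using z by (cases "i < N") (auto simp: colv_def)
  then have "0 = U (\<lambda>i. \<Sum>k\<in>S. colv N M k i) (\<rho> k0)" by simp
  also have "\<dots> = (\<Sum>k\<in>S. unitv (\<rho> k) (\<rho> k0))"
    unfolding tr_sum using U_pivot S by (intro sum.cong) auto
  also have "\<dots> = (\<Sum>k\<in>S. of_bool (k = k0))"
    using inj_rho S k0 by (intro sum.cong refl) (auto simp: unitv_def inj_on_def)
  also have "\<dots> = 1" using fin k0 by (simp add: of_bool_def sum.delta)
  finally show False by simp
qed

text \<open>If \<open>U y\<close> is supported on pivot rows, it is a sum of unit vectors, and these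
  are the images of pivot columns. Injectivity of \<open>U\<close> carries the equality back to
  \<open>y\<close>.\<close>

lemma in_column_space:
  assumes y: "\<And>i. i \<ge> N \<Longrightarrow> y i = 0" and z: "\<And>i. i < N \<Longrightarrow> i \<notin> used \<Longrightarrow> U y i = 0"
  shows "\<exists>S\<subseteq>P. \<forall>i<N. y i = (\<Sum>k\<in>S. M i k)"
proof (intro exI conjI allI impI)
  let ?S = "{k \<in> P. U y (\<rho> k) = 1}"
  show "?S \<subseteq> P" by blast
  have "U (\<lambda>i. \<Sum>k\<in>?S. colv N M k i) j = U y j" for j
  proof -
    have "U (\<lambda>i. \<Sum>k\<in>?S. colv N M k i) j = (\<Sum>k\<in>?S. unitv (\<rho> k) j)"
      unfolding tr_sum using U_pivot by (intro sum.cong) auto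
    also have "\<dots> = (\<Sum>k\<in>P. if U y (\<rho> k) = 1 then unitv (\<rho> k) j else 0)"
      by (rule sum.inter_filter) simp
    also have "\<dots> = U y j"
    proof (cases "j \<in> used")
      case True
      then obtain k0 where k0: "k0 \<in> P" "j = \<rho> k0" using used by blast
      have "(\<Sum>k\<in>P. if U y (\<rho> k) = 1 then unitv (\<rho> k) j else 0) = (\<Sum>k\<in>P. if k = k0 then U y j else 0)"
        using inj_rho k0 by (intro sum.cong refl) (auto simp: unitv_def inj_on_def)
      then show ?thesis using k0 by simp
    next
      case False
      have "(\<Sum>k\<in>P. if U y (\<rho> k) = 1 then unitv (\<rho> k) j else 0) = 0"
        using False used by (intro sum.neutral) (auto simp: unitv_def)
      moreover have "U y j = 0" using False z[of j] y[of j] by (cases "j < N") (auto simp: tr_def)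
      ultimately show ?thesis by simp
    qed
    finally show ?thesis .
  qed
  then have "U (\<lambda>i. \<Sum>k\<in>?S. colv N M k i) = U y" by (rule ext)
  then have e: "(\<lambda>i. \<Sum>k\<in>?S. colv N M k i) = y" by (rule injD[OF bij_is_inj[OF bij_U]])
  show "y i = (\<Sum>k\<in>?S. M i k)" if "i < N" for i
    using fun_cong[OF e, of i] that unfolding colv_def by simp
qed

lemma pivots_span:
  assumes "S \<subseteq> {..<N}"
  shows "\<exists>S'\<subseteq>P. \<forall>i<N. (\<Sum>k\<in>S. M i k) = (\<Sum>k\<in>S'. M i k)"
proof -
  have "U (\<lambda>i. \<Sum>k\<in>S. colv N M k i) i = 0" if "i \<notin> used" for i
    unfolding tr_sum using U_col_outside[OF _ that] assms by (intro sum.neutral) auto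
  from in_column_space[OF _ this] obtain S' where "S' \<subseteq> P"
    "\<forall>i<N. (\<Sum>k\<in>S. colv N M k i) = (\<Sum>k\<in>S'. M i k)" by (auto simp: colv_def)
  then show ?thesis by (auto simp: colv_def)
qed

lemma zero_row: "\<lbrakk>i < N; \<And>k. k < N \<Longrightarrow> M i k = 0; k \<in> P\<rbrakk> \<Longrightarrow> V i k = 0"
  using elim unfolding eliminated_def by auto

end

section \<open>Gauss-Jordan elimination on the word RAM\<close>

abbreviation seq_com (infixr ";;" 60) where "c1 ;; c2 \<equiv> Seq c1 c2"
abbreviation add_expr (infixl "[+]" 65) where "e1 [+] e2 \<equiv> Bin Add e1 e2"
abbreviation sub_expr (infixl "[-]" 65) where "e1 [-] e2 \<equiv> Bin Sub e1 e2"
abbreviation mul_expr (infixl "[*]" 70) where "e1 [*] e2 \<equiv> Bin Mul e1 e2"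
abbreviation less_expr (infix "[<]" 50) where "e1 [<] e2 \<equiv> Bin Less e1 e2"

lemma idx_eq:
  fixes p q N :: nat
  assumes "q < N" "q' < N"
  shows "p * N + q = p' * N + q' \<longleftrightarrow> p = p' \<and> q = q'"
proof
  assume e: "p * N + q = p' * N + q'"
  have "(p * N + q) div N = p" "(p' * N + q') div N = p'" using assms by auto
  then show "p = p' \<and> q = q'" using e by simp
qed simp

lemma idx_less: "\<lbrakk>p < R; q < N\<rbrakk> \<Longrightarrow> p * N + q < R * (N :: nat)"
proof -
  assume "p < R" "q < N"
  then have "p * N + q < Suc p * N" by simp
  also have "\<dots> \<le> R * N" using \<open>p < R\<close> by (intro mult_le_mono1) simp
  finally show ?thesis .
qed

text \<open>The overhead per row is linear in m in total and is absorbed by the quadratic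
  term.\<close>

lemma fill_time:
  assumes "t' \<le> t + m * (m * k + 14) + 6" "1 \<le> m" "K = k + 14"
  shows "t' \<le> t + (K * (m * m) + (6 :: nat))"
proof -
  have "m * (m * k + 14) \<le> K * (m * m)" using assms(2,3) by (simp add: algebra_simps)
  then show ?thesis using assms(1) by linarith
qed

lemma inj_idx: "inj_on (\<lambda>(i, j). i * m + j) ({..<R} \<times> {..<m :: nat})"
  by (auto simp: inj_on_def idx_eq)

lemma idx_cases:
  assumes "x < R * (m :: nat)"
  obtains i j where "i < R" "j < m" "x = i * m + j"
proof
  have "m > 0" using assms by (cases m) auto
  then show "x div m < R" "x mod m < m" "x = (x div m) * m + x mod m"
    using assms by (auto simp: less_mult_imp_div_less)
qed

lemma length_concat_rows: "(\<And>x. x \<in> set xs \<Longrightarrow> length x = m) \<Longrightarrow> length (concat xs) = length xs * m"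
  by (induction xs) auto

lemma nth_concat_rows:
  "\<lbrakk>\<And>x. x \<in> set xs \<Longrightarrow> length x = m; i < length xs; j < m\<rbrakk> \<Longrightarrow> concat xs ! (i * m + j) = xs ! i ! j"
proof (induction xs arbitrary: i)
  case (Cons x xs)
  then show ?case by (cases i) (auto simp: nth_append add.assoc)
qed simp

definition bit_mat :: "nat \<Rightarrow> (nat \<Rightarrow> nat \<Rightarrow> bit) \<Rightarrow> bit mat" where
  "bit_mat m A = mat m m (\<lambda>(i, j). A i j)"

lemma length_vec_code: "length (vec_code v) = dim_vec v"
  by (simp add: vec_code_def)

lemma nth_vec_code: "i < dim_vec v \<Longrightarrow> vec_code v ! i = bit_code (v $ i)"
  by (simp add: vec_code_def list_of_vec_index)

lemma length_mat_code: "M \<in> carrier_mat m m \<Longrightarrow> length (mat_code M) = m * m"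
  unfolding mat_code_def by (subst length_concat_rows[of _ m]) (auto simp: length_vec_code rows_def)

lemma nth_mat_code:
  "\<lbrakk>M \<in> carrier_mat m m; i < m; j < m\<rbrakk> \<Longrightarrow> mat_code M ! (i * m + j) = bit_code (M $$ (i, j))"
  unfolding mat_code_def
  by (subst nth_concat_rows[of _ m]) (auto simp: length_vec_code rows_def nth_vec_code)

lemma bit_code_le: "bit_code b \<le> 1"
  by (simp add: bit_code_def)

lemma bit_code_of_nat: "x \<le> 1 \<Longrightarrow> bit_code (of_nat x) = x"
  by (cases x) (auto simp: bit_code_def)

lemma of_nat_bit_code: "of_nat (bit_code b) = b"
  by (cases b) (auto simp: bit_code_def)

lemma of_nat_mod_2: "(of_nat (x mod 2) :: bit) = of_nat x"
  by (metis bit_not_zero_iff even_of_nat mod2_eq_if odd_iff_mod_2_eq_one of_nat_0 of_nat_1 parity_cases bit_not_one_iff even_zero odd_one)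

lemma mat_code_le: "x \<in> set (mat_code A) \<Longrightarrow> x \<le> 1"
  by (auto simp: mat_code_def vec_code_def bit_code_def)

section \<open>Products of square blocks inside a larger matrix\<close>

locale mult_program =
  fixes c0 :: com and C0 :: nat and \<omega> :: real
  assumes omega: "\<omega> > 2"
    and mult: "\<And>n A B. \<lbrakk>n \<ge> 1; A \<in> carrier_mat n n; B \<in> carrier_mat n n\<rbrakk> \<Longrightarrow>
      computes_within c0 C0 [[n], mat_code A, mat_code B] (real C0 * real n powr \<omega>) (mat_code (A * B))"
begin

definition tm :: "nat \<Rightarrow> nat" where "tm m = nat \<lfloor>real C0 * real m powr \<omega>\<rfloor>"
text \<open>The base bounds the input size of a product of m by m matrices: each of the 2 m^2 bits
  contributes at most 2, and the word m contributes m + 1, at most 2 m^2.\<close>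

definition word_need :: "nat \<Rightarrow> nat" where "word_need m = C0 * (6 * m * m) ^ C0"

lemma word_need_mono: "m \<le> m' \<Longrightarrow> word_need m \<le> word_need m'"
  unfolding word_need_def by (intro mult_le_mono power_mono) auto

lemma tm_mono: "m \<le> m' \<Longrightarrow> tm m \<le> tm m'"
  unfolding tm_def using omega by (intro nat_mono floor_mono mult_left_mono powr_mono2) auto

lemma mult_exec:
  assumes m: "m \<ge> 1"
  obtains t s where "exec (word_need m) c0 (init [[m], mat_code (bit_mat m A), mat_code (bit_mat m B)]) t s"
    "t \<le> tm m" "\<And>i j. \<lbrakk>i < m; j < m\<rbrakk> \<Longrightarrow> arr s 0 (i * m + j) = bit_code (\<Sum>k<m. A i k * B k j)"
proof -
  let ?A = "bit_mat m A" and ?B = "bit_mat m B"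
  let ?ins = "[[m], mat_code ?A, mat_code ?B]"
  have c: "?A \<in> carrier_mat m m" "?B \<in> carrier_mat m m" by (auto simp: bit_mat_def)
  obtain t s where ts: "exec (C0 * input_size ?ins ^ C0) c0 (init ?ins) t s" "real t \<le> real C0 * real m powr \<omega>"
    "\<And>i. i < m * m \<Longrightarrow> arr s 0 i = mat_code (?A * ?B) ! i"
    using mult[OF m c] length_mat_code[of "?A * ?B" m] c unfolding computes_within_def by auto
  have le2: "(\<Sum>x\<leftarrow>mat_code M. Suc x) \<le> 2 * (m * m)" if "M \<in> carrier_mat m m" for M
  proof -
    have "(\<Sum>x\<leftarrow>mat_code M. Suc x) \<le> (\<Sum>x\<leftarrow>mat_code M. 2)"
      using mat_code_le by (intro sum_list_mono) fastforce
    then show ?thesis using length_mat_code[OF that] by (simp add: sum_list_triv)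
  qed
  have "input_size ?ins \<le> 6 * m * m"
  proof -
    have "m \<le> m * m" "1 \<le> m * m" using m by simp_all
    moreover have "input_size ?ins = Suc m + ((\<Sum>x\<leftarrow>mat_code ?A. Suc x) + (\<Sum>x\<leftarrow>mat_code ?B. Suc x))"
      by (simp add: input_size_def)
    ultimately show ?thesis using le2[OF c(1)] le2[OF c(2)] by linarith
  qed
  then have "exec (word_need m) c0 (init ?ins) t s"
    unfolding word_need_def by (intro exec_mono_word[OF ts(1)] mult_le_mono power_mono) auto
  moreover have "t \<le> tm m" unfolding tm_def using ts(2) by linarith
  moreover have "arr s 0 (i * m + j) = bit_code (\<Sum>k<m. A i k * B k j)" if ij: "i < m" "j < m" for i j
  proof -
    have "arr s 0 (i * m + j) = bit_code ((?A * ?B) $$ (i, j))"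
      using ts(3)[OF idx_less[OF ij]] c ij nth_mat_code[of "?A * ?B" m] by simp
    also have "(?A * ?B) $$ (i, j) = (\<Sum>k<m. A i k * B k j)"
      unfolding bit_mat_def using ij
      by (subst index_mult_mat) (auto simp: scalar_prod_def lessThan_atLeast0 intro!: sum.cong)
    finally show ?thesis .
  qed
  ultimately show ?thesis using that by blast
qed

definition mult_call :: com where
  "mult_call = Assign 12 (Const 0) ;; instr c0"

text \<open>Besides the product, the conclusion records what restoring the memory requires: which
  arrays and registers of the copy may have changed, and that each changed cell has its index in the
  log.\<close>

lemma wp_mult_call:
  assumes m: "m \<ge> 1" and sm: "sim (init [[m], mat_code (bit_mat m A), mat_code (bit_mat m B)]) s"
    and W: "word_need m \<le> W" "tm m \<le> W"
    and Q: "\<And>s' t'. \<lbrakk>agree (insert 12 {100..}) (insert 7 {100..}) s s';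
      \<And>i j. \<lbrakk>i < m; j < m\<rbrakk> \<Longrightarrow> arr s' 100 (i * m + j) = bit_code (\<Sum>k<m. A i k * B k j);
      reg s' 12 \<le> tm m; \<And>x. x < reg s' 12 \<Longrightarrow> arr s' 7 x \<le> W;
      \<And>a i. arr s' (100 + a) i \<noteq> arr s (100 + a) i \<Longrightarrow> a < max_arr c0 \<and> (\<exists>x<reg s' 12. arr s' 7 x = i);
      \<And>r. r \<ge> max_reg c0 \<Longrightarrow> reg s' (100 + r) = 0; t' \<le> t + (6 * tm m + 2)\<rbrakk> \<Longrightarrow> Q s' t'"
  shows "wp W mult_call Q s t"
proof -
  let ?i = "init [[m], mat_code (bit_mat m A), mat_code (bit_mat m B)]"
  let ?s = "s\<lparr>reg := (reg s)(12 := 0)\<rparr>"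
  obtain t0 s0 where 0: "exec (word_need m) c0 ?i t0 s0" "t0 \<le> tm m"
    "\<And>i j. \<lbrakk>i < m; j < m\<rbrakk> \<Longrightarrow> arr s0 0 (i * m + j) = bit_code (\<Sum>k<m. A i k * B k j)"
    by (rule mult_exec[OF m, where A = A and B = B]) blast
  have s1: "sim ?i ?s" using sm by (simp add: sim_def)
  have "reg ?s 12 + t0 \<le> W" using W(2) 0(2) by simp
  from instr_exec[OF 0(1) s1 W(1) this] obtain t1 S where 1: "exec W (instr c0) ?s t1 S" "t1 \<le> 6 * t0" "sim s0 S" "reg S 12 \<le> reg ?s 12 + t0"
    "logged W ?i s0 ?s S"
    by blast
  have ag0: "agree (wregs c0) (warrs c0) ?i s0" using exec_agree[OF 0(1)] .
  have "agree (wregs (instr c0)) (warrs (instr c0)) ?s S" using exec_agree[OF 1(1)] .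
  then have ag: "agree (insert 12 {100..}) (insert 7 {100..}) ?s S"
    by (rule agree_mono[OF _ wregs_instr warrs_instr])
  have "Q S (t + (1 + 1) + t1)"
  proof (rule Q)
    show "agree (insert 12 {100..}) (insert 7 {100..}) s S" using ag by (auto simp: agree_def)
    show "arr S 100 (i * m + j) = bit_code (\<Sum>k<m. A i k * B k j)" if "i < m" "j < m" for i j
      using 0(3)[OF that] 1(3) by (metis add_0_right sim_def)
    show "reg S 12 \<le> tm m" using 1(4) 0(2) by simp
    show "arr S 7 x \<le> W" if "x < reg S 12" for x
      using 1(5) that by (simp add: logged_def)
    show "reg S (100 + r) = 0" if "r \<ge> max_reg c0" for r
    proof -
      have "r \<notin> wregs c0" using wregs_max[of c0] that by auto
      then have "reg s0 r = 0" using ag0 by (simp add: agree_def init_def)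
      then show ?thesis using 1(3) by (simp add: sim_def)
    qed
    show "a < max_arr c0 \<and> (\<exists>x<reg S 12. arr S 7 x = i)" if "arr S (100 + a) i \<noteq> arr s (100 + a) i" for a i
    proof -
      have ne: "arr s0 a i \<noteq> arr ?i a i" using that sm 1(3) by (simp add: sim_def)
      then have "a \<in> warrs c0" using ag0 by (auto simp: agree_def)
      moreover have "\<exists>x\<in>{reg ?s 12..<reg S 12}. arr S 7 x = i" using 1(5) ne unfolding logged_def by blast
      ultimately show ?thesis using warrs_max[of c0] by auto
    qed
    show "t + (1 + 1) + t1 \<le> t + (6 * tm m + 2)" using 1(2) 0(2) by simp
  qed
  then have "wp W (instr c0) Q ?s (t + (1 + 1))" unfolding wp_def using 1(1) by blast
  then show ?thesis unfolding mult_call_def by (intro wp_Seq wp_Assign) auto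
qed

definition clean :: "ram \<Rightarrow> bool" where
  "clean s \<longleftrightarrow> (\<forall>r\<ge>100. reg s r = 0) \<and> (\<forall>a\<ge>100. \<forall>i. arr s a i = 0)"

text \<open>The first bound covers all addresses in an N by N matrix, the second and third a run of
  the copied program and its log. Both are monotone in the size, so bounds at \<open>N\<close> are
  enough for all smaller blocks.\<close>

definition word_ok :: "nat \<Rightarrow> nat \<Rightarrow> bool" where
  "word_ok N W \<longleftrightarrow> 2 * N * N + 4 \<le> W \<and> word_need N \<le> W \<and> tm N \<le> W"

text \<open>Registers: 1 the size \<open>N\<close> of the matrix in array 3, 2 the block size, 5 and 6 the first
  columns of the stored transformation and of the columns to be updated, 8 the block of rows.
  Array 6 holds the pivot rows of the columns to be updated.\<close>

definition load_block :: com where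
  "load_block =
     For 9 2 (For 10 2 (Store 102 (Reg 9 [*] Reg 2 [+] Reg 10)
       (Cell 3 ((Reg 8 [*] Reg 2 [+] Reg 9) [*] Reg 1 [+] Reg 5 [+] Reg 10)))) ;;
     For 9 2 (For 10 2 (Store 103 (Reg 9 [*] Reg 2 [+] Reg 10) (Cell 6 (Reg 9 [*] Reg 2 [+] Reg 10)))) ;;
     Store 101 (Const 0) (Reg 2)"

definition add_block :: com where
  "add_block =
     For 9 2 (For 10 2 (Store 3 ((Reg 8 [*] Reg 2 [+] Reg 9) [*] Reg 1 [+] Reg 6 [+] Reg 10)
       (Bin Rem (Cell 3 ((Reg 8 [*] Reg 2 [+] Reg 9) [*] Reg 1 [+] Reg 6 [+] Reg 10)
         [+] Cell 100 (Reg 9 [*] Reg 2 [+] Reg 10)) (Const 2))))"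

definition undo :: com where
  "undo =
     For 14 12 (clear_cells (max_arr c0) (Cell 7 (Reg 14))) ;;
     clear_regs (max_reg c0) ;;
     For 9 2 (For 10 2 (Store 102 (Reg 9 [*] Reg 2 [+] Reg 10) (Const 0))) ;;
     For 9 2 (For 10 2 (Store 103 (Reg 9 [*] Reg 2 [+] Reg 10) (Const 0))) ;;
     Store 101 (Const 0) (Const 0)"

text \<open>The copy must find exactly the initial memory of the original, zeros included. The
  loaded cells give the inputs, and \<open>clean\<close> gives the zeros everywhere else.\<close>

lemma wp_load_block:
  assumes r: "reg s 1 = N" "reg s 2 = m" "reg s 8 = b" "reg s 5 = vc"
    and le: "1 \<le> m" "(b + 1) * m \<le> N" "vc + m \<le> N"
    and bits: "\<And>x. x < N * N \<Longrightarrow> arr s 3 x \<le> 1" "\<And>x. x < m * m \<Longrightarrow> arr s 6 x \<le> 1"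
    and cl: "clean s" and W: "2 * N * N + 4 \<le> W"
    and Q: "\<And>s' t'. \<lbrakk>agree {9, 10} {101, 102, 103} s s';
      sim (init [[m], mat_code (bit_mat m (\<lambda>i k. of_nat (arr s 3 ((b * m + i) * N + (vc + k))))),
        mat_code (bit_mat m (\<lambda>k j. of_nat (arr s 6 (k * m + j))))]) s';
      t' \<le> t + (74 * (m * m) + 15)\<rbrakk> \<Longrightarrow> Q s' t'"
  shows "wp W load_block Q s t"
proof -
  have rows: "b * m + i < N" if "i < m" for i using le that by simp
  have mN: "m \<le> N" using le by simp
  have small: "x \<le> N * N \<Longrightarrow> x \<le> W" for x using W by simp
  have NN: "N \<le> N * N" "m * m \<le> N * N" using le mN mult_le_mono[OF mN mN] by simp_all
  have smallN: "x \<le> N \<Longrightarrow> x \<le> W" for x using NN(1) small by (meson le_trans)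
  have bN: "b \<le> N" using le by (cases m) auto
  have e1: "(b * m + i) * N + (vc + k) < N * N" if "i < m" "k < m" for i k
    using rows[OF that(1)] le that by (intro idx_less) auto
  have e2: "i * m + k < m * m" if "i < m" "k < m" for i k using that by (rule idx_less)
  show ?thesis unfolding load_block_def
  proof (rule wp_Seq, rule wp_For_fill[where R = m and S = m and idx = "\<lambda>i j. i * m + j" and
        v = "\<lambda>i k. arr s 3 ((b * m + i) * N + (vc + k))"])
    fix s1 i j assume a: "agree {9, 10} {102} s s1" "reg s1 9 = i" "reg s1 10 = j" "i < m" "j < m"
    have "arr s 3 ((b * m + i) * N + (vc + j)) \<le> W" using bits(1)[OF e1[OF a(4,5)]] W by simp
    moreover have "arr s1 3 = arr s 3" "reg s1 1 = N" "reg s1 2 = m" "reg s1 8 = b" "reg s1 5 = vc"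
      using a(1) r by (simp_all add: agree_def)
    moreover have "i * m + j \<le> W" "i * m \<le> W" "(b * m + i) * N + (vc + j) \<le> W"
      "(b * m + i) * N + vc \<le> W" "(b * m + i) * N \<le> W"
      using e1[OF a(4,5)] e2[OF a(4,5)] NN rows[OF a(4)] by (intro small; simp)+
    moreover have "b * m + i \<le> W" "b * m \<le> W" "N \<le> W" "m \<le> W" "i \<le> W" "b \<le> W" "vc \<le> W" "j \<le> W"
      using rows[OF a(4)] a mN le bN by (intro smallN; simp)+
    ultimately show "val s1 (Reg 9 [*] Reg 2 [+] Reg 10) = i * m + j \<and>
      val s1 (Cell 3 ((Reg 8 [*] Reg 2 [+] Reg 9) [*] Reg 1 [+] Reg 5 [+] Reg 10)) =
        arr s 3 ((b * m + i) * N + (vc + j)) \<and> fits W s1 (Reg 9 [*] Reg 2 [+] Reg 10) \<and>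
      fits W s1 (Cell 3 ((Reg 8 [*] Reg 2 [+] Reg 9) [*] Reg 1 [+] Reg 5 [+] Reg 10))"
      using a by (simp add: add.assoc)
  next
    fix s1 t1
    assume 1: "agree {9, 10} {102} s s1"
      "\<And>i j. \<lbrakk>i < m; j < m\<rbrakk> \<Longrightarrow> arr s1 102 (i * m + j) = arr s 3 ((b * m + i) * N + (vc + j))"
      "\<And>x. (\<And>i j. \<lbrakk>i < m; j < m\<rbrakk> \<Longrightarrow> x \<noteq> i * m + j) \<Longrightarrow> arr s1 102 x = arr s 102 x"
      and t1: "t1 \<le> t + m * (m * (cost (Reg 9 [*] Reg 2 [+] Reg 10) +
        cost (Cell 3 ((Reg 8 [*] Reg 2 [+] Reg 9) [*] Reg 1 [+] Reg 5 [+] Reg 10)) + 9) + 14) + 6"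
    show "wp W (For 9 2 (For 10 2 (Store 103 (Reg 9 [*] Reg 2 [+] Reg 10) (Cell 6 (Reg 9 [*] Reg 2 [+] Reg 10)))) ;;
       Store 101 (Const 0) (Reg 2)) Q s1 t1"
    proof (rule wp_Seq, rule wp_For_fill[where R = m and S = m and idx = "\<lambda>i j. i * m + j" and
          v = "\<lambda>i k. arr s 6 (i * m + k)"])
      fix s2 i j assume a: "agree {9, 10} {103} s1 s2" "reg s2 9 = i" "reg s2 10 = j" "i < m" "j < m"
      have "arr s 6 (i * m + j) \<le> W" using bits(2)[OF e2[OF a(4,5)]] W by simp
      moreover have "arr s2 6 = arr s 6" "reg s2 2 = m" using a(1) 1(1) r by (simp_all add: agree_def)
      moreover have "i * m + j \<le> W" "i * m \<le> W"
        using e2[OF a(4,5)] NN by (intro small; simp)+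
      moreover have "j \<le> W" "m \<le> W" "i \<le> W" using a mN by (intro smallN; simp)+
      ultimately show "val s2 (Reg 9 [*] Reg 2 [+] Reg 10) = i * m + j \<and>
        val s2 (Cell 6 (Reg 9 [*] Reg 2 [+] Reg 10)) = arr s 6 (i * m + j) \<and>
        fits W s2 (Reg 9 [*] Reg 2 [+] Reg 10) \<and> fits W s2 (Cell 6 (Reg 9 [*] Reg 2 [+] Reg 10))"
        using a by simp
    next
      fix s2 t2
      assume 2: "agree {9, 10} {103} s1 s2"
        "\<And>i j. \<lbrakk>i < m; j < m\<rbrakk> \<Longrightarrow> arr s2 103 (i * m + j) = arr s 6 (i * m + j)"
        "\<And>x. (\<And>i j. \<lbrakk>i < m; j < m\<rbrakk> \<Longrightarrow> x \<noteq> i * m + j) \<Longrightarrow> arr s2 103 x = arr s1 103 x"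
        and t2: "t2 \<le> t1 + m * (m * (cost (Reg 9 [*] Reg 2 [+] Reg 10) +
          cost (Cell 6 (Reg 9 [*] Reg 2 [+] Reg 10)) + 9) + 14) + 6"
      let ?V = "bit_mat m (\<lambda>i k. of_nat (arr s 3 ((b * m + i) * N + (vc + k))))"
      let ?E = "bit_mat m (\<lambda>k j. of_nat (arr s 6 (k * m + j)))"
      let ?s = "s2\<lparr>arr := (arr s2)(101 := (arr s2 101)(0 := m))\<rparr>"
      have c: "?V \<in> carrier_mat m m" "?E \<in> carrier_mat m m" by (simp_all add: bit_mat_def)
      have V: "arr s2 102 x = (if x < m * m then mat_code ?V ! x else 0)" for x
      proof (cases "x < m * m")
        case True
        then obtain i j where ij: "i < m" "j < m" "x = i * m + j" by (rule idx_cases)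
        have "arr s2 102 x = arr s 3 ((b * m + i) * N + (vc + j))" using 1(2) 2(1) ij by (simp add: agree_def)
        then show ?thesis using True nth_mat_code[OF c(1) ij(1,2)] ij bits(1)[OF e1[OF ij(1,2)]]
          by (simp add: bit_mat_def bit_code_of_nat)
      next
        case False
        then have "arr s1 102 x = arr s 102 x" using e2 by (intro 1(3)) auto
        then show ?thesis using False 2(1) cl by (simp add: agree_def clean_def)
      qed
      have E: "arr s2 103 x = (if x < m * m then mat_code ?E ! x else 0)" for x
      proof (cases "x < m * m")
        case True
        then obtain i j where ij: "i < m" "j < m" "x = i * m + j" by (rule idx_cases)
        then show ?thesis using True nth_mat_code[OF c(2) ij(1,2)] ij bits(2)[OF e2[OF ij(1,2)]] 2(2)
          by (simp add: bit_mat_def bit_code_of_nat)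
      next
        case False
        then have "arr s2 103 x = arr s1 103 x" using e2 by (intro 2(3)) auto
        then show ?thesis using False 1(1) cl by (simp add: agree_def clean_def)
      qed
      have sm: "sim (init [[m], mat_code ?V, mat_code ?E]) ?s"
        unfolding sim_def
      proof (intro conjI allI)
        fix r show "reg ?s (100 + r) = reg (init [[m], mat_code ?V, mat_code ?E]) r"
          using 1(1) 2(1) cl by (simp add: init_def agree_def clean_def)
      next
        fix a :: nat
        consider "a = 1" | "a = 2" | "a = 3" | "a = 0 \<or> a > 3" by linarith
        then show "arr ?s (100 + a) = arr (init [[m], mat_code ?V, mat_code ?E]) a"
        proof cases
          case 1
          then show ?thesis using \<open>agree {9, 10} {102} s s1\<close> 2(1) cl
            by (auto simp: init_def agree_def clean_def)
        next
          case 2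
          then show ?thesis using V length_mat_code[OF c(1)] by (auto simp: init_def)
        next
          case 3
          then show ?thesis using E length_mat_code[OF c(2)] by (auto simp: init_def)
        next
          case 4
          then show ?thesis using 1(1) 2(1) cl by (auto simp: init_def agree_def clean_def)
        qed
      qed
      show "wp W (Store 101 (Const 0) (Reg 2)) Q s2 t2"
      proof (rule wp_Store)
        have m2: "reg s2 2 = m" using 1(1) 2(1) r by (simp add: agree_def)
        then show "fits W s2 (Reg 2)" using smallN[of m] mN by simp
        have "t1 \<le> t + m * (m * 26 + 14) + 6" "t2 \<le> t1 + m * (m * 20 + 14) + 6"
          using t1 t2 by simp_all
        from this[THEN fill_time, OF le(1) refl] have "t2 + 3 \<le> t + (74 * (m * m) + 15)" by simp
        moreover have "agree {9, 10} {101, 102, 103} s ?s" using 1(1) 2(1) by (simp add: agree_def)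
        ultimately show "Q (s2\<lparr>arr := (arr s2)(101 := (arr s2 101)(val s2 (Const 0) := val s2 (Reg 2)))\<rparr>)
          (t2 + (1 + cost (Const 0) + cost (Reg 2)))"
          using Q[of ?s "t2 + 3"] sm m2 by (simp add: numeral_3_eq_3)
      qed simp
    qed (use 1 r inj_idx[of m m] W mN smallN in \<open>simp_all add: agree_def\<close>)
  qed (use r inj_idx[of m m] W mN smallN in \<open>simp_all\<close>)
qed

lemma wp_add_block:
  assumes r: "reg s 1 = N" "reg s 2 = m" "reg s 8 = b" "reg s 6 = yc"
    and le: "1 \<le> m" "(b + 1) * m \<le> N" "yc + m \<le> N"
    and bits: "\<And>x. x < N * N \<Longrightarrow> arr s 3 x \<le> 1"
    and out: "\<And>i j. \<lbrakk>i < m; j < m\<rbrakk> \<Longrightarrow> arr s 100 (i * m + j) = bit_code (D i j)"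
    and W: "2 * N * N + 4 \<le> W"
    and Q: "\<And>s' t'. \<lbrakk>agree {9, 10} {3} s s';
      \<And>i j. \<lbrakk>i < m; j < m\<rbrakk> \<Longrightarrow> arr s' 3 ((b * m + i) * N + (yc + j)) =
        bit_code (of_nat (arr s 3 ((b * m + i) * N + (yc + j))) + D i j);
      \<And>x. (\<And>i j. \<lbrakk>i < m; j < m\<rbrakk> \<Longrightarrow> x \<noteq> (b * m + i) * N + (yc + j)) \<Longrightarrow> arr s' 3 x = arr s 3 x;
      t' \<le> t + (55 * (m * m) + 6)\<rbrakk> \<Longrightarrow> Q s' t'"
  shows "wp W add_block Q s t"
proof -
  have rows: "b * m + i < N" if "i < m" for i using le that by simp
  have mN: "m \<le> N" using le by simp
  have small: "x \<le> N * N \<Longrightarrow> x \<le> W" for x using W by simp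
  have NN: "N \<le> N * N" "m * m \<le> N * N" using le mN mult_le_mono[OF mN mN] by simp_all
  have smallN: "x \<le> N \<Longrightarrow> x \<le> W" for x using NN(1) small by (meson le_trans)
  have bN: "b \<le> N" using le by (cases m) auto
  have e1: "(b * m + i) * N + (yc + k) < N * N" if "i < m" "k < m" for i k
    using rows[OF that(1)] le that by (intro idx_less) auto
  have e2: "i * m + k < m * m" if "i < m" "k < m" for i k using that by (rule idx_less)
  have inj: "inj_on (\<lambda>(i, j). (b * m + i) * N + (yc + j)) ({..<m} \<times> {..<m})"
    using le by (auto simp: inj_on_def idx_eq)
  show ?thesis unfolding add_block_def
  proof (rule wp_For_fill[OF r(2,2) _ _ _ _ inj, where v = "\<lambda>i j. bit_code (of_nat (arr s 3 ((b * m + i) * N + (yc + j))) + D i j)"])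
    fix s1 i j assume a: "agree {9, 10} {3} s s1" "reg s1 9 = i" "reg s1 10 = j" "i < m" "j < m"
      "arr s1 3 ((b * m + i) * N + (yc + j)) = arr s 3 ((b * m + i) * N + (yc + j))"
    let ?x = "arr s 3 ((b * m + i) * N + (yc + j))"
    have x: "?x \<le> 1" "bit_code (D i j) \<le> 1" using bits(1)[OF e1[OF a(4,5)]] bit_code_le by auto
    have "arr s1 100 (i * m + j) = bit_code (D i j)" using a(1) out[OF a(4,5)] by (simp add: agree_def)
    moreover have "reg s1 1 = N" "reg s1 2 = m" "reg s1 8 = b" "reg s1 6 = yc"
      using a(1) r by (simp_all add: agree_def)
    moreover have "i * m + j \<le> W" "i * m \<le> W" "(b * m + i) * N + (yc + j) \<le> W"
      "(b * m + i) * N + yc \<le> W" "(b * m + i) * N \<le> W"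
      using e1[OF a(4,5)] e2[OF a(4,5)] NN rows[OF a(4)] by (intro small; simp)+
    moreover have "b * m + i \<le> W" "b * m \<le> W" "N \<le> W" "m \<le> W" "i \<le> W" "b \<le> W" "yc \<le> W" "j \<le> W"
      using rows[OF a(4)] a mN le bN by (intro smallN; simp)+
    moreover have "(?x + bit_code (D i j)) mod 2 = bit_code (of_nat ?x + D i j)"
    proof -
      have "bit_code (of_nat ((?x + bit_code (D i j)) mod 2)) = (?x + bit_code (D i j)) mod 2"
        by (rule bit_code_of_nat) simp
      then show ?thesis by (simp only: of_nat_mod_2 of_nat_add of_nat_bit_code)
    qed
    moreover have "?x + bit_code (D i j) \<le> W" "?x \<le> W" "bit_code (D i j) \<le> W" "2 \<le> W"
      "(?x + bit_code (D i j)) mod 2 \<le> W" using x W by simp_all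
    ultimately show "val s1 ((Reg 8 [*] Reg 2 [+] Reg 9) [*] Reg 1 [+] Reg 6 [+] Reg 10) =
        (b * m + i) * N + (yc + j) \<and>
      val s1 (Bin Rem (Cell 3 ((Reg 8 [*] Reg 2 [+] Reg 9) [*] Reg 1 [+] Reg 6 [+] Reg 10)
         [+] Cell 100 (Reg 9 [*] Reg 2 [+] Reg 10)) (Const 2)) = bit_code (of_nat ?x + D i j) \<and>
      fits W s1 ((Reg 8 [*] Reg 2 [+] Reg 9) [*] Reg 1 [+] Reg 6 [+] Reg 10) \<and>
      fits W s1 (Bin Rem (Cell 3 ((Reg 8 [*] Reg 2 [+] Reg 9) [*] Reg 1 [+] Reg 6 [+] Reg 10)
         [+] Cell 100 (Reg 9 [*] Reg 2 [+] Reg 10)) (Const 2))"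
      using a by (simp add: add.assoc)
  next
    fix s' t' assume 1: "agree {9, 10} {3} s s'"
      "\<And>i j. \<lbrakk>i < m; j < m\<rbrakk> \<Longrightarrow> arr s' 3 ((b * m + i) * N + (yc + j)) =
        bit_code (of_nat (arr s 3 ((b * m + i) * N + (yc + j))) + D i j)"
      "\<And>x. (\<And>i j. \<lbrakk>i < m; j < m\<rbrakk> \<Longrightarrow> x \<noteq> (b * m + i) * N + (yc + j)) \<Longrightarrow> arr s' 3 x = arr s 3 x"
      and t': "t' \<le> t + m * (m * (cost ((Reg 8 [*] Reg 2 [+] Reg 9) [*] Reg 1 [+] Reg 6 [+] Reg 10) +
        cost (Bin Rem (Cell 3 ((Reg 8 [*] Reg 2 [+] Reg 9) [*] Reg 1 [+] Reg 6 [+] Reg 10)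
         [+] Cell 100 (Reg 9 [*] Reg 2 [+] Reg 10)) (Const 2)) + 9) + 14) + 6"
    have "t' \<le> t + m * (m * 41 + 14) + 6" using t' by simp
    then have 2: "t' \<le> t + (55 * (m * m) + 6)" by (rule fill_time) (use le in simp_all)
    show "Q s' t'" by (rule Q; fact 1 2)
  qed (use mN smallN W in simp_all)
qed

definition undo_const :: nat where "undo_const = 4 * max_arr c0 + 2 * max_reg c0 + 100"

text \<open>Nonzero cells of the copy are either logged or belong to the inputs, which were loaded
  without logging; the latter are cleared explicitly. Thus undoing takes time proportional to the
  log and to m^2, whatever part of the memory the addresses range over.\<close>

lemma wp_undo:
  assumes r: "reg s 2 = m" "1 \<le> m" "m * m + m + 1 \<le> W" "reg s 12 \<le> W"
    and log: "\<And>x. x < reg s 12 \<Longrightarrow> arr s 7 x \<le> W"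
    and cells: "\<And>a i. arr s (100 + a) i \<noteq> 0 \<Longrightarrow> (a < max_arr c0 \<and> (\<exists>x<reg s 12. arr s 7 x = i)) \<or>
      (a = 1 \<and> i = 0) \<or> ((a = 2 \<or> a = 3) \<and> i < m * m)"
    and regs: "\<And>r. r \<ge> max_reg c0 \<Longrightarrow> reg s (100 + r) = 0"
    and Q: "\<And>s' t'. \<lbrakk>agree ({9, 10, 14} \<union> {100..}) {100..} s s'; clean s';
      t' \<le> t + undo_const * (m * m + reg s 12)\<rbrakk> \<Longrightarrow> Q s' t'"
  shows "wp W undo Q s t"
proof -
  let ?h = "reg s 12" and ?A = "max_arr c0" and ?R = "max_reg c0"
  have mW: "m \<le> W" "1 \<le> W" using r by simp_all
  have e2: "i * m + k < m * m" if "i < m" "k < m" for i k using that by (rule idx_less)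
  let ?c = "clear_cells ?A (Cell 7 (Reg 14))"
  have fill: "wp W (For 9 2 (For 10 2 (Store a (Reg 9 [*] Reg 2 [+] Reg 10) (Const 0)))) Q s t"
    if "reg s 2 = m" and Q: "\<And>s' t'. \<lbrakk>agree {9, 10} {a} s s'; \<And>x. x < m * m \<Longrightarrow> arr s' a x = 0;
      \<And>x. \<not> x < m * m \<Longrightarrow> arr s' a x = arr s a x; t' \<le> t + (29 * (m * m) + 6)\<rbrakk> \<Longrightarrow> Q s' t'"
    for a Q s t
  proof (rule wp_For_fill[OF that(1,1) _ _ _ _ inj_idx, where v = "\<lambda>_ _. 0"])
    fix s1 i j assume a: "agree {9, 10} {a} s s1" "reg s1 9 = i" "reg s1 10 = j" "i < m" "j < m"
    then have "i * m + j \<le> W" "i \<le> W" "j \<le> W" using e2[OF a(4,5)] r mW by auto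
    then show "val s1 (Reg 9 [*] Reg 2 [+] Reg 10) = i * m + j \<and> val s1 (Const 0) = 0 \<and>
        fits W s1 (Reg 9 [*] Reg 2 [+] Reg 10) \<and> fits W s1 (Const 0)"
      using a that(1) mW by (auto simp: agree_def)
  next
    fix s' t' assume 1: "agree {9, 10} {a} s s'" "\<And>i j. \<lbrakk>i < m; j < m\<rbrakk> \<Longrightarrow> arr s' a (i * m + j) = 0"
      "\<And>x. (\<And>i j. \<lbrakk>i < m; j < m\<rbrakk> \<Longrightarrow> x \<noteq> i * m + j) \<Longrightarrow> arr s' a x = arr s a x"
      "t' \<le> t + m * (m * (cost (Reg 9 [*] Reg 2 [+] Reg 10) + cost (Const 0) + 9) + 14) + 6"
    show "Q s' t'"
    proof (rule Q[OF 1(1)])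
      show "arr s' a x = 0" if "x < m * m" for x using that 1(2) by (metis idx_cases)
      show "arr s' a x = arr s a x" if "\<not> x < m * m" for x using that e2 by (intro 1(3)) auto
      have "t' \<le> t + m * (m * 15 + 14) + 6" using 1(4) by simp
      then show "t' \<le> t + (29 * (m * m) + 6)" by (rule fill_time) (use r in simp_all)
    qed
  qed (use mW in auto)
  show ?thesis unfolding undo_def
  proof (rule wp_Seq, rule wp_For[where n = ?h and B = "4 * ?A + 1" and I = "\<lambda>x s1. \<forall>a<?A.
      arr s1 (100 + a) = (\<lambda>i. if \<exists>x'<x. arr s 7 x' = i then 0 else arr s (100 + a) i)"])
    fix x s1 t1 assume x: "x < ?h" and a: "agree (insert 14 (wregs ?c)) (warrs ?c) s s1" "reg s1 14 = x"
      and I: "\<forall>a<?A. arr s1 (100 + a) = (\<lambda>i. if \<exists>x'<x. arr s 7 x' = i then 0 else arr s (100 + a) i)"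
    have 7: "arr s1 7 = arr s 7" using a(1) by (simp add: agree_def)
    show "wp W ?c (\<lambda>s2 t2. (\<forall>a<?A. arr s2 (100 + a) = (\<lambda>i. if \<exists>x'<Suc x. arr s 7 x' = i then 0 else
        arr s (100 + a) i)) \<and> t2 \<le> t1 + (4 * ?A + 1)) s1 t1"
    proof (rule wp_clear_cells[where x = "arr s 7 x"])
      show "val s1 (Cell 7 (Reg 14)) = arr s 7 x" using 7 a by simp
      show "fits W s1 (Cell 7 (Reg 14))" using 7 a log[OF x] x r by simp
      then show "val s' (Cell 7 (Reg 14)) = val s1 (Cell 7 (Reg 14)) \<and> fits W s' (Cell 7 (Reg 14))"
        if "agree {} {100..} s1 s'" for s' using that by (simp add: agree_def)
    qed (use I in \<open>auto simp: fun_eq_iff less_Suc_eq\<close>)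
  next
    fix s1 t1 assume a1: "agree (insert 14 (wregs ?c)) (warrs ?c) s s1"
      and I: "\<forall>a<?A. arr s1 (100 + a) = (\<lambda>i. if \<exists>x'<?h. arr s 7 x' = i then 0 else arr s (100 + a) i)"
      and t1: "t1 \<le> t + ?h * (4 * ?A + 1 + 8) + 6"
    have z1: "arr s1 (100 + a) i = 0 \<or> (a = 1 \<and> i = 0) \<or> ((a = 2 \<or> a = 3) \<and> i < m * m)" for a i
    proof (cases "a < ?A")
      case True
      then show ?thesis using I cells[of a i] by auto
    next
      case False
      then have "arr s1 (100 + a) = arr s (100 + a)" using a1 by (simp add: agree_def)
      then show ?thesis using cells[of a i] False by auto
    qed
    show "wp W (clear_regs ?R ;; For 9 2 (For 10 2 (Store 102 (Reg 9 [*] Reg 2 [+] Reg 10) (Const 0))) ;;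
      For 9 2 (For 10 2 (Store 103 (Reg 9 [*] Reg 2 [+] Reg 10) (Const 0))) ;; Store 101 (Const 0) (Const 0)) Q s1 t1"
    proof (rule wp_Seq, rule wp_clear_regs, rule wp_Seq, rule fill)
      fix s2 t2 assume a2: "agree {100..<100 + ?R} {} s1 s2" and z: "\<And>r. r < ?R \<Longrightarrow> reg s2 (100 + r) = 0"
        and t2: "t2 \<le> t1 + (2 * ?R + 1)"
      have rz: "reg s2 (100 + r) = 0" for r
      proof (cases "r < ?R")
        case False
        then have "reg s2 (100 + r) = reg s (100 + r)" using a1 a2 by (simp add: agree_def)
        then show ?thesis using regs False by simp
      qed (rule z)
      show "reg s2 2 = m" using a1 a2 r by (simp add: agree_def)
      fix s3 t3 assume a3: "agree {9, 10} {102} s2 s3" and z3: "\<And>x. x < m * m \<Longrightarrow> arr s3 102 x = 0"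
        "\<And>x. \<not> x < m * m \<Longrightarrow> arr s3 102 x = arr s2 102 x" and t3: "t3 \<le> t2 + (29 * (m * m) + 6)"
      show "wp W (For 9 2 (For 10 2 (Store 103 (Reg 9 [*] Reg 2 [+] Reg 10) (Const 0))) ;;
          Store 101 (Const 0) (Const 0)) Q s3 t3"
      proof (rule wp_Seq, rule fill)
        show "reg s3 2 = m" using a1 a2 a3 r by (simp add: agree_def)
        fix s4 t4 assume a4: "agree {9, 10} {103} s3 s4" and z4: "\<And>x. x < m * m \<Longrightarrow> arr s4 103 x = 0"
          "\<And>x. \<not> x < m * m \<Longrightarrow> arr s4 103 x = arr s3 103 x" and t4: "t4 \<le> t3 + (29 * (m * m) + 6)"
        let ?s = "s4\<lparr>arr := (arr s4)(101 := (arr s4 101)(0 := 0))\<rparr>"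
        have "Q ?s (t4 + 3)"
        proof (rule Q)
          show "agree ({9, 10, 14} \<union> {100..}) {100..} s ?s"
            using a1 a2 a3 a4 by (auto simp: agree_def)
          have 2: "arr s2 = arr s1" using a2 by (auto simp: agree_def)
          have "arr s4 102 x = 0" for x
            using z3(1)[of x] z3(2)[of x] z1[of 2 x] a4 2 by (cases "x < m * m") (auto simp: agree_def)
          moreover have "arr s4 103 x = 0" for x
            using z4(1)[of x] z4(2)[of x] z1[of 3 x] a3 2 by (cases "x < m * m") (auto simp: agree_def)
          moreover have "arr s4 (100 + a) x = 0" if "a \<noteq> 2" "a \<noteq> 3" "\<not> (a = 1 \<and> x = 0)" for a x
            using z1[of a x] a3 a4 2 that by (auto simp: agree_def)
          moreover have "arr s4 101 x = 0" if "x \<noteq> 0" for x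
            using z1[of 1 x] a3 a4 2 that by (auto simp: agree_def)
          ultimately have az: "arr ?s (100 + a) x = 0" for a x
            by (cases "a = 2"; cases "a = 3"; cases "a = 1") auto
          have "reg ?s (100 + r) = 0" for r using rz[of r] a3 a4 by (simp add: agree_def)
          then show "clean ?s" unfolding clean_def using az by (metis le_Suc_ex)
          have "1 \<le> m * m" using r by simp
          moreover have u: "undo_const * (m * m + ?h) = (4 * ?A + 100) * ?h + undo_const * (m * m) + 2 * ?R * ?h"
            by (simp add: undo_const_def algebra_simps)
          moreover have h: "(4 * ?A + 100) * ?h = ?h * (4 * ?A + 1 + 8) + 91 * ?h" by (simp add: algebra_simps)
          moreover have "undo_const * (m * m) \<ge> 100 * (m * m) + 2 * ?R"
          proof -
            have "100 * (m * m) + 2 * ?R * 1 \<le> 100 * (m * m) + 2 * ?R * (m * m)"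
              using r by (intro add_left_mono mult_le_mono2) simp
            also have "\<dots> \<le> undo_const * (m * m)" by (simp add: undo_const_def algebra_simps)
            finally show ?thesis by simp
          qed
          ultimately show "t4 + 3 \<le> t + undo_const * (m * m + ?h)"
            using t1 t2 t3 t4 h by linarith
        qed
        then show "wp W (Store 101 (Const 0) (Const 0)) Q s4 t4"
          by (intro wp_Store) (auto simp: numeral_3_eq_3)
      qed
    qed
  qed (use r mW in \<open>auto simp: agree_def\<close>)
qed

end

definition mat_of :: "nat \<Rightarrow> ram \<Rightarrow> nat \<Rightarrow> nat \<Rightarrow> bit" where
  "mat_of N s i k = of_nat (arr s 3 (i * N + k))"

text \<open>A sum over pivot columns only becomes a full row-by-column product of length
  \<open>m\<close>: columns without a pivot get the contribution zero.\<close>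

lemma sum_piv_cols:
  "(\<Sum>k\<in>piv_cols piv c m. f k) = (\<Sum>k<m. if piv (c + k) = 0 then 0 else (f (c + k) :: 'a::comm_monoid_add))"
proof -
  have "(\<Sum>k\<in>piv_cols piv c m. f k) = (\<Sum>k\<in>{c..<c + m}. if piv k \<noteq> 0 then f k else 0)"
    unfolding piv_cols_def by (rule sum.inter_filter) simp
  also have "\<dots> = (\<Sum>k<m. if piv (c + k) \<noteq> 0 then f (c + k) else 0)"
    by (rule sum.reindex_bij_witness[where i = "\<lambda>k. c + k" and j = "\<lambda>k. k - c"]) auto
  also have "\<dots> = (\<Sum>k<m. if piv (c + k) = 0 then 0 else f (c + k))"
    by (rule sum.cong) auto
  finally show ?thesis .
qed

lemma length_mat_code_bit_mat: "length (mat_code (bit_mat m A)) = m * m"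
  by (rule length_mat_code) (simp add: bit_mat_def)

context mult_program
begin

definition mul_block :: com where
  "mul_block = load_block ;; mult_call ;; add_block ;; undo"

definition block_const :: nat where "block_const = undo_const + 160"

lemma wp_mul_block:
  assumes r: "reg s 1 = N" "reg s 2 = m" "reg s 8 = b" "reg s 5 = vc" "reg s 6 = yc"
    and le: "1 \<le> m" "(b + 1) * m \<le> N" "vc + m \<le> N" "yc + m \<le> N"
    and bits: "\<And>x. x < N * N \<Longrightarrow> arr s 3 x \<le> 1" "\<And>x. x < m * m \<Longrightarrow> arr s 6 x \<le> 1"
    and cl: "clean s" and W: "word_ok N W"
    and Q: "\<And>s' t'. \<lbrakk>agree ({9, 10, 12, 14} \<union> {100..}) ({3, 7} \<union> {100..}) s s'; clean s';
      \<And>i j. \<lbrakk>i < m; j < m\<rbrakk> \<Longrightarrow> arr s' 3 ((b * m + i) * N + (yc + j)) =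
        bit_code (mat_of N s (b * m + i) (yc + j) + (\<Sum>k<m. mat_of N s (b * m + i) (vc + k) * of_nat (arr s 6 (k * m + j))));
      \<And>x. (\<And>i j. \<lbrakk>i < m; j < m\<rbrakk> \<Longrightarrow> x \<noteq> (b * m + i) * N + (yc + j)) \<Longrightarrow> arr s' 3 x = arr s 3 x;
      t' \<le> t + block_const * (m * m + tm m)\<rbrakk> \<Longrightarrow> Q s' t'"
  shows "wp W mul_block Q s t"
proof -
  have mN: "m \<le> N" using le by simp
  have W': "2 * N * N + 4 \<le> W" "word_need m \<le> W" "tm m \<le> W"
    using W word_need_mono[OF mN] tm_mono[OF mN] by (simp_all add: word_ok_def)
  have mW: "m * m + m + 1 \<le> W"
  proof -
    have "m * m \<le> N * N" "m * 1 \<le> N * N" using mN le by (intro mult_le_mono; simp)+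
    then show ?thesis using W'(1) by simp
  qed
  define D where "D i j = (\<Sum>k<m. mat_of N s (b * m + i) (vc + k) * of_nat (arr s 6 (k * m + j)))" for i j
  show ?thesis unfolding mul_block_def
  proof (rule wp_Seq, rule wp_load_block[OF r(1-4) le(1-3) bits cl W'(1)])
    fix s1 t1 assume 1: "agree {9, 10} {101, 102, 103} s s1"
      and sm: "sim (init [[m], mat_code (bit_mat m (\<lambda>i k. of_nat (arr s 3 ((b * m + i) * N + (vc + k))))),
        mat_code (bit_mat m (\<lambda>k j. of_nat (arr s 6 (k * m + j))))]) s1"
      and t1: "t1 \<le> t + (74 * (m * m) + 15)"
    show "wp W (mult_call ;; add_block ;; undo) Q s1 t1"
    proof (rule wp_Seq, rule wp_mult_call[OF le(1) sm W'(2,3)])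
      fix s2 t2
      assume 2: "agree (insert 12 {100..}) (insert 7 {100..}) s1 s2"
        and out: "\<And>i j. \<lbrakk>i < m; j < m\<rbrakk> \<Longrightarrow> arr s2 100 (i * m + j) =
          bit_code (\<Sum>k<m. of_nat (arr s 3 ((b * m + i) * N + (vc + k))) * of_nat (arr s 6 (k * m + j)))"
        and top: "reg s2 12 \<le> tm m" and log: "\<And>x. x < reg s2 12 \<Longrightarrow> arr s2 7 x \<le> W"
        and cells: "\<And>a i. arr s2 (100 + a) i \<noteq> arr s1 (100 + a) i \<Longrightarrow> a < max_arr c0 \<and> (\<exists>x<reg s2 12. arr s2 7 x = i)"
        and regs: "\<And>r. r \<ge> max_reg c0 \<Longrightarrow> reg s2 (100 + r) = 0"
        and t2: "t2 \<le> t1 + (6 * tm m + 2)"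
      have r2: "reg s2 1 = N" "reg s2 2 = m" "reg s2 8 = b" "reg s2 6 = yc" and a3: "arr s2 3 = arr s 3"
        using 1 2 r by (simp_all add: agree_def)
      have out': "arr s2 100 (i * m + j) = bit_code (D i j)" if "i < m" "j < m" for i j
        using out[OF that] by (simp only: D_def mat_of_def)
      show "wp W (add_block ;; undo) Q s2 t2"
      proof (rule wp_Seq, rule wp_add_block[OF r2 le(1,2,4) _ out' W'(1)])
        show "x < N * N \<Longrightarrow> arr s2 3 x \<le> 1" for x using bits(1) a3 by simp
        fix s3 t3
        assume 3: "agree {9, 10} {3} s2 s3"
          and new: "\<And>i j. \<lbrakk>i < m; j < m\<rbrakk> \<Longrightarrow> arr s3 3 ((b * m + i) * N + (yc + j)) =
            bit_code (of_nat (arr s2 3 ((b * m + i) * N + (yc + j))) + D i j)"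
          and old: "\<And>x. (\<And>i j. \<lbrakk>i < m; j < m\<rbrakk> \<Longrightarrow> x \<noteq> (b * m + i) * N + (yc + j)) \<Longrightarrow> arr s3 3 x = arr s2 3 x"
          and t3: "t3 \<le> t2 + (55 * (m * m) + 6)"
        have c3: "arr s3 (100 + a) i = arr s2 (100 + a) i" for a i using 3 by (simp add: agree_def)
        have r3: "reg s3 r = reg s2 r" if "r \<noteq> 9" "r \<noteq> 10" for r using 3 that by (simp add: agree_def)
        have l3: "arr s3 7 = arr s2 7" using 3 by (simp add: agree_def)
        show "wp W undo Q s3 t3"
        proof (rule wp_undo[OF _ le(1) mW])
          show "reg s3 2 = m" "reg s3 12 \<le> W" using r3 r2 top W' by auto
          show "arr s3 7 x \<le> W" if "x < reg s3 12" for x using that log r3 l3 by simp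
          show "reg s3 (100 + r) = 0" if "r \<ge> max_reg c0" for r using that regs r3 by simp
          show "(a < max_arr c0 \<and> (\<exists>x<reg s3 12. arr s3 7 x = i)) \<or>
              (a = 1 \<and> i = 0) \<or> ((a = 2 \<or> a = 3) \<and> i < m * m)" if nz: "arr s3 (100 + a) i \<noteq> 0" for a i
          \<comment> \<open>A cell not changed by the call can be nonzero only as part of the loaded
            input.\<close>
          proof (cases "arr s2 (100 + a) i = arr s1 (100 + a) i")
            case True
            have "arr s1 (100 + a) i \<noteq> 0" using nz c3 True by simp
            moreover have "arr s1 (100 + a) = arr (init [[m], mat_code (bit_mat m (\<lambda>i k. of_nat (arr s 3 ((b * m + i) * N + (vc + k))))),
                mat_code (bit_mat m (\<lambda>k j. of_nat (arr s 6 (k * m + j))))]) a"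
              using sm by (simp add: sim_def)
            moreover have "a \<in> {1, 2, 3}" if "1 \<le> a" "a \<le> 3" using that by auto
            ultimately show ?thesis
              by (auto simp: init_def length_mat_code_bit_mat split: if_splits)
          next
            case False
            then show ?thesis using cells[OF False] r3 l3 by auto
          qed
          fix s4 t4 assume 4: "agree ({9, 10, 14} \<union> {100..}) {100..} s3 s4" "clean s4"
            "t4 \<le> t3 + undo_const * (m * m + reg s3 12)"
          have a4: "arr s4 3 = arr s3 3" using 4 by (simp add: agree_def)
          show "Q s4 t4"
          proof (rule Q)
            show "agree ({9, 10, 12, 14} \<union> {100..}) ({3, 7} \<union> {100..}) s s4"
              using 1 2 3 4(1) by (auto simp: agree_def)
            show "clean s4" by fact
            show "arr s4 3 ((b * m + i) * N + (yc + j)) = bit_code (mat_of N s (b * m + i) (yc + j) +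
               (\<Sum>k<m. mat_of N s (b * m + i) (vc + k) * of_nat (arr s 6 (k * m + j))))" if "i < m" "j < m" for i j
              using new[OF that] a3 a4 unfolding D_def mat_of_def by simp
            show "arr s4 3 x = arr s 3 x" if "\<And>i j. \<lbrakk>i < m; j < m\<rbrakk> \<Longrightarrow> x \<noteq> (b * m + i) * N + (yc + j)" for x
              using old[OF that] a3 a4 by simp
            have "undo_const * (m * m + reg s3 12) \<le> undo_const * (m * m + tm m)"
              using r3 top by (intro mult_le_mono2) simp
            moreover have "1 \<le> m * m" using le by simp
            moreover have "block_const * (m * m + tm m) = undo_const * (m * m + tm m) + 160 * (m * m) + 160 * tm m"
              by (simp add: block_const_def algebra_simps)
            ultimately show "t4 \<le> t + block_const * (m * m + tm m)" using t1 t2 t3 4(3) by linarith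
          qed
        qed
      qed
    qed
  qed
qed

section \<open>Applying a stored transformation to a block of columns\<close>

definition gj_ok :: "nat \<Rightarrow> ram \<Rightarrow> bool" where
  "gj_ok N s \<longleftrightarrow> reg s 1 = N \<and> clean s \<and> (\<forall>x<N * N. arr s 3 x \<le> 1) \<and> (\<forall>k<N. arr s 4 k \<le> N) \<and>
     (\<forall>i<N. arr s 5 i \<le> 1)"

definition update :: com where
  "update =
     For 9 2 (For 10 2 (Store 6 (Reg 9 [*] Reg 2 [+] Reg 10)
       ((Const 0 [<] Cell 4 (Reg 5 [+] Reg 9)) [*]
         Cell 3 ((Cell 4 (Reg 5 [+] Reg 9) [-] Const 1) [*] Reg 1 [+] Reg 6 [+] Reg 10)))) ;;
     Assign 7 (Bin Quo (Reg 1) (Reg 2)) ;;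
     For 8 7 mul_block"

definition update_time :: "nat \<Rightarrow> nat" where
  "update_time m = (block_const + 80) * (m * m + tm m)"

abbreviation "gj_regs \<equiv> {2..19} \<union> {100..}"
abbreviation "gj_arrs \<equiv> {3..7} \<union> {100..}"

lemma wregs_mul_block: "wregs mul_block \<subseteq> {9, 10, 12, 14} \<union> {100..}"
  and warrs_mul_block: "warrs mul_block \<subseteq> {3, 7} \<union> {100..}"
  using wregs_instr[of c0] warrs_instr[of c0]
  by (auto simp: mul_block_def load_block_def mult_call_def add_block_def undo_def)

text \<open>With \<open>E\<close> the pivot rows restricted to the target columns, the update adds
  the product of the stored columns and \<open>E\<close>. It is carried out on
  \<open>N div m\<close> row blocks, one square product each.\<close>

lemma wp_update:
  assumes ok: "gj_ok N s" and r: "reg s 2 = m" "reg s 5 = vc" "reg s 6 = yc"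
    and le: "1 \<le> m" "m dvd N" "vc + m \<le> N" "yc + m \<le> N" and dis: "vc + m \<le> yc \<or> yc + m \<le> vc"
    and W: "word_ok N W"
    and Q: "\<And>s' t'. \<lbrakk>agree ({7, 8, 9, 10, 12, 14} \<union> {100..}) ({3, 6, 7} \<union> {100..}) s s';
      gj_ok N s';
      \<And>k. k \<in> {yc..<yc + m} \<Longrightarrow> colv N (mat_of N s') k = tr N vc m (mat_of N s) (arr s 4) (colv N (mat_of N s) k);
      \<And>i k. \<lbrakk>i < N; k < N; k \<notin> {yc..<yc + m}\<rbrakk> \<Longrightarrow> mat_of N s' i k = mat_of N s i k;
      t' \<le> t + (N div m) * update_time m\<rbrakk> \<Longrightarrow> Q s' t'"
  shows "wp W update Q s t"
proof -
  have cl: "clean s" and rN: "reg s 1 = N" and bits: "\<And>x. x < N * N \<Longrightarrow> arr s 3 x \<le> 1"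
    and piv: "\<And>k. k < N \<Longrightarrow> arr s 4 k \<le> N" using ok by (auto simp: gj_ok_def)
  have mN: "m \<le> N" using le by simp
  have W': "2 * N * N + 4 \<le> W" using W by (simp add: word_ok_def)
  have small: "x \<le> N * N \<Longrightarrow> x \<le> W" for x using W' by simp
  have NN: "N \<le> N * N" "m * m \<le> N * N" using le mN mult_le_mono[OF mN mN] by simp_all
  have smallN: "x \<le> N \<Longrightarrow> x \<le> W" for x using NN(1) small by (meson le_trans)
  have e2: "i * m + k < m * m" if "i < m" "k < m" for i k using that by (rule idx_less)
  \<comment> \<open>These rows are copied to array 6 before the first product, since the update
    overwrites the pivot rows as well. For a column without a pivot the truncated subtraction reads
    row 0, and the comparison factor masks the value.\<close>
  define E where "E k j = (if arr s 4 (vc + k) = 0 then 0 else arr s 3 ((arr s 4 (vc + k) - 1) * N + (yc + j)))" for k j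
  have piv1: "arr s 4 (vc + k) - 1 < N" if "k < m" for k
    using piv[of "vc + k"] that le by simp
  have eidx: "(arr s 4 (vc + k) - 1) * N + (yc + j) < N * N" if "k < m" "j < m" for k j
    using piv1[OF that(1)] that le by (intro idx_less) auto
  have Eb: "E k j \<le> 1" if "k < m" "j < m" for k j
    using bits[OF eidx[OF that]] by (simp add: E_def)
  define New where "New i j = mat_of N s i (yc + j) + (\<Sum>k<m. mat_of N s i (vc + k) * of_nat (E k j))" for i j
  have New: "New i j = tr N vc m (mat_of N s) (arr s 4) (colv N (mat_of N s) (yc + j)) i" if "i < N" "j < m" for i j
  proof -
    have "(\<Sum>k<m. mat_of N s i (vc + k) * of_nat (E k j)) =
        (\<Sum>k\<in>piv_cols (arr s 4) vc m. mat_of N s i k * colv N (mat_of N s) (yc + j) (arr s 4 k - 1))"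
      unfolding sum_piv_cols
    proof (rule sum.cong[OF refl])
      fix k assume k: "k \<in> {..<m}"
      show "mat_of N s i (vc + k) * of_nat (E k j) = (if arr s 4 (vc + k) = 0 then 0 else
        mat_of N s i (vc + k) * colv N (mat_of N s) (yc + j) (arr s 4 (vc + k) - 1))"
        using piv1[of k] k unfolding E_def colv_def mat_of_def by (cases "arr s 4 (vc + k) = 0") simp_all
    qed
    then show ?thesis unfolding New_def tr_def using that by (simp only: colv_def if_True)
  qed
  show ?thesis unfolding update_def
  proof (rule wp_Seq, rule wp_For_fill[OF r(1) r(1) _ _ _ _ inj_idx, where v = E])
    fix s1 i j assume a: "agree {9, 10} {6} s s1" "reg s1 9 = i" "reg s1 10 = j" "i < m" "j < m"
    have "arr s1 3 = arr s 3" "arr s1 4 = arr s 4" "reg s1 1 = N" "reg s1 2 = m" "reg s1 5 = vc" "reg s1 6 = yc"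
      using a(1) r rN by (simp_all add: agree_def)
    moreover have "i * m + j \<le> W" "i * m \<le> W" "(arr s 4 (vc + i) - 1) * N + (yc + j) \<le> W"
      "(arr s 4 (vc + i) - 1) * N + yc \<le> W" "(arr s 4 (vc + i) - 1) * N \<le> W"
      using e2[OF a(4,5)] eidx[OF a(4,5)] NN by (intro small; linarith)+
    moreover have "N \<le> W" "m \<le> W" "i \<le> W" "vc \<le> W" "yc \<le> W" "j \<le> W" "vc + i \<le> W"
      "arr s 4 (vc + i) \<le> W" "arr s 4 (vc + i) - 1 \<le> W"
      using a mN le piv[of "vc + i"] by (intro smallN; simp)+
    moreover have "arr s 3 ((arr s 4 (vc + i) - 1) * N + (yc + j)) \<le> W" "1 \<le> W"
      using bits[OF eidx[OF a(4,5)]] W' by auto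
    ultimately show "val s1 (Reg 9 [*] Reg 2 [+] Reg 10) = i * m + j \<and>
      val s1 ((Const 0 [<] Cell 4 (Reg 5 [+] Reg 9)) [*]
         Cell 3 ((Cell 4 (Reg 5 [+] Reg 9) [-] Const 1) [*] Reg 1 [+] Reg 6 [+] Reg 10)) = E i j \<and>
      fits W s1 (Reg 9 [*] Reg 2 [+] Reg 10) \<and>
      fits W s1 ((Const 0 [<] Cell 4 (Reg 5 [+] Reg 9)) [*]
         Cell 3 ((Cell 4 (Reg 5 [+] Reg 9) [-] Const 1) [*] Reg 1 [+] Reg 6 [+] Reg 10))"
      using a by (auto simp: add.assoc E_def)
  next
    fix s1 t1
    assume 1: "agree {9, 10} {6} s s1" and E1: "\<And>i j. \<lbrakk>i < m; j < m\<rbrakk> \<Longrightarrow> arr s1 6 (i * m + j) = E i j"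
      and t1: "t1 \<le> t + m * (m * (cost (Reg 9 [*] Reg 2 [+] Reg 10) + cost ((Const 0 [<] Cell 4 (Reg 5 [+] Reg 9)) [*]
         Cell 3 ((Cell 4 (Reg 5 [+] Reg 9) [-] Const 1) [*] Reg 1 [+] Reg 6 [+] Reg 10)) + 9) + 14) + 6"
    let ?s = "s1\<lparr>reg := (reg s1)(7 := N div m)\<rparr>"
    have r1: "reg s1 1 = N" "reg s1 2 = m" using 1 r rN by (simp_all add: agree_def)
    have "wp W (For 8 7 mul_block) Q ?s (t1 + 4)"
    proof (rule wp_For[where n = "N div m" and B = "block_const * (m * m + tm m)" and
          I = "\<lambda>b s2. clean s2 \<and> (\<forall>i<b * m. \<forall>j<m. arr s2 3 (i * N + (yc + j)) = bit_code (New i j)) \<and>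
            (\<forall>x. (\<forall>i<b * m. \<forall>j<m. x \<noteq> i * N + (yc + j)) \<longrightarrow> arr s2 3 x = arr s 3 x)"])
      show "N div m \<le> W" using smallN[of "N div m"] by simp
      show "8 \<notin> wregs mul_block" "7 \<notin> wregs mul_block" using wregs_mul_block by auto
      show "clean ?s \<and> (\<forall>i<0 * m. \<forall>j<m. arr ?s 3 (i * N + (yc + j)) = bit_code (New i j)) \<and>
            (\<forall>x. (\<forall>i<0 * m. \<forall>j<m. x \<noteq> i * N + (yc + j)) \<longrightarrow> arr ?s 3 x = arr s 3 x)"
        using cl 1 by (simp add: clean_def agree_def)
    next
      fix b s2 t2
      assume b: "b < N div m" and a: "agree (insert 8 (wregs mul_block)) (warrs mul_block) ?s s2" "reg s2 8 = b"
        and I: "clean s2 \<and> (\<forall>i<b * m. \<forall>j<m. arr s2 3 (i * N + (yc + j)) = bit_code (New i j)) \<and>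
            (\<forall>x. (\<forall>i<b * m. \<forall>j<m. x \<noteq> i * N + (yc + j)) \<longrightarrow> arr s2 3 x = arr s 3 x)"
      have a': "agree ({8, 9, 10, 12, 14} \<union> {100..}) ({3, 7} \<union> {100..}) ?s s2"
        by (rule agree_mono[OF a(1)]) (use wregs_mul_block warrs_mul_block in auto)
      have r2: "reg s2 1 = N" "reg s2 2 = m" "reg s2 5 = vc" "reg s2 6 = yc" "arr s2 6 = arr s1 6"
        using a' 1 r rN by (simp_all add: agree_def)
      have "(b + 1) * m \<le> N div m * m" using b by (intro mult_le_mono1) simp
      then have bm: "(b + 1) * m \<le> N" using le by simp
      have b2: "arr s2 3 x \<le> 1" if "x < N * N" for x
        using bits[OF that] I bit_code_le by (metis)
      \<comment> \<open>Earlier rounds wrote only to rows below \<open>b * m\<close>, so row block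
        \<open>b\<close> still has its original entries in every column.\<close>
      have same: "mat_of N s2 (b * m + i) k = mat_of N s (b * m + i) k" if "i < m" "k < N" for i k
      proof -
        have "(b * m + i) * N + k \<noteq> i' * N + (yc + j)" if "i' < b * m" "j < m" for i' j
          using that \<open>k < N\<close> le by (subst idx_eq) auto
        then show ?thesis using I unfolding mat_of_def by simp
      qed
      show "wp W mul_block (\<lambda>s3 t3. (clean s3 \<and> (\<forall>i<Suc b * m. \<forall>j<m. arr s3 3 (i * N + (yc + j)) = bit_code (New i j)) \<and>
            (\<forall>x. (\<forall>i<Suc b * m. \<forall>j<m. x \<noteq> i * N + (yc + j)) \<longrightarrow> arr s3 3 x = arr s 3 x)) \<and>
            t3 \<le> t2 + block_const * (m * m + tm m)) s2 t2"
      proof (rule wp_mul_block[OF r2(1,2) a(2) r2(3,4) le(1) bm le(3,4) b2])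
        show "arr s2 6 x \<le> 1" if "x < m * m" for x
          using that E1 Eb r2(5) by (metis idx_cases)
        show "clean s2" using I by blast
        show "word_ok N W" by (rule W)
        fix s3 t3
        assume c3: "clean s3"
          and new: "\<And>i j. \<lbrakk>i < m; j < m\<rbrakk> \<Longrightarrow> arr s3 3 ((b * m + i) * N + (yc + j)) =
            bit_code (mat_of N s2 (b * m + i) (yc + j) + (\<Sum>k<m. mat_of N s2 (b * m + i) (vc + k) * of_nat (arr s2 6 (k * m + j))))"
          and old: "\<And>x. (\<And>i j. \<lbrakk>i < m; j < m\<rbrakk> \<Longrightarrow> x \<noteq> (b * m + i) * N + (yc + j)) \<Longrightarrow> arr s3 3 x = arr s2 3 x"
          and t3: "t3 \<le> t2 + block_const * (m * m + tm m)"
        have new': "arr s3 3 ((b * m + i) * N + (yc + j)) = bit_code (New (b * m + i) j)" if "i < m" "j < m" for i j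
        proof -
          have "(\<Sum>k<m. mat_of N s2 (b * m + i) (vc + k) * of_nat (arr s2 6 (k * m + j))) =
              (\<Sum>k<m. mat_of N s (b * m + i) (vc + k) * of_nat (E k j))"
            using same[OF that(1)] E1 that le r2(5) by (intro sum.cong refl) auto
          moreover have "mat_of N s2 (b * m + i) (yc + j) = mat_of N s (b * m + i) (yc + j)"
            using same[OF that(1)] that le by simp
          ultimately show ?thesis unfolding new[OF that] New_def by simp
        qed
        show "(clean s3 \<and> (\<forall>i<Suc b * m. \<forall>j<m. arr s3 3 (i * N + (yc + j)) = bit_code (New i j)) \<and>
            (\<forall>x. (\<forall>i<Suc b * m. \<forall>j<m. x \<noteq> i * N + (yc + j)) \<longrightarrow> arr s3 3 x = arr s 3 x)) \<and>
            t3 \<le> t2 + block_const * (m * m + tm m)"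
        proof (intro conjI allI impI)
          fix i j assume ij: "i < Suc b * m" "j < m"
          show "arr s3 3 (i * N + (yc + j)) = bit_code (New i j)"
          proof (cases "i < b * m")
            case True
            have "arr s3 3 (i * N + (yc + j)) = arr s2 3 (i * N + (yc + j))"
            proof (rule old)
              fix i' j' assume "i' < m" "j' < m"
              then show "i * N + (yc + j) \<noteq> (b * m + i') * N + (yc + j')"
                using ij True le by (subst idx_eq) auto
            qed
            then show ?thesis using I True ij by simp
          next
            case False
            then have "i = b * m + (i - b * m)" "i - b * m < m" using ij by auto
            then show ?thesis using new'[of "i - b * m" j] ij by simp
          qed
        next
          fix x assume x: "\<forall>i<Suc b * m. \<forall>j<m. x \<noteq> i * N + (yc + j)"
          have "arr s3 3 x = arr s2 3 x" by (rule old) (use x in auto)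
          moreover have "\<forall>i<b * m. \<forall>j<m. x \<noteq> i * N + (yc + j)" using x by simp
          ultimately show "arr s3 3 x = arr s 3 x" using I by simp
        qed fact+
      qed
    next
      fix s' t'
      assume a: "agree (insert 8 (wregs mul_block)) (warrs mul_block) ?s s'"
        and I: "clean s' \<and> (\<forall>i<N div m * m. \<forall>j<m. arr s' 3 (i * N + (yc + j)) = bit_code (New i j)) \<and>
            (\<forall>x. (\<forall>i<N div m * m. \<forall>j<m. x \<noteq> i * N + (yc + j)) \<longrightarrow> arr s' 3 x = arr s 3 x)"
        and t': "t' \<le> t1 + 4 + N div m * (block_const * (m * m + tm m) + 8) + 6"
      have a': "agree ({8, 9, 10, 12, 14} \<union> {100..}) ({3, 7} \<union> {100..}) ?s s'"
        by (rule agree_mono[OF a(1)]) (use wregs_mul_block warrs_mul_block in auto)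
      have dN: "N div m * m = N" using le by simp
      have new: "arr s' 3 (i * N + (yc + j)) = bit_code (New i j)" if "i < N" "j < m" for i j
        using I that unfolding dN by blast
      have old: "arr s' 3 x = arr s 3 x" if "\<forall>i<N. \<forall>j<m. x \<noteq> i * N + (yc + j)" for x
        using I that unfolding dN by blast
      show "Q s' t'"
      proof (rule Q)
        show "agree ({7, 8, 9, 10, 12, 14} \<union> {100..}) ({3, 6, 7} \<union> {100..}) s s'"
          using 1 a' by (auto simp: agree_def)
        have "reg s' 1 = N" "arr s' 4 = arr s 4" "arr s' 5 = arr s 5" using 1 a' rN by (simp_all add: agree_def)
        moreover have "arr s' 3 x \<le> 1" if "x < N * N" for x
          using bits[OF that] new old[of x] bit_code_le by metis
        ultimately show "gj_ok N s'" using ok I by (simp add: gj_ok_def)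
        show "colv N (mat_of N s') k = tr N vc m (mat_of N s) (arr s 4) (colv N (mat_of N s) k)"
          if k: "k \<in> {yc..<yc + m}" for k
        proof
          fix i
          have kj: "k = yc + (k - yc)" "k - yc < m" using k by auto
          show "colv N (mat_of N s') k i = tr N vc m (mat_of N s) (arr s 4) (colv N (mat_of N s) k) i"
          proof (cases "i < N")
            case True
            have "colv N (mat_of N s') k i = of_nat (arr s' 3 (i * N + (yc + (k - yc))))"
              using True kj by (simp add: colv_def mat_of_def)
            also have "\<dots> = New i (k - yc)" unfolding new[OF True kj(2)] of_nat_bit_code ..
            finally show ?thesis using New[OF True kj(2)] kj by simp
          next
            case False
            then show ?thesis by (simp add: colv_def tr_def)
          qed
        qed
        show "mat_of N s' i k = mat_of N s i k" if "i < N" "k < N" "k \<notin> {yc..<yc + m}" for i k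
        proof -
          have "i * N + k \<noteq> i' * N + (yc + j)" if "j < m" for i' j
            using that \<open>k < N\<close> \<open>k \<notin> {yc..<yc + m}\<close> le by (subst idx_eq) auto
          then show ?thesis unfolding mat_of_def using old[of "i * N + k"] by simp
        qed
        have "t1 \<le> t + m * (m * 34 + 14) + 6" using t1 by simp
        then have "t1 \<le> t + (48 * (m * m) + 6)" by (rule fill_time) (use le in simp_all)
        moreover have q: "N div m \<ge> 1" using le mN by (simp add: Suc_leI div_greater_zero_iff)
        have "m * m \<le> N div m * (m * m)" "1 \<le> N div m * (m * m)" "N div m \<le> N div m * (m * m)"
          using q le by simp_all
        moreover have "N div m * update_time m =
            N div m * (block_const * (m * m + tm m)) + 80 * (N div m * (m * m)) + 80 * (N div m * tm m)"
          by (simp add: update_time_def algebra_simps)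
        moreover have "N div m * (block_const * (m * m + tm m) + 8) = N div m * (block_const * (m * m + tm m)) + 8 * (N div m)"
          by (simp add: algebra_simps)
        ultimately show "t' \<le> t + N div m * update_time m" using t' by linarith
      qed
    qed (use r1 W' in \<open>simp_all add: clean_def\<close>)
    then show "wp W (Assign 7 (Bin Quo (Reg 1) (Reg 2)) ;; For 8 7 mul_block) Q s1 t1"
      using r1 smallN[of N] smallN[of m] mN smallN[of "N div m"]
      by (intro wp_Seq wp_Assign) (simp_all add: numeral_eq_Suc)
  qed (use smallN mN W' in \<open>simp_all\<close>)
qed

end

section \<open>Pivot search and the unrolled recursion\<close>

definition used_rows :: "nat \<Rightarrow> ram \<Rightarrow> nat set" where
  "used_rows N s = {i. i < N \<and> arr s 5 i = 1}"

lemma mat_of_reg [simp]: "mat_of N (s\<lparr>reg := q\<rparr>) = mat_of N s"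
  and used_rows_reg [simp]: "used_rows N (s\<lparr>reg := q\<rparr>) = used_rows N s"
  by (simp_all add: mat_of_def used_rows_def fun_eq_iff)

context mult_program
begin

definition find_pivot :: com where
  "find_pivot =
     Assign 11 (Reg 1) ;;
     For 9 1 (If (Cell 5 (Reg 9) [<] Cell 3 (Reg 9 [*] Reg 1 [+] Reg 3)) (Assign 11 (Reg 9)) Skip) ;;
     If (Reg 11 [<] Reg 1)
       (Store 4 (Reg 3) (Reg 11 [+] Const 1) ;; Store 5 (Reg 11) (Const 1) ;;
        Store 3 (Reg 11 [*] Reg 1 [+] Reg 3) (Const 0))
       Skip"

lemma wp_find_pivot:
  assumes ok: "gj_ok N s" and c: "reg s 3 = c" "c < N" "arr s 4 c = 0" and W: "word_ok N W"
    and Q: "\<And>s' t'. \<lbrakk>agree {9, 11} {3, 4, 5} s s'; gj_ok N s';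
      eliminated N c 1 (mat_of N s) (used_rows N s) (arr s 4) (mat_of N s') (used_rows N s') (arr s' 4);
      t' \<le> t + (40 * N + 40)\<rbrakk> \<Longrightarrow> Q s' t'"
  shows "wp W find_pivot Q s t"
proof -
  have rN: "reg s 1 = N" and bits: "\<And>x. x < N * N \<Longrightarrow> arr s 3 x \<le> 1" and used1: "\<And>i. i < N \<Longrightarrow> arr s 5 i \<le> 1"
    using ok by (auto simp: gj_ok_def)
  have W': "2 * N * N + 4 \<le> W" using W by (simp add: word_ok_def)
  have small: "x \<le> N * N \<Longrightarrow> x \<le> W" for x using W' by simp
  have NN: "N \<le> N * N" by simp
  have smallN: "x \<le> N \<Longrightarrow> x \<le> W" for x using NN small by (meson le_trans)
  have idx: "i * N + c < N * N" if "i < N" for i using that c by (intro idx_less) auto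
  let ?cand = "\<lambda>i. arr s 5 i = 0 \<and> arr s 3 (i * N + c) = 1"
  let ?c = "If (Cell 5 (Reg 9) [<] Cell 3 (Reg 9 [*] Reg 1 [+] Reg 3)) (Assign 11 (Reg 9)) Skip"
  let ?s = "s\<lparr>reg := (reg s)(11 := N)\<rparr>"
  have "wp W (For 9 1 ?c ;; If (Reg 11 [<] Reg 1)
       (Store 4 (Reg 3) (Reg 11 [+] Const 1) ;; Store 5 (Reg 11) (Const 1) ;;
        Store 3 (Reg 11 [*] Reg 1 [+] Reg 3) (Const 0)) Skip) Q ?s (t + 2)"
  proof (rule wp_Seq, rule wp_For[where n = N and B = 20 and I = "\<lambda>i s1.
      if \<exists>i'<i. ?cand i' then reg s1 11 < N \<and> ?cand (reg s1 11) else reg s1 11 = N"])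
    fix i s1 t1
    assume i: "i < N" and a: "agree (insert 9 (wregs ?c)) (warrs ?c) ?s s1" "reg s1 9 = i"
      and I: "if \<exists>i'<i. ?cand i' then reg s1 11 < N \<and> ?cand (reg s1 11) else reg s1 11 = N"
    have m: "arr s1 = arr s" "reg s1 1 = N" "reg s1 3 = c"
      using a rN c by (auto simp: agree_def)
    have f: "fits W s1 (Cell 5 (Reg 9) [<] Cell 3 (Reg 9 [*] Reg 1 [+] Reg 3))"
    proof -
      have "i * N + c \<le> W" "i * N \<le> W" using idx[OF i] i by (intro small; simp)+
      moreover have "i \<le> W" "N \<le> W" "c \<le> W" using i c by (intro smallN; simp)+
      moreover have "arr s 3 (i * N + c) \<le> W" "arr s 5 i \<le> W" "1 \<le> W"
        using bits[OF idx[OF i]] used1[OF i] W' by auto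
      ultimately show ?thesis using m a by simp
    qed
    have v: "val s1 (Cell 5 (Reg 9) [<] Cell 3 (Reg 9 [*] Reg 1 [+] Reg 3)) \<noteq> 0 \<longleftrightarrow> ?cand i"
      using m a bits[OF idx[OF i]] by auto
    show "wp W ?c (\<lambda>s2 t2. (if \<exists>i'<Suc i. ?cand i' then reg s2 11 < N \<and> ?cand (reg s2 11) else reg s2 11 = N)
        \<and> t2 \<le> t1 + 20) s1 t1"
    proof (rule wp_If[OF f])
      assume "val s1 (Cell 5 (Reg 9) [<] Cell 3 (Reg 9 [*] Reg 1 [+] Reg 3)) \<noteq> 0"
      then have "?cand i" using v by blast
      then show "wp W (Assign 11 (Reg 9)) (\<lambda>s2 t2. (if \<exists>i'<Suc i. ?cand i' then reg s2 11 < N \<and> ?cand (reg s2 11)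
          else reg s2 11 = N) \<and> t2 \<le> t1 + 20) s1
          (t1 + (1 + cost (Cell 5 (Reg 9) [<] Cell 3 (Reg 9 [*] Reg 1 [+] Reg 3))))"
        using a i smallN[of i] by (intro wp_Assign) auto
    next
      assume "val s1 (Cell 5 (Reg 9) [<] Cell 3 (Reg 9 [*] Reg 1 [+] Reg 3)) = 0"
      then have "\<not> ?cand i" using v by blast
      then have "(\<exists>i'<Suc i. ?cand i') \<longleftrightarrow> (\<exists>i'<i. ?cand i')" using less_Suc_eq by auto
      then show "wp W Skip (\<lambda>s2 t2. (if \<exists>i'<Suc i. ?cand i' then reg s2 11 < N \<and> ?cand (reg s2 11)
          else reg s2 11 = N) \<and> t2 \<le> t1 + 20) s1
          (t1 + (1 + cost (Cell 5 (Reg 9) [<] Cell 3 (Reg 9 [*] Reg 1 [+] Reg 3))))"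
        using I by (intro wp_Skip) simp
    qed
  next
    fix s1 t1
    assume a: "agree (insert 9 (wregs ?c)) (warrs ?c) ?s s1"
      and I: "if \<exists>i'<N. ?cand i' then reg s1 11 < N \<and> ?cand (reg s1 11) else reg s1 11 = N"
      and t1: "t1 \<le> t + 2 + N * (20 + 8) + 6"
    have m: "arr s1 = arr s" "reg s1 1 = N" "reg s1 3 = c"
      using a rN c by (auto simp: agree_def)
    have ag: "agree {9, 11} {} s s1" using a by (auto simp: agree_def)
    have fit: "fits W s1 (Reg 11 [<] Reg 1)"
      using I m smallN[of N] smallN[of "reg s1 11"] W' by (auto split: if_splits)
    show "wp W (If (Reg 11 [<] Reg 1)
       (Store 4 (Reg 3) (Reg 11 [+] Const 1) ;; Store 5 (Reg 11) (Const 1) ;;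
        Store 3 (Reg 11 [*] Reg 1 [+] Reg 3) (Const 0)) Skip) Q s1 t1"
    proof (rule wp_If[OF fit])
      assume "val s1 (Reg 11 [<] Reg 1) \<noteq> 0"
      then have r: "reg s1 11 < N" using m by simp
      then have cand: "?cand (reg s1 11)" using I by (auto split: if_splits)
      define p where "p = reg s1 11"
      let ?s1 = "s1\<lparr>arr := (arr s1)(4 := (arr s 4)(c := p + 1), 5 := (arr s 5)(p := 1),
         3 := (arr s 3)(p * N + c := 0))\<rparr>"
      have pN: "p < N" "arr s 5 p = 0" "arr s 3 (p * N + c) = 1" using r cand by (auto simp: p_def)
      have elim: "eliminated N c 1 (mat_of N s) (used_rows N s) (arr s 4) (mat_of N ?s1)
          (insert p (used_rows N s)) ((arr s 4)(c := Suc p))"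
      proof (rule eliminated_pivot)
        show "mat_of N ?s1 i k = mat_of N s i k" if "i < N" "k < N" "(i, k) \<noteq> (p, c)" for i k
        proof -
          have "i * N + k \<noteq> p * N + c" using that c by (subst idx_eq) auto
          then show ?thesis by (simp add: mat_of_def)
        qed
      qed (use pN c in \<open>auto simp: mat_of_def used_rows_def\<close>)
      moreover have "used_rows N ?s1 = insert p (used_rows N s)"
        using pN by (auto simp: used_rows_def)
      moreover have "gj_ok N ?s1"
        using ok ag pN c by (auto simp: gj_ok_def clean_def agree_def)
      moreover have "agree {9, 11} {3, 4, 5} s ?s1" using ag by (auto simp: agree_def)
      ultimately have "Q ?s1 t'" if "t' \<le> t + (40 * N + 40)" for t' using Q[of ?s1 t'] that by simp
      moreover have "p * N + c \<le> W" "p * N \<le> W" "p \<le> W" "c \<le> W" "N \<le> W" "Suc p \<le> W" "1 \<le> W"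
        using idx[OF pN(1)] pN c W' small[of "p * N + c"] smallN[of "Suc p"] smallN[of c] smallN[of N] by simp_all
      ultimately show "wp W (Store 4 (Reg 3) (Reg 11 [+] Const 1) ;; Store 5 (Reg 11) (Const 1) ;;
        Store 3 (Reg 11 [*] Reg 1 [+] Reg 3) (Const 0)) Q s1 (t1 + (1 + cost (Reg 11 [<] Reg 1)))"
        using t1 m by (intro wp_Seq wp_Store) (simp_all add: p_def[symmetric] fun_upd_twist)
    next
      assume "val s1 (Reg 11 [<] Reg 1) = 0"
      then have "\<not> (\<exists>i'<N. ?cand i')" using I m by (auto split: if_splits)
      then have none: "mat_of N s i c = 0" if "i < N" "i \<notin> used_rows N s" for i
        using that bits[OF idx[of i]] used1[of i] unfolding mat_of_def used_rows_def
        by (cases "arr s 3 (i * N + c)") (auto simp: le_Suc_eq)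
      have "eliminated N c 1 (mat_of N s) (used_rows N s) (arr s 4) (mat_of N s) (used_rows N s) (arr s 4)"
        using none c(3) by (rule eliminated_no_pivot)
      moreover have "mat_of N s1 = mat_of N s" "used_rows N s1 = used_rows N s"
        using m by (simp_all add: mat_of_def used_rows_def fun_eq_iff)
      moreover have "gj_ok N s1" using ok ag by (auto simp: gj_ok_def clean_def agree_def)
      moreover have "agree {9, 11} {3, 4, 5} s s1" using ag by (auto simp: agree_def)
      ultimately show "wp W Skip Q s1 (t1 + (1 + cost (Reg 11 [<] Reg 1)))"
        using t1 m by (intro wp_Skip Q) simp_all
    qed
  qed (use rN smallN[of N] W' in auto)
  then show ?thesis unfolding find_pivot_def
    using rN smallN[of N] by - (rule wp_Seq, rule wp_Assign, simp_all add: numeral_2_eq_2)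
qed

text \<open>The recursion on column halves, unrolled: register 3 is the current column, register 4
  tells whether it has been eliminated, and the last (register 2) columns up to it are a
  finished block. This block is the left or the right half of a block of twice the size,
  according to the parity of its number.\<close>

definition gj_guard :: expr where
  "gj_guard = (Reg 4 [+] Reg 2 [<] Reg 1 [+] Const 1)"

definition gj_step :: com where
  "gj_step =
     If (Reg 4)
       (Assign 5 (Reg 3 [+] Const 1 [-] Reg 2) ;;
        If (Bin Rem (Bin Quo (Reg 3 [+] Const 1) (Reg 2)) (Const 2))
          (Assign 6 (Reg 3 [+] Const 1) ;; update ;; Assign 3 (Reg 3 [+] Const 1) ;; Assign 4 (Const 0))
          (Assign 6 (Reg 3 [+] Const 1 [-] Reg 2 [-] Reg 2) ;; update ;; Assign 2 (Reg 2 [+] Reg 2)))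
       (find_pivot ;; Assign 2 (Const 1) ;; Assign 4 (Const 1))"

abbreviation "gj_loop \<equiv> While gj_guard gj_step"

text \<open>The second argument is the level: a block of 2^(l+1) columns consists of two half blocks
  and two updates, each spending \<open>N div 2 ^ l\<close> square products. The additive constants
  pay for control flow.\<close>

fun gj_time :: "nat \<Rightarrow> nat \<Rightarrow> nat" where
  "gj_time N 0 = 40 * N + 60"
| "gj_time N (Suc l) = 2 * gj_time N l + 2 * ((N div 2 ^ l) * update_time (2 ^ l)) + 100"

text \<open>A finished block with an even number is a left half: its right sibling is brought up to
  date and the scan moves to the next column. With an odd number it is a right half: the
  transformation stored in its left sibling is updated, the block size doubles and the merged block
  counts as finished. The conclusion is about the remaining loop, so that passes can be
  chained.\<close>

lemma wp_gj_update:
  assumes ok: "gj_ok N s" and r: "reg s 2 = m" "reg s 4 = 1" and m: "1 \<le> m" "m < N" "m dvd N"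
    and vc: "reg s 3 + 1 = vc + m" "m dvd vc" "vc + m \<le> N"
    and yc: "yc = (if odd (vc div m) then vc - m else vc + m)" "yc + m \<le> N"
    and W: "word_ok N W"
    and Q: "\<And>s' t'. \<lbrakk>agree ({2..14} \<union> {100..}) ({3, 6, 7} \<union> {100..}) s s'; gj_ok N s';
      reg s' 2 = (if odd (vc div m) then 2 * m else m);
      reg s' 3 = (if odd (vc div m) then reg s 3 else reg s 3 + 1);
      reg s' 4 = (if odd (vc div m) then 1 else 0);
      \<And>k. k \<in> {yc..<yc + m} \<Longrightarrow> colv N (mat_of N s') k = tr N vc m (mat_of N s) (arr s 4) (colv N (mat_of N s) k);
      \<And>i k. \<lbrakk>i < N; k < N; k \<notin> {yc..<yc + m}\<rbrakk> \<Longrightarrow> mat_of N s' i k = mat_of N s i k;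
      t' \<le> t + (N div m) * update_time m + 50\<rbrakk> \<Longrightarrow> wp W gj_loop Q s' t'"
  shows "wp W gj_loop Q s t"
proof -
  have rN: "reg s 1 = N" using ok by (simp add: gj_ok_def)
  have W': "2 * N * N + 4 \<le> W" using W by (simp add: word_ok_def)
  have N2: "2 * N + 4 \<le> W" using W' m by (metis add_le_mono1 le_trans mult_le_mono2 mult_1_right le_less_trans less_imp_le Suc_leI One_nat_def mult.assoc le_square)
  obtain q where q: "vc = m * q" using vc(2) by (auto simp: dvd_def)
  have qdiv: "vc div m = q" and q1: "(vc + m) div m = Suc q" using q m by auto
  have odd_le: "m \<le> vc" if "odd q" using q that by (cases q) auto
  have dis: "vc + m \<le> yc \<or> yc + m \<le> vc" using yc odd_le qdiv by (auto split: if_splits)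
  let ?s1 = "s\<lparr>reg := (reg s)(5 := vc)\<rparr>"
  show ?thesis
  proof (rule wp_While_step)
    show "fits W s gj_guard" "val s gj_guard \<noteq> 0" using r rN m N2 by (auto simp: gj_guard_def)
    have c1: "reg s 3 + 1 - m = vc" "reg s 3 + 1 \<le> N" using vc by simp_all
    define Q' where "Q' = wp W gj_loop Q"
    have "wp W gj_step Q' s (t + (1 + cost gj_guard))"
      unfolding gj_step_def
    proof (rule wp_If, goal_cases)
      case 2
      show ?case
      proof (rule wp_Seq, rule wp_Assign, goal_cases)
        case 1
        then show ?case using c1 r m N2 by simp
      next
        case 2
        have s1: "s\<lparr>reg := (reg s)(5 := val s (Reg 3 [+] Const 1 [-] Reg 2))\<rparr> = ?s1"
          using c1 r by simp
        show ?case unfolding s1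
        proof (rule wp_If, goal_cases)
          case 1
          have "Suc q \<le> N" using q1 vc(3) by (metis div_le_dividend le_trans)
          then show ?case using c1 r m N2 vc(1) q1 by simp
        next
          case 2
          then have ev: "even q" using r vc(1) q1 by (auto simp: mod2_eq_if split: if_splits)
          then have yc': "yc = vc + m" using yc qdiv by simp
          let ?s2 = "?s1\<lparr>reg := (reg ?s1)(6 := yc)\<rparr>"
          show ?case
          proof (rule wp_Seq, rule wp_Assign, goal_cases)
            case 1
            then show ?case using c1 N2 by simp
          next
            case 2
            have s2: "?s1\<lparr>reg := (reg ?s1)(6 := val ?s1 (Reg 3 [+] Const 1))\<rparr> = ?s2"
              using yc' vc(1) by simp
            show ?case unfolding s2
            proof (rule wp_Seq, rule wp_update[where N = N and m = m and vc = vc and yc = yc])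
              show "gj_ok N ?s2" using ok by (auto simp: gj_ok_def clean_def)
              fix s3 t3
              assume a: "agree ({7, 8, 9, 10, 12, 14} \<union> {100..}) ({3, 6, 7} \<union> {100..}) ?s2 s3" "gj_ok N s3"
                and M: "\<And>k. k \<in> {yc..<yc + m} \<Longrightarrow> colv N (mat_of N s3) k =
                  tr N vc m (mat_of N ?s2) (arr ?s2 4) (colv N (mat_of N ?s2) k)"
                  "\<And>i k. \<lbrakk>i < N; k < N; k \<notin> {yc..<yc + m}\<rbrakk> \<Longrightarrow> mat_of N s3 i k = mat_of N ?s2 i k"
                and t3: "t3 \<le> t + (1 + cost gj_guard) + (1 + cost (Reg 4)) + (1 + cost (Reg 3 [+] Const 1 [-] Reg 2)) +
                  (1 + cost (Bin Rem (Bin Quo (Reg 3 [+] Const 1) (Reg 2)) (Const 2))) +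
                  (1 + cost (Reg 3 [+] Const 1)) + N div m * update_time m"
              let ?s4 = "s3\<lparr>reg := (reg s3)(3 := reg s 3 + 1, 4 := 0)\<rparr>"
              have r3: "reg s3 3 = reg s 3" "reg s3 2 = m" using a r by (simp_all add: agree_def)
              have "wp W gj_loop Q ?s4 (t3 + 4 + 2)"
              proof (rule Q)
                show "agree ({2..14} \<union> {100..}) ({3, 6, 7} \<union> {100..}) s ?s4" using a by (auto simp: agree_def)
                show "gj_ok N ?s4" using a(2) by (auto simp: gj_ok_def clean_def)
                show "t3 + 4 + 2 \<le> t + N div m * update_time m + 50" using t3 by (simp add: gj_guard_def)
              qed (use ev qdiv r3 M in simp_all)
              then show "wp W (Assign 3 (Reg 3 [+] Const 1) ;; Assign 4 (Const 0)) Q' s3 t3"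
                using r3 c1 N2 by (intro wp_Seq wp_Assign) (simp_all add: numeral_eq_Suc Q'_def)
            qed (use r m vc yc dis W in simp_all)
          qed
        next
          case 3
          then have od: "odd q" using r vc(1) q1 by (auto simp: mod2_eq_if split: if_splits)
          then have yc': "yc = vc - m" "m \<le> vc" using yc qdiv odd_le by simp_all
          let ?s2 = "?s1\<lparr>reg := (reg ?s1)(6 := yc)\<rparr>"
          show ?case
          proof (rule wp_Seq, rule wp_Assign, goal_cases)
            case 1
            then show ?case using c1 N2 r m vc by simp
          next
            case 2
            have s2: "?s1\<lparr>reg := (reg ?s1)(6 := val ?s1 (Reg 3 [+] Const 1 [-] Reg 2 [-] Reg 2))\<rparr> = ?s2"
              using yc' vc(1) r by simp
            show ?case unfolding s2
            proof (rule wp_Seq, rule wp_update[where N = N and m = m and vc = vc and yc = yc])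
              show "gj_ok N ?s2" using ok by (auto simp: gj_ok_def clean_def)
              fix s3 t3
              assume a: "agree ({7, 8, 9, 10, 12, 14} \<union> {100..}) ({3, 6, 7} \<union> {100..}) ?s2 s3" "gj_ok N s3"
                and M: "\<And>k. k \<in> {yc..<yc + m} \<Longrightarrow> colv N (mat_of N s3) k =
                  tr N vc m (mat_of N ?s2) (arr ?s2 4) (colv N (mat_of N ?s2) k)"
                  "\<And>i k. \<lbrakk>i < N; k < N; k \<notin> {yc..<yc + m}\<rbrakk> \<Longrightarrow> mat_of N s3 i k = mat_of N ?s2 i k"
                and t3: "t3 \<le> t + (1 + cost gj_guard) + (1 + cost (Reg 4)) + (1 + cost (Reg 3 [+] Const 1 [-] Reg 2)) +
                  (1 + cost (Bin Rem (Bin Quo (Reg 3 [+] Const 1) (Reg 2)) (Const 2))) +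
                  (1 + cost (Reg 3 [+] Const 1 [-] Reg 2 [-] Reg 2)) + N div m * update_time m"
              let ?s4 = "s3\<lparr>reg := (reg s3)(2 := m + m)\<rparr>"
              have r3: "reg s3 3 = reg s 3" "reg s3 2 = m" "reg s3 4 = 1" using a r by (simp_all add: agree_def)
              have "wp W gj_loop Q ?s4 (t3 + 4)"
              proof (rule Q)
                show "agree ({2..14} \<union> {100..}) ({3, 6, 7} \<union> {100..}) s ?s4" using a by (auto simp: agree_def)
                show "gj_ok N ?s4" using a(2) by (auto simp: gj_ok_def clean_def)
                show "t3 + 4 \<le> t + N div m * update_time m + 50" using t3 by (simp add: gj_guard_def)
              qed (use od qdiv r3 M in simp_all)
              then show "wp W (Assign 2 (Reg 2 [+] Reg 2)) Q' s3 t3"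
                using r3 m N2 by (intro wp_Assign) (simp_all add: numeral_eq_Suc Q'_def)
            qed (use r m vc yc dis W in simp_all)
          qed
        qed
      qed
    qed (use r N2 in simp_all)
    then show "wp W gj_step (wp W gj_loop Q) s (t + (1 + cost gj_guard))" by (simp only: Q'_def)
  qed
qed

text \<open>A block of the recursion is not a subprogram but a run of consecutive passes of one
  loop. Therefore the statement is in continuation form: if the remaining loop is correct from every
  state in which the block is finished, it is correct from the state before. Induction on the level
  then recovers the recursion.\<close>

lemma wp_gj_block:
  assumes L: "N = 2 ^ L" and W: "word_ok N W"
  shows "\<lbrakk>gj_ok N s; reg s 3 = c; reg s 4 = 0; reg s 2 \<le> N; 2 ^ l dvd c; c + 2 ^ l \<le> N;
    \<And>k. k \<in> {c..<c + 2 ^ l} \<Longrightarrow> arr s 4 k = 0;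
    \<And>s' t'. \<lbrakk>agree ({2..14} \<union> {100..}) ({3..7} \<union> {100..}) s s'; gj_ok N s';
      reg s' 3 + 1 = c + 2 ^ l; reg s' 4 = 1; reg s' 2 = 2 ^ l;
      eliminated N c (2 ^ l) (mat_of N s) (used_rows N s) (arr s 4) (mat_of N s') (used_rows N s') (arr s' 4);
      t' \<le> t + gj_time N l\<rbrakk> \<Longrightarrow> wp W gj_loop Q s' t'\<rbrakk> \<Longrightarrow> wp W gj_loop Q s t"
proof (induction l arbitrary: s t c)
  case 0
  have W': "2 * N * N + 4 \<le> W" using W by (simp add: word_ok_def)
  have "2 * N \<le> 2 * N * N" by simp
  then have N2: "2 * N + 4 \<le> W" using W' by linarith
  have rN: "reg s 1 = N" using 0 by (simp add: gj_ok_def)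
  show ?case
  proof (rule wp_While_step)
    show "fits W s gj_guard" "val s gj_guard \<noteq> 0" using 0 rN N2 by (auto simp: gj_guard_def)
    define Q' where "Q' = wp W gj_loop Q"
    have "wp W gj_step Q' s (t + (1 + cost gj_guard))"
      unfolding gj_step_def
    proof (rule wp_If, goal_cases)
      case 3
      show ?case
      proof (rule wp_Seq, rule wp_find_pivot[OF 0(1,2) _ _ W])
        show "c < N" "arr s 4 c = 0" using 0 by simp_all
        fix s1 t1
        assume 1: "agree {9, 11} {3, 4, 5} s s1" "gj_ok N s1"
          "eliminated N c 1 (mat_of N s) (used_rows N s) (arr s 4) (mat_of N s1) (used_rows N s1) (arr s1 4)"
          "t1 \<le> t + (1 + cost gj_guard) + (1 + cost (Reg 4)) + (40 * N + 40)"
        let ?s2 = "s1\<lparr>reg := (reg s1)(2 := 1, 4 := 1)\<rparr>"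
        have "wp W gj_loop Q ?s2 (t1 + 2 + 2)"
        proof (rule 0(8))
          show "agree ({2..14} \<union> {100..}) ({3..7} \<union> {100..}) s ?s2" using 1(1) by (auto simp: agree_def)
          show "gj_ok N ?s2" using 1(2) by (auto simp: gj_ok_def clean_def)
          show "reg ?s2 3 + 1 = c + 2 ^ 0" using 1(1) 0 by (simp add: agree_def)
          show "t1 + 2 + 2 \<le> t + gj_time N 0" using 1(4) by (simp add: gj_guard_def)
        qed (use 1 in simp_all)
        then show "wp W (Assign 2 (Const 1) ;; Assign 4 (Const 1)) Q' s1 t1"
          using N2 by (intro wp_Seq wp_Assign) (simp_all add: numeral_eq_Suc Q'_def)
      qed
    qed (use 0 N2 in simp_all)
    then show "wp W gj_step (wp W gj_loop Q) s (t + (1 + cost gj_guard))" by (simp only: Q'_def)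
  qed
next
  case (Suc l)
  define m :: nat where "m = 2 ^ l"
  have m2: "2 ^ Suc l = m + m" by (simp add: m_def)
  note prems = Suc.prems[unfolded m2] and IH = Suc.IH[folded m_def]
  have m1: "1 \<le> m" "m < N" using prems(6) one_le_power[of "2 :: nat" l] unfolding m_def[symmetric] by linarith+
  have "l \<le> L" using m1(2) by (simp add: L m_def)
  then have mN: "m dvd N" by (simp add: L m_def le_imp_power_dvd)
  obtain q where q: "c = (m + m) * q" using prems(5) by (auto simp: dvd_def)
  \<comment> \<open>As 2m divides c, the halves have an even and an odd number, so the loop takes
    its two update branches in the order that the recursion demands.\<close>
  have "c = m * (2 * q)" using q by (simp add: algebra_simps)
  then have mc: "m dvd c" "even (c div m)" and odd1: "odd ((c + m) div m)"
    using m1 by auto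
  show ?case
  proof (rule IH[OF prems(1-4) mc(1)])
    show "c + m \<le> N" using prems by simp
    show "k \<in> {c..<c + m} \<Longrightarrow> arr s 4 k = 0" for k using prems(7) by simp
    fix s1 t1
    assume 1: "agree ({2..14} \<union> {100..}) ({3..7} \<union> {100..}) s s1" "gj_ok N s1"
      "reg s1 3 + 1 = c + m" "reg s1 4 = 1" "reg s1 2 = m"
      and e1: "eliminated N c m (mat_of N s) (used_rows N s) (arr s 4) (mat_of N s1) (used_rows N s1) (arr s1 4)"
      and t1: "t1 \<le> t + gj_time N l"
    show "wp W gj_loop Q s1 t1"
    proof (rule wp_gj_update[OF 1(2,5,4) m1 mN 1(3) mc(1) _ refl _ W])
      show "c + m \<le> N" "(if odd (c div m) then c - m else c + m) + m \<le> N" using prems mc by simp_all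
      fix s2 t2
      assume 2: "agree ({2..14} \<union> {100..}) ({3, 6, 7} \<union> {100..}) s1 s2" "gj_ok N s2"
        "reg s2 2 = (if odd (c div m) then 2 * m else m)"
        "reg s2 3 = (if odd (c div m) then reg s1 3 else reg s1 3 + 1)"
        "reg s2 4 = (if odd (c div m) then 1 else 0)"
        and M2: "\<And>k. k \<in> {if odd (c div m) then c - m else c + m..<(if odd (c div m) then c - m else c + m) + m} \<Longrightarrow>
          colv N (mat_of N s2) k = tr N c m (mat_of N s1) (arr s1 4) (colv N (mat_of N s1) k)"
          "\<And>i k. \<lbrakk>i < N; k < N; k \<notin> {if odd (c div m) then c - m else c + m..<(if odd (c div m) then c - m else c + m) + m}\<rbrakk>
            \<Longrightarrow> mat_of N s2 i k = mat_of N s1 i k"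
        and t2: "t2 \<le> t1 + N div m * update_time m + 50"
      have same2: "arr s2 4 = arr s1 4" "used_rows N s2 = used_rows N s1"
        using 2(1) by (simp_all add: agree_def used_rows_def)
      show "wp W gj_loop Q s2 t2"
      proof (rule IH[where c = "c + m"])
        show "gj_ok N s2" by fact
        show "reg s2 3 = c + m" "reg s2 4 = 0" "reg s2 2 \<le> N" using 2(3-5) mc 1(3) m1 by simp_all
        show "m dvd c + m" using mc by simp
        show "c + m + m \<le> N" using prems by simp
        show "arr s2 4 k = 0" if "k \<in> {c + m..<c + m + m}" for k
        proof -
          have "arr s1 4 k = arr s 4 k" using e1 that unfolding eliminated_def by auto
          then show ?thesis using same2 prems(7)[of k] that by simp
        qed
        fix s3 t3
        assume 3: "agree ({2..14} \<union> {100..}) ({3..7} \<union> {100..}) s2 s3" "gj_ok N s3"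
          "reg s3 3 + 1 = c + m + m" "reg s3 4 = 1" "reg s3 2 = m"
          and e3: "eliminated N (c + m) m (mat_of N s2) (used_rows N s2) (arr s2 4) (mat_of N s3) (used_rows N s3) (arr s3 4)"
          and t3: "t3 \<le> t2 + gj_time N l"
        have dv: "m dvd c + m" using mc by simp
        have yc: "c = (if odd ((c + m) div m) then c + m - m else c + m + m)" using odd1 by simp
        show "wp W gj_loop Q s3 t3"
        proof (rule wp_gj_update[OF 3(2,5,4) m1 mN 3(3) dv _ yc _ W])
          show "c + m + m \<le> N" "c + m \<le> N" using prems by simp_all
          fix s4 t4
          assume 4: "agree ({2..14} \<union> {100..}) ({3, 6, 7} \<union> {100..}) s3 s4" "gj_ok N s4"
            "reg s4 2 = (if odd ((c + m) div m) then 2 * m else m)"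
            "reg s4 3 = (if odd ((c + m) div m) then reg s3 3 else reg s3 3 + 1)"
            "reg s4 4 = (if odd ((c + m) div m) then 1 else 0)"
            and M4: "\<And>k. k \<in> {c..<c + m} \<Longrightarrow>
              colv N (mat_of N s4) k = tr N (c + m) m (mat_of N s3) (arr s3 4) (colv N (mat_of N s3) k)"
              "\<And>i k. \<lbrakk>i < N; k < N; k \<notin> {c..<c + m}\<rbrakk> \<Longrightarrow> mat_of N s4 i k = mat_of N s3 i k"
            and t4: "t4 \<le> t3 + N div m * update_time m + 50"
          have same4: "arr s4 4 = arr s3 4" "used_rows N s4 = used_rows N s3"
            using 4(1) by (simp_all add: agree_def used_rows_def)
          have "eliminated N c (m + m) (mat_of N s) (used_rows N s) (arr s 4) (mat_of N s4) (used_rows N s4) (arr s4 4)"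
            unfolding same4
            by (rule eliminated_compose[OF e1 _ _ e3[unfolded same2] M4]) (use M2 mc prems in simp_all)
          moreover have "agree ({2..14} \<union> {100..}) ({3..7} \<union> {100..}) s s4"
          proof -
            have w: "{3, 6, 7 :: nat} \<union> {100..} \<subseteq> {3..7} \<union> {100..}" by auto
            show ?thesis
              using 1(1) agree_mono[OF 2(1) order_refl w] 3(1) agree_mono[OF 4(1) order_refl w]
              by (blast intro: agree_trans)
          qed
          moreover have "reg s4 3 + 1 = c + (m + m)" "reg s4 4 = 1" "reg s4 2 = m + m"
            using 4(3-5) odd1 3(3) by simp_all
          moreover have "t4 \<le> t + gj_time N (Suc l)"
            using t1 t2 t3 t4 by (simp add: m_def)
          ultimately show "wp W gj_loop Q s4 t4" using 4(2) by (intro prems(8))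
        qed
      qed
    qed
  qed
qed

definition gauss_jordan :: com where
  "gauss_jordan =
     For 9 1 (Store 4 (Reg 9) (Const 0)) ;; For 9 1 (Store 5 (Reg 9) (Const 0)) ;;
     Assign 2 (Const 1) ;; Assign 3 (Const 0) ;; Assign 4 (Const 0) ;; gj_loop"

lemma wp_gauss_jordan:
  assumes r: "reg s 1 = N" and L: "N = 2 ^ L" and cl: "clean s"
    and bits: "\<And>x. x < N * N \<Longrightarrow> arr s 3 x \<le> 1" and pz: "\<And>k. k \<ge> N \<Longrightarrow> arr s 4 k = 0"
    and W: "word_ok N W"
    and Q: "\<And>s' t'. \<lbrakk>agree ({2..14} \<union> {100..}) ({3..7} \<union> {100..}) s s'; gj_ok N s';
      eliminated_matrix N (mat_of N s) (mat_of N s') (arr s' 4) (used_rows N s');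
      t' \<le> t + gj_time N L + 30 * N + 40\<rbrakk> \<Longrightarrow> Q s' t'"
  shows "wp W gauss_jordan Q s t"
proof -
  have W': "2 * N * N + 4 \<le> W" using W by (simp add: word_ok_def)
  have "2 * N \<le> 2 * N * N" by simp
  then have N2: "2 * N + 4 \<le> W" using W' by linarith
  have inj: "inj_on (\<lambda>x. x) {..<N}" by simp
  have N1: "1 \<le> N" using L by simp
  show ?thesis unfolding gauss_jordan_def
  proof (rule wp_Seq, rule wp_For_fill1[OF r _ _ _ inj, where v = "\<lambda>_. 0"])
    fix s1 t1 assume 1: "agree {9} {4} s s1" "\<And>j. j < N \<Longrightarrow> arr s1 4 j = 0"
      "\<And>x. (\<And>j. j < N \<Longrightarrow> x \<noteq> j) \<Longrightarrow> arr s1 4 x = arr s 4 x"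
      and t1: "t1 \<le> t + N * (cost (Reg 9) + cost (Const 0) + 9) + 6"
    have r1: "reg s1 1 = N" using 1 r by (simp add: agree_def)
    \<comment> \<open>The elimination starts from the pivot function that is zero everywhere, so the
      cells beyond the matrix matter as well.\<close>
    have z4: "arr s1 4 = (\<lambda>_. 0)"
    proof
      fix k show "arr s1 4 k = 0" using 1(2)[of k] 1(3)[of k] pz[of k] by (cases "k < N") auto
    qed
    show "wp W (For 9 1 (Store 5 (Reg 9) (Const 0)) ;; Assign 2 (Const 1) ;; Assign 3 (Const 0) ;;
        Assign 4 (Const 0) ;; gj_loop) Q s1 t1"
    proof (rule wp_Seq, rule wp_For_fill1[OF r1 _ _ _ inj, where v = "\<lambda>_. 0"])
      fix s2 t2 assume 2: "agree {9} {5} s1 s2" "\<And>j. j < N \<Longrightarrow> arr s2 5 j = 0"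
        and t2: "t2 \<le> t1 + N * (cost (Reg 9) + cost (Const 0) + 9) + 6"
      let ?s3 = "s2\<lparr>reg := (reg s2)(2 := 1, 3 := 0, 4 := 0)\<rparr>"
      have a3: "arr s2 3 = arr s 3" "arr s2 4 = (\<lambda>_. 0)" using 1(1) 2(1) z4 by (simp_all add: agree_def)
      have M3: "mat_of N ?s3 = mat_of N s" using a3 by (simp add: mat_of_def fun_eq_iff)
      have u3: "used_rows N ?s3 = {}" using 2(2) by (auto simp: used_rows_def)
      have ag3: "agree ({2..14} \<union> {100..}) ({3..7} \<union> {100..}) s ?s3" using 1(1) 2(1) by (auto simp: agree_def)
      have "wp W gj_loop Q ?s3 (t2 + 6)"
      proof (rule wp_gj_block[OF L W, where c = 0 and l = L])
        have "clean ?s3" using cl 1(1) 2(1) by (simp add: clean_def agree_def)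
        then show "gj_ok N ?s3" using a3 bits r1 2 by (auto simp: gj_ok_def agree_def)
        fix s' t'
        assume 4: "agree ({2..14} \<union> {100..}) ({3..7} \<union> {100..}) ?s3 s'" "gj_ok N s'"
          "reg s' 3 + 1 = 0 + 2 ^ L" "reg s' 4 = 1" "reg s' 2 = 2 ^ L"
          and e: "eliminated N 0 (2 ^ L) (mat_of N ?s3) (used_rows N ?s3) (arr ?s3 4) (mat_of N s') (used_rows N s') (arr s' 4)"
          and t': "t' \<le> t2 + 6 + gj_time N L"
        show "wp W gj_loop Q s' t'"
        proof (rule wp_While_done)
          have "reg s' 1 = N" using 4(2) by (simp add: gj_ok_def)
          \<comment> \<open>With the flag set, the guard fails once the finished block has all
            \<open>N\<close> columns.\<close>
          then show "fits W s' gj_guard" "val s' gj_guard = 0" using 4 L N2 by (auto simp: gj_guard_def)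
          show "Q s' (t' + (1 + cost gj_guard))"
          proof (rule Q[OF agree_trans[OF ag3 4(1)] 4(2)])
            show "eliminated_matrix N (mat_of N s) (mat_of N s') (arr s' 4) (used_rows N s')"
              using e unfolding eliminated_matrix_def M3 u3 by (simp add: a3 flip: L)
            show "t' + (1 + cost gj_guard) \<le> t + gj_time N L + 30 * N + 40"
              using t1 t2 t' by (simp add: gj_guard_def)
          qed
        qed
      qed (use N1 L a3 in simp_all)
      then show "wp W (Assign 2 (Const 1) ;; Assign 3 (Const 0) ;; Assign 4 (Const 0) ;; gj_loop) Q s2 t2"
        using N2 by (intro wp_Seq wp_Assign) (simp_all add: numeral_eq_Suc)
    qed (use N2 in \<open>auto simp: agree_def\<close>)
  qed (use N2 in \<open>auto simp: agree_def\<close>)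
qed

lemma wregs_gauss_jordan: "wregs gauss_jordan \<subseteq> {2..14} \<union> {100..}"
  and warrs_gauss_jordan: "warrs gauss_jordan \<subseteq> {3..7} \<union> {100..}"
  using wregs_mul_block warrs_mul_block
  by (auto simp: gauss_jordan_def gj_step_def find_pivot_def update_def)

end

section \<open>Annotations from elimination\<close>

definition chain_sum :: "'a set set \<Rightarrow> 'a set" where
  "chain_sum S = {\<sigma>. odd (card {z \<in> S. \<sigma> \<in> z})}"

lemma chain_sum_empty [simp]: "chain_sum {} = {}"
  by (simp add: chain_sum_def)

lemma chain_sum_insert:
  assumes "finite S" "z \<notin> S" shows "chain_sum (insert z S) = sym_diff z (chain_sum S)"
proof -
  have "card {y \<in> insert z S. \<sigma> \<in> y} = card {y \<in> S. \<sigma> \<in> y} + (if \<sigma> \<in> z then 1 else 0)" for \<sigma>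
  proof (cases "\<sigma> \<in> z")
    case True
    then have "{y \<in> insert z S. \<sigma> \<in> y} = insert z {y \<in> S. \<sigma> \<in> y}" by auto
    then show ?thesis using assms True by simp
  next
    case False
    then have "{y \<in> insert z S. \<sigma> \<in> y} = {y \<in> S. \<sigma> \<in> y}" by auto
    then show ?thesis using False by simp
  qed
  then have "odd (card {y \<in> insert z S. \<sigma> \<in> y}) \<longleftrightarrow> (\<sigma> \<in> z) \<noteq> odd (card {y \<in> S. \<sigma> \<in> y})" for \<sigma>
    by simp
  then show ?thesis unfolding chain_sum_def by blast
qed

lemma bit_add_self: "(b :: bit) + b = 0"
  by (cases b) auto

lemma sum_sym_diff:
  fixes f :: "'a \<Rightarrow> bit"
  assumes "finite A" "finite B"
  shows "sum f (sym_diff A B) = sum f A + sum f B"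
proof -
  have "sum f A = sum f (A - B) + sum f (A \<inter> B)" "sum f B = sum f (B - A) + sum f (A \<inter> B)"
    using sum.Int_Diff[OF assms(1), of f B] sum.Int_Diff[OF assms(2), of f A]
    by (simp_all only: add.commute Int_commute)
  moreover have "sum f (sym_diff A B) = sum f (A - B) + sum f (B - A)"
    using assms by (intro sum.union_disjoint) auto
  moreover have "x + y = (x + c) + (y + c)" for x y c :: bit
  proof -
    have "(x + c) + (y + c) = (x + y) + (c + c)" by (simp only: ac_simps)
    then show ?thesis by (simp only: bit_add_self add_0_right)
  qed
  ultimately show ?thesis by metis
qed

section \<open>Homology over F_2 in terms of sums of cycles\<close>

locale finite_complex =
  fixes K :: "nat set set" and p :: nat
  assumes K: "simplicial_complex K"
begin

abbreviation "hc \<equiv> hom_class K p"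

lemma finite_cycle: "z \<in> cycles K p \<Longrightarrow> finite z"
  using finite_simplices[OF K, of p] by (auto simp: cycles_def intro: finite_subset)

lemma finite_cycles: "finite (cycles K p)"
  using finite_simplices[OF K, of p] by (auto simp: cycles_def intro: finite_subset[of _ "Pow (simplices K p)"])

lemma hom_class_eq_iff: "hc x = hc y \<longleftrightarrow> sym_diff x y \<in> boundaries K p"
proof
  assume "hc x = hc y"
  moreover have "sym_diff x {} \<in> hc x" unfolding hom_class_def by (rule imageI) (rule empty_boundary)
  ultimately have "x \<in> hc y" by simp
  then obtain b where "x = sym_diff y b" "b \<in> boundaries K p" unfolding hom_class_def by (rule imageE)
  moreover have "sym_diff (sym_diff y b) y = b" by blast
  ultimately show "sym_diff x y \<in> boundaries K p" by simp
next
  have half: "hc x \<subseteq> hc y" if d: "sym_diff x y \<in> boundaries K p" for x y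
  proof
    fix u assume "u \<in> hc x"
    then obtain b where b: "b \<in> boundaries K p" "u = sym_diff x b" unfolding hom_class_def by blast
    have "u = sym_diff y (sym_diff (sym_diff x y) b)" unfolding b by blast
    then show "u \<in> hc y" unfolding hom_class_def using sym_diff_boundaries[OF K d b(1)] by (rule image_eqI)
  qed
  assume d: "sym_diff x y \<in> boundaries K p"
  moreover have "sym_diff y x = sym_diff x y" by blast
  ultimately show "hc x = hc y" using half[of x y] half[of y x] by auto
qed

lemma hom_class_zero_iff: "hc x = boundaries K p \<longleftrightarrow> x \<in> boundaries K p"
  using hom_class_eq_iff[of x "{}"] by (simp add: hom_class_empty)

lemma chain_sum_cycle: "S \<subseteq> cycles K p \<Longrightarrow> chain_sum S \<in> cycles K p"
proof -
  assume S: "S \<subseteq> cycles K p"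
  then have "finite S" using finite_cycles finite_subset by blast
  then show ?thesis using S
    by (induction S) (auto simp: empty_cycle chain_sum_insert sym_diff_cycles[OF K])
qed

text \<open>Coefficients in F_2 only select a subset, so a linear combination of classes is the
  class of a sum of cycles. Injectivity makes the coefficient of a class the coefficient of one
  cycle.\<close>

lemma lincomb_hom_class:
  assumes "S \<subseteq> cycles K p" "inj_on hc S"
  shows "module.lincomb (homology K p) a (hc ` S) = hc (chain_sum {z \<in> S. a (hc z) \<noteq> (0 :: bit)})"
proof -
  interpret H: vectorspace class_ring "homology K p" by (rule vectorspace_homology[OF K])
  have sm: "c \<odot>\<^bsub>homology K p\<^esub> X = (if c = 0 then boundaries K p else X)" for c X
    by (simp add: homology_def)
  have zero: "\<zero>\<^bsub>homology K p\<^esub> = boundaries K p" by (simp add: homology_def)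
  have carr: "carrier (homology K p) = hc ` cycles K p" by (simp add: homology_def)
  have "finite S" using assms finite_cycles finite_subset by blast
  then show ?thesis using assms
  proof (induction S)
    case empty
    show ?case by (simp add: H.lincomb_def zero hom_class_empty)
  next
    case (insert z S)
    let ?f = "\<lambda>v. a v \<odot>\<^bsub>homology K p\<^esub> v"
    have zn: "hc z \<notin> hc ` S" using insert by auto
    have f: "v \<in> hc ` cycles K p \<Longrightarrow> ?f v \<in> carrier (homology K p)" for v
      unfolding sm carr using empty_cycle[of K p] by (auto simp flip: hom_class_empty)
    have IH: "H.lincomb a (hc ` S) = hc (chain_sum {z \<in> S. a (hc z) \<noteq> 0})" using insert by auto
    have "H.lincomb a (hc ` insert z S) = ?f (hc z) \<oplus>\<^bsub>homology K p\<^esub> H.lincomb a (hc ` S)"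
      unfolding H.lincomb_def image_insert
      by (rule H.finsum_insert) (use insert f zn in auto)
    also have "\<dots> = hc (chain_sum {y \<in> insert z S. a (hc y) \<noteq> 0})"
    proof (cases "a (hc z) = 0")
      case True
      then have "{y \<in> insert z S. a (hc y) \<noteq> 0} = {z \<in> S. a (hc z) \<noteq> 0}" by auto
      then show ?thesis unfolding IH sm using True hom_class_add[OF K, of p "{}"] hom_class_empty by simp
    next
      case False
      then have "{y \<in> insert z S. a (hc y) \<noteq> 0} = insert z {z \<in> S. a (hc z) \<noteq> 0}" by auto
      then show ?thesis unfolding IH sm using False insert
        by (simp add: hom_class_add[OF K] chain_sum_insert del: bit_not_zero_iff)
    qed
    finally show ?case .
  qed
qed

text \<open>Replaces the module-theoretic notion by sums of cycles. Injectivity of the class map on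
  \<open>S\<close> follows from the right-hand side: two distinct homologous cycles form a subset
  whose sum is a boundary.\<close>

lemma homology_independent_iff:
  assumes S: "S \<subseteq> cycles K p"
  shows "homology_independent K p S \<longleftrightarrow> (\<forall>T\<subseteq>S. T \<noteq> {} \<longrightarrow> chain_sum T \<notin> boundaries K p)"
proof -
  interpret H: vectorspace class_ring "homology K p" by (rule vectorspace_homology[OF K])
  have fin: "finite S" using S finite_cycles finite_subset by blast
  have zero: "\<zero>\<^bsub>homology K p\<^esub> = boundaries K p" by (simp add: homology_def)
  have carr: "hc ` S \<subseteq> carrier (homology K p)" using S by (auto simp: homology_def)
  have dep: "H.lin_dep (hc ` S) \<longleftrightarrow> (\<exists>T\<subseteq>S. T \<noteq> {} \<and> chain_sum T \<in> boundaries K p)" if inj: "inj_on hc S"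
  proof
    assume "H.lin_dep (hc ` S)"
    then obtain a v where av: "H.lincomb a (hc ` S) = \<zero>\<^bsub>homology K p\<^esub>" "v \<in> hc ` S" "a v \<noteq> (0 :: bit)"
      using H.finite_lin_dep[OF _ _ carr] fin by auto
    let ?T = "{z \<in> S. a (hc z) \<noteq> 0}"
    have "hc (chain_sum ?T) = boundaries K p"
      unfolding lincomb_hom_class[OF S inj, of a, symmetric] av(1) zero ..
    then have "chain_sum ?T \<in> boundaries K p" by (rule iffD1[OF hom_class_zero_iff])
    moreover obtain x where "x \<in> S" "a (hc x) \<noteq> 0" using av(2,3) by (elim imageE) simp
    then have "?T \<noteq> {}" by (metis (mono_tags, lifting) empty_Collect_eq)
    moreover have "?T \<subseteq> S" by (rule Collect_restrict)
    ultimately show "\<exists>T\<subseteq>S. T \<noteq> {} \<and> chain_sum T \<in> boundaries K p" by (intro exI[of _ ?T] conjI)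
  next
    assume "\<exists>T\<subseteq>S. T \<noteq> {} \<and> chain_sum T \<in> boundaries K p"
    then obtain T z where T: "T \<subseteq> S" "z \<in> T" "chain_sum T \<in> boundaries K p" by blast
    define a :: "nat set set set \<Rightarrow> bit" where "a X = (if X \<in> hc ` T then 1 else 0)" for X
    have "hc z \<in> hc ` T \<longleftrightarrow> z \<in> T" if "z \<in> S" for z
      using inj_on_image_mem_iff[OF inj that T(1)] .
    then have "{z \<in> S. a (hc z) \<noteq> 0} = T"
      using T(1) by (auto simp: a_def)
    then have "H.lincomb a (hc ` S) = \<zero>\<^bsub>homology K p\<^esub>"
      using lincomb_hom_class[OF S inj, of a] T(3) by (simp only: zero hom_class_zero_iff)
    moreover have "a (hc z) \<noteq> \<zero>\<^bsub>class_ring\<^esub>" "hc z \<in> hc ` S" using T by (auto simp: a_def)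
    ultimately show "H.lin_dep (hc ` S)" using fin by (intro H.lin_dep_crit[of "hc ` S" _ a "hc z"]) auto
  qed
  show ?thesis
  proof
    assume i: "homology_independent K p S"
    then show "\<forall>T\<subseteq>S. T \<noteq> {} \<longrightarrow> chain_sum T \<notin> boundaries K p"
      using dep unfolding homology_independent_def by blast
  next
    assume n: "\<forall>T\<subseteq>S. T \<noteq> {} \<longrightarrow> chain_sum T \<notin> boundaries K p"
    have "inj_on hc S"
    proof (rule inj_onI, rule ccontr)
      fix x y assume xy: "x \<in> S" "y \<in> S" "hc x = hc y" "x \<noteq> y"
      then have "chain_sum {x, y} = sym_diff x y"
        by (simp add: chain_sum_insert)
      then show False using xy n[rule_format, of "{x, y}"] hom_class_eq_iff[of x y] by auto
    qed
    then show "homology_independent K p S"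
      using dep n S unfolding homology_independent_def by blast
  qed
qed

text \<open>A linear map on cycles that vanishes exactly on the boundaries, and onto \<open>F\<^sub>2\<^sup>g\<close>,
  identifies the homology with \<open>F\<^sub>2\<^sup>g\<close>.\<close>

lemma betti_eq:
  fixes \<phi> :: "nat set set \<Rightarrow> nat \<Rightarrow> bit"
  assumes add: "\<And>x y e. \<lbrakk>x \<in> cycles K p; y \<in> cycles K p; e < g\<rbrakk> \<Longrightarrow> \<phi> (sym_diff x y) e = \<phi> x e + \<phi> y e"
    and ker: "\<And>x. x \<in> cycles K p \<Longrightarrow> x \<in> boundaries K p \<longleftrightarrow> (\<forall>e<g. \<phi> x e = 0)"
    and unit: "\<And>e. e < g \<Longrightarrow> z e \<in> cycles K p" "\<And>e e'. \<lbrakk>e < g; e' < g\<rbrakk> \<Longrightarrow> \<phi> (z e) e' = of_bool (e = e')"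
  shows "betti K p = g"
proof -
  interpret H: vectorspace class_ring "homology K p" by (rule vectorspace_homology[OF K])
  have zS: "z ` {..<g} \<subseteq> cycles K p" using unit(1) by auto
  have injz: "inj_on z {..<g}"
  proof (rule inj_onI)
    fix e e' assume "e \<in> {..<g}" "e' \<in> {..<g}" "z e = z e'"
    then have "of_bool (e = e') = (of_bool (e' = e') :: bit)" using unit(2)[of _ e'] by (metis lessThan_iff)
    then show "e = e'" by (simp split: if_splits)
  qed
  have phi_sum: "\<phi> (chain_sum (z ` E)) e = (\<Sum>e'\<in>E. of_bool (e' = e))" if "E \<subseteq> {..<g}" "e < g" for E e
  proof -
    have "finite E" using that finite_subset by blast
    then show ?thesis using that(1)
    proof (induction E)
      case empty
      have "\<phi> (sym_diff {} {}) e = \<phi> {} e + \<phi> {} e" using that(2) by (intro add empty_cycle)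
      then show ?case using bit_add_self by simp
    next
      case (insert x E)
      have n: "z x \<notin> z ` E" using injz insert by (auto simp: inj_on_def)
      have "\<phi> (chain_sum (z ` insert x E)) e = \<phi> (z x) e + \<phi> (chain_sum (z ` E)) e"
        unfolding image_insert chain_sum_insert[OF finite_imageI[OF insert(1)] n]
        by (rule add) (use insert that(2) unit(1) zS in \<open>auto intro!: chain_sum_cycle\<close>)
      also have "\<dots> = of_bool (x = e) + (\<Sum>e'\<in>E. of_bool (e' = e))"
        using insert unit(2)[of x e] that(2) by (simp only: insert_subset lessThan_iff)
      also have "\<dots> = (\<Sum>e'\<in>insert x E. of_bool (e' = e))"
        using sum.insert[OF insert(1,2), of "\<lambda>e'. of_bool (e' = e)"] by metis
      finally show ?case .
    qed
  qed
  have delta: "(\<Sum>e'\<in>E. of_bool (e' = e)) = (of_bool (e \<in> E) :: bit)" if "finite E" for E and e :: nat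
    using sum.delta[OF that, of e "\<lambda>_. 1 :: bit"] by (simp only: of_bool_def)
  have phi: "\<phi> (chain_sum (z ` E)) e = of_bool (e \<in> E)" if "E \<subseteq> {..<g}" "e < g" for E e
    using phi_sum[OF that] delta[of E e] that finite_subset by fastforce
  have nb: "chain_sum T \<notin> boundaries K p" if T: "T \<subseteq> z ` {..<g}" "T \<noteq> {}" for T
  proof -
    obtain E where E: "E \<subseteq> {..<g}" "T = z ` E" using T(1) by (auto simp: subset_image_iff)
    then obtain e where "e \<in> E" using T(2) by auto
    moreover have "chain_sum T \<in> cycles K p" using T(1) zS by (intro chain_sum_cycle) auto
    ultimately show ?thesis using ker[of "chain_sum T"] phi[OF E(1), of e] E by auto
  qed
  then have ind: "homology_independent K p (z ` {..<g})"
    using homology_independent_iff[OF zS] by blast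
  then have inj: "inj_on hc (z ` {..<g})" and li: "\<not> H.lin_dep (hc ` z ` {..<g})"
    by (auto simp: homology_independent_def)
  let ?B = "hc ` z ` {..<g}"
  have BC: "?B \<subseteq> carrier (homology K p)" using zS by (auto simp: homology_def)
  have "carrier (homology K p) \<subseteq> H.span ?B"
  proof
    fix X assume "X \<in> carrier (homology K p)"
    then obtain x where x: "x \<in> cycles K p" "X = hc x" by (auto simp: homology_def)
    \<comment> \<open>The coordinates at which x is 1. Adding the corresponding unit cycles to x
      gives a cycle with all coordinates zero, hence a boundary.\<close>
    define E where "E = {e. e < g \<and> \<phi> x e = 1}"
    let ?a = "\<lambda>Y. if Y \<in> hc ` z ` E then 1 else (0 :: bit)"
    have E: "E \<subseteq> {..<g}" by (auto simp: E_def)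
    have c: "chain_sum (z ` E) \<in> cycles K p" using E zS by (intro chain_sum_cycle) auto
    have "\<phi> (sym_diff x (chain_sum (z ` E))) e = 0" if "e < g" for e
    proof -
      have "\<phi> x e = of_bool (e \<in> E)" using that unfolding E_def by (cases "\<phi> x e") auto
      then show ?thesis unfolding add[OF x(1) c that] phi[OF E that] by (simp only: bit_add_self)
    qed
    then have "sym_diff x (chain_sum (z ` E)) \<in> boundaries K p"
      using ker[OF sym_diff_cycles[OF K x(1) c]] by blast
    then have "X = hc (chain_sum (z ` E))" using hom_class_eq_iff x(2) by blast
    also have "{y \<in> z ` {..<g}. ?a (hc y) \<noteq> 0} = z ` E"
      using E inj by (auto simp: inj_on_def split: if_splits) blast
    then have "hc (chain_sum (z ` E)) = H.lincomb ?a ?B"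
      using lincomb_hom_class[OF zS inj, of ?a] by simp
    finally have X: "X = H.lincomb ?a ?B" .
    show "X \<in> H.span ?B" unfolding H.span_def X by (rule CollectI) (intro exI[of _ ?a] exI[of _ ?B], auto)
  qed
  then have "H.span ?B = carrier (homology K p)"
    using H.span_is_subset2[OF BC] by blast
  then have "H.basis ?B" unfolding H.basis_def using li BC by blast
  then have "H.dim = card ?B" by (intro H.dim_basis) auto
  also have "\<dots> = g" using inj injz by (simp add: card_image)
  finally show ?thesis by (simp add: betti_def)
qed

text \<open>The square of the boundary map is zero: a face \<tau> of \<rho> with two vertices fewer
  lies in exactly two simplices between them, so every \<rho> in the chain contributes an even
  number of incidences. For p = 0 there is no \<tau>, because \<open>K\<close> does not contain the
  empty set.\<close>

lemma boundary_is_cycle: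
  assumes b: "b \<in> boundaries K p" shows "b \<in> cycles K p"
proof -
  obtain c where c: "c \<subseteq> simplices K (Suc p)" "b = bd K (Suc p) c" using b by (auto simp: boundaries_def)
  have finc: "finite c" using finite_subset[OF c(1) finite_simplices[OF K]] .
  have bs: "b \<subseteq> simplices K p" unfolding c bd_def simplices_def by auto
  have fb: "finite b" using finite_subset[OF bs finite_simplices[OF K]] .
  have "even (card {\<sigma> \<in> b. \<tau> \<subseteq> \<sigma>})" if \<tau>: "\<tau> \<in> K" "card \<tau> = p" for \<tau>
  proof -
    let ?A = "{\<sigma> \<in> simplices K p. \<tau> \<subseteq> \<sigma>}"
    have finA: "finite ?A" using finite_simplices[OF K, of p] by simp
    have two: "even (card {\<sigma> \<in> ?A. \<sigma> \<subseteq> \<rho>})" if \<rho>: "\<rho> \<in> c" for \<rho>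
    proof (cases "\<tau> \<subseteq> \<rho>")
      case True
      have r: "\<rho> \<in> K" "card \<rho> = Suc (Suc p)" "finite \<rho>" using \<rho> c K by (auto simp: simplices_def simplicial_complex_def)
      have ft: "finite \<tau>" using True r finite_subset by blast
      have "card (\<rho> - \<tau>) = 2" using True r \<tau> ft by (simp add: card_Diff_subset)
      then obtain u v where uv: "\<rho> - \<tau> = {u, v}" "u \<noteq> v" by (auto simp: card_2_iff)
      have sub: "insert w \<tau> \<in> K" if "w \<in> \<rho>" for w
        using K r True that unfolding simplicial_complex_def by (metis insert_not_empty insert_subset)
      have "{\<sigma> \<in> ?A. \<sigma> \<subseteq> \<rho>} = {insert u \<tau>, insert v \<tau>}"
      proof (intro equalityI subsetI)
        fix \<sigma> assume s: "\<sigma> \<in> {\<sigma> \<in> ?A. \<sigma> \<subseteq> \<rho>}"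
        then have "finite \<sigma>" using r finite_subset by blast
        then have "card (\<sigma> - \<tau>) = 1" using s \<tau> ft by (simp add: card_Diff_subset simplices_def)
        then obtain w where w: "\<sigma> - \<tau> = {w}" by (auto simp: card_1_singleton_iff)
        then have "\<sigma> = insert w \<tau>" using s by auto
        moreover have "w \<in> \<rho> - \<tau>" using w s by auto
        ultimately show "\<sigma> \<in> {insert u \<tau>, insert v \<tau>}" using uv by auto
      next
        fix \<sigma> assume "\<sigma> \<in> {insert u \<tau>, insert v \<tau>}"
        then obtain w where w: "\<sigma> = insert w \<tau>" "w \<in> \<rho> - \<tau>" using uv by blast
        then show "\<sigma> \<in> {\<sigma> \<in> ?A. \<sigma> \<subseteq> \<rho>}" using sub \<tau> True ft by (auto simp: simplices_def)
      qed
      moreover have "insert u \<tau> \<noteq> insert v \<tau>" using uv by auto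
      ultimately show ?thesis by simp
    next
      case False
      then have "{\<sigma> \<in> ?A. \<sigma> \<subseteq> \<rho>} = {}" by auto
      then show ?thesis by (simp only: card.empty even_zero)
    qed
    have e: "{\<sigma> \<in> b. \<tau> \<subseteq> \<sigma>} = {\<sigma> \<in> ?A. odd (card {\<rho> \<in> c. \<sigma> \<subseteq> \<rho>})}"
      unfolding c(2) bd_def simplices_def by auto
    \<comment> \<open>The number of odd terms and the sum of all terms have the same parity. The sum
      counts pairs of a simplex containing \<tau> and a simplex of \<open>c\<close> above it, and is
      then rearranged as a sum over \<open>c\<close>.\<close>
    have "even (card {\<sigma> \<in> ?A. odd (card {\<rho> \<in> c. \<sigma> \<subseteq> \<rho>})}) \<longleftrightarrow> even (\<Sum>\<sigma>\<in>?A. card {\<rho> \<in> c. \<sigma> \<subseteq> \<rho>})"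
      using finA by (simp add: even_sum_iff)
    also have "(\<Sum>\<sigma>\<in>?A. card {\<rho> \<in> c. \<sigma> \<subseteq> \<rho>}) = (\<Sum>\<rho>\<in>c. card {\<sigma> \<in> ?A. \<sigma> \<subseteq> \<rho>})"
      by (rule sum_multicount_gen[OF finA finc]) simp
    also have "even \<dots>" using two by (intro dvd_sum) auto
    finally show ?thesis unfolding e by blast
  qed
  then have "bd K p b = {}" unfolding bd_def by blast
  then show ?thesis using bs by (simp add: cycles_def)
qed

end

context eliminated_matrix
begin

text \<open>This is how a column of \<open>U\<close> is read off the memory: away from its own row,
  the column belonging to a pivot row is the one stored at the pivot column.\<close>

lemma U_unit:
  assumes "k \<in> P"
  shows "U (unitv (\<rho> k)) i = unitv (\<rho> k) i + (if i < N then V i k else 0)"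
proof -
  have "(\<Sum>k'\<in>P. V i k' * unitv (\<rho> k) (\<rho> k')) = (\<Sum>k'\<in>P. if k' = k then V i k' else 0)"
    using inj_rho assms by (intro sum.cong refl) (auto simp: unitv_def inj_on_def)
  also have "\<dots> = V i k" using assms by (simp only: sum.delta finite_piv_cols if_True)
  finally show ?thesis unfolding tr_def by (simp only:)
qed

lemma U_unit_nonpivot: "j \<notin> used \<Longrightarrow> U (unitv j) = unitv j"
  by (rule tr_unit_fix) (use used in auto)

lemma pivot_col_nonzero:
  assumes "k \<in> P" obtains i where "i < N" "M i k \<noteq> 0"
  using pivots_independent[of "{k}"] assms by (metis empty_not_insert insert_subset empty_subsetI sum_single)

end

lemma of_nat_bit: "(of_nat m :: bit) = of_bool (odd m)"
proof -
  have "(of_nat m :: bit) = of_nat (m mod 2)" by (rule of_nat_mod_2[symmetric])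
  then show ?thesis by (cases "odd m") (auto simp: mod2_eq_if)
qed

lemma sum_of_bool_bit:
  assumes "finite A" shows "(\<Sum>x\<in>A. of_bool (Q x)) = (of_bool (odd (card {x \<in> A. Q x})) :: bit)"
proof -
  have "(\<Sum>x\<in>A. of_bool (Q x)) = (\<Sum>x\<in>A. if Q x then 1 else (0 :: bit))" by (simp only: of_bool_def)
  also have "\<dots> = sum (\<lambda>_. 1) {x \<in> A. Q x}" by (rule sum.inter_filter[symmetric]) fact
  also have "\<dots> = of_nat (card {x \<in> A. Q x})" by (simp only: sum_constant mult_1_right)
  finally show ?thesis by (simp only: of_nat_bit)
qed

text \<open>The boundary matrix on faces with \<open>q\<close> vertices, in a form that can be
  eliminated as a square matrix: rows and columns share the numbering of \<open>\<sigma>s\<close>,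
  indices beyond it give zero padding, and the rows in \<open>skip\<close> are zeroed instead of
  removed.\<close>

definition face :: "nat set list \<Rightarrow> nat \<Rightarrow> nat set \<Rightarrow> nat \<Rightarrow> nat \<Rightarrow> bit" where
  "face \<sigma>s q skip i j = of_bool (i < length \<sigma>s \<and> j < length \<sigma>s \<and> card (\<sigma>s ! i) = q \<and>
     card (\<sigma>s ! j) = Suc q \<and> \<sigma>s ! i \<subseteq> \<sigma>s ! j \<and> i \<notin> skip)"

locale enumerated_complex = finite_complex +
  fixes \<sigma>s :: "nat set list"
  assumes dist: "distinct \<sigma>s" and set_s: "set \<sigma>s = K"
begin

abbreviation "n \<equiv> length \<sigma>s"

definition J :: "nat set set \<Rightarrow> nat set" where "J z = {j. j < n \<and> \<sigma>s ! j \<in> z}"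

lemma J_sub: "J z \<subseteq> {..<n}" by (auto simp: J_def)
lemma finite_J [simp]: "finite (J z)" using J_sub finite_subset by blast
lemma nth_inj: "\<lbrakk>i < n; j < n\<rbrakk> \<Longrightarrow> \<sigma>s ! i = \<sigma>s ! j \<longleftrightarrow> i = j" using dist by (rule nth_eq_iff_index_eq)
lemma nth_in: "i < n \<Longrightarrow> \<sigma>s ! i \<in> K" using set_s by auto
lemma image_J: "z \<subseteq> K \<Longrightarrow> (!) \<sigma>s ` J z = z"
  using set_s unfolding J_def by (auto simp: in_set_conv_nth image_iff) (metis in_set_conv_nth subsetD)
lemma inj_J: "A \<subseteq> {..<n} \<Longrightarrow> inj_on ((!) \<sigma>s) A" by (rule inj_onI) (use nth_inj in blast)
lemma J_image: "A \<subseteq> {..<n} \<Longrightarrow> J ((!) \<sigma>s ` A) = A" using nth_inj by (auto simp: J_def)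
lemma J_sym_diff: "J (sym_diff x y) = sym_diff (J x) (J y)" by (auto simp: J_def)

lemma cycle_sub: "z \<in> cycles K p \<Longrightarrow> z \<subseteq> K"
  by (auto simp: cycles_def simplices_def)

lemma sum_face:
  assumes A: "A \<subseteq> {..<n}" "\<And>j. j \<in> A \<Longrightarrow> card (\<sigma>s ! j) = Suc q" and i: "i < n" "card (\<sigma>s ! i) = q"
  shows "(\<Sum>j\<in>A. face \<sigma>s q {} i j) = of_bool (\<sigma>s ! i \<in> bd K q ((!) \<sigma>s ` A))"
proof -
  have "finite A" using A(1) finite_subset by blast
  have "(\<Sum>j\<in>A. face \<sigma>s q {} i j) = (\<Sum>j\<in>A. of_bool (\<sigma>s ! i \<subseteq> \<sigma>s ! j))"
    unfolding face_def using A i by (intro sum.cong refl arg_cong[where f = of_bool]) auto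
  also have "\<dots> = of_bool (odd (card {j \<in> A. \<sigma>s ! i \<subseteq> \<sigma>s ! j}))" by (rule sum_of_bool_bit) fact
  also have "card {j \<in> A. \<sigma>s ! i \<subseteq> \<sigma>s ! j} = card ((!) \<sigma>s ` {j \<in> A. \<sigma>s ! i \<subseteq> \<sigma>s ! j})"
    using A(1) by (intro card_image[symmetric] inj_J) auto
  also have "(!) \<sigma>s ` {j \<in> A. \<sigma>s ! i \<subseteq> \<sigma>s ! j} = {\<sigma> \<in> (!) \<sigma>s ` A. \<sigma>s ! i \<subseteq> \<sigma>}" by auto
  finally show ?thesis using nth_in[OF i(1)] i(2) unfolding bd_def by simp
qed

lemma cycleI:
  assumes A: "A \<subseteq> {..<n}" "\<And>j. j \<in> A \<Longrightarrow> card (\<sigma>s ! j) = Suc p"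
    and z: "\<And>i. i < n \<Longrightarrow> (\<Sum>j\<in>A. face \<sigma>s p {} i j) = 0"
  shows "(!) \<sigma>s ` A \<in> cycles K p"
proof -
  have "\<tau> \<notin> bd K p ((!) \<sigma>s ` A)" for \<tau>
  proof
    assume b: "\<tau> \<in> bd K p ((!) \<sigma>s ` A)"
    then obtain i where "i < n" "\<tau> = \<sigma>s ! i" "card \<tau> = p"
      using set_s unfolding bd_def by (auto simp: in_set_conv_nth)
    then show False using b sum_face[OF A, of i] z[of i] by simp
  qed
  then have "bd K p ((!) \<sigma>s ` A) = {}" by blast
  then show ?thesis using A nth_in by (auto simp: cycles_def simplices_def)
qed

lemma cycleD:
  assumes z: "z \<in> cycles K p" and i: "i < n"
  shows "(\<Sum>j\<in>J z. face \<sigma>s p {} i j) = 0"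
proof (cases "card (\<sigma>s ! i) = p")
  case True
  have "card (\<sigma>s ! j) = Suc p" if "j \<in> J z" for j using that z by (auto simp: J_def cycles_def simplices_def)
  then show ?thesis using sum_face[OF J_sub, of z p i] i True z image_J[OF cycle_sub[OF z]]
    by (simp add: cycles_def)
next
  case False
  then show ?thesis by (intro sum.neutral) (simp add: face_def)
qed

end

text \<open>Both matrices number rows and columns by position in the enumeration. Hence a pivot
  column of the first names a row of the second, and the restriction to non-pivot simplices is
  obtained by skipping these rows.\<close>

locale annotated_complex = enumerated_complex +
  fixes N :: nat and V1 V2 :: "nat \<Rightarrow> nat \<Rightarrow> bit" and piv1 piv2 :: "nat \<Rightarrow> nat" and u1 u2 :: "nat set"
  assumes nN: "n \<le> N"
    and e1: "eliminated_matrix N (face \<sigma>s p {}) V1 piv1 u1"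
    and e2: "eliminated_matrix N (face \<sigma>s (Suc p) {i. piv1 i \<noteq> 0}) V2 piv2 u2"
begin

sublocale E1: eliminated_matrix N "face \<sigma>s p {}" V1 piv1 u1 by (rule e1)
sublocale E2: eliminated_matrix N "face \<sigma>s (Suc p) {i. piv1 i \<noteq> 0}" V2 piv2 u2 by (rule e2)

definition F :: "nat set" where "F = {j. j < n \<and> card (\<sigma>s ! j) = Suc p \<and> piv1 j = 0}"
definition G :: "nat set" where "G = F - u2"
definition gl :: "nat list" where "gl = sorted_list_of_set G"
definition g :: nat where "g = card G"

text \<open>Coordinates on the cokernel: restrict the chain to \<open>F\<close>, apply the
  transformation of the second elimination, and read the entries in the non-pivot rows
  \<open>G\<close>, listed by \<open>gl\<close>. Written as a sum over simplices, it is visibly a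
  sum of annotations.\<close>

definition \<phi> :: "nat set set \<Rightarrow> nat \<Rightarrow> bit" where
  "\<phi> z e = (\<Sum>j\<in>J z \<inter> F. E2.U (unitv j) (gl ! e))"

definition ann :: "nat set \<Rightarrow> bit vec" where "ann \<sigma> = vec g (\<phi> {\<sigma>})"

lemma finite_G: "finite G" by (simp add: G_def F_def)
lemma length_gl: "length gl = g" by (simp add: gl_def g_def)
lemma set_gl: "set gl = G" using finite_G by (simp add: gl_def)
lemma gl_in: "e < g \<Longrightarrow> gl ! e \<in> G" using length_gl set_gl nth_mem by metis
lemma gl_inj: "\<lbrakk>e < g; e' < g\<rbrakk> \<Longrightarrow> gl ! e = gl ! e' \<longleftrightarrow> e = e'"
  using finite_G length_gl by (simp add: gl_def nth_eq_iff_index_eq)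
lemma gl_ex: "i \<in> G \<Longrightarrow> \<exists>e<g. i = gl ! e" using set_gl length_gl by (metis in_set_conv_nth)

lemma P1_simplex: "k \<in> E1.P \<Longrightarrow> k < n \<and> card (\<sigma>s ! k) = Suc p"
  by (erule E1.pivot_col_nonzero) (auto simp: face_def split: if_splits)

lemma P2_simplex: "k \<in> E2.P \<Longrightarrow> k < n \<and> card (\<sigma>s ! k) = Suc (Suc p)"
  by (erule E2.pivot_col_nonzero) (auto simp: face_def split: if_splits)

lemma cycle_J: "\<lbrakk>z \<in> cycles K p; j \<in> J z\<rbrakk> \<Longrightarrow> j < n \<and> card (\<sigma>s ! j) = Suc p"
  by (auto simp: J_def cycles_def simplices_def)

lemma cycle_J_cases: "\<lbrakk>z \<in> cycles K p; j \<in> J z\<rbrakk> \<Longrightarrow> j \<in> F \<or> j \<in> E1.P"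
  using cycle_J[of z j] nN by (auto simp: F_def piv_cols_def)

text \<open>Outside \<open>F\<close> a cycle is supported on pivot columns of the boundary matrix,
  which are independent. So a cycle is determined by its restriction to \<open>F\<close>.\<close>

lemma cycle_zero:
  assumes z: "z \<in> cycles K p" and JF: "J z \<inter> F = {}" shows "z = {}"
proof -
  have JP: "J z \<subseteq> E1.P" using cycle_J_cases[OF z] JF by blast
  have "(\<Sum>j\<in>J z. face \<sigma>s p {} i j) = 0" if "i < N" for i
  proof (cases "i < n")
    case True
    then show ?thesis by (rule cycleD[OF z])
  next
    case False
    then show ?thesis by (intro sum.neutral) (simp add: face_def)
  qed
  from E1.pivots_independent[OF JP this] have "J z = {}" by blast
  then show ?thesis using image_J[OF cycle_sub[OF z]] by blast
qed

text \<open>The columns in \<open>Y\<close> sum to a combination of pivot columns; adding those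
  simplices closes up the chain without touching \<open>F\<close>. So the restriction of cycles to
  \<open>F\<close> is onto.\<close>

lemma cycle_extend:
  assumes Y: "Y \<subseteq> F" obtains z where "z \<in> cycles K p" "J z \<inter> F = Y"
proof -
  have Yn: "Y \<subseteq> {..<n}" using Y by (auto simp: F_def)
  then have YN: "Y \<subseteq> {..<N}" using nN by auto
  obtain S where S: "S \<subseteq> E1.P" "\<And>i. i < N \<Longrightarrow> (\<Sum>k\<in>Y. face \<sigma>s p {} i k) = (\<Sum>k\<in>S. face \<sigma>s p {} i k)"
    using E1.pivots_span[OF YN] by blast
  have "piv1 k \<noteq> 0" if "k \<in> S" for k using that S(1) by (auto simp: piv_cols_def)
  moreover have "piv1 k = 0" if "k \<in> F" for k using that by (simp add: F_def)
  ultimately have dis: "Y \<inter> S = {}" "S \<inter> F = {}" using Y by blast+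
  have Sn: "S \<subseteq> {..<n}" using S(1) P1_simplex by blast
  have fin: "finite Y" "finite S" using Yn Sn finite_subset by blast+
  have "(!) \<sigma>s ` (Y \<union> S) \<in> cycles K p"
  proof (rule cycleI)
    show "Y \<union> S \<subseteq> {..<n}" using Yn Sn by blast
    show "card (\<sigma>s ! j) = Suc p" if "j \<in> Y \<union> S" for j
      using that Y S(1) P1_simplex by (auto simp: F_def)
    show "(\<Sum>j\<in>Y \<union> S. face \<sigma>s p {} i j) = 0" if "i < n" for i
      unfolding sum.union_disjoint[OF fin dis(1)] using S(2)[of i] that nN by (simp only: bit_add_self less_le_trans)
  qed
  moreover have "J ((!) \<sigma>s ` (Y \<union> S)) \<inter> F = Y" using J_image[of "Y \<union> S"] Yn Sn dis Y by auto
  ultimately show ?thesis using that by blast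
qed

lemma phi_add:
  "\<phi> (sym_diff x y) e = \<phi> x e + \<phi> y e"
proof -
  have "J (sym_diff x y) \<inter> F = sym_diff (J x \<inter> F) (J y \<inter> F)" unfolding J_sym_diff by blast
  then show ?thesis unfolding \<phi>_def by (simp only: sum_sym_diff finite_Int finite_J simp_thms)
qed

lemma phi_U: "(\<Sum>j\<in>A. E2.U (unitv j) i) = E2.U (\<lambda>i. \<Sum>j\<in>A. unitv j i) i"
  unfolding tr_sum ..

lemma sum_unitv: "finite A \<Longrightarrow> (\<Sum>j\<in>A. unitv j i) = (of_bool (i \<in> A) :: bit)"
  unfolding unitv_def using sum.delta'[of A i "\<lambda>_. 1 :: bit"] by (simp only: of_bool_def)

text \<open>The surviving rows of the second matrix are those in \<open>F\<close>, so a sum of its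
  columns is the indicator of a boundary restricted to \<open>F\<close>.\<close>

lemma boundary_face:
  assumes A: "A \<subseteq> {..<n}" "\<And>j. j \<in> A \<Longrightarrow> card (\<sigma>s ! j) = Suc (Suc p)" and i: "i < N"
  shows "(\<Sum>k\<in>A. face \<sigma>s (Suc p) {i. piv1 i \<noteq> 0} i k) = of_bool (i \<in> J (bd K (Suc p) ((!) \<sigma>s ` A)) \<inter> F)"
proof (cases "i \<in> F")
  case True
  then have "face \<sigma>s (Suc p) {i. piv1 i \<noteq> 0} i k = face \<sigma>s (Suc p) {} i k" for k
    by (simp add: face_def F_def)
  then have "(\<Sum>k\<in>A. face \<sigma>s (Suc p) {i. piv1 i \<noteq> 0} i k) = (\<Sum>k\<in>A. face \<sigma>s (Suc p) {} i k)" by (simp only:)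
  also have "\<dots> = of_bool (\<sigma>s ! i \<in> bd K (Suc p) ((!) \<sigma>s ` A))"
    using True by (intro sum_face A) (auto simp: F_def)
  finally show ?thesis using True by (simp add: J_def F_def)
next
  case False
  then have "(\<Sum>k\<in>A. face \<sigma>s (Suc p) {i. piv1 i \<noteq> 0} i k) = 0"
    by (intro sum.neutral) (auto simp: face_def F_def)
  then show ?thesis using False by simp
qed

text \<open>The restriction of a boundary is a sum of columns of the second matrix, and
  \<open>U\<close> sends these to vectors supported on pivot rows. Conversely, if the coordinates
  vanish, the restriction of \<open>z\<close> agrees with that of some boundary; their difference is
  a cycle that vanishes on \<open>F\<close>, hence is zero.\<close>

lemma phi_kernel:
  assumes z: "z \<in> cycles K p"
  shows "z \<in> boundaries K p \<longleftrightarrow> (\<forall>e<g. \<phi> z e = 0)"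
proof
  assume "z \<in> boundaries K p"
  then obtain c where c: "c \<subseteq> simplices K (Suc p)" "z = bd K (Suc p) c" by (auto simp: boundaries_def)
  have cK: "c \<subseteq> K" using c by (auto simp: simplices_def)
  have Jc: "card (\<sigma>s ! j) = Suc (Suc p)" if "j \<in> J c" for j using that c by (auto simp: J_def simplices_def)
  show "\<forall>e<g. \<phi> z e = 0"
  proof (intro allI impI)
    fix e assume e: "e < g"
    have G: "gl ! e \<in> F" "gl ! e \<notin> u2" using gl_in[OF e] by (auto simp: G_def)
    have "(\<lambda>i. \<Sum>j\<in>J z \<inter> F. unitv j i) = (\<lambda>i. \<Sum>k\<in>J c. colv N (face \<sigma>s (Suc p) {i. piv1 i \<noteq> 0}) k i)"
    proof
      fix i
      have "(\<Sum>k\<in>J c. colv N (face \<sigma>s (Suc p) {i. piv1 i \<noteq> 0}) k i) = of_bool (i \<in> J z \<inter> F)"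
      proof (cases "i < N")
        case True
        then show ?thesis using boundary_face[OF J_sub Jc True] image_J[OF cK] c(2) unfolding colv_def by simp
      next
        case False
        then show ?thesis using nN by (auto simp: colv_def F_def)
      qed
      then show "(\<Sum>j\<in>J z \<inter> F. unitv j i) = (\<Sum>k\<in>J c. colv N (face \<sigma>s (Suc p) {i. piv1 i \<noteq> 0}) k i)"
        by (simp only: sum_unitv finite_Int finite_J simp_thms)
    qed
    then have "\<phi> z e = (\<Sum>k\<in>J c. E2.U (colv N (face \<sigma>s (Suc p) {i. piv1 i \<noteq> 0}) k) (gl ! e))"
      unfolding \<phi>_def phi_U by (simp only: tr_sum)
    also have "\<dots> = 0" using E2.U_col_outside[OF _ G(2)] J_sub[of c] nN by (intro sum.neutral) auto
    finally show "\<phi> z e = 0" .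
  qed
next
  assume p0: "\<forall>e<g. \<phi> z e = 0"
  let ?y = "\<lambda>i. \<Sum>j\<in>J z \<inter> F. (unitv j i :: bit)"
  have y: "?y i = of_bool (i \<in> J z \<inter> F)" for i by (simp only: sum_unitv finite_Int finite_J simp_thms)
  \<comment> \<open>In a row outside \<open>F\<close> the second matrix is zero, so \<open>U\<close>
    leaves this entry of the vector alone, and it is zero because the vector is supported on
    \<open>F\<close>.\<close>
  have out: "E2.U ?y i = 0" if i: "i < N" "i \<notin> u2" for i
  proof (cases "i \<in> F")
    case True
    then obtain e where "e < g" "i = gl ! e" using gl_ex i by (auto simp: G_def)
    then show ?thesis using p0 unfolding \<phi>_def phi_U by blast
  next
    case False
    have "face \<sigma>s (Suc p) {i. piv1 i \<noteq> 0} i k = 0" for k using False by (auto simp: face_def F_def)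
    then have "V2 i k = 0" if "k \<in> E2.P" for k using E2.zero_row[OF i(1)] that by blast
    then have "(\<Sum>k\<in>E2.P. V2 i k * ?y (E2.\<rho> k)) = 0" by (intro sum.neutral) simp
    then show ?thesis unfolding tr_def using y[of i] False by simp
  qed
  have "\<exists>S\<subseteq>E2.P. \<forall>i<N. ?y i = (\<Sum>k\<in>S. face \<sigma>s (Suc p) {i. piv1 i \<noteq> 0} i k)"
  proof (rule E2.in_column_space[OF _ out])
    show "?y i = 0" if "i \<ge> N" for i
    proof -
      have "i \<notin> F" using that nN by (auto simp: F_def)
      then show ?thesis unfolding y by simp
    qed
  qed
  then obtain S where S: "S \<subseteq> E2.P" "\<And>i. i < N \<Longrightarrow> ?y i = (\<Sum>k\<in>S. face \<sigma>s (Suc p) {i. piv1 i \<noteq> 0} i k)"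
    by blast
  have Sn: "S \<subseteq> {..<n}" "\<And>j. j \<in> S \<Longrightarrow> card (\<sigma>s ! j) = Suc (Suc p)" using S(1) P2_simplex by blast+
  let ?b = "bd K (Suc p) ((!) \<sigma>s ` S)"
  have "(!) \<sigma>s ` S \<subseteq> simplices K (Suc p)" using Sn nth_in by (auto simp: simplices_def)
  then have b: "?b \<in> boundaries K p" unfolding boundaries_def by blast
  have "J ?b \<inter> F = J z \<inter> F"
  proof (rule Set.set_eqI)
    fix i show "i \<in> J ?b \<inter> F \<longleftrightarrow> i \<in> J z \<inter> F"
    proof (cases "i < N")
      case True
      have "of_bool (i \<in> J ?b \<inter> F) = (of_bool (i \<in> J z \<inter> F) :: bit)"
        using boundary_face[OF Sn True] S(2)[OF True] y[of i] by metis
      then show ?thesis by (simp only: of_bool_eq_iff)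
    qed (use nN in \<open>auto simp: F_def\<close>)
  qed
  then have "J (sym_diff z ?b) \<inter> F = {}" unfolding J_sym_diff by blast
  with sym_diff_cycles[OF K z boundary_is_cycle[OF b]] have "sym_diff z ?b = {}"
    by (rule cycle_zero)
  then have "z = ?b" by blast
  then show "z \<in> boundaries K p" using b by simp
qed

text \<open>The cycles extending a single simplex of \<open>G\<close> have unit coordinate vectors,
  because \<open>U\<close> fixes the unit vectors of non-pivot rows. Together with
  \<open>phi_kernel\<close> this identifies the homology with F_2^g.\<close>

lemma betti: "betti K p = g"
proof -
  have "\<exists>z. z \<in> cycles K p \<and> J z \<inter> F = {gl ! e}" if "e < g" for e
    using cycle_extend[of "{gl ! e}"] gl_in[OF that] by (metis DiffD1 G_def empty_subsetI insert_subset)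
  then obtain z where z: "\<And>e. e < g \<Longrightarrow> z e \<in> cycles K p" "\<And>e. e < g \<Longrightarrow> J (z e) \<inter> F = {gl ! e}"
    by metis
  show ?thesis
  proof (rule betti_eq[OF phi_add phi_kernel z(1)])
    show "\<phi> (z e) e' = of_bool (e = e')" if "e < g" "e' < g" for e e'
    proof -
      have u: "gl ! e \<notin> u2" using gl_in[OF that(1)] by (simp add: G_def)
      have "\<phi> (z e) e' = unitv (gl ! e) (gl ! e')"
        unfolding \<phi>_def z(2)[OF that(1)] sum_single E2.U_unit_nonpivot[OF u] ..
      then show ?thesis using gl_inj[OF that] by (auto simp: unitv_def)
    qed
  qed
qed

lemma phi_sum: "z \<subseteq> K \<Longrightarrow> \<phi> z e = (\<Sum>\<sigma>\<in>z. \<phi> {\<sigma>} e)"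
proof -
  assume z: "z \<subseteq> K"
  have one: "\<phi> {\<sigma>s ! j} e = (if j \<in> F then E2.U (unitv j) (gl ! e) else 0)" if "j \<in> J z" for j
  proof -
    have "J {\<sigma>s ! j} = {j}" using J_image[of "{j}"] that J_sub by force
    then show ?thesis by (simp add: \<phi>_def)
  qed
  have "(\<Sum>\<sigma>\<in>z. \<phi> {\<sigma>} e) = (\<Sum>j\<in>J z. \<phi> {\<sigma>s ! j} e)"
    using sum.reindex[OF inj_J[OF J_sub], of "\<lambda>\<sigma>. \<phi> {\<sigma>} e" z] image_J[OF z] by (simp only: o_def)
  also have "\<dots> = (\<Sum>j\<in>J z. if j \<in> F then E2.U (unitv j) (gl ! e) else 0)" using one by (rule sum.cong[OF refl])
  also have "\<dots> = \<phi> z e" unfolding \<phi>_def by (rule sum.inter_restrict[symmetric]) simp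
  finally show ?thesis ..
qed

lemma annotation: "annotation K p ann"
  unfolding annotation_def betti
proof (intro conjI ballI)
  show "ann \<sigma> \<in> carrier_vec g" for \<sigma> by (simp add: ann_def)
  fix z z' assume zz: "z \<in> cycles K p" "z' \<in> cycles K p"
  have S: "finsum_vec TYPE(bit) g ann z = vec g (\<phi> z)" if z: "z \<in> cycles K p" for z
  proof (rule eq_vecI)
    have c: "ann \<in> z \<rightarrow> carrier_vec g" by (simp add: ann_def)
    show "dim_vec (finsum_vec TYPE(bit) g ann z) = dim_vec (vec g (\<phi> z))"
      using finsum_vec_closed[OF c] by auto
    fix e assume "e < dim_vec (vec g (\<phi> z))"
    then have e: "e < g" by simp
    show "finsum_vec TYPE(bit) g ann z $ e = vec g (\<phi> z) $ e"
      unfolding index_finsum_vec[OF finite_cycle[OF z] e c] using phi_sum[OF cycle_sub[OF z], of e] e by (simp add: ann_def)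
  qed
  have "hc z = hc z' \<longleftrightarrow> (\<forall>e<g. \<phi> z e + \<phi> z' e = 0)"
    unfolding hom_class_eq_iff phi_kernel[OF sym_diff_cycles[OF K zz]] phi_add ..
  also have "\<dots> \<longleftrightarrow> (\<forall>e<g. \<phi> z e = \<phi> z' e)"
  proof -
    have "a + b = 0 \<longleftrightarrow> a = b" for a b :: bit by (cases a; cases b) auto
    then show ?thesis by (simp only:)
  qed
  also have "\<dots> \<longleftrightarrow> vec g (\<phi> z) = vec g (\<phi> z')" by (auto simp: vec_eq_iff)
  finally show "hc z = hc z' \<longleftrightarrow> finsum_vec TYPE(bit) g ann z = finsum_vec TYPE(bit) g ann z'"
    unfolding S[OF zz(1)] S[OF zz(2)] .
qed

lemma ann_entry:
  assumes j: "j < n" "e < g"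
  shows "ann (\<sigma>s ! j) $ e = (if j \<in> F then E2.U (unitv j) (gl ! e) else 0)"
proof -
  have "J {\<sigma>s ! j} = {j}" using J_image[of "{j}"] j by simp
  then show ?thesis using j by (simp add: ann_def \<phi>_def)
qed

end

section \<open>Answers to a query in terms of annotation sums\<close>

context enumerated_complex
begin

text \<open>Reduces an answer to linear algebra with the sums \<open>w\<close> of annotations over
  the listed cycles: a sum of cycles is a boundary exactly when its annotation sum is zero.
  Independence and span concern positions, while the answer concerns sets of cycles, and the same
  cycle may be listed at several positions.\<close>

lemma correct_answerI:
  assumes a: "annotation K p a" and valid: "valid_query K p \<sigma>s zs"
    and w: "\<And>j e. \<lbrakk>j < length zs; e < betti K p\<rbrakk> \<Longrightarrow> w j e = (\<Sum>i\<leftarrow>zs ! j. a (\<sigma>s ! i) $ e)"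
    and js: "distinct js" "set js \<subseteq> {..<length zs}"
    and ind: "\<And>T. \<lbrakk>T \<subseteq> set js; \<And>e. e < betti K p \<Longrightarrow> (\<Sum>j\<in>T. w j e) = 0\<rbrakk> \<Longrightarrow> T = {}"
    and span: "\<And>j. j < length zs \<Longrightarrow> \<exists>T\<subseteq>set js. \<forall>e<betti K p. w j e = (\<Sum>i\<in>T. w i e)"
  shows "correct_answer K p \<sigma>s zs js"
proof -
  define z where "z j = chain_of \<sigma>s (zs ! j)" for j
  let ?g = "betti K p"
  have zc: "z j \<in> cycles K p" if "j < length zs" for j
    using valid that by (auto simp: valid_query_def z_def)
  have ac: "a \<in> x \<rightarrow> carrier_vec ?g" if "x \<in> cycles K p" for x
    using a that by (auto simp: annotation_def cycles_def)
  define s where "s x e = (\<Sum>\<sigma>\<in>x. a \<sigma> $ e)" for x e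
  have sz: "s (z j) e = w j e" if j: "j < length zs" "e < ?g" for j e
  proof -
    have v: "distinct (zs ! j)" "set (zs ! j) \<subseteq> {..<n}" using valid j by (auto simp: valid_query_def)
    have "s (z j) e = (\<Sum>i\<in>set (zs ! j). a (\<sigma>s ! i) $ e)"
      unfolding s_def z_def chain_of_def using sum.reindex[OF inj_J[OF v(2)], of "\<lambda>\<sigma>. a \<sigma> $ e"] by (simp only: o_def)
    also have "\<dots> = (\<Sum>i\<leftarrow>zs ! j. a (\<sigma>s ! i) $ e)" by (rule sum.distinct_set_conv_list[OF v(1)])
    finally show ?thesis using w[OF j] by simp
  qed
  have bnd: "x \<in> boundaries K p \<longleftrightarrow> (\<forall>e<?g. s x e = 0)" if x: "x \<in> cycles K p" for x
  proof -
    have v: "finsum_vec TYPE(bit) ?g a x = vec ?g (s x)" if x: "x \<in> cycles K p" for x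
      using finsum_vec_closed[OF ac[OF x]] index_finsum_vec[OF finite_cycle[OF x] _ ac[OF x]]
      by (intro eq_vecI) (auto simp: s_def)
    have "x \<in> boundaries K p \<longleftrightarrow> hc x = hc {}" by (simp add: hom_class_empty hom_class_zero_iff)
    also have "\<dots> \<longleftrightarrow> vec ?g (s x) = vec ?g (s {})"
      using a x empty_cycle[of K p] unfolding annotation_def by (simp only: v simp_thms)
    also have "\<dots> \<longleftrightarrow> (\<forall>e<?g. s x e = 0)" by (auto simp: vec_eq_iff s_def)
    finally show ?thesis .
  qed
  have s_chain: "s (chain_sum T) e = (\<Sum>x\<in>T. s x e)" if "T \<subseteq> cycles K p" for T e
  proof -
    have "finite T" using that finite_cycles finite_subset by blast
    then show ?thesis using that
    proof (induction T)
      case (insert x T)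
      have "finite (chain_sum T)" "finite x" using insert chain_sum_cycle finite_cycle by auto
      then have "s (chain_sum (insert x T)) e = s x e + s (chain_sum T) e"
        unfolding s_def chain_sum_insert[OF insert(1,2)] by (intro sum_sym_diff)
      then show ?case unfolding sum.insert[OF insert(1,2)] using insert by simp
    qed (simp add: s_def)
  qed
  have hi: "homology_independent K p S \<longleftrightarrow> (\<forall>T\<subseteq>S. (\<forall>e<?g. (\<Sum>x\<in>T. s x e) = 0) \<longrightarrow> T = {})"
    if S: "S \<subseteq> cycles K p" for S
  proof -
    have "chain_sum T \<in> boundaries K p \<longleftrightarrow> (\<forall>e<?g. (\<Sum>x\<in>T. s x e) = 0)" if "T \<subseteq> S" for T
      using bnd[of "chain_sum T"] chain_sum_cycle[of T] s_chain[of T] that S by auto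
    then show ?thesis unfolding homology_independent_iff[OF S] by blast
  qed
  \<comment> \<open>Equal cycles at two positions would have equal sums, and these two positions
    would be dependent.\<close>
  have injz: "inj_on z (set js)"
  proof (rule inj_onI, rule ccontr)
    fix i j assume ij: "i \<in> set js" "j \<in> set js" "z i = z j" "i \<noteq> j"
    have "(\<Sum>j\<in>{i, j}. w j e) = 0" if "e < ?g" for e
    proof -
      have "w i e = w j e" using sz[of i e] sz[of j e] ij js that by force
      then show ?thesis using ij by (simp add: bit_add_self)
    qed
    then have "{i, j} = {}" by (intro ind) (use ij in auto)
    then show False by simp
  qed
  have zjs: "z ` set js \<subseteq> cycles K p" using js zc by auto
  have sumz: "(\<Sum>x\<in>z ` T. s x e) = (\<Sum>j\<in>T. w j e)" if "T \<subseteq> set js" "e < ?g" for T e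
  proof -
    have "(\<Sum>x\<in>z ` T. s x e) = (\<Sum>j\<in>T. s (z j) e)"
      using sum.reindex[OF inj_on_subset[OF injz that(1)], of "\<lambda>x. s x e"] by (simp only: o_def)
    also have "\<dots> = (\<Sum>j\<in>T. w j e)" using sz that js by (intro sum.cong refl) auto
    finally show ?thesis .
  qed
  have "homology_independent K p (z ` set js)"
    unfolding hi[OF zjs]
  proof (intro allI impI)
    fix T assume T: "T \<subseteq> z ` set js" "\<forall>e<?g. (\<Sum>x\<in>T. s x e) = 0"
    then obtain T' where T': "T' \<subseteq> set js" "T = z ` T'" by (auto simp: subset_image_iff)
    then have "T' = {}" using ind[OF T'(1)] T(2) sumz[OF T'(1)] by simp
    then show "T = {}" using T' by simp
  qed
  note hom = this
  \<comment> \<open>A further cycle \<open>z j\<close>, together with the selected cycles that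
    represent its annotation sum, is a dependent subset, so no proper superset is
    independent.\<close>
  have mx: "B = z ` set js" if B: "z ` set js \<subseteq> B" "B \<subseteq> z ` {..<length zs}" "homology_independent K p B" for B
  proof (rule ccontr)
    assume "B \<noteq> z ` set js"
    then obtain b where b: "b \<in> B" "b \<notin> z ` set js" using B(1) by blast
    then obtain j where "b = z j" "j < length zs" using B(2) by blast
    then have j: "j < length zs" "z j \<in> B" "z j \<notin> z ` set js" using b by simp_all
    obtain T where T: "T \<subseteq> set js" "\<And>e. e < ?g \<Longrightarrow> w j e = (\<Sum>i\<in>T. w i e)" using span[OF j(1)] by blast
    have BC: "B \<subseteq> cycles K p" using B zc by auto
    have fT: "finite (z ` T)" using T finite_subset by blast
    have n: "z j \<notin> z ` T" using j T by blast
    have z0: "(\<Sum>x\<in>insert (z j) (z ` T). s x e) = 0" if "e < ?g" for e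
      unfolding sum.insert[OF fT n] sumz[OF T(1) that] sz[OF j(1) that] T(2)[OF that] by (rule bit_add_self)
    have "insert (z j) (z ` T) \<subseteq> B" using image_mono[OF T(1), of z] B(1) j(2) by simp
    then show False using iffD1[OF hi[OF BC] B(3), rule_format, of "insert (z j) (z ` T)"] z0 by simp
  qed
  have zeq: "(\<lambda>j. chain_of \<sigma>s (zs ! j)) = z" by (simp add: z_def fun_eq_iff)
  show ?thesis
    unfolding correct_answer_def Let_def zeq maximal_def
  proof (intro conjI allI impI)
    show "distinct (map z js)" using js(1) injz by (simp add: distinct_map)
    show "z ` set js \<subseteq> z ` {..<length zs}" using js(2) by (rule image_mono)
    show "B = z ` set js" if "z ` set js \<subseteq> B \<and> B \<subseteq> z ` {..<length zs} \<and> homology_independent K p B" for B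
      using that by (elim conjE) (rule mx)
  qed (fact js hom)+
qed

end

section \<open>The preprocessing program\<close>

definition offset :: "'a list list \<Rightarrow> nat \<Rightarrow> nat" where
  "offset xss j = length (concat (take j xss))"

lemma offset_0 [simp]: "offset xss 0 = 0"
  by (simp add: offset_def)

lemma offset_Suc: "j < length xss \<Longrightarrow> offset xss (Suc j) = offset xss j + length (xss ! j)"
  by (simp add: offset_def take_Suc_conv_app_nth)

lemma offset_le: "offset xss j \<le> length (concat xss)"
  unfolding offset_def by (metis append_take_drop_id concat_append le_add1 length_append)

lemma nth_concat_offset:
  assumes "j < length xss" "u < length (xss ! j)"
  shows "concat xss ! (offset xss j + u) = xss ! j ! u" "offset xss j + u < length (concat xss)"
proof -
  have e: "concat xss = concat (take j xss) @ xss ! j @ concat (drop (Suc j) xss)"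
    using assms(1) by (metis id_take_nth_drop concat.simps(2) concat_append)
  show "concat xss ! (offset xss j + u) = xss ! j ! u"
    using assms(2) by (subst e) (simp add: offset_def nth_append)
  show "offset xss j + u < length (concat xss)"
    using assms(2) by (subst e) (simp add: offset_def)
qed

lemma input_size_ge:
  assumes "x \<in> set (concat ins)" shows "Suc x \<le> input_size ins"
  unfolding input_size_def using assms member_le_sum_list[of "Suc x" "map Suc (concat ins)"] by simp

lemma length_le_input_size: "length (concat ins) \<le> input_size ins"
proof -
  have "sum_list (map (\<lambda>_. 1) xs) \<le> (\<Sum>x\<leftarrow>xs. Suc x)" for xs :: "nat list" by (rule sum_list_mono) simp
  from this[of "concat ins"] show ?thesis by (simp add: input_size_def sum_list_triv)
qed

text \<open>The array holds the intended matrix only below \<open>N\<close>; a column index beyond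
  \<open>N\<close> runs into the next row. The elimination depends on the entries below
  \<open>N\<close> alone.\<close>

lemma eliminated_matrix_cong:
  assumes e: "eliminated_matrix N M V piv u" and M: "\<And>i k. \<lbrakk>i < N; k < N\<rbrakk> \<Longrightarrow> M i k = M' i k"
  shows "eliminated_matrix N M' V piv u"
proof -
  have c: "colv N M' k = colv N M k" if "k < N" for k using M that by (auto simp: colv_def)
  have kN: "k < N" if "k \<in> piv_cols piv 0 N" for k using that by (simp add: piv_cols_def)
  note d = e[unfolded eliminated_matrix_def eliminated_def]
  note d1 = d[THEN conjunct1] and d3 = d[THEN conjunct2, THEN conjunct2]
  show ?thesis
    unfolding eliminated_matrix_def eliminated_def
  proof (intro conjI)
    show "\<forall>k\<in>piv_cols piv 0 N. tr N 0 N V piv (colv N M' k) = unitv (piv k - 1)"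
      using d c kN by metis
    show "\<forall>k\<in>{0..<0 + N} - piv_cols piv 0 N. \<forall>i<N. i \<notin> u \<longrightarrow> tr N 0 N V piv (colv N M' k) i = 0"
    proof (intro ballI)
      fix k assume k: "k \<in> {0..<0 + N} - piv_cols piv 0 N"
      then have "k < N" by simp
      then show "\<forall>i<N. i \<notin> u \<longrightarrow> tr N 0 N V piv (colv N M' k) i = 0" using d k c by metis
    qed
    show "\<forall>i<N. (\<forall>k\<in>{0..<0 + N}. M' i k = 0) \<longrightarrow> (\<forall>k\<in>piv_cols piv 0 N. V i k = 0)"
    proof (intro allI impI)
      fix i assume i: "i < N" "\<forall>k\<in>{0..<0 + N}. M' i k = 0"
      then have "\<forall>k\<in>{0..<0 + N}. M i k = 0" using M by simp
      then show "\<forall>k\<in>piv_cols piv 0 N. V i k = 0" using d i(1) by blast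
    qed
    show "\<forall>i<N. \<forall>k<N. k \<notin> {0..<0 + N} \<longrightarrow> V i k = M' i k" by simp
  qed (rule d1 d3 d3[THEN conjunct1] d3[THEN conjunct2, THEN conjunct1]
      d3[THEN conjunct2, THEN conjunct2, THEN conjunct1]
      d3[THEN conjunct2, THEN conjunct2, THEN conjunct2, THEN conjunct2, THEN conjunct2, THEN conjunct1])+
qed

lemma eliminated_matrix_piv_outside: "\<lbrakk>eliminated_matrix N M V piv u; k \<ge> N\<rbrakk> \<Longrightarrow> piv k = 0"
proof -
  assume "eliminated_matrix N M V piv u" and k: "k \<ge> N"
  then have "eliminated N 0 N M {} (\<lambda>_. 0) V u piv" by (simp only: eliminated_matrix_def)
  from this[unfolded eliminated_def, THEN conjunct1] k show ?thesis by simp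
qed

context enumerated_complex
begin

text \<open>Records in the input have different lengths, so array 8 keeps the position of the record
  of each simplex in array 2. \<open>X\<close> bounds the addresses and vertex names that are
  read.\<close>

definition holds_complex :: "nat \<Rightarrow> nat \<Rightarrow> ram \<Rightarrow> bool" where
  "holds_complex X N s \<longleftrightarrow> reg s 20 = n \<and> reg s 21 = p \<and> reg s 1 = N \<and>
     (\<forall>j<n. arr s 2 (arr s 8 j) = card (\<sigma>s ! j) \<and> arr s 8 j + 1 + card (\<sigma>s ! j) \<le> X \<and>
       (\<forall>u<card (\<sigma>s ! j). arr s 2 (arr s 8 j + 1 + u) = sorted_list_of_set (\<sigma>s ! j) ! u \<and>
         sorted_list_of_set (\<sigma>s ! j) ! u \<le> X))"

lemma holds_complex_agree:
  "\<lbrakk>holds_complex X N s; agree R A s s'; 20 \<notin> R; 21 \<notin> R; 1 \<notin> R; 2 \<notin> A; 8 \<notin> A\<rbrakk> \<Longrightarrow> holds_complex X N s'"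
  unfolding holds_complex_def agree_def by metis

text \<open>Only soundness of old marks is kept invariant. This suffices because all vertices of a
  simplex are marked anew before its marks are consulted, and it makes marks left by an earlier
  matrix harmless.\<close>

definition good_marks :: "ram \<Rightarrow> bool" where
  "good_marks s \<longleftrightarrow> (\<forall>v j. arr s 10 v = Suc j \<longrightarrow> j < n \<and> v \<in> \<sigma>s ! j)"

lemma finite_simplex: "j < n \<Longrightarrow> finite (\<sigma>s ! j)"
  using nth_in K by (auto simp: simplicial_complex_def)

end

text \<open>The value doubles until it reaches the target. After j rounds it exceeds j unless it has
  stopped, so as many rounds as the target are enough; linear time is affordable here.\<close>

definition power_of_two :: "nat \<Rightarrow> com" where
  "power_of_two r = Assign 1 (Const 1) ;; For 22 r (If (Reg 1 [<] Reg r) (Assign 1 (Reg 1 [+] Reg 1)) Skip)"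

lemma wp_power_of_two:
  assumes r: "reg s r = m" "r \<noteq> 1" "r \<noteq> 22" and m: "1 \<le> m" "2 * m \<le> W"
    and Q: "\<And>s' t' L. \<lbrakk>agree {1, 22} {} s s'; reg s' 1 = 2 ^ L; m \<le> 2 ^ L; 2 ^ L < 2 * m;
      t' \<le> t + 28 * m + 8\<rbrakk> \<Longrightarrow> Q s' t'"
  shows "wp W (power_of_two r) Q s t"
proof -
  let ?s = "s\<lparr>reg := (reg s)(1 := 1)\<rparr>" and ?c = "If (Reg 1 [<] Reg r) (Assign 1 (Reg 1 [+] Reg 1)) Skip"
  have "wp W (For 22 r ?c) Q ?s (t + (1 + cost (Const 1)))"
  proof (rule wp_For[where n = m and B = 20 and I = "\<lambda>j s2. (\<exists>L. reg s2 1 = 2 ^ L) \<and> reg s2 1 < 2 * m \<and>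
      (m \<le> reg s2 1 \<or> j < reg s2 1)"])
    fix j s2 t2
    assume j: "j < m" and b: "agree (insert 22 (wregs ?c)) (warrs ?c) ?s s2" "reg s2 22 = j"
      and I: "(\<exists>L. reg s2 1 = 2 ^ L) \<and> reg s2 1 < 2 * m \<and> (m \<le> reg s2 1 \<or> j < reg s2 1)"
    have r2: "reg s2 r = m" using b r by (simp add: agree_def)
    obtain L where L: "reg s2 1 = 2 ^ L" using I by blast
    show "wp W ?c (\<lambda>s3 t3. ((\<exists>L. reg s3 1 = 2 ^ L) \<and> reg s3 1 < 2 * m \<and> (m \<le> reg s3 1 \<or> Suc j < reg s3 1)) \<and>
        t3 \<le> t2 + 20) s2 t2"
    proof (rule wp_If)
      show "fits W s2 (Reg 1 [<] Reg r)" using r2 I m by simp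
      assume "val s2 (Reg 1 [<] Reg r) \<noteq> 0"
      then have lt: "reg s2 1 < m" using r2 by simp
      then have gt: "j < reg s2 1" using I by simp
      have "reg s2 1 + reg s2 1 = 2 ^ Suc L" using L by simp
      moreover have "Suc j < reg s2 1 + reg s2 1" using gt by linarith
      ultimately show "wp W (Assign 1 (Reg 1 [+] Reg 1)) (\<lambda>s3 t3. ((\<exists>L. reg s3 1 = 2 ^ L) \<and> reg s3 1 < 2 * m \<and>
          (m \<le> reg s3 1 \<or> Suc j < reg s3 1)) \<and> t3 \<le> t2 + 20) s2 (t2 + (1 + cost (Reg 1 [<] Reg r)))"
        using lt m by (intro wp_Assign) (auto intro: exI[of _ "Suc L"])
    next
      assume "val s2 (Reg 1 [<] Reg r) = 0"
      then have "m \<le> reg s2 1" using r2 by simp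
      then show "wp W Skip (\<lambda>s3 t3. ((\<exists>L. reg s3 1 = 2 ^ L) \<and> reg s3 1 < 2 * m \<and>
          (m \<le> reg s3 1 \<or> Suc j < reg s3 1)) \<and> t3 \<le> t2 + 20) s2 (t2 + (1 + cost (Reg 1 [<] Reg r)))"
        using I by (intro wp_Skip) auto
    qed
  next
    show "(\<exists>L. reg ?s 1 = 2 ^ L) \<and> reg ?s 1 < 2 * m \<and> (m \<le> reg ?s 1 \<or> 0 < reg ?s 1)"
      using m by (auto intro: exI[of _ 0])
    fix s' t'
    assume b: "agree (insert 22 (wregs ?c)) (warrs ?c) ?s s'"
      and I: "(\<exists>L. reg s' 1 = 2 ^ L) \<and> reg s' 1 < 2 * m \<and> (m \<le> reg s' 1 \<or> m < reg s' 1)"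
      and t': "t' \<le> t + (1 + cost (Const 1)) + m * (20 + 8) + 6"
    obtain L where "reg s' 1 = 2 ^ L" using I by blast
    moreover have "agree {1, 22} {} s s'" using b by (auto simp: agree_def)
    ultimately show "Q s' t'" using I t' by (intro Q[where L = L]) auto
  qed (use r m in auto)
  then show ?thesis unfolding power_of_two_def using m
    by - (rule wp_Seq, rule wp_Assign, simp_all)
qed

definition prepare :: com where
  "prepare =
     Assign 20 (Cell 1 (Const 1)) ;; Assign 21 (Cell 1 (Const 0)) ;; Assign 26 (Const 0) ;;
     For 22 20 (Store 8 (Reg 22) (Reg 26) ;; Assign 26 (Reg 26 [+] Cell 2 (Reg 26) [+] Const 1)) ;;
     power_of_two 20"

text \<open>Marks are never removed: \<open>mark v = j + 1\<close> implies that \<open>v\<close> is a vertex of simplex \<open>j\<close>,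
  whenever it was set.\<close>

definition build :: com where
  "build =
     For 22 1 (For 23 1 (Store 3 (Reg 22 [*] Reg 1 [+] Reg 23) (Const 0))) ;;
     For 22 20 (
       Assign 28 (Cell 2 (Cell 8 (Reg 22))) ;;
       For 24 28 (Store 10 (Cell 2 (Cell 8 (Reg 22) [+] Const 1 [+] Reg 24)) (Reg 22 [+] Const 1)) ;;
       For 23 20 (
         Assign 29 (Cell 2 (Cell 8 (Reg 23))) ;;
         Assign 27 (Const 0) ;;
         For 24 29 (Assign 27 (Reg 27 [+] Bin Eq (Cell 10 (Cell 2 (Cell 8 (Reg 23) [+] Const 1 [+] Reg 24))) (Reg 22 [+] Const 1))) ;;
         Store 3 (Reg 23 [*] Reg 1 [+] Reg 22)
           (Bin Eq (Reg 29) (Reg 25) [*] Bin Eq (Reg 28) (Reg 25 [+] Const 1) [*] Bin Eq (Reg 27) (Reg 29)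
             [*] Bin Eq (Cell 11 (Reg 23)) (Const 0))))"

context enumerated_complex
begin

lemma wp_prepare:
  assumes s: "s = init (complex_input p \<sigma>s)" and n: "1 \<le> n" and X: "X = input_size (complex_input p \<sigma>s)"
    and W: "2 * X + 4 \<le> W"
    and Q: "\<And>s' t' N L. \<lbrakk>holds_complex X N s'; agree {1, 20, 21, 22, 26} {8} s s'; N = 2 ^ L; n \<le> N; N < 2 * n;
      t' \<le> t + 60 * n + 60\<rbrakk> \<Longrightarrow> Q s' t'"
  shows "wp W prepare Q s t"
proof -
  let ?xs = "map (\<lambda>\<sigma>. card \<sigma> # sorted_list_of_set \<sigma>) \<sigma>s"
  let ?vs = "concat ?xs"
  have ins: "concat (complex_input p \<sigma>s) = [p, n] @ ?vs" by (simp add: complex_input_def)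
  have pX: "Suc p \<le> X" "Suc n \<le> X" unfolding X by (rule input_size_ge; simp only: ins; simp)+
  have vX: "v \<le> X" if "v \<in> set ?vs" for v
    using input_size_ge[of v "complex_input p \<sigma>s"] that unfolding X ins by auto
  have lX: "length ?vs + 2 \<le> X" using length_le_input_size[of "complex_input p \<sigma>s"] unfolding ins X by simp
  have a1: "arr s 1 0 = p" "arr s 1 1 = n" by (simp_all add: s init_def complex_input_def)
  have a2: "arr s 2 x = ?vs ! x" if "x < length ?vs" for x using that by (simp add: s init_def complex_input_def)
  have len: "length (?xs ! j) = Suc (card (\<sigma>s ! j))" if "j < n" for j
    using that finite_simplex by simp
  have rd: "arr s 2 (offset ?xs j) = card (\<sigma>s ! j)" "offset ?xs j < length ?vs"
    "offset ?xs (Suc j) = offset ?xs j + card (\<sigma>s ! j) + 1"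
    "card (\<sigma>s ! j) \<le> X" if j: "j < n" for j
  proof -
    have l: "j < length ?xs" "0 < length (?xs ! j)" using j len by simp_all
    have c: "?vs ! offset ?xs j = card (\<sigma>s ! j)" "offset ?xs j < length ?vs"
      using nth_concat_offset[OF l] j by simp_all
    then show "arr s 2 (offset ?xs j) = card (\<sigma>s ! j)" "offset ?xs j < length ?vs" using a2 by simp_all
    show "offset ?xs (Suc j) = offset ?xs j + card (\<sigma>s ! j) + 1" using offset_Suc[OF l(1)] len[OF j] by simp
    show "card (\<sigma>s ! j) \<le> X" using c vX nth_mem by metis
  qed
  have offX: "offset ?xs j \<le> X" for j using offset_le[of ?xs j] lX by linarith
  have ver: "arr s 2 (offset ?xs j + 1 + u) = sorted_list_of_set (\<sigma>s ! j) ! u"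
    "sorted_list_of_set (\<sigma>s ! j) ! u \<le> X" "offset ?xs j + 1 + card (\<sigma>s ! j) \<le> X" if j: "j < n" "u < card (\<sigma>s ! j)" for j u
  proof -
    have l: "j < length ?xs" "Suc u < length (?xs ! j)" using j len[OF j(1)] by simp_all
    have c: "?vs ! (offset ?xs j + Suc u) = sorted_list_of_set (\<sigma>s ! j) ! u" "offset ?xs j + Suc u < length ?vs"
      using nth_concat_offset[OF l] j by simp_all
    then show "arr s 2 (offset ?xs j + 1 + u) = sorted_list_of_set (\<sigma>s ! j) ! u" using a2 by simp
    show "sorted_list_of_set (\<sigma>s ! j) ! u \<le> X" using c vX nth_mem by metis
    show "offset ?xs j + 1 + card (\<sigma>s ! j) \<le> X" using rd(3)[OF j(1)] offX[of "Suc j"] by simp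
  qed
  have offc: "offset ?xs j + 1 + card (\<sigma>s ! j) \<le> X" if "j < n" for j
    using rd(3)[OF that] offX[of "Suc j"] by simp
  let ?s1 = "s\<lparr>reg := (reg s)(20 := n, 21 := p, 26 := 0)\<rparr>"
  let ?c1 = "Store 8 (Reg 22) (Reg 26) ;; Assign 26 (Reg 26 [+] Cell 2 (Reg 26) [+] Const 1)"
  have main: "wp W (For 22 20 ?c1 ;; power_of_two 20) Q ?s1
      (t + (1 + cost (Cell 1 (Const 1))) + (1 + cost (Cell 1 (Const 0))) + (1 + cost (Const 0)))"
  proof (rule wp_Seq, rule wp_For[where n = n and B = 20 and I = "\<lambda>j s1. reg s1 26 = offset ?xs j \<and>
      (\<forall>j'<j. arr s1 8 j' = offset ?xs j')"])
    fix j s1 t1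
    assume j: "j < n" and a: "agree (insert 22 (wregs ?c1)) (warrs ?c1) ?s1 s1" "reg s1 22 = j"
      and I: "reg s1 26 = offset ?xs j \<and> (\<forall>j'<j. arr s1 8 j' = offset ?xs j')"
    have "arr s1 2 = arr s 2" using a by (simp add: agree_def)
    then show "wp W ?c1 (\<lambda>s2 t2. (reg s2 26 = offset ?xs (Suc j) \<and> (\<forall>j'<Suc j. arr s2 8 j' = offset ?xs j')) \<and>
        t2 \<le> t1 + 20) s1 t1"
      using I a j rd[OF j] offX[of j] W pX
      by (intro wp_Seq wp_Store wp_Assign) (auto simp: less_Suc_eq)
  next
    fix s1 t1
    assume a: "agree (insert 22 (wregs ?c1)) (warrs ?c1) ?s1 s1"
      and I: "reg s1 26 = offset ?xs n \<and> (\<forall>j'<n. arr s1 8 j' = offset ?xs j')"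
      and t1: "t1 \<le> (t + (1 + cost (Cell 1 (Const 1))) + (1 + cost (Cell 1 (Const 0))) + (1 + cost (Const 0))) + n * (20 + 8) + 6"
    have r20: "reg s1 20 = n" using a by (simp add: agree_def)
    show "wp W (power_of_two 20) Q s1 t1"
    proof (rule wp_power_of_two[OF r20 _ _ n])
      show "2 * n \<le> W" using W pX by simp
      fix s' t' L
      assume b: "agree {1, 22} {} s1 s'" and L: "reg s' 1 = 2 ^ L" "n \<le> 2 ^ L" "2 ^ L < 2 * n"
        and t': "t' \<le> t1 + 28 * n + 8"
      have ag: "agree {1, 20, 21, 22, 26} {8} s s'" using a b by (auto simp: agree_def)
      have "reg s' 20 = n" "reg s' 21 = p" "arr s' 2 = arr s 2" "arr s' 8 = arr s1 8"
        using a b by (auto simp: agree_def)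
      then have "holds_complex X (2 ^ L) s'"
        unfolding holds_complex_def using L I rd(1) ver offc by auto
      then show "Q s' t'" using ag L t1 t' by (intro Q[where N = "2 ^ L" and L = L]) auto
    qed simp_all
  qed (use W pX in auto)
  show ?thesis unfolding prepare_def
    by (rule wp_Seq, rule wp_Assign, use a1 pX W in simp, rule wp_Seq, rule wp_Assign, use a1 pX W in simp,
        rule wp_Seq, rule wp_Assign, simp, use main a1 in simp)
qed

text \<open>Containment is tested by counting: the program counts the vertices of one simplex that
  carry the mark of the other and compares with the number of its vertices.\<close>

lemma subset_iff_count:
  assumes "i < n"
  shows "card {u. u < card (\<sigma>s ! i) \<and> sorted_list_of_set (\<sigma>s ! i) ! u \<in> \<tau>} = card (\<sigma>s ! i) \<longleftrightarrow> \<sigma>s ! i \<subseteq> \<tau>"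
proof -
  let ?l = "sorted_list_of_set (\<sigma>s ! i)" and ?m = "card (\<sigma>s ! i)"
  have l: "set ?l = \<sigma>s ! i" "length ?l = ?m" using finite_simplex[OF assms] by simp_all
  have sub: "{u. u < ?m \<and> ?l ! u \<in> \<tau>} \<subseteq> {..<?m}" by auto
  have "card {u. u < ?m \<and> ?l ! u \<in> \<tau>} = ?m \<longleftrightarrow> {u. u < ?m \<and> ?l ! u \<in> \<tau>} = {..<?m}"
    by (metis (no_types, lifting) card_lessThan card_subset_eq finite_lessThan sub)
  also have "\<dots> \<longleftrightarrow> (\<forall>u<?m. ?l ! u \<in> \<tau>)" by auto
  also have "\<dots> \<longleftrightarrow> \<sigma>s ! i \<subseteq> \<tau>"
    using l by (metis (no_types, lifting) in_set_conv_nth subset_eq)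
  finally show ?thesis .
qed

text \<open>Once the vertices of the column simplex are marked, testing one candidate face takes
  time proportional to its number of vertices. So the whole matrix costs a factor of order \<kappa>,
  a bound on the vertices of a simplex, in addition to N^2.\<close>

lemma wp_build:
  assumes h: "holds_complex X N s" and gm: "good_marks s" and q: "reg s 25 = q"
    and nN: "n \<le> N" "1 \<le> N" and kap: "\<And>j. j < n \<Longrightarrow> card (\<sigma>s ! j) \<le> \<kappa>"
    and skip: "\<And>i. i < N \<Longrightarrow> arr s 11 i \<le> N"
    and W: "2 * N * N + 4 \<le> W" "X + 4 \<le> W" "q + 4 \<le> W"
    and Q: "\<And>s' t'. \<lbrakk>agree {22, 23, 24, 27, 28, 29} {3, 10} s s'; good_marks s';
      \<And>i j. \<lbrakk>i < N; j < N\<rbrakk> \<Longrightarrow> arr s' 3 (i * N + j) = bit_code (face \<sigma>s q {i. arr s 11 i \<noteq> 0} i j);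
      t' \<le> t + 150 * (\<kappa> + 1) * (N * N)\<rbrakk> \<Longrightarrow> Q s' t'"
  shows "wp W build Q s t"
proof -
  have small: "x \<le> N * N \<Longrightarrow> x \<le> W" for x using W by simp
  have NN: "N \<le> N * N" by simp
  have smallN: "x \<le> N \<Longrightarrow> x \<le> W" for x using NN small by (meson le_trans)
  have rN: "reg s 1 = N" "reg s 20 = n" using h by (simp_all add: holds_complex_def)
  let ?f = "\<lambda>i j. bit_code (face \<sigma>s q {i. arr s 11 i \<noteq> 0} i j)"
  let ?l = "\<lambda>j u. sorted_list_of_set (\<sigma>s ! j) ! u"
  let ?mark = "Store 10 (Cell 2 (Cell 8 (Reg 22) [+] Const 1 [+] Reg 24)) (Reg 22 [+] Const 1)"
  let ?count = "Assign 27 (Reg 27 [+] Bin Eq (Cell 10 (Cell 2 (Cell 8 (Reg 23) [+] Const 1 [+] Reg 24))) (Reg 22 [+] Const 1))"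
  let ?store = "Store 3 (Reg 23 [*] Reg 1 [+] Reg 22)
           (Bin Eq (Reg 29) (Reg 25) [*] Bin Eq (Reg 28) (Reg 25 [+] Const 1) [*] Bin Eq (Reg 27) (Reg 29)
             [*] Bin Eq (Cell 11 (Reg 23)) (Const 0))"
  let ?row = "Assign 29 (Cell 2 (Cell 8 (Reg 23))) ;; Assign 27 (Const 0) ;; For 24 29 ?count ;; ?store"
  let ?col = "Assign 28 (Cell 2 (Cell 8 (Reg 22))) ;; For 24 28 ?mark ;; For 23 20 ?row"
  \<comment> \<open>\<open>P\<close> describes the entries already computed; all others still hold
    the zero of the initial filling.\<close>
  define D :: "(nat \<Rightarrow> nat \<Rightarrow> bool) \<Rightarrow> ram \<Rightarrow> bool" where "D P s' \<longleftrightarrow> (\<forall>i<N. \<forall>j<N. arr s' 3 (i * N + j) = (if P i j then ?f i j else 0))" for P s'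
  have D_reg: "D P (s'\<lparr>reg := r\<rparr>) \<longleftrightarrow> D P s'" for P and s' :: ram and r by (simp add: D_def)
  have gm_reg: "good_marks (s'\<lparr>reg := r\<rparr>) \<longleftrightarrow> good_marks s'" for s' r by (simp add: good_marks_def)
  have row: "wp W ?row Q s1 t1"
    if a: "agree {22, 23, 24, 27, 28, 29} {3, 10} s s1" "reg s1 22 = j" "reg s1 23 = i" "reg s1 28 = card (\<sigma>s ! j)"
      and ij: "i < n" "j < n" and marks: "\<And>v. arr s1 10 v = Suc j \<longleftrightarrow> v \<in> \<sigma>s ! j" and m10: "\<And>v. arr s1 10 v \<le> n"
      and Q: "\<And>s2 t2. \<lbrakk>agree {24, 27, 29} {3} s1 s2; arr s2 3 = (arr s1 3)(i * N + j := ?f i j);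
        t2 \<le> t1 + (23 * \<kappa> + 40)\<rbrakk> \<Longrightarrow> Q s2 t2" for i j s1 t1 Q
  proof -
    have h1: "holds_complex X N s1" by (rule holds_complex_agree[OF h a(1)]) auto
    have r: "reg s1 1 = N" "reg s1 25 = q" "arr s1 11 = arr s 11" using a rN q by (auto simp: agree_def)
    let ?s1 = "s1\<lparr>reg := (reg s1)(29 := card (\<sigma>s ! i), 27 := 0)\<rparr>"
    let ?c = "\<lambda>u. card {u'. u' < u \<and> ?l i u' \<in> \<sigma>s ! j}"
    have ci: "card (\<sigma>s ! i) \<le> X" "card (\<sigma>s ! j) \<le> X" using h ij by (auto simp: holds_complex_def)
    have m: "wp W (For 24 29 ?count ;; ?store) Q ?s1 (t1 + (1 + cost (Cell 2 (Cell 8 (Reg 23)))) + (1 + cost (Const 0)))"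
    proof (rule wp_Seq, rule wp_For[where n = "card (\<sigma>s ! i)" and B = 15 and I = "\<lambda>u s2. reg s2 27 = ?c u"])
      fix u s2 t2
      assume u: "u < card (\<sigma>s ! i)" and b: "agree (insert 24 (wregs ?count)) (warrs ?count) ?s1 s2" "reg s2 24 = u"
        and I: "reg s2 27 = ?c u"
      have h2: "arr s2 8 i + 1 + card (\<sigma>s ! i) \<le> X" "arr s2 2 (arr s2 8 i + 1 + u) = ?l i u" "?l i u \<le> X"
        using h1 b u ij by (auto simp: holds_complex_def agree_def)
      have r2: "reg s2 23 = i" "reg s2 22 = j" "arr s2 10 = arr s1 10" using b a by (auto simp: agree_def)
      have cS: "?c (Suc u) = ?c u + of_bool (?l i u \<in> \<sigma>s ! j)"
      proof (cases "?l i u \<in> \<sigma>s ! j")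
        case True
        then have "{u'. u' < Suc u \<and> ?l i u' \<in> \<sigma>s ! j} = insert u {u'. u' < u \<and> ?l i u' \<in> \<sigma>s ! j}"
          by (auto simp: less_Suc_eq)
        then show ?thesis using True by simp
      next
        case False
        then have "{u'. u' < Suc u \<and> ?l i u' \<in> \<sigma>s ! j} = {u'. u' < u \<and> ?l i u' \<in> \<sigma>s ! j}"
          by (auto simp: less_Suc_eq)
        then show ?thesis using False by simp
      qed
      have "?c (Suc u) \<le> card {..<Suc u}" by (intro card_mono) auto
      then have cX: "?c (Suc u) \<le> X" using u ci by simp
      have e: "val s2 (Reg 27 [+] Bin Eq (Cell 10 (Cell 2 (Cell 8 (Reg 23) [+] Const 1 [+] Reg 24))) (Reg 22 [+] Const 1)) = ?c (Suc u)"
        using r2 b(2) h2(2) I marks[of "?l i u"] cS by simp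
      show "wp W ?count (\<lambda>s3 t3. reg s3 27 = ?c (Suc u) \<and> t3 \<le> t2 + 15) s2 t2"
      proof (rule wp_Assign)
        have "i \<le> W" "Suc j \<le> W" using ij nN by (intro smallN; simp)+
        then show "fits W s2 (Reg 27 [+] Bin Eq (Cell 10 (Cell 2 (Cell 8 (Reg 23) [+] Const 1 [+] Reg 24))) (Reg 22 [+] Const 1))"
          using e cX cS W h2 r2 b(2) I u m10[of "?l i u"] smallN[of n] nN by (simp del: of_bool_eq_1_iff)
        show "reg (s2\<lparr>reg := (reg s2)(27 := val s2 (Reg 27 [+] Bin Eq (Cell 10 (Cell 2 (Cell 8 (Reg 23) [+] Const 1 [+] Reg 24))) (Reg 22 [+] Const 1)))\<rparr>) 27 = ?c (Suc u) \<and>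
          t2 + (1 + cost (Reg 27 [+] Bin Eq (Cell 10 (Cell 2 (Cell 8 (Reg 23) [+] Const 1 [+] Reg 24))) (Reg 22 [+] Const 1))) \<le> t2 + 15"
          using e by simp
      qed
    next
      fix s2 t2
      assume b: "agree (insert 24 (wregs ?count)) (warrs ?count) ?s1 s2" and I: "reg s2 27 = ?c (card (\<sigma>s ! i))"
        and t2: "t2 \<le> t1 + (1 + cost (Cell 2 (Cell 8 (Reg 23)))) + (1 + cost (Const 0)) + card (\<sigma>s ! i) * (15 + 8) + 6"
      have r2: "reg s2 1 = N" "reg s2 22 = j" "reg s2 23 = i" "reg s2 25 = q" "reg s2 28 = card (\<sigma>s ! j)"
        "reg s2 29 = card (\<sigma>s ! i)" "arr s2 11 = arr s 11" "arr s2 3 = arr s1 3"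
        using b a r by (auto simp: agree_def)
      have v: "val s2 (Bin Eq (Reg 29) (Reg 25) [*] Bin Eq (Reg 28) (Reg 25 [+] Const 1) [*] Bin Eq (Reg 27) (Reg 29)
             [*] Bin Eq (Cell 11 (Reg 23)) (Const 0)) = ?f i j"
        using r2 I subset_iff_count[OF ij(1), of "\<sigma>s ! j"] ij by (auto simp: face_def bit_code_def)
      have "i * N + j < N * N" using ij nN by (intro idx_less) auto
      then have iW: "i * N + j \<le> W" "i * N \<le> W" "i \<le> W" "j \<le> W" "N \<le> W"
        using ij nN smallN[of i] smallN[of j] smallN[of N] by (auto intro!: small)
      have "?c (card (\<sigma>s ! i)) \<le> card {..<card (\<sigma>s ! i)}" by (intro card_mono) auto
      then have cX: "?c (card (\<sigma>s ! i)) \<le> X" using ci by simp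
      have s11: "arr s 11 i \<le> W" using skip[of i] ij nN smallN by simp
      show "wp W ?store Q s2 t2"
      proof (rule wp_Store)
        show "fits W s2 (Reg 23 [*] Reg 1 [+] Reg 22)" using r2 iW by simp
        show "fits W s2 (Bin Eq (Reg 29) (Reg 25) [*] Bin Eq (Reg 28) (Reg 25 [+] Const 1) [*] Bin Eq (Reg 27) (Reg 29)
             [*] Bin Eq (Cell 11 (Reg 23)) (Const 0))"
          using r2 I iW cX ci s11 W by auto
        show "Q (s2\<lparr>arr := (arr s2)(3 := (arr s2 3)(val s2 (Reg 23 [*] Reg 1 [+] Reg 22) :=
            val s2 (Bin Eq (Reg 29) (Reg 25) [*] Bin Eq (Reg 28) (Reg 25 [+] Const 1) [*] Bin Eq (Reg 27) (Reg 29)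
             [*] Bin Eq (Cell 11 (Reg 23)) (Const 0))))\<rparr>)
          (t2 + (1 + cost (Reg 23 [*] Reg 1 [+] Reg 22) + cost (Bin Eq (Reg 29) (Reg 25) [*] Bin Eq (Reg 28) (Reg 25 [+] Const 1) [*] Bin Eq (Reg 27) (Reg 29)
             [*] Bin Eq (Cell 11 (Reg 23)) (Const 0))))"
          unfolding v
        proof (rule Q)
          have "card (\<sigma>s ! i) * 23 \<le> 23 * \<kappa>" using kap[OF ij(1)] by simp
          then show "t2 + (1 + cost (Reg 23 [*] Reg 1 [+] Reg 22) + cost (Bin Eq (Reg 29) (Reg 25) [*] Bin Eq (Reg 28) (Reg 25 [+] Const 1) [*] Bin Eq (Reg 27) (Reg 29)
             [*] Bin Eq (Cell 11 (Reg 23)) (Const 0))) \<le> t1 + (23 * \<kappa> + 40)"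
            using t2 by simp
        qed (use b r2 in \<open>auto simp: agree_def\<close>)
      qed
    qed (use ci W in auto)
    have v29: "val s1 (Cell 2 (Cell 8 (Reg 23))) = card (\<sigma>s ! i)" "fits W s1 (Cell 2 (Cell 8 (Reg 23)))"
      using h1 a ij W ci smallN[of i] nN by (auto simp: holds_complex_def)
    show ?thesis
      by (rule wp_Seq, rule wp_Assign, rule v29(2), rule wp_Seq, rule wp_Assign, simp,
          use m v29(1) in simp)
  qed
  show ?thesis unfolding build_def
  proof (rule wp_Seq, rule wp_For_fill[OF rN(1,1) _ _ _ _ inj_idx, where v = "\<lambda>_ _. 0"])
    fix s1 i j assume a: "agree {22, 23} {3} s s1" "reg s1 22 = i" "reg s1 23 = j" "i < N" "j < N"
    have "i * N + j \<le> W" "i * N \<le> W" using idx_less[OF a(4,5)] a(4) by (intro small; simp)+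
    then show "val s1 (Reg 22 [*] Reg 1 [+] Reg 23) = i * N + j \<and> val s1 (Const 0) = 0 \<and>
        fits W s1 (Reg 22 [*] Reg 1 [+] Reg 23) \<and> fits W s1 (Const 0)"
      using a rN smallN[of i] smallN[of j] smallN[of N] by (auto simp: agree_def)
  next
    fix s1 t1 assume 1: "agree {22, 23} {3} s s1" "\<And>i j. \<lbrakk>i < N; j < N\<rbrakk> \<Longrightarrow> arr s1 3 (i * N + j) = 0"
      and t1: "t1 \<le> t + N * (N * (cost (Reg 22 [*] Reg 1 [+] Reg 23) + cost (Const 0) + 9) + 14) + 6"
    show "wp W (For 22 20 ?col) Q s1 t1"
    proof (rule wp_For[where n = n and B = "19 * \<kappa> + 20 + n * (23 * \<kappa> + 48)" and
          I = "\<lambda>j s2. good_marks s2 \<and> D (\<lambda>i' j'. j' < j) s2"])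
      show "good_marks s1 \<and> D (\<lambda>i' j'. j' < 0) s1" using gm 1 by (auto simp: good_marks_def D_def agree_def)
    next
      fix j s2 t2
      assume j: "j < n" and a: "agree (insert 22 (wregs ?col)) (warrs ?col) s1 s2" "reg s2 22 = j"
        and I: "good_marks s2 \<and> D (\<lambda>i' j'. j' < j) s2"
      have a2: "agree {22, 23, 24, 27, 28, 29} {3, 10} s s2" using a 1(1) by (auto simp: agree_def)
      have h2: "holds_complex X N s2" by (rule holds_complex_agree[OF h a2]) auto
      have cj: "card (\<sigma>s ! j) \<le> X" using h j by (auto simp: holds_complex_def)
      let ?s2 = "s2\<lparr>reg := (reg s2)(28 := card (\<sigma>s ! j))\<rparr>"
      have jW: "Suc j \<le> W" using j nN by (intro smallN) simp
      have "wp W (For 24 28 ?mark ;; For 23 20 ?row) (\<lambda>s3 t3. (good_marks s3 \<and> D (\<lambda>i' j'. j' < Suc j) s3) \<and>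
          t3 \<le> t2 + (19 * \<kappa> + 20 + n * (23 * \<kappa> + 48))) ?s2 (t2 + (1 + cost (Cell 2 (Cell 8 (Reg 22)))))"
      proof (rule wp_Seq, rule wp_For[where n = "card (\<sigma>s ! j)" and B = 11 and
            I = "\<lambda>u s3. good_marks s3 \<and> (\<forall>u'<u. arr s3 10 (?l j u') = Suc j)"])
        fix u s3 t3
        assume u: "u < card (\<sigma>s ! j)" and b: "agree (insert 24 (wregs ?mark)) (warrs ?mark) ?s2 s3" "reg s3 24 = u"
          and I3: "good_marks s3 \<and> (\<forall>u'<u. arr s3 10 (?l j u') = Suc j)"
        have h3: "arr s3 8 j + 1 + card (\<sigma>s ! j) \<le> X" "arr s3 2 (arr s3 8 j + 1 + u) = ?l j u" "?l j u \<le> X"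
          using h2 b u j by (auto simp: holds_complex_def agree_def)
        have r3: "reg s3 22 = j" using b a by (auto simp: agree_def)
        have lj: "?l j u \<in> \<sigma>s ! j" using u finite_simplex[OF j] nth_mem[of u "sorted_list_of_set (\<sigma>s ! j)"] by simp
        show "wp W ?mark (\<lambda>s4 t4. (good_marks s4 \<and> (\<forall>u'<Suc u. arr s4 10 (?l j u') = Suc j)) \<and> t4 \<le> t3 + 11) s3 t3"
          by (rule wp_Store)
             (use h3 r3 b(2) u I3 lj j W jW in \<open>auto simp: good_marks_def less_Suc_eq\<close>)
      next
        fix s3 t3
        assume b: "agree (insert 24 (wregs ?mark)) (warrs ?mark) ?s2 s3"
          and I3: "good_marks s3 \<and> (\<forall>u'<card (\<sigma>s ! j). arr s3 10 (?l j u') = Suc j)"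
          and t3: "t3 \<le> t2 + (1 + cost (Cell 2 (Cell 8 (Reg 22)))) + card (\<sigma>s ! j) * (11 + 8) + 6"
        have a3: "agree {22, 23, 24, 27, 28, 29} {3, 10} s s3" using a2 b by (auto simp: agree_def)
        have marks: "arr s3 10 v = Suc j \<longleftrightarrow> v \<in> \<sigma>s ! j" for v
        proof
          assume "v \<in> \<sigma>s ! j"
          then obtain u where "u < card (\<sigma>s ! j)" "v = ?l j u"
            using finite_simplex[OF j] by (metis in_set_conv_nth length_sorted_list_of_set set_sorted_list_of_set)
          then show "arr s3 10 v = Suc j" using I3 by blast
        qed (use I3 in \<open>auto simp: good_marks_def\<close>)
        have m10: "arr s3 10 v \<le> n" for v
          using I3 unfolding good_marks_def by (cases "arr s3 10 v") (auto simp: Suc_le_eq)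
        have r3: "reg s3 22 = j" "reg s3 28 = card (\<sigma>s ! j)" "reg s3 20 = n" "arr s3 3 = arr s2 3"
          using a3 b a rN by (auto simp: agree_def)
        show "wp W (For 23 20 ?row) (\<lambda>s3 t3. (good_marks s3 \<and> D (\<lambda>i' j'. j' < Suc j) s3) \<and>
          t3 \<le> t2 + (19 * \<kappa> + 20 + n * (23 * \<kappa> + 48))) s3 t3"
        proof (rule wp_For[where n = n and B = "23 * \<kappa> + 40" and I = "\<lambda>i s4. D (\<lambda>i' j'. j' < j \<or> (j' = j \<and> i' < i)) s4"])
          show "D (\<lambda>i' j'. j' < j \<or> (j' = j \<and> i' < 0)) s3" using I r3 by (simp add: D_def)
          fix i s4 t4
          assume i: "i < n" and c: "agree (insert 23 (wregs ?row)) (warrs ?row) s3 s4" "reg s4 23 = i"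
            and I4: "D (\<lambda>i' j'. j' < j \<or> (j' = j \<and> i' < i)) s4"
          show "wp W ?row (\<lambda>s5 t5. D (\<lambda>i' j'. j' < j \<or> (j' = j \<and> i' < Suc i)) s5 \<and> t5 \<le> t4 + (23 * \<kappa> + 40)) s4 t4"
          proof (rule row[OF _ _ c(2) _ i j])
            show "agree {22, 23, 24, 27, 28, 29} {3, 10} s s4" using a3 c by (auto simp: agree_def)
            show "reg s4 22 = j" "reg s4 28 = card (\<sigma>s ! j)" using c r3 by (auto simp: agree_def)
            show "arr s4 10 v = Suc j \<longleftrightarrow> v \<in> \<sigma>s ! j" "arr s4 10 v \<le> n" for v
              using marks m10 c by (simp_all add: agree_def)
            fix s5 :: ram and t5 assume 5: "arr s5 3 = (arr s4 3)(i * N + j := ?f i j)" "t5 \<le> t4 + (23 * \<kappa> + 40)"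
            have "i' * N + j' = i * N + j \<longleftrightarrow> i' = i \<and> j' = j" if "j' < N" for i' j'
              using that j nN by (intro idx_eq) auto
            then show "D (\<lambda>i' j'. j' < j \<or> (j' = j \<and> i' < Suc i)) s5 \<and> t5 \<le> t4 + (23 * \<kappa> + 40)"
              using I4 5 unfolding D_def by (auto simp: less_Suc_eq)
          qed
        next
          fix s4 t4
          assume c: "agree (insert 23 (wregs ?row)) (warrs ?row) s3 s4"
            and I4: "D (\<lambda>i' j'. j' < j \<or> (j' = j \<and> i' < n)) s4"
            and t4: "t4 \<le> t3 + n * (23 * \<kappa> + 40 + 8) + 6"
          have "good_marks s4" using I3 c by (simp add: good_marks_def agree_def)
          moreover have "D (\<lambda>i' j'. j' < Suc j) s4"
            unfolding D_def
          proof (intro allI impI)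
            fix i' j' assume ij: "i' < N" "j' < N"
            \<comment> \<open>The loops visit only the \<open>n\<close> simplices. The remaining
              entries keep the zero of the initial filling, as the padding in \<open>face\<close>
              requires.\<close>
            have "?f i' j' = 0" if "\<not> i' < n" using that by (simp add: face_def bit_code_def)
            then show "arr s4 3 (i' * N + j') = (if j' < Suc j then ?f i' j' else 0)"
              using I4 ij unfolding D_def by (auto simp: less_Suc_eq)
          qed
          ultimately have gmD: "good_marks s4 \<and> D (\<lambda>i' j'. j' < Suc j) s4" by blast
          have "card (\<sigma>s ! j) * 19 \<le> 19 * \<kappa>" using kap[OF j] by simp
          moreover have "23 * \<kappa> + 40 + 8 = 23 * \<kappa> + 48" by simp
          then have "t4 \<le> t3 + n * (23 * \<kappa> + 48) + 6" using t4 by (simp only:)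
          moreover have "t3 \<le> t2 + card (\<sigma>s ! j) * 19 + 10" using t3 by simp
          ultimately have "t4 \<le> t2 + (19 * \<kappa> + 20 + n * (23 * \<kappa> + 48))" by linarith
          with gmD show "(good_marks s4 \<and> D (\<lambda>i' j'. j' < Suc j) s4) \<and> t4 \<le> t2 + (19 * \<kappa> + 20 + n * (23 * \<kappa> + 48))"
            by blast
        qed (use r3 smallN[of n] nN W in \<open>auto simp: D_reg\<close>)
      qed (use cj W I in \<open>auto simp: gm_reg\<close>)
      moreover have "val s2 (Cell 2 (Cell 8 (Reg 22))) = card (\<sigma>s ! j)" "fits W s2 (Cell 2 (Cell 8 (Reg 22)))"
        using h2 a j W cj smallN[of j] nN by (auto simp: holds_complex_def)
      ultimately show "wp W ?col (\<lambda>s3 t3. (good_marks s3 \<and> D (\<lambda>i' j'. j' < Suc j) s3) \<and>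
          t3 \<le> t2 + (19 * \<kappa> + 20 + n * (23 * \<kappa> + 48))) s2 t2"
        by - (rule wp_Seq, rule wp_Assign, assumption, simp)
    next
      fix s' t'
      assume a: "agree (insert 22 (wregs ?col)) (warrs ?col) s1 s'"
        and I: "good_marks s' \<and> D (\<lambda>i' j'. j' < n) s'"
        and t': "t' \<le> t1 + n * (19 * \<kappa> + 20 + n * (23 * \<kappa> + 48) + 8) + 6"
      show "Q s' t'"
      proof (rule Q)
        show "agree {22, 23, 24, 27, 28, 29} {3, 10} s s'" using a 1(1) by (auto simp: agree_def)
        show "good_marks s'" using I by blast
        show "arr s' 3 (i * N + j) = ?f i j" if "i < N" "j < N" for i j
        proof -
          have "?f i j = 0" if "\<not> j < n" using that by (simp add: face_def bit_code_def)
          then show ?thesis using I that unfolding D_def by auto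
        qed
        have "t1 \<le> t + N * (N * 15 + 14) + 6" using t1 by simp
        then have "t1 \<le> t + (29 * (N * N) + 6)" by (rule fill_time) (use nN in simp_all)
        moreover have "n * (19 * \<kappa> + 28) \<le> N * N * (19 * \<kappa> + 28)"
          using nN le_trans[OF nN(1) NN] by (intro mult_le_mono1)
        moreover have "(n * n) * (23 * \<kappa> + 48) \<le> (N * N) * (23 * \<kappa> + 48)"
          using nN by (intro mult_le_mono) auto
        moreover have "n * (19 * \<kappa> + 20 + n * (23 * \<kappa> + 48) + 8) = n * (19 * \<kappa> + 28) + (n * n) * (23 * \<kappa> + 48)"
          by (simp add: algebra_simps)
        moreover have "150 * (\<kappa> + 1) * (N * N) = N * N * (19 * \<kappa> + 28) + (N * N) * (23 * \<kappa> + 48) + 108 * (\<kappa> * (N * N)) + 74 * (N * N)"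
          by (simp add: algebra_simps)
        moreover have "1 \<le> N * N" using nN by simp
        ultimately show "t' \<le> t + 150 * (\<kappa> + 1) * (N * N)" using t' by linarith
      qed
    qed (use 1(1) rN smallN[of n] nN W in \<open>auto simp: D_reg gm_reg agree_def\<close>)
  qed (use smallN[of N] W in auto)
qed

end

text \<open>Array 12 inverts the pivot function: its entry at a row is one more than the column with
  this pivot row, or 0. Array 13 collects the rows \<open>G\<close>. An entry of the annotation is
  then either a cell of the stored transformation or an entry of a unit vector, and products with
  comparisons select the case.\<close>

definition emit :: com where
  "emit =
     For 22 1 (If (Cell 4 (Reg 22)) (Store 12 (Cell 4 (Reg 22) [-] Const 1) (Reg 22 [+] Const 1)) Skip) ;;
     Assign 30 (Const 0) ;;
     For 22 20 (If (Bin Eq (Cell 2 (Cell 8 (Reg 22))) (Reg 21 [+] Const 1) [*] Bin Eq (Cell 11 (Reg 22)) (Const 0)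
          [*] Bin Eq (Cell 5 (Reg 22)) (Const 0))
       (Store 13 (Reg 30) (Reg 22) ;; Assign 30 (Reg 30 [+] Const 1)) Skip) ;;
     Store 0 (Const 0) (Reg 30) ;;
     For 22 20 (For 23 30 (Store 0 (Reg 22 [*] Reg 30 [+] Reg 23 [+] Const 1)
       (Bin Eq (Cell 2 (Cell 8 (Reg 22))) (Reg 21 [+] Const 1) [*] Bin Eq (Cell 11 (Reg 22)) (Const 0) [*]
         ((Const 0 [<] Cell 12 (Reg 22)) [*] Cell 3 (Cell 13 (Reg 23) [*] Reg 1 [+] (Cell 12 (Reg 22) [-] Const 1))
           [+] Bin Eq (Cell 12 (Reg 22)) (Const 0) [*] Bin Eq (Cell 13 (Reg 23)) (Reg 22)))))"

locale emit_program = mult_program + annotated_complex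
begin

lemma F_iff: "j < n \<Longrightarrow> j \<in> F \<longleftrightarrow> card (\<sigma>s ! j) = Suc p \<and> piv1 j = 0"
  by (simp add: F_def)

text \<open>The program finds the members of \<open>G\<close> while scanning upwards, so its list
  agrees with \<open>gl\<close> because both are increasing.\<close>

lemma gl_filter: "gl = filter (\<lambda>i. i \<in> G) [0..<n]"
proof -
  have "set (filter (\<lambda>i. i \<in> G) [0..<n]) = G" by (auto simp: G_def F_def)
  then show ?thesis
    unfolding gl_def using finite_G by (intro sorted_distinct_set_unique) (simp_all add: sorted_wrt_filter)
qed

lemma nth_annotation_code:
  "annotation_code g p \<sigma>s ann ! 0 = g"
  "\<lbrakk>j < n; e < g\<rbrakk> \<Longrightarrow> annotation_code g p \<sigma>s ann ! (j * g + e + 1) =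
     (if j \<in> F then bit_code (E2.U (unitv j) (gl ! e)) else 0)"
  "length (annotation_code g p \<sigma>s ann) = n * g + 1"
proof -
  let ?r = "\<lambda>\<sigma>. if card \<sigma> = Suc p then vec_code (ann \<sigma>) else replicate g 0"
  have l: "length x = g" if "x \<in> set (map ?r \<sigma>s)" for x
    using that by (auto simp: length_vec_code ann_def)
  show "annotation_code g p \<sigma>s ann ! 0 = g" by (simp add: annotation_code_def)
  show "length (annotation_code g p \<sigma>s ann) = n * g + 1"
  proof -
    have "length (concat (map ?r \<sigma>s)) = length (map ?r \<sigma>s) * g" by (rule length_concat_rows[OF l])
    then show ?thesis by (simp add: annotation_code_def)
  qed
  assume je: "j < n" "e < g"
  have "annotation_code g p \<sigma>s ann ! (j * g + e + 1) = ?r (\<sigma>s ! j) ! e"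
  proof -
    have "concat (map ?r \<sigma>s) ! (j * g + e) = map ?r \<sigma>s ! j ! e"
      by (rule nth_concat_rows[OF l]) (use je in simp_all)
    then show ?thesis using je by (simp add: annotation_code_def)
  qed
  also have "\<dots> = (if j \<in> F then bit_code (E2.U (unitv j) (gl ! e)) else 0)"
    using je ann_entry[OF je] by (auto simp: nth_vec_code ann_def F_iff bit_code_def)
  finally show "annotation_code g p \<sigma>s ann ! (j * g + e + 1) = (if j \<in> F then bit_code (E2.U (unitv j) (gl ! e)) else 0)" .
qed

lemma wp_emit:
  assumes h: "holds_complex X N s" and gj: "gj_ok N s" and st: "arr s 4 = piv2" "used_rows N s = u2" "mat_of N s = V2"
    and s11: "\<And>i. i < N \<Longrightarrow> arr s 11 i = piv1 i" "\<And>i. i < N \<Longrightarrow> piv1 i \<le> N" and s12: "\<And>i. arr s 12 i = 0" and n1: "1 \<le> n"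
    and W: "2 * N * N + 4 \<le> W" "2 * X + 4 \<le> W"  "p + 4 \<le> W"
    and Q: "\<And>s' t'. \<lbrakk>\<And>i. i < length (annotation_code g p \<sigma>s ann) \<Longrightarrow> arr s' 0 i = annotation_code g p \<sigma>s ann ! i;
      t' \<le> t + 300 * (N * N) + 100\<rbrakk> \<Longrightarrow> Q s' t'"
  shows "wp W emit Q s t"
proof -
  have N1: "1 \<le> N" using n1 nN by simp
  have small: "x \<le> N * N \<Longrightarrow> x \<le> W" for x using W by simp
  have NN: "N \<le> N * N" by simp
  have smallN: "x \<le> N \<Longrightarrow> x \<le> W" for x using NN small by (meson le_trans)
  have rN: "reg s 1 = N" "reg s 20 = n" "reg s 21 = p" using h by (simp_all add: holds_complex_def)
  have pivN: "k < N \<Longrightarrow> piv2 k \<le> N" for k using gj st by (auto simp: gj_ok_def)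
  have bits: "x < N * N \<Longrightarrow> arr s 3 x \<le> 1" for x using gj by (auto simp: gj_ok_def)
  have u5: "i < N \<Longrightarrow> arr s 5 i = 0 \<longleftrightarrow> i \<notin> u2" for i
    using gj st(2) by (force simp: gj_ok_def used_rows_def le_Suc_eq)
  let ?inv = "If (Cell 4 (Reg 22)) (Store 12 (Cell 4 (Reg 22) [-] Const 1) (Reg 22 [+] Const 1)) Skip"
  let ?t = "Bin Eq (Cell 2 (Cell 8 (Reg 22))) (Reg 21 [+] Const 1) [*] Bin Eq (Cell 11 (Reg 22)) (Const 0)
          [*] Bin Eq (Cell 5 (Reg 22)) (Const 0)"
  let ?list = "If ?t (Store 13 (Reg 30) (Reg 22) ;; Assign 30 (Reg 30 [+] Const 1)) Skip"
  let ?i = "Reg 22 [*] Reg 30 [+] Reg 23 [+] Const 1"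
  let ?e = "Bin Eq (Cell 2 (Cell 8 (Reg 22))) (Reg 21 [+] Const 1) [*] Bin Eq (Cell 11 (Reg 22)) (Const 0) [*]
         ((Const 0 [<] Cell 12 (Reg 22)) [*] Cell 3 (Cell 13 (Reg 23) [*] Reg 1 [+] (Cell 12 (Reg 22) [-] Const 1))
           [+] Bin Eq (Cell 12 (Reg 22)) (Const 0) [*] Bin Eq (Cell 13 (Reg 23)) (Reg 22))"
  let ?fl = "\<lambda>I. filter (\<lambda>i. i \<in> G) [0..<I]"
  have "gl = ?fl n" by (rule gl_filter)
  have lenfl: "length (?fl I) \<le> I" for I using length_filter_le[of "\<lambda>i. i \<in> G" "[0..<I]"] by simp
  show ?thesis unfolding emit_def
  proof (rule wp_Seq, rule wp_For[where n = N and B = 20 and I = "\<lambda>m s1. \<forall>i k. arr s1 12 i = Suc k \<longleftrightarrow> k < m \<and> piv2 k = Suc i"])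
    fix m s1 t1
    assume m: "m < N" and a: "agree (insert 22 (wregs ?inv)) (warrs ?inv) s s1" "reg s1 22 = m"
      and I: "\<forall>i k. arr s1 12 i = Suc k \<longleftrightarrow> k < m \<and> piv2 k = Suc i"
    have 4: "arr s1 4 = piv2" using a st by (simp add: agree_def)
    have mW: "Suc m \<le> W" "m \<le> W" "piv2 m \<le> W" using m smallN[of "Suc m"] smallN[OF pivN[OF m]] by simp_all
    show "wp W ?inv (\<lambda>s2 t2. (\<forall>i k. arr s2 12 i = Suc k \<longleftrightarrow> k < Suc m \<and> piv2 k = Suc i) \<and> t2 \<le> t1 + 20) s1 t1"
    proof (rule wp_If)
      show "fits W s1 (Cell 4 (Reg 22))" using 4 a mW by simp
      assume "val s1 (Cell 4 (Reg 22)) \<noteq> 0"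
      then have nz: "piv2 m \<noteq> 0" using 4 a by simp
      then have mP: "m \<in> E2.P" using m by (simp add: piv_cols_def)
      \<comment> \<open>Injectivity on the pivot columns extends to all indices, because the pivot
        function vanishes beyond \<open>N\<close>.\<close>
      have uniq: "k = m" if "piv2 k = piv2 m" for k
      proof -
        have "k < N" using that nz eliminated_matrix_piv_outside[OF e2, of k] by force
        then have "k \<in> E2.P" using that nz by (simp add: piv_cols_def)
        then show ?thesis using E2.inj_piv mP that by (simp add: inj_on_def)
      qed
      show "wp W (Store 12 (Cell 4 (Reg 22) [-] Const 1) (Reg 22 [+] Const 1))
        (\<lambda>s2 t2. (\<forall>i k. arr s2 12 i = Suc k \<longleftrightarrow> k < Suc m \<and> piv2 k = Suc i) \<and> t2 \<le> t1 + 20) s1 (t1 + (1 + cost (Cell 4 (Reg 22))))"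
      proof (rule wp_Store)
        show "fits W s1 (Cell 4 (Reg 22) [-] Const 1)" "fits W s1 (Reg 22 [+] Const 1)" using 4 a mW by simp_all
        have "arr (s1\<lparr>arr := (arr s1)(12 := (arr s1 12)(piv2 m - 1 := Suc m))\<rparr>) 12 i = Suc k \<longleftrightarrow> k < Suc m \<and> piv2 k = Suc i" for i k
        proof (cases "i = piv2 m - 1")
          case True
          then have "Suc i = piv2 m" using nz by simp
          then show ?thesis using True uniq[of k] by auto
        next
          case False
          then have "piv2 m \<noteq> Suc i" by auto
          then show ?thesis using False I by (auto simp: less_Suc_eq)
        qed
        then show "(\<forall>i k. arr (s1\<lparr>arr := (arr s1)(12 := (arr s1 12)(val s1 (Cell 4 (Reg 22) [-] Const 1) := val s1 (Reg 22 [+] Const 1)))\<rparr>) 12 i = Suc k \<longleftrightarrow>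
            k < Suc m \<and> piv2 k = Suc i) \<and>
          t1 + (1 + cost (Cell 4 (Reg 22))) + (1 + cost (Cell 4 (Reg 22) [-] Const 1) + cost (Reg 22 [+] Const 1)) \<le> t1 + 20"
          using 4 a by simp
      qed
    next
      assume "val s1 (Cell 4 (Reg 22)) = 0"
      then have "piv2 m = 0" using 4 a by simp
      then have "k < Suc m \<and> piv2 k = Suc i \<longleftrightarrow> k < m \<and> piv2 k = Suc i" for i k by (cases "k = m") auto
      then show "wp W Skip (\<lambda>s2 t2. (\<forall>i k. arr s2 12 i = Suc k \<longleftrightarrow> k < Suc m \<and> piv2 k = Suc i) \<and> t2 \<le> t1 + 20) s1
          (t1 + (1 + cost (Cell 4 (Reg 22))))"
        using I by (intro wp_Skip) simp
    qed
  next
    fix s1 t1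
    assume a1: "agree (insert 22 (wregs ?inv)) (warrs ?inv) s s1"
      and I1: "\<forall>i k. arr s1 12 i = Suc k \<longleftrightarrow> k < N \<and> piv2 k = Suc i"
      and t1: "t1 \<le> t + N * (20 + 8) + 6"
    let ?s1 = "s1\<lparr>reg := (reg s1)(30 := 0)\<rparr>"
    have "wp W (For 22 20 ?list ;; Store 0 (Const 0) (Reg 30) ;; For 22 20 (For 23 30 (Store 0 ?i ?e))) Q ?s1 (t1 + (1 + cost (Const 0)))"
    proof (rule wp_Seq, rule wp_For[where n = n and B = 40 and I = "\<lambda>I s2. reg s2 30 = length (?fl I) \<and>
        (\<forall>e<length (?fl I). arr s2 13 e = ?fl I ! e)"])
      fix j s2 t2
      assume j: "j < n" and a: "agree (insert 22 (wregs ?list)) (warrs ?list) ?s1 s2" "reg s2 22 = j"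
        and I: "reg s2 30 = length (?fl j) \<and> (\<forall>e<length (?fl j). arr s2 13 e = ?fl j ! e)"
      have st2: "arr s2 2 (arr s2 8 j) = card (\<sigma>s ! j)" "arr s2 8 j \<le> X" "card (\<sigma>s ! j) \<le> X" "reg s2 21 = p"
        "arr s2 11 j = piv1 j" "arr s2 5 = arr s 5"
        using h j a a1 rN s11[of j] nN by (auto simp: holds_complex_def agree_def)
      have v: "val s2 ?t \<noteq> 0 \<longleftrightarrow> j \<in> G"
        using st2 a(2) F_iff[OF j] u5[of j] j nN by (auto simp: G_def)
      have f: "fits W s2 ?t"
      proof -
        have "arr s 5 j \<le> 1" using gj j nN by (auto simp: gj_ok_def)
        then show ?thesis using st2 a(2) W s11(2)[of j] j nN smallN[of j] smallN[of "piv1 j"] by auto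
      qed
      have flS: "?fl (Suc j) = ?fl j @ (if j \<in> G then [j] else [])" by simp
      have jW: "Suc j \<le> W" using j nN by (intro smallN) simp
      show "wp W ?list (\<lambda>s3 t3. (reg s3 30 = length (?fl (Suc j)) \<and>
          (\<forall>e<length (?fl (Suc j)). arr s3 13 e = ?fl (Suc j) ! e)) \<and> t3 \<le> t2 + 40) s2 t2"
      proof (rule wp_If[OF f])
        assume "val s2 ?t \<noteq> 0"
        then have G: "j \<in> G" using v by blast
        show "wp W (Store 13 (Reg 30) (Reg 22) ;; Assign 30 (Reg 30 [+] Const 1))
           (\<lambda>s3 t3. (reg s3 30 = length (?fl (Suc j)) \<and>
          (\<forall>e<length (?fl (Suc j)). arr s3 13 e = ?fl (Suc j) ! e)) \<and> t3 \<le> t2 + 40) s2 (t2 + (1 + cost ?t))"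
          using I G a(2) jW lenfl[of j] by (intro wp_Seq wp_Store wp_Assign) (auto simp: nth_append less_Suc_eq)
      next
        assume "val s2 ?t = 0"
        then have "j \<notin> G" using v by blast
        then show "wp W Skip (\<lambda>s3 t3. (reg s3 30 = length (?fl (Suc j)) \<and>
          (\<forall>e<length (?fl (Suc j)). arr s3 13 e = ?fl (Suc j) ! e)) \<and> t3 \<le> t2 + 40) s2 (t2 + (1 + cost ?t))"
          using I by (intro wp_Skip) auto
      qed
    next
      fix s2 t2
      assume a2: "agree (insert 22 (wregs ?list)) (warrs ?list) ?s1 s2"
        and I2: "reg s2 30 = length (?fl n) \<and> (\<forall>e<length (?fl n). arr s2 13 e = ?fl n ! e)"
        and t2: "t2 \<le> t1 + (1 + cost (Const 0)) + n * (40 + 8) + 6"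
      have g30: "reg s2 30 = g" "\<And>e. e < g \<Longrightarrow> arr s2 13 e = gl ! e"
        using I2 length_gl by (simp_all flip: gl_filter)
      have gn: "g \<le> n" using lenfl[of n] length_gl by (simp flip: gl_filter)
      let ?s2 = "s2\<lparr>arr := (arr s2)(0 := (arr s2 0)(0 := g))\<rparr>"
      have r2: "reg s2 20 = n" "reg s2 1 = N" "reg s2 21 = p" using a2 a1 rN by (auto simp: agree_def)
      have "wp W (For 22 20 (For 23 30 (Store 0 ?i ?e))) Q ?s2 (t2 + (1 + cost (Const 0) + cost (Reg 30)))"
      proof (rule wp_For_fill[where R = n and S = g and idx = "\<lambda>j e. j * g + e + 1" and
            v = "\<lambda>j e. if j \<in> F then bit_code (E2.U (unitv j) (gl ! e)) else 0"])
        show "inj_on (\<lambda>(j, e). j * g + e + 1) ({..<n} \<times> {..<g})" using inj_idx[of g n] by (auto simp: inj_on_def)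
      next
        fix s3 j e assume a: "agree {22, 23} {0} ?s2 s3" "reg s3 22 = j" "reg s3 23 = e" "j < n" "e < g"
        have jN: "j < N" using a nN by simp
        have G: "gl ! e \<in> G" "gl ! e < N" using gl_in[OF a(5)] nN by (auto simp: G_def F_def)
        have st3: "arr s3 2 (arr s3 8 j) = card (\<sigma>s ! j)" "arr s3 8 j \<le> X" "card (\<sigma>s ! j) \<le> X" "reg s3 21 = p"
          "arr s3 11 j = piv1 j" "arr s3 3 = arr s 3" "arr s3 12 = arr s1 12" "arr s3 13 e = gl ! e" "reg s3 1 = N" "reg s3 30 = g"
          using h a a1 a2 rN s11[OF jN] g30 by (auto simp: holds_complex_def agree_def)
        have inv: "arr s1 12 j \<le> N" 
        proof (cases "arr s1 12 j")
          case (Suc k)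
          then have "k < N" using I1 by blast
          then show ?thesis using Suc by simp
        qed simp
        have idx: "(gl ! e) * N + (arr s1 12 j - 1) < N * N" using G inv N1 by (intro idx_less) auto
        \<comment> \<open>If \<open>j\<close> is a pivot row, column \<open>j\<close> of
          \<open>U\<close> is the stored column plus a unit vector, which does not show in the
          non-pivot row \<open>gl ! e\<close>. Otherwise it is the unit vector itself.\<close>
        have U: "bit_code (E2.U (unitv j) (gl ! e)) = (if 0 < arr s1 12 j then arr s 3 ((gl ! e) * N + (arr s1 12 j - 1)) else of_bool (gl ! e = j))"
        proof (cases "arr s1 12 j")
          case 0
          have "j \<notin> u2"
          proof
            assume "j \<in> u2"
            then obtain k where "k \<in> E2.P" "j = piv2 k - 1" using E2.used by blast
            then have "k < N" "piv2 k = Suc j" by (auto simp: piv_cols_def)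
            then show False using I1 0 by (metis nat.distinct(1))
          qed
          then show ?thesis using 0 by (simp add: E2.U_unit_nonpivot unitv_def bit_code_def)
        next
          case (Suc k)
          then have k: "k < N" "piv2 k = Suc j" using I1 by blast+
          then have kP: "k \<in> E2.P" and j: "j = piv2 k - 1" by (auto simp: piv_cols_def)
          have "j \<in> u2" unfolding E2.used using kP j by blast
          then have "gl ! e \<noteq> j" using G by (auto simp: G_def)
          then have "E2.U (unitv j) (gl ! e) = V2 (gl ! e) k"
            using E2.U_unit[OF kP, of "gl ! e"] G j by (simp add: unitv_def)
          also have "\<dots> = of_nat (arr s 3 ((gl ! e) * N + k))" by (simp add: mat_of_def flip: st(3))
          finally show ?thesis using Suc bits[OF idx] by (simp add: bit_code_of_nat)
        qed
        have "val s3 ?e = (if j \<in> F then bit_code (E2.U (unitv j) (gl ! e)) else 0)"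
          unfolding U using st3 a(2,3) F_iff[OF a(4)] by auto
        moreover have "val s3 ?i = j * g + e + 1" using st3 a by simp
        moreover have "j * g + e < n * g" using a by (intro idx_less) auto
        then have "j * g + e < N * N" using mult_le_mono[OF nN le_trans[OF gn nN]] by linarith
        then have iW: "j * g + e + 1 \<le> W" "j * g + e \<le> W" "j * g \<le> W" using W by simp_all
        then have "fits W s3 ?i" using st3 a smallN[of j] smallN[of g] smallN[of e] nN gn by simp
        moreover have "fits W s3 ?e"
        proof -
          have "(gl ! e) * N \<le> W" "(gl ! e) * N + (arr s1 12 j - 1) \<le> W"
            using idx G by (intro small; simp)+
          moreover have "gl ! e \<le> W" "arr s1 12 j \<le> W" "N \<le> W" "j \<le> W" "piv1 j \<le> W" "e \<le> W"
            using G inv jN s11(2)[OF jN] a gn nN by (intro smallN; simp)+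
          moreover have "arr s 3 ((gl ! e) * N + (arr s1 12 j - 1)) \<le> 1" using bits[OF idx] .
          ultimately show ?thesis using st3 a(2,3) W by auto
        qed
        ultimately show "val s3 ?i = j * g + e + 1 \<and> val s3 ?e = (if j \<in> F then bit_code (E2.U (unitv j) (gl ! e)) else 0) \<and>
            fits W s3 ?i \<and> fits W s3 ?e" by blast
      next
        fix s' :: ram and t'
        assume a3: "\<And>j e. \<lbrakk>j < n; e < g\<rbrakk> \<Longrightarrow> arr s' 0 (j * g + e + 1) = (if j \<in> F then bit_code (E2.U (unitv j) (gl ! e)) else 0)"
          "\<And>x. (\<And>j e. \<lbrakk>j < n; e < g\<rbrakk> \<Longrightarrow> x \<noteq> j * g + e + 1) \<Longrightarrow> arr s' 0 x = arr ?s2 0 x"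
          and t': "t' \<le> t2 + (1 + cost (Const 0) + cost (Reg 30)) + n * (g * (cost ?i + cost ?e + 9) + 14) + 6"
        show "Q s' t'"
        proof (rule Q)
          fix i assume i: "i < length (annotation_code g p \<sigma>s ann)"
          show "arr s' 0 i = annotation_code g p \<sigma>s ann ! i"
          proof (cases i)
            case 0
            then show ?thesis using a3(2)[of 0] by (simp add: nth_annotation_code(1))
          next
            case (Suc x)
            then have "x < n * g" using i by (simp add: nth_annotation_code(3))
            then obtain j e where "j < n" "e < g" "x = j * g + e" by (rule idx_cases)
            then show ?thesis using a3(1)[of j e] nth_annotation_code(2)[of j e] Suc by simp
          qed
        next
          have c: "cost ?i + cost ?e + 9 \<le> 60" by simp
          have "n * (g * (cost ?i + cost ?e + 9) + 14) \<le> N * (N * 60 + 14)"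
            by (rule mult_le_mono[OF nN], rule add_le_mono1, rule mult_le_mono[OF _ c]) (use gn nN in simp)
          also have "N * (N * 60 + 14) \<le> 74 * (N * N)" using N1 by (simp add: algebra_simps)
          finally have Z: "n * (g * (cost ?i + cost ?e + 9) + 14) \<le> 74 * (N * N)" .
          define Z where "Z = n * (g * (cost ?i + cost ?e + 9) + 14)"
          have "t' \<le> t2 + 3 + Z + 6" using t'[folded Z_def] by simp
          moreover have "t2 \<le> t1 + 2 + 48 * n + 6" using t2 by simp
          moreover have "t1 \<le> t + 28 * N + 6" using t1 by simp
          ultimately show "t' \<le> t + 300 * (N * N) + 100" using Z[folded Z_def] le_trans[OF nN NN] NN by linarith
        qed
      qed (use r2 g30 smallN[of n] smallN[of g] nN gn W in auto)
      then show "wp W (Store 0 (Const 0) (Reg 30) ;; For 22 20 (For 23 30 (Store 0 ?i ?e))) Q s2 t2"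
        using g30 gn nN smallN[of g] by - (rule wp_Seq, rule wp_Store, simp_all)
    qed (use smallN[of n] nN W a1 rN in \<open>auto simp: agree_def\<close>)
    then show "wp W (Assign 30 (Const 0) ;; For 22 20 ?list ;; Store 0 (Const 0) (Reg 30) ;;
        For 22 20 (For 23 30 (Store 0 ?i ?e))) Q s1 t1"
      by - (rule wp_Seq, rule wp_Assign, simp_all)
  qed (use rN smallN[of N] W s12 in auto)
qed

end

context mult_program
begin

text \<open>Array 11 is zero during the first construction, so no row is skipped; then it saves the
  first pivots, which become the rows to skip. Register 25 is the number of vertices of the faces, p
  and then p + 1.\<close>

definition pre :: com where
  "pre = prepare ;; Assign 25 (Reg 21) ;; build ;; gauss_jordan ;;
     For 22 1 (Store 11 (Reg 22) (Cell 4 (Reg 22))) ;;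
     Assign 25 (Reg 21 [+] Const 1) ;; build ;; gauss_jordan ;; emit"

definition pre_time :: "nat \<Rightarrow> nat \<Rightarrow> nat \<Rightarrow> nat" where
  "pre_time N L \<kappa> = 2 * gj_time N L + 1000 * (\<kappa> + 1) * (N * N) + 1000"

end

locale complex_program = mult_program + enumerated_complex
begin

lemma wp_pre:
  assumes s: "s = init (complex_input p \<sigma>s)" and n: "1 \<le> n" and X: "X = input_size (complex_input p \<sigma>s)"
    and kap: "\<And>j. j < n \<Longrightarrow> card (\<sigma>s ! j) \<le> \<kappa>"
    and W: "2 * X + 8 \<le> W" "\<And>N. N < 2 * n \<Longrightarrow> word_ok N W"
    and Q: "\<And>s' t' a N L. \<lbrakk>annotation K p a; N = 2 ^ L; N < 2 * n; t' \<le> t + pre_time N L \<kappa>;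
      \<And>i. i < length (annotation_code (betti K p) p \<sigma>s a) \<Longrightarrow> arr s' 0 i = annotation_code (betti K p) p \<sigma>s a ! i\<rbrakk> \<Longrightarrow> Q s' t'"
  shows "wp W pre Q s t"
proof -
  have "p \<in> set (concat (complex_input p \<sigma>s))" by (simp add: complex_input_def)
  then have pX: "Suc p \<le> X" unfolding X by (rule input_size_ge)
  show ?thesis unfolding pre_def
  proof (rule wp_Seq, rule wp_prepare[OF s n X])
    show "2 * X + 4 \<le> W" using W by simp
    fix s1 t1 N L
    assume h1: "holds_complex X N s1" and a1: "agree {1, 20, 21, 22, 26} {8} s s1" and N: "N = 2 ^ L" "n \<le> N" "N < 2 * n"
      and t1: "t1 \<le> t + 60 * n + 60"
    have N1: "1 \<le> N" using N n by simp
    have wok: "word_ok N W" using W N by blast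
    then have W': "2 * N * N + 4 \<le> W" by (simp add: word_ok_def)
    have NN: "N \<le> N * N" by simp
    have NW: "N \<le> W" using W' NN by linarith
    let ?s1 = "s1\<lparr>reg := (reg s1)(25 := p)\<rparr>"
    have r1: "reg s1 21 = p" "reg s1 1 = N" using h1 by (simp_all add: holds_complex_def)
    have z1: "arr s1 a = (\<lambda>_. 0)" if "a \<noteq> 8" "a > 2" for a
      using a1 that s by (auto simp: agree_def init_def complex_input_def)
    have zr: "reg s1 r = 0" if "r \<ge> 100" for r using a1 that s by (auto simp: agree_def init_def)
    have "wp W (build ;; gauss_jordan ;; For 22 1 (Store 11 (Reg 22) (Cell 4 (Reg 22))) ;;
      Assign 25 (Reg 21 [+] Const 1) ;; build ;; gauss_jordan ;; emit) Q ?s1 (t1 + (1 + cost (Reg 21)))"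
    proof (rule wp_Seq, rule wp_build[where N = N and q = p and X = X and \<kappa> = \<kappa>])
      show "holds_complex X N ?s1" using h1 by (simp add: holds_complex_def)
      show "good_marks ?s1" using z1 by (simp add: good_marks_def)
      show "arr ?s1 11 i \<le> N" for i using z1 by simp
      fix s2 t2
      assume a2: "agree {22, 23, 24, 27, 28, 29} {3, 10} ?s1 s2" and gm2: "good_marks s2"
        and M2: "\<And>i j. \<lbrakk>i < N; j < N\<rbrakk> \<Longrightarrow> arr s2 3 (i * N + j) = bit_code (face \<sigma>s p {i. arr ?s1 11 i \<noteq> 0} i j)"
        and t2: "t2 \<le> t1 + (1 + cost (Reg 21)) + 150 * (\<kappa> + 1) * (N * N)"
      have e11: "{i. arr ?s1 11 i \<noteq> 0} = {}" using z1 by simp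
      have M2': "mat_of N s2 i k = face \<sigma>s p {} i k" if "i < N" "k < N" for i k
        unfolding mat_of_def M2[OF that] e11 by (rule of_nat_bit_code)
      have b2: "arr s2 3 x \<le> 1" if "x < N * N" for x using M2 bit_code_le that by (metis idx_cases)
      have c2: "clean s2" using a2 z1 zr by (simp add: clean_def agree_def)
      show "wp W (gauss_jordan ;; For 22 1 (Store 11 (Reg 22) (Cell 4 (Reg 22))) ;;
        Assign 25 (Reg 21 [+] Const 1) ;; build ;; gauss_jordan ;; emit) Q s2 t2"
      proof (rule wp_Seq, rule wp_gauss_jordan[OF _ N(1) c2 b2 _ wok])
        show "reg s2 1 = N" using a2 r1 by (simp add: agree_def)
        show "arr s2 4 k = 0" for k using a2 z1 by (simp add: agree_def)
        fix s3 t3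
        assume a3: "agree ({2..14} \<union> {100..}) ({3..7} \<union> {100..}) s2 s3" and gj3: "gj_ok N s3"
          and em3: "eliminated_matrix N (mat_of N s2) (mat_of N s3) (arr s3 4) (used_rows N s3)"
          and t3: "t3 \<le> t2 + gj_time N L + 30 * N + 40"
        define piv1 where "piv1 = arr s3 4"
        have em1: "eliminated_matrix N (face \<sigma>s p {}) (mat_of N s3) piv1 (used_rows N s3)"
          using eliminated_matrix_cong[OF em3 M2'] unfolding piv1_def .
        have pivN: "i < N \<Longrightarrow> piv1 i \<le> N" and piv0: "i \<ge> N \<Longrightarrow> piv1 i = 0" for i
          using gj3 eliminated_matrix_piv_outside[OF em1] by (auto simp: gj_ok_def piv1_def)
        have r3: "reg s3 1 = N" "reg s3 21 = p" "arr s3 11 = (\<lambda>_. 0)" "arr s3 12 = (\<lambda>_. 0)"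
          using a3 a2 r1 z1 by (simp_all add: agree_def)
        show "wp W (For 22 1 (Store 11 (Reg 22) (Cell 4 (Reg 22))) ;;
          Assign 25 (Reg 21 [+] Const 1) ;; build ;; gauss_jordan ;; emit) Q s3 t3"
        proof (rule wp_Seq, rule wp_For_fill1[where S = N and idx = "\<lambda>i. i" and v = piv1])
          fix s4 j assume "agree {22} {11} s3 s4" "reg s4 22 = j" "j < N"
          then show "val s4 (Reg 22) = j \<and> val s4 (Cell 4 (Reg 22)) = piv1 j \<and> fits W s4 (Reg 22) \<and> fits W s4 (Cell 4 (Reg 22))"
            using pivN[of j] NW by (auto simp: agree_def piv1_def)
        next
          fix s4 t4
          assume a4: "agree {22} {11} s3 s4" "\<And>j. j < N \<Longrightarrow> arr s4 11 j = piv1 j"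
            "\<And>x. (\<And>j. j < N \<Longrightarrow> x \<noteq> j) \<Longrightarrow> arr s4 11 x = arr s3 11 x"
            and t4: "t4 \<le> t3 + N * (cost (Reg 22) + cost (Cell 4 (Reg 22)) + 9) + 6"
          have s11: "arr s4 11 = piv1"
          proof
            fix i show "arr s4 11 i = piv1 i"
              using a4(2)[of i] a4(3)[of i] piv0[of i] r3 by (cases "i < N") auto
          qed
          let ?s4 = "s4\<lparr>reg := (reg s4)(25 := Suc p)\<rparr>"
          have ag4: "agree ({2..30} \<union> {100..}) ({3..7} \<union> {10, 11} \<union> {100..}) s1 ?s4"
            using a2 a3 a4(1) by (auto simp: agree_def)
          have "wp W (build ;; gauss_jordan ;; emit) Q ?s4 (t4 + (1 + cost (Reg 21 [+] Const 1)))"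
          proof (rule wp_Seq, rule wp_build[where N = N and q = "Suc p" and X = X and \<kappa> = \<kappa>])
            have hs4: "holds_complex X N s2" by (rule holds_complex_agree[OF _ a2]) (use h1 in \<open>auto simp: holds_complex_def\<close>)
            then have "holds_complex X N s3" by (rule holds_complex_agree[OF _ a3]) auto
            then have "holds_complex X N s4" by (rule holds_complex_agree[OF _ a4(1)]) auto
            then show h4: "holds_complex X N ?s4" by (simp add: holds_complex_def)
            show "good_marks ?s4" using gm2 a3 a4(1) by (simp add: good_marks_def agree_def)
            show "i < N \<Longrightarrow> arr ?s4 11 i \<le> N" for i using s11 pivN by simp
            fix s5 t5
            assume a5: "agree {22, 23, 24, 27, 28, 29} {3, 10} ?s4 s5"
              and M5: "\<And>i j. \<lbrakk>i < N; j < N\<rbrakk> \<Longrightarrow> arr s5 3 (i * N + j) = bit_code (face \<sigma>s (Suc p) {i. arr ?s4 11 i \<noteq> 0} i j)"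
              and t5: "t5 \<le> t4 + (1 + cost (Reg 21 [+] Const 1)) + 150 * (\<kappa> + 1) * (N * N)"
            have M5': "mat_of N s5 i k = face \<sigma>s (Suc p) {i. piv1 i \<noteq> 0} i k" if "i < N" "k < N" for i k
              unfolding mat_of_def M5[OF that] of_nat_bit_code by (simp add: s11)
            have b5: "arr s5 3 x \<le> 1" if "x < N * N" for x using M5 bit_code_le that by (metis idx_cases)
            have "clean s3" using gj3 by (simp add: gj_ok_def)
            then have c5: "clean s5" using a4(1) a5 by (simp add: clean_def agree_def)
            show "wp W (gauss_jordan ;; emit) Q s5 t5"
            proof (rule wp_Seq, rule wp_gauss_jordan[OF _ N(1) c5 b5 _ wok])
              show "reg s5 1 = N" using a5 a4(1) r3 by (simp add: agree_def)
              show "k \<ge> N \<Longrightarrow> arr s5 4 k = 0" for k using a5 a4(1) piv0 by (simp add: agree_def piv1_def)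
              fix s6 t6
              assume a6: "agree ({2..14} \<union> {100..}) ({3..7} \<union> {100..}) s5 s6" and gj6: "gj_ok N s6"
                and em6: "eliminated_matrix N (mat_of N s5) (mat_of N s6) (arr s6 4) (used_rows N s6)"
                and t6: "t6 \<le> t5 + gj_time N L + 30 * N + 40"
              have em2: "eliminated_matrix N (face \<sigma>s (Suc p) {i. piv1 i \<noteq> 0}) (mat_of N s6) (arr s6 4) (used_rows N s6)"
                by (rule eliminated_matrix_cong[OF em6 M5'])
              interpret A: emit_program c0 C0 \<omega> K p \<sigma>s N "mat_of N s3" "mat_of N s6" piv1 "arr s6 4" "used_rows N s3" "used_rows N s6"
                using N(2) em1 em2 em1[unfolded eliminated_matrix_def] em2[unfolded eliminated_matrix_def] by unfold_locales
              have "holds_complex X N s5" by (rule holds_complex_agree[OF h4 a5]) auto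
              then have h6: "holds_complex X N s6" by (rule holds_complex_agree[OF _ a6]) auto
              show "wp W emit Q s6 t6"
              proof (rule A.wp_emit[OF h6 gj6 refl refl refl])
                show "i < N \<Longrightarrow> arr s6 11 i = piv1 i" for i using a5 a6 s11 by (simp add: agree_def)
                show "i < N \<Longrightarrow> piv1 i \<le> N" for i by (rule pivN)
                show "arr s6 12 i = 0" for i using a4(1) a5 a6 r3 by (simp add: agree_def)
                fix s' :: ram and t'
                assume out: "\<And>i. i < length (annotation_code A.g p \<sigma>s A.ann) \<Longrightarrow> arr s' 0 i = annotation_code A.g p \<sigma>s A.ann ! i"
                  and t': "t' \<le> t6 + 300 * (N * N) + 100"
                show "Q s' t'"
                proof (rule Q[OF A.annotation N(1,3)])
                  show "i < length (annotation_code (betti K p) p \<sigma>s A.ann) \<Longrightarrow>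
                    arr s' 0 i = annotation_code (betti K p) p \<sigma>s A.ann ! i" for i using out unfolding A.betti .
                  \<comment> \<open>The products are named so that the remaining comparison of times
                    is linear.\<close>
                  define M Y C where "M = N * N" and "Y = 150 * (\<kappa> + 1) * (N * N)" and "C = \<kappa> * (N * N)"
                  have "n \<le> M" "1 \<le> M" "N \<le> M" unfolding M_def by (fact le_trans[OF N(2) NN] le_trans[OF N1 NN] NN)+
                  moreover have "pre_time N L \<kappa> = 2 * gj_time N L + (2 * Y + 700 * M + 700 * C) + 1000"
                    by (simp add: pre_time_def M_def Y_def C_def algebra_simps)
                  moreover have "t2 \<le> t1 + 2 + Y" "t5 \<le> t4 + 4 + Y" using t2[folded Y_def] t5[folded Y_def] by simp_all
                  moreover have "t4 \<le> t3 + 12 * N + 6" using t4 by simp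
                  ultimately show "t' \<le> t + pre_time N L \<kappa>"
                    using t1 t3 t6 t'[folded M_def] by linarith
                qed
              qed (use n W W' pX in auto)
            qed
          qed (use a4(1) r3 N N1 kap W W' pX in \<open>auto simp: agree_def\<close>)
          then show "wp W (Assign 25 (Reg 21 [+] Const 1) ;; build ;; gauss_jordan ;; emit) Q s4 t4"
            using a4(1) r3 pX W by - (rule wp_Seq, rule wp_Assign, auto simp: agree_def)
        qed (use r3 NW N1 in auto)
      qed
    qed (use N N1 kap W W' pX in auto)
    then show "wp W (Assign 25 (Reg 21) ;; build ;; gauss_jordan ;; For 22 1 (Store 11 (Reg 22) (Cell 4 (Reg 22))) ;;
      Assign 25 (Reg 21 [+] Const 1) ;; build ;; gauss_jordan ;; emit) Q s1 t1"
      using r1 pX W by - (rule wp_Seq, rule wp_Assign, auto)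
  qed
qed

end

section \<open>The query program\<close>

definition sum_annotations :: com where
  "sum_annotations =
     Assign 26 (Const 1) ;;
     For 22 21 (
       Assign 27 (Cell 2 (Reg 26)) ;;
       For 23 27 (
         Assign 28 (Cell 2 (Reg 26 [+] Const 1 [+] Reg 23)) ;;
         For 24 20 (Store 8 (Reg 22 [*] Reg 20 [+] Reg 24)
           (Bin Rem (Cell 8 (Reg 22 [*] Reg 20 [+] Reg 24) [+] Cell 1 (Reg 28 [*] Reg 20 [+] Reg 24 [+] Const 1)) (Const 2)))) ;;
       Assign 26 (Reg 26 [+] Reg 27 [+] Const 1))"

definition append_candidates :: com where
  "append_candidates =
     If (Reg 32 [+] Reg 20 [<] Reg 21) (Assign 34 (Reg 20)) (Assign 34 (Reg 21 [-] Reg 32)) ;;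
     For 23 34 (Store 9 (Reg 30 [+] Reg 23) (Reg 32 [+] Reg 23)) ;;
     Assign 30 (Reg 30 [+] Reg 34) ;;
     Assign 32 (Reg 32 [+] Reg 34)"

definition fill_candidates :: com where
  "fill_candidates =
     For 23 1 (For 24 1 (Store 3 (Reg 23 [*] Reg 1 [+] Reg 24)
       ((Reg 24 [<] Reg 30) [*] (Reg 23 [<] Reg 20) [*] Cell 8 (Cell 9 (Reg 24) [*] Reg 20 [+] Reg 23))))"

definition select_pivots :: com where
  "select_pivots =
     Assign 31 (Const 0) ;;
     For 23 30 (If (Cell 4 (Reg 23)) (Store 9 (Reg 31) (Cell 9 (Reg 23)) ;; Assign 31 (Reg 31 [+] Const 1)) Skip) ;;
     Assign 30 (Reg 31)"

lemma input_le:
  "x \<in> set (concat ins) \<Longrightarrow> x \<le> input_size ins"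
  using input_size_ge by fastforce

context enumerated_complex
begin

lemma nth_annotation_code_simplex:
  assumes a: "annotation K p a" and g: "g = betti K p"
  shows "annotation_code g p \<sigma>s a ! 0 = g" "length (annotation_code g p \<sigma>s a) = n * g + 1"
    "\<lbrakk>j < n; card (\<sigma>s ! j) = Suc p; e < g\<rbrakk> \<Longrightarrow> annotation_code g p \<sigma>s a ! (j * g + e + 1) = bit_code (a (\<sigma>s ! j) $ e)"
proof -
  let ?r = "\<lambda>\<sigma>. if card \<sigma> = Suc p then vec_code (a \<sigma>) else replicate g 0"
  have dim: "dim_vec (a \<sigma>) = g" if "\<sigma> \<in> set \<sigma>s" "card \<sigma> = Suc p" for \<sigma>
    using a that set_s g unfolding annotation_def simplices_def by auto
  have l: "length x = g" if "x \<in> set (map ?r \<sigma>s)" for x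
    using that dim by (auto simp: length_vec_code)
  show "annotation_code g p \<sigma>s a ! 0 = g" by (simp add: annotation_code_def)
  have "length (concat (map ?r \<sigma>s)) = length (map ?r \<sigma>s) * g" by (rule length_concat_rows[OF l])
  then show "length (annotation_code g p \<sigma>s a) = n * g + 1" by (simp add: annotation_code_def)
  assume j: "j < n" "card (\<sigma>s ! j) = Suc p" "e < g"
  have "concat (map ?r \<sigma>s) ! (j * g + e) = map ?r \<sigma>s ! j ! e"
    by (rule nth_concat_rows[OF l]) (use j in simp_all)
  then show "annotation_code g p \<sigma>s a ! (j * g + e + 1) = bit_code (a (\<sigma>s ! j) $ e)"
    using j dim[of "\<sigma>s ! j"] by (simp add: annotation_code_def nth_vec_code)
qed

end

locale annotation_query = enumerated_complex +
  fixes a :: "nat set \<Rightarrow> bit vec" and zs :: "nat list list" and g k X :: nat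
  assumes a: "annotation K p a" and valid: "valid_query K p \<sigma>s zs"
    and g: "g = betti K p" and k: "k = length zs"
    and X: "X = input_size [annotation_code g p \<sigma>s a, query_code zs]"
begin

definition w :: "nat \<Rightarrow> nat \<Rightarrow> bit" where "w j e = (\<Sum>i\<leftarrow>zs ! j. a (\<sigma>s ! i) $ e)"

definition t_size :: nat where "t_size = sum_list (map length zs)"

lemma bounds: "Suc g \<le> X" "Suc k \<le> X" "n * g + 1 \<le> X" "length (query_code zs) \<le> X"
  "x \<in> set (query_code zs) \<Longrightarrow> x \<le> X"
proof -
  have c: "concat [annotation_code g p \<sigma>s a, query_code zs] = annotation_code g p \<sigma>s a @ query_code zs" by simp
  show "Suc g \<le> X" unfolding X by (rule input_size_ge) (simp add: annotation_code_def)
  show "Suc k \<le> X" unfolding X by (rule input_size_ge) (simp add: query_code_def k)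
  have "length (annotation_code g p \<sigma>s a) + length (query_code zs) \<le> X"
    using length_le_input_size[of "[annotation_code g p \<sigma>s a, query_code zs]"] X by simp
  then show "n * g + 1 \<le> X" "length (query_code zs) \<le> X"
    using nth_annotation_code_simplex(2)[OF a g] by simp_all
  show "x \<in> set (query_code zs) \<Longrightarrow> x \<le> X" unfolding X by (rule input_le) simp
qed

text \<open>The cost of a cycle depends on its length, hence the loop rule with a bound per round.
  The bounds add up to the total number \<open>t_size\<close> of simplices times g + 1, where the 1
  pays for reading a simplex, and a constant per cycle.\<close>

lemma wp_sum_annotations:
  assumes s: "arr s 1 = arr (init [annotation_code g p \<sigma>s a, query_code zs]) 1"
    "arr s 2 = arr (init [annotation_code g p \<sigma>s a, query_code zs]) 2" "arr s 8 = (\<lambda>_. 0)"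
    "reg s 20 = g" "reg s 21 = k"
    and W: "8 * X * X + 10 \<le> W"
    and Q: "\<And>s' t'. \<lbrakk>agree {22, 23, 24, 26, 27, 28} {8} s s'; \<And>i e. \<lbrakk>i < k; e < g\<rbrakk> \<Longrightarrow> arr s' 8 (i * g + e) = bit_code (w i e);
      \<And>x. arr s' 8 x \<le> 1; t' \<le> t + 60 * (t_size * (g + 1)) + 60 * k + 60\<rbrakk> \<Longrightarrow> Q s' t'"
  shows "wp W sum_annotations Q s t"
proof -
  let ?xs = "map list_code zs"
  have XX: "X \<le> X * X" by simp
  have small: "x \<le> X \<Longrightarrow> x \<le> W" for x using W XX by linarith
  have qc: "query_code zs = k # concat ?xs" by (simp add: query_code_def k)
  have a2: "arr s 2 (Suc x) = concat ?xs ! x" if "x < length (concat ?xs)" for x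
    using that s by (simp add: init_def qc)
  have a1: "arr s 1 x = annotation_code g p \<sigma>s a ! x" if "x < n * g + 1" for x
    using that s nth_annotation_code_simplex(2)[OF a g] by (simp add: init_def)
  have lX: "Suc (length (concat ?xs)) \<le> X" using bounds(4) by (simp add: qc)
  have offX: "Suc (offset ?xs i) \<le> X" for i using offset_le[of ?xs i] lX by linarith
  have rd: "arr s 2 (Suc (offset ?xs i)) = length (zs ! i)" "offset ?xs (Suc i) = offset ?xs i + length (zs ! i) + 1"
    "length (zs ! i) \<le> X" if i: "i < k" for i
  proof -
    have l: "i < length ?xs" "0 < length (?xs ! i)" using i k by (simp_all add: list_code_def)
    show o: "arr s 2 (Suc (offset ?xs i)) = length (zs ! i)"
      using a2 nth_concat_offset[OF l] i k by (simp add: list_code_def)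
    show os: "offset ?xs (Suc i) = offset ?xs i + length (zs ! i) + 1"
      using offset_Suc[OF l(1)] i k by (simp add: list_code_def)
    show "length (zs ! i) \<le> X" using os offX[of "Suc i"] by simp
  qed
  have rq: "arr s 2 (Suc (offset ?xs i) + 1 + q) = zs ! i ! q" "zs ! i ! q < n" "card (\<sigma>s ! (zs ! i ! q)) = Suc p"
    "Suc (offset ?xs i) + 1 + q \<le> X" if i: "i < k" "q < length (zs ! i)" for i q
  proof -
    have l: "i < length ?xs" "Suc q < length (?xs ! i)" using i k by (simp_all add: list_code_def)
    show "arr s 2 (Suc (offset ?xs i) + 1 + q) = zs ! i ! q"
      using a2[of "offset ?xs i + Suc q"] nth_concat_offset[OF l] i k by (simp add: list_code_def)
    have v: "zs ! i \<in> set zs" "zs ! i ! q \<in> set (zs ! i)" using i k by simp_all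
    then show n: "zs ! i ! q < n" using valid by (auto simp: valid_query_def)
    have "\<sigma>s ! (zs ! i ! q) \<in> chain_of \<sigma>s (zs ! i)" using v by (simp add: chain_of_def)
    moreover have "chain_of \<sigma>s (zs ! i) \<in> cycles K p" using valid v by (simp add: valid_query_def)
    ultimately show "card (\<sigma>s ! (zs ! i ! q)) = Suc p" by (auto simp: cycles_def simplices_def)
    show "Suc (offset ?xs i) + 1 + q \<le> X" using rd(2)[OF i(1)] offX[of "Suc i"] i by simp
  qed
  let ?add = "Store 8 (Reg 22 [*] Reg 20 [+] Reg 24)
           (Bin Rem (Cell 8 (Reg 22 [*] Reg 20 [+] Reg 24) [+] Cell 1 (Reg 28 [*] Reg 20 [+] Reg 24 [+] Const 1)) (Const 2))"
  let ?one = "Assign 28 (Cell 2 (Reg 26 [+] Const 1 [+] Reg 23)) ;; For 24 20 ?add"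
  let ?cyc = "Assign 27 (Cell 2 (Reg 26)) ;; For 23 27 ?one ;; Assign 26 (Reg 26 [+] Reg 27 [+] Const 1)"
  define part where "part i q e = (\<Sum>x\<leftarrow>take q (zs ! i). a (\<sigma>s ! x) $ e)" for i q e
  \<comment> \<open>While cycle \<open>i\<close> is processed, the rows before \<open>i\<close> hold
    final sums, row \<open>i\<close> a partial sum, and the later rows are still zero.\<close>
  define D where "D i q s' \<longleftrightarrow> (\<forall>i'<k. \<forall>e<g. arr s' 8 (i' * g + e) =
      bit_code (if i' < i then w i' e else if i' = i then part i q e else 0)) \<and> (\<forall>x. arr s' 8 x \<le> 1)" for i q and s' :: ram
  have D_reg: "D i q (s'\<lparr>reg := r\<rparr>) \<longleftrightarrow> D i q s'" for i q and s' :: ram and r by (simp add: D_def)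
  have part0: "part i 0 e = 0" for i e by (simp add: part_def)
  have part_full: "part i (length (zs ! i)) e = w i e" for i e by (simp add: part_def w_def)
  have D_next: "D i (length (zs ! i)) s' \<Longrightarrow> D (Suc i) 0 s'" for i and s' :: ram
    unfolding D_def part0 part_full by (auto simp: less_Suc_eq)
  have one: "wp W ?one Q s1 t1"
    if ag: "agree {22, 23, 24, 26, 27, 28} {8} s s1" "reg s1 22 = i" "reg s1 23 = q" "reg s1 26 = Suc (offset ?xs i)"
      and iq: "i < k" "q < length (zs ! i)" and D1: "D i q s1"
      and Q: "\<And>s2 t2. \<lbrakk>agree {24, 28} {8} s1 s2; D i (Suc q) s2; t2 \<le> t1 + (g * 33 + 20)\<rbrakk> \<Longrightarrow> Q s2 t2" for i q s1 t1 Q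
  proof -
    let ?x = "zs ! i ! q"
    let ?s1 = "s1\<lparr>reg := (reg s1)(28 := ?x)\<rparr>"
    have r: "reg s1 20 = g" "arr s1 1 = arr s 1" "arr s1 2 = arr s 2" using ag s by (simp_all add: agree_def)
    have iX: "i * g + e \<le> X * X" if "e < g" for e
    proof -
      have "i * g + e < k * g" using iq that by (intro idx_less) auto
      moreover have "k * g \<le> X * X" using bounds by (intro mult_le_mono) auto
      ultimately show ?thesis by linarith
    qed
    have xX: "?x * g + e + 1 \<le> X" "?x * g + e + 1 < n * g + 1" if "e < g" for e
    proof -
      have "?x * g + e < n * g" using rq(2)[OF iq] that by (intro idx_less) auto
      then show "?x * g + e + 1 \<le> X" "?x * g + e + 1 < n * g + 1" using bounds(3) by linarith+
    qed
    have tab: "arr s 1 (?x * g + e + 1) = bit_code (a (\<sigma>s ! ?x) $ e)" if "e < g" for e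
      using a1[OF xX(2)[OF that]] nth_annotation_code_simplex(3)[OF a g rq(2,3)[OF iq] that] by simp
    have partS: "part i (Suc q) e = part i q e + a (\<sigma>s ! ?x) $ e" for e
      using iq by (simp add: part_def take_Suc_conv_app_nth)
    have "wp W (For 24 20 ?add) Q ?s1 (t1 + (1 + cost (Cell 2 (Reg 26 [+] Const 1 [+] Reg 23))))"
    proof (rule wp_For_fill1[where S = g and idx = "\<lambda>e. i * g + e" and v = "\<lambda>e. bit_code (part i (Suc q) e)"])
      fix s2 e assume b: "agree {24} {8} ?s1 s2" "reg s2 24 = e" "e < g" "arr s2 8 (i * g + e) = arr ?s1 8 (i * g + e)"
      have r2: "reg s2 20 = g" "reg s2 22 = i" "reg s2 28 = ?x" "arr s2 1 (?x * g + e + 1) = bit_code (a (\<sigma>s ! ?x) $ e)"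
        "arr s2 8 (i * g + e) = bit_code (part i q e)"
        using b r ag tab[OF b(3)] D1 iq by (simp_all add: agree_def D_def)
      have md: "(bit_code x + bit_code y) mod 2 = bit_code (x + y)" for x y
        by (metis bit_code_of_nat of_nat_mod_2 of_nat_add of_nat_bit_code mod_less_divisor pos2 less_Suc_eq_le numeral_2_eq_2 One_nat_def)
      have "i * g + e \<le> W" "i * g \<le> W" using iX[OF b(3)] W by linarith+
      moreover have "?x * g + e + 1 \<le> W" "?x * g + e \<le> W" "?x * g \<le> W" using small[OF xX(1)[OF b(3)]] by linarith+
      moreover have "i \<le> W" "g \<le> W" "e \<le> W" using iq bounds b(3) by (intro small; simp)+
      moreover have "?x \<le> W"
        using xX(1)[OF b(3)] b(3) small[of ?x] by (cases g) (auto intro: le_trans)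
      moreover have "bit_code (part i q e) \<le> 1" "bit_code (a (\<sigma>s ! ?x) $ e) \<le> 1" by (rule bit_code_le)+
      ultimately show "val s2 (Reg 22 [*] Reg 20 [+] Reg 24) = i * g + e \<and>
        val s2 (Bin Rem (Cell 8 (Reg 22 [*] Reg 20 [+] Reg 24) [+] Cell 1 (Reg 28 [*] Reg 20 [+] Reg 24 [+] Const 1)) (Const 2)) = bit_code (part i (Suc q) e) \<and>
        fits W s2 (Reg 22 [*] Reg 20 [+] Reg 24) \<and>
        fits W s2 (Bin Rem (Cell 8 (Reg 22 [*] Reg 20 [+] Reg 24) [+] Cell 1 (Reg 28 [*] Reg 20 [+] Reg 24 [+] Const 1)) (Const 2))"
        using r2 b(2) W partS[of e] md[of "part i q e" "a (\<sigma>s ! ?x) $ e"] bit_code_le[of "part i (Suc q) e"] by simp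
    next
      fix s2 t2
      assume b: "agree {24} {8} ?s1 s2" "\<And>e. e < g \<Longrightarrow> arr s2 8 (i * g + e) = bit_code (part i (Suc q) e)"
        "\<And>x. (\<And>e. e < g \<Longrightarrow> x \<noteq> i * g + e) \<Longrightarrow> arr s2 8 x = arr ?s1 8 x"
        and t2: "t2 \<le> t1 + (1 + cost (Cell 2 (Reg 26 [+] Const 1 [+] Reg 23))) + g * (cost (Reg 22 [*] Reg 20 [+] Reg 24) +
          cost (Bin Rem (Cell 8 (Reg 22 [*] Reg 20 [+] Reg 24) [+] Cell 1 (Reg 28 [*] Reg 20 [+] Reg 24 [+] Const 1)) (Const 2)) + 9) + 6"
      show "Q s2 t2"
      proof (rule Q)
        show "agree {24, 28} {8} s1 s2" using b(1) by (auto simp: agree_def)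
        show "D i (Suc q) s2" unfolding D_def
        proof (intro conjI allI impI)
          fix i' e assume ie: "i' < k" "e < g"
          show "arr s2 8 (i' * g + e) = bit_code (if i' < i then w i' e else if i' = i then part i (Suc q) e else 0)"
          proof (cases "i' = i")
            case True
            then show ?thesis using b(2)[OF ie(2)] by simp
          next
            case False
            have "arr s2 8 (i' * g + e) = arr ?s1 8 (i' * g + e)"
            proof (rule b(3))
              show "i' * g + e \<noteq> i * g + e'" if "e' < g" for e' using that ie False by (subst idx_eq) auto
            qed
            then show ?thesis using D1 ie False by (simp add: D_def)
          qed
        next
          fix x show "arr s2 8 x \<le> 1"
            using b(2) b(3)[of x] D1 bit_code_le unfolding D_def by (cases "\<exists>e<g. x = i * g + e") auto
        qed
        show "t2 \<le> t1 + (g * 33 + 20)" using t2 by simp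
      qed
    qed (use r small[of g] small[of 1] bounds in \<open>auto simp: inj_on_def\<close>)
    moreover have "val s1 (Cell 2 (Reg 26 [+] Const 1 [+] Reg 23)) = ?x" "fits W s1 (Cell 2 (Reg 26 [+] Const 1 [+] Reg 23))"
    proof -
      have "?x \<le> X"
      proof (cases "arr s 2 (Suc (offset ?xs i) + 1 + q) = 0")
        case False
        then have "Suc (offset ?xs i) + 1 + q < length (query_code zs)" using s by (simp add: init_def split: if_splits)
        moreover from this have "arr s 2 (Suc (offset ?xs i) + 1 + q) = query_code zs ! (Suc (offset ?xs i) + 1 + q)"
          using s by (simp add: init_def)
        ultimately show ?thesis using bounds(5) rq(1)[OF iq] nth_mem by metis
      qed (use rq(1)[OF iq] in simp)
      moreover have "q \<le> X" "Suc (offset ?xs i) \<le> X" using rq(4)[OF iq] by linarith+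
      ultimately show "val s1 (Cell 2 (Reg 26 [+] Const 1 [+] Reg 23)) = ?x" "fits W s1 (Cell 2 (Reg 26 [+] Const 1 [+] Reg 23))"
        using ag r rq(1,4)[OF iq] small[of ?x] small[of q] small[of "Suc (offset ?xs i) + 1 + q"] small[of 1] bounds(1) by auto
    qed
    ultimately show ?thesis by - (rule wp_Seq, rule wp_Assign, assumption, simp)
  qed
  have main: "wp W (For 22 21 ?cyc) Q (s\<lparr>reg := (reg s)(26 := 1)\<rparr>) (t + (1 + cost (Const 1)))"
  proof (rule wp_For_sum[where n = k and B = "\<lambda>i. length (zs ! i) * (g * 33 + 28) + 30" and
        I = "\<lambda>i s1. reg s1 26 = Suc (offset ?xs i) \<and> D i 0 s1"])
    show "reg (s\<lparr>reg := (reg s)(26 := 1)\<rparr>) 26 = Suc (offset ?xs 0) \<and> D 0 0 (s\<lparr>reg := (reg s)(26 := 1)\<rparr>)"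
      using s part0 by (simp add: D_def bit_code_def)
    fix i s1 t1
    assume i: "i < k" and ag: "agree (insert 22 (wregs ?cyc)) (warrs ?cyc) (s\<lparr>reg := (reg s)(26 := 1)\<rparr>) s1" "reg s1 22 = i"
      and I: "reg s1 26 = Suc (offset ?xs i) \<and> D i 0 s1"
    let ?s1 = "s1\<lparr>reg := (reg s1)(27 := length (zs ! i))\<rparr>"
    have v: "val s1 (Cell 2 (Reg 26)) = length (zs ! i)" "fits W s1 (Cell 2 (Reg 26))"
      using ag I rd[OF i] small[of "length (zs ! i)"] small[of "Suc (offset ?xs i)"] offX[of i] by (simp_all add: agree_def)
    have "wp W (For 23 27 ?one ;; Assign 26 (Reg 26 [+] Reg 27 [+] Const 1))
       (\<lambda>s2 t2. (reg s2 26 = Suc (offset ?xs (Suc i)) \<and> D (Suc i) 0 s2) \<and> t2 \<le> t1 + (length (zs ! i) * (g * 33 + 28) + 30))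
       ?s1 (t1 + (1 + cost (Cell 2 (Reg 26))))"
    proof (rule wp_Seq, rule wp_For[where n = "length (zs ! i)" and B = "g * 33 + 20" and I = "\<lambda>q s2. D i q s2"])
      fix q s2 t2
      assume q: "q < length (zs ! i)" and b: "agree (insert 23 (wregs ?one)) (warrs ?one) ?s1 s2" "reg s2 23 = q" and D: "D i q s2"
      show "wp W ?one (\<lambda>s3 t3. D i (Suc q) s3 \<and> t3 \<le> t2 + (g * 33 + 20)) s2 t2"
      proof (rule one[OF _ _ b(2) _ i q D])
        show "agree {22, 23, 24, 26, 27, 28} {8} s s2" using ag b by (auto simp: agree_def)
        show "reg s2 22 = i" "reg s2 26 = Suc (offset ?xs i)" using ag b I by (auto simp: agree_def)
      qed blast
    next
      fix s2 t2
      assume b: "agree (insert 23 (wregs ?one)) (warrs ?one) ?s1 s2" and D: "D i (length (zs ! i)) s2"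
        and t2: "t2 \<le> t1 + (1 + cost (Cell 2 (Reg 26))) + length (zs ! i) * (g * 33 + 20 + 8) + 6"
      have r2: "reg s2 26 = Suc (offset ?xs i)" "reg s2 27 = length (zs ! i)" using b I by (auto simp: agree_def)
      have "g * 33 + 20 + 8 = g * 33 + 28" by simp
      then have t2': "t2 \<le> t1 + length (zs ! i) * (g * 33 + 28) + 9" using t2 by (simp only:) simp
      show "wp W (Assign 26 (Reg 26 [+] Reg 27 [+] Const 1))
        (\<lambda>s2 t2. (reg s2 26 = Suc (offset ?xs (Suc i)) \<and> D (Suc i) 0 s2) \<and> t2 \<le> t1 + (length (zs ! i) * (g * 33 + 28) + 30)) s2 t2"
      proof (rule wp_Assign)
        show "fits W s2 (Reg 26 [+] Reg 27 [+] Const 1)"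
          using r2 rd[OF i] offX[of "Suc i"] small[of "Suc (offset ?xs (Suc i))"] by simp
      qed (use r2 rd(2)[OF i] D_next[OF D] t2' in \<open>simp add: D_reg\<close>)
    qed (use rd[OF i] small I bounds(1) in \<open>auto simp: D_reg\<close>)
    then show "wp W ?cyc (\<lambda>s2 t2. (reg s2 26 = Suc (offset ?xs (Suc i)) \<and> D (Suc i) 0 s2) \<and>
        t2 \<le> t1 + (length (zs ! i) * (g * 33 + 28) + 30)) s1 t1"
      using v by - (rule wp_Seq, rule wp_Assign, assumption, simp)
  next
    fix s' t'
    assume ag: "agree (insert 22 (wregs ?cyc)) (warrs ?cyc) (s\<lparr>reg := (reg s)(26 := 1)\<rparr>) s'"
      and I: "reg s' 26 = Suc (offset ?xs k) \<and> D k 0 s'"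
      and t': "t' \<le> t + (1 + cost (Const 1)) + (\<Sum>i<k. length (zs ! i) * (g * 33 + 28) + 30 + 8) + 6"
    show "Q s' t'"
    proof (rule Q)
      show "agree {22, 23, 24, 26, 27, 28} {8} s s'" using ag by (auto simp: agree_def)
      show "arr s' 8 (i * g + e) = bit_code (w i e)" if "i < k" "e < g" for i e
        using I that by (simp add: D_def)
      show "arr s' 8 x \<le> 1" for x using I by (simp add: D_def)
      have "(\<Sum>i<k. length (zs ! i) * (g * 33 + 28) + 30 + 8) = (\<Sum>i<k. length (zs ! i)) * (g * 33 + 28) + 38 * k"
        by (simp add: sum.distrib sum_distrib_right add.assoc)
      also have "(\<Sum>i<k. length (zs ! i)) = t_size"
        unfolding t_size_def k using sum_list_sum_nth[of "map length zs"] by (simp add: lessThan_atLeast0)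
      also have "t_size * (g * 33 + 28) \<le> t_size * (60 * (g + 1))" by (intro mult_le_mono2) simp
      finally have "(\<Sum>i<k. length (zs ! i) * (g * 33 + 28) + 30 + 8) \<le> t_size * (60 * (g + 1)) + 38 * k" by simp
      moreover have "t_size * (60 * (g + 1)) = 60 * (t_size * (g + 1))" by (simp add: algebra_simps)
      ultimately show "t' \<le> t + 60 * (t_size * (g + 1)) + 60 * k + 60" using t' by simp
    qed
  qed (use s small[of k] small[of 1] bounds in \<open>auto simp: D_reg\<close>)
  then show ?thesis unfolding sum_annotations_def
    using small[of 1] bounds by - (rule wp_Seq, rule wp_Assign, simp_all)
qed

definition independent :: "nat list \<Rightarrow> bool" where
  "independent js \<longleftrightarrow> (\<forall>T\<subseteq>set js. (\<forall>e<g. (\<Sum>j\<in>T. w j e) = 0) \<longrightarrow> T = {})"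

definition spans :: "nat list \<Rightarrow> nat set \<Rightarrow> bool" where
  "spans js A \<longleftrightarrow> (\<forall>j\<in>A. \<exists>T\<subseteq>set js. \<forall>e<g. w j e = (\<Sum>i\<in>T. w i e))"

text \<open>The matrix has the annotation sums of the candidates as columns and is padded with
  zeros. Zero columns are never pivots, and zero rows are never pivot rows, so there are at most
  \<open>g\<close> pivots, and they form a basis of the span of all candidates.\<close>

lemma pivot_basis:
  assumes e: "eliminated_matrix N M V piv u" and cs: "distinct cs" "length cs \<le> N" and gN: "g \<le> N"
    and M: "\<And>e c. \<lbrakk>e < N; c < N\<rbrakk> \<Longrightarrow> M e c = (if c < length cs \<and> e < g then w (cs ! c) e else 0)"
    and js: "js = map ((!) cs) (filter (\<lambda>c. piv c \<noteq> 0) [0..<length cs])"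
  shows "distinct js" "set js \<subseteq> set cs" "length js \<le> g" "independent js"
    "T \<subseteq> set cs \<Longrightarrow> \<exists>T'\<subseteq>set js. \<forall>e<g. (\<Sum>j\<in>T. w j e) = (\<Sum>j\<in>T'. w j e)"
proof -
  interpret E: eliminated_matrix N M V piv u by (rule e)
  let ?b = "length cs"
  have Pb: "k < ?b" if k: "k \<in> E.P" for k
  proof -
    obtain i where "i < N" "M i k \<noteq> 0" by (rule E.pivot_col_nonzero[OF k])
    then show ?thesis using M[of i k] E.P_less[OF k] by (auto split: if_splits)
  qed
  have P: "E.P = {c. c < ?b \<and> piv c \<noteq> 0}" using Pb cs(2) by (force simp: piv_cols_def)
  have inj: "inj_on ((!) cs) {..<?b}" using cs(1) by (auto simp: inj_on_def nth_eq_iff_index_eq)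
  have set_js: "set js = (!) cs ` E.P" unfolding js P by auto
  show "distinct js" unfolding js distinct_map
    using inj_on_subset[OF inj, of "set (filter (\<lambda>c. piv c \<noteq> 0) [0..<?b])"] by auto
  show "set js \<subseteq> set cs" unfolding set_js using Pb by auto
  \<comment> \<open>A row from \<open>g\<close> on is zero and \<open>U\<close> leaves it alone, so
    no column can acquire a one there.\<close>
  have rg: "E.\<rho> k < g" if k: "k \<in> E.P" for k
  proof (rule ccontr)
    assume ge: "\<not> E.\<rho> k < g"
    have r: "E.\<rho> k < N" by (rule E.rho_less[OF k])
    have z: "M (E.\<rho> k) c = 0" if "c < N" for c using M[OF r that] ge by simp
    have "V (E.\<rho> k) c = 0" if "c \<in> E.P" for c by (rule E.zero_row[OF r z that])
    then have "E.U (colv N M k) (E.\<rho> k) = colv N M k (E.\<rho> k)" unfolding tr_def by simp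
    also have "\<dots> = 0" using z[OF E.P_less[OF k]] r by (simp add: colv_def)
    finally show False unfolding E.U_pivot[OF k] by (simp add: unitv_def)
  qed
  have "card (set js) = card (E.\<rho> ` E.P)"
    unfolding set_js using E.inj_rho inj_on_subset[OF inj] Pb by (simp add: card_image subset_eq)
  also have "\<dots> \<le> card {..<g}" using rg by (intro card_mono) auto
  finally show "length js \<le> g" using \<open>distinct js\<close> by (simp add: distinct_card)
  have sum_M: "(\<Sum>c\<in>S. M e c) = (\<Sum>j\<in>(!) cs ` S. w j e)" if "S \<subseteq> {..<?b}" "e < g" for S e
  proof -
    have "(\<Sum>j\<in>(!) cs ` S. w j e) = (\<Sum>c\<in>S. w (cs ! c) e)"
      using sum.reindex[OF inj_on_subset[OF inj that(1)], of "\<lambda>j. w j e"] by (simp only: o_def)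
    also have "\<dots> = (\<Sum>c\<in>S. M e c)"
    proof (rule sum.cong[OF refl])
      fix c assume "c \<in> S"
      then have "c < ?b" using that by auto
      then show "w (cs ! c) e = M e c" using M[of e c] that gN cs by simp
    qed
    finally show ?thesis ..
  qed
  have sub: "\<exists>S\<subseteq>A. T = (!) cs ` S" if "T \<subseteq> (!) cs ` A" for T A using that by (auto simp: subset_image_iff)
  show "independent js" unfolding independent_def
  proof (intro allI impI)
    fix T assume T: "T \<subseteq> set js" "\<forall>e<g. (\<Sum>j\<in>T. w j e) = 0"
    then obtain S where S: "S \<subseteq> E.P" "T = (!) cs ` S" using sub[of T E.P] unfolding set_js by blast
    have Sb: "S \<subseteq> {..<?b}" using S(1) Pb by auto
    have "S = {}"
    proof (rule E.pivots_independent[OF S(1)])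
      fix i assume i: "i < N"
      show "(\<Sum>k\<in>S. M i k) = 0"
      proof (cases "i < g")
        case True
        then show ?thesis using sum_M[OF Sb True] T(2) S(2) by simp
      next
        case False
        show ?thesis
        proof (rule sum.neutral, rule ballI)
          fix c assume "c \<in> S"
          then show "M i c = 0" using M[OF i, of c] False S(1) E.P_less by auto
        qed
      qed
    qed
    then show "T = {}" using S by simp
  qed
  assume T: "T \<subseteq> set cs"
  have "set cs = (!) cs ` {..<?b}" by (auto simp: set_conv_nth)
  then obtain S where S: "S \<subseteq> {..<?b}" "T = (!) cs ` S" using sub[of T "{..<?b}"] T by auto
  have "S \<subseteq> {..<N}" using S(1) cs(2) by auto
  from E.pivots_span[OF this] obtain S' where S': "S' \<subseteq> E.P" "\<forall>i<N. (\<Sum>k\<in>S. M i k) = (\<Sum>k\<in>S'. M i k)" by blast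
  have "S' \<subseteq> {..<?b}" using S'(1) Pb by auto
  then have "(\<Sum>j\<in>T. w j e) = (\<Sum>j\<in>(!) cs ` S'. w j e)" if "e < g" for e
    using sum_M[OF S(1) that] sum_M[of S' e] S(2) S'(2) that gN by simp
  then show "\<exists>T'\<subseteq>set js. \<forall>e<g. (\<Sum>j\<in>T. w j e) = (\<Sum>j\<in>T'. w j e)"
    using S'(1) unfolding set_js by (intro exI[of _ "(!) cs ` S'"]) auto
qed

end

locale query_program = mult_program + annotation_query
begin

text \<open>The bounds on arrays 8 and 9 hold for all cells and not just for the entries in use:
  when the matrix is filled, the masked products are evaluated for padding columns too and must not
  overflow.\<close>

definition holds_candidates :: "nat \<Rightarrow> nat list \<Rightarrow> nat \<Rightarrow> ram \<Rightarrow> bool" where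
  "holds_candidates N cs pos s \<longleftrightarrow> reg s 1 = N \<and> reg s 20 = g \<and> reg s 21 = k \<and> reg s 30 = length cs \<and> reg s 32 = pos \<and>
     clean s \<and> (\<forall>i<k. \<forall>e<g. arr s 8 (i * g + e) = bit_code (w i e)) \<and> (\<forall>x. arr s 8 x \<le> 1) \<and>
     (\<forall>c<length cs. arr s 9 c = cs ! c) \<and> (\<forall>x. arr s 9 x \<le> k) \<and> (\<forall>x\<ge>N. arr s 4 x = 0) \<and>
     distinct cs \<and> set cs \<subseteq> {..<pos} \<and> pos \<le> k"

lemma wp_append_candidates:
  assumes h: "holds_candidates N cs pos s" and W: "8 * X * X + 10 \<le> W" and len: "length cs \<le> g"
    and Q: "\<And>s' t' m. \<lbrakk>holds_candidates N (cs @ [pos..<pos + m]) (pos + m) s'; pos + m = min k (pos + g); m \<le> g;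
      t' \<le> t + 15 * g + 40\<rbrakk> \<Longrightarrow> Q s' t'"
  shows "wp W append_candidates Q s t"
proof -
  have XX: "X \<le> X * X" by simp
  have small: "x \<le> 4 * X \<Longrightarrow> x \<le> W" for x using W XX by linarith
  note h' = h[unfolded holds_candidates_def]
  define m where "m = min g (k - pos)"
  have pk: "pos \<le> k" using h' by blast
  have bd: "g \<le> X" "k \<le> X" "length cs \<le> X" using bounds len by linarith+
  let ?s = "s\<lparr>reg := (reg s)(34 := m)\<rparr>"
  let ?T = "t + (1 + cost (Reg 32 [+] Reg 20 [<] Reg 21))"
  have main: "wp W (For 23 34 (Store 9 (Reg 30 [+] Reg 23) (Reg 32 [+] Reg 23)) ;; Assign 30 (Reg 30 [+] Reg 34) ;;
     Assign 32 (Reg 32 [+] Reg 34)) Q ?s t1" if t1: "t1 \<le> t + 14" for t1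
  proof (rule wp_Seq, rule wp_For_fill1[where S = m and idx = "\<lambda>c. length cs + c" and v = "\<lambda>c. pos + c"])
    fix s1 c assume a: "agree {23} {9} ?s s1" "reg s1 23 = c" "c < m"
    have "length cs + c \<le> W" "pos + c \<le> W" "c \<le> W" "length cs \<le> W" "pos \<le> W"
      using a(3) bd pk m_def by (intro small; simp)+
    then show "val s1 (Reg 30 [+] Reg 23) = length cs + c \<and> val s1 (Reg 32 [+] Reg 23) = pos + c \<and>
        fits W s1 (Reg 30 [+] Reg 23) \<and> fits W s1 (Reg 32 [+] Reg 23)"
      using a h' by (simp add: agree_def)
  next
    fix s1 t2
    assume a: "agree {23} {9} ?s s1" "\<And>c. c < m \<Longrightarrow> arr s1 9 (length cs + c) = pos + c"
      "\<And>x. (\<And>c. c < m \<Longrightarrow> x \<noteq> length cs + c) \<Longrightarrow> arr s1 9 x = arr ?s 9 x"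
      and t2: "t2 \<le> t1 + m * (cost (Reg 30 [+] Reg 23) + cost (Reg 32 [+] Reg 23) + 9) + 6"
    have r: "reg s1 30 = length cs" "reg s1 32 = pos" "reg s1 34 = m" using a(1) h' by (simp_all add: agree_def)
    let ?s2 = "s1\<lparr>reg := (reg s1)(30 := length cs + m, 32 := pos + m)\<rparr>"
    have "Q ?s2 t3" if t3: "t3 \<le> t2 + 8" for t3
    proof (rule Q)
      have "arr s1 9 c = (cs @ [pos..<pos + m]) ! c" if "c < length cs + m" for c
      proof (cases "c < length cs")
        case True
        then show ?thesis using a(3)[of c] h' by (simp add: nth_append)
      next
        case False
        then show ?thesis using a(2)[of "c - length cs"] that by (simp add: nth_append)
      qed
      moreover have "arr s1 9 x \<le> k" for x
      proof (cases "\<exists>c<m. x = length cs + c")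
        case True
        then show ?thesis using a(2) m_def by auto
      next
        case False
        then show ?thesis using a(3)[of x] h' by auto
      qed
      moreover have "clean ?s2" using a(1) h' by (simp add: clean_def agree_def)
      moreover have "distinct (cs @ [pos..<pos + m])" "set (cs @ [pos..<pos + m]) \<subseteq> {..<pos + m}" using h' by auto
      ultimately show "holds_candidates N (cs @ [pos..<pos + m]) (pos + m) ?s2"
        unfolding holds_candidates_def using a(1) h' m_def by (auto simp: agree_def)
      show "pos + m = min k (pos + g)" "m \<le> g" using pk m_def by auto
      have "m * 15 \<le> 15 * g" using m_def by simp
      then show "t3 \<le> t + 15 * g + 40" using t1 t2 t3 by simp
    qed
    moreover have "length cs + m \<le> W" "pos + m \<le> W" "length cs \<le> W" "pos \<le> W" "m \<le> W"
      using bd pk m_def by (intro small; simp)+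
    ultimately show "wp W (Assign 30 (Reg 30 [+] Reg 34) ;; Assign 32 (Reg 32 [+] Reg 34)) Q s1 t2"
      using r by (intro wp_Seq wp_Assign) simp_all
  qed (use small[of m] small[of 1] bd bounds(1) m_def in \<open>auto simp: inj_on_def\<close>)
  have r: "reg s 20 = g" "reg s 21 = k" "reg s 32 = pos" using h' by blast+
  have fw: "pos + g \<le> W" "pos \<le> W" "g \<le> W" "k \<le> W" "k - pos \<le> W" "1 \<le> W" using bd pk bounds(1) by (intro small; simp)+
  show ?thesis unfolding append_candidates_def
  proof (rule wp_Seq, rule wp_If)
    show "fits W s (Reg 32 [+] Reg 20 [<] Reg 21)" using r fw by simp
    assume "val s (Reg 32 [+] Reg 20 [<] Reg 21) \<noteq> 0"
    then have "m = g" using r m_def by (auto split: if_splits)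
    then show "wp W (Assign 34 (Reg 20)) (wp W (For 23 34 (Store 9 (Reg 30 [+] Reg 23) (Reg 32 [+] Reg 23)) ;;
      Assign 30 (Reg 30 [+] Reg 34) ;; Assign 32 (Reg 32 [+] Reg 34)) Q) s ?T"
      using main r fw by (intro wp_Assign) simp_all
  next
    assume "val s (Reg 32 [+] Reg 20 [<] Reg 21) = 0"
    then have "m = k - pos" using r m_def by (auto split: if_splits)
    then show "wp W (Assign 34 (Reg 21 [-] Reg 32)) (wp W (For 23 34 (Store 9 (Reg 30 [+] Reg 23) (Reg 32 [+] Reg 23)) ;;
      Assign 30 (Reg 30 [+] Reg 34) ;; Assign 32 (Reg 32 [+] Reg 34)) Q) s ?T"
      using main r fw by (intro wp_Assign) simp_all
  qed
qed

lemma wp_fill_candidates: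
  assumes h: "holds_candidates N cs pos s" and W: "8 * X * X + 10 \<le> W" "2 * N * N + 4 \<le> W"
    and N: "length cs \<le> N" "N < 4 * g"
    and Q: "\<And>s' t'. \<lbrakk>holds_candidates N cs pos s';
      \<And>e c. \<lbrakk>e < N; c < N\<rbrakk> \<Longrightarrow> arr s' 3 (e * N + c) = bit_code (if c < length cs \<and> e < g then w (cs ! c) e else 0);
      t' \<le> t + 43 * (N * N) + 6\<rbrakk> \<Longrightarrow> Q s' t'"
  shows "wp W fill_candidates Q s t"
proof (cases "N = 0")
  case False
  then have N1: "1 \<le> N" by simp
  note h' = h[unfolded holds_candidates_def]
  have small: "x \<le> N * N \<Longrightarrow> x \<le> W" for x using W by simp
  have NN: "N \<le> N * N" by simp
  have smallN: "x \<le> N \<Longrightarrow> x \<le> W" for x using NN small by (meson le_trans)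
  have XX: "X \<le> X * X" by simp
  have big: "x * g + e \<le> W" "x * g \<le> W" "x \<le> W" if x: "x \<le> k" and e: "e < N" for x e
  proof -
    have "x * g \<le> X * X" using x bounds(1,2) by (intro mult_le_mono) auto
    moreover have "e \<le> 4 * X" using e N(2) bounds(1) by simp
    moreover have "x \<le> X" using x bounds(2) by simp
    moreover have "8 * X * X = 8 * (X * X)" by simp
    ultimately show "x * g + e \<le> W" "x * g \<le> W" "x \<le> W" using XX W(1) by linarith+
  qed
  show ?thesis unfolding fill_candidates_def
  proof (rule wp_For_fill[where R = N and S = N and idx = "\<lambda>e c. e * N + c" and
        v = "\<lambda>e c. bit_code (if c < length cs \<and> e < g then w (cs ! c) e else 0)"])
    fix s1 e c assume a: "agree {23, 24} {3} s s1" "reg s1 23 = e" "reg s1 24 = c" "e < N" "c < N"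
    have r: "reg s1 1 = N" "reg s1 20 = g" "reg s1 30 = length cs" "arr s1 9 = arr s 9" "arr s1 8 = arr s 8"
      using a h' by (simp_all add: agree_def)
    have "e * N + c \<le> W" "e * N \<le> W" using idx_less[OF a(4,5)] a(4) by (intro small; simp)+
    moreover have "e \<le> W" "c \<le> W" "N \<le> W" "length cs \<le> W" "1 \<le> W" using a(4,5) N N1 by (intro smallN; simp)+
    moreover have "arr s 9 c \<le> k" using h' by blast
    note big[OF this a(4)]
    moreover have "g \<le> W" using bounds(1) W(1) XX by linarith
    moreover have le1: "arr s 8 (arr s 9 c * g + e) \<le> 1" using h' by blast
    moreover have "arr s 8 (arr s 9 c * g + e) = bit_code (w (cs ! c) e)" if "c < length cs" "e < g"
    proof -
      have "cs ! c \<in> set cs" using that by simp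
      then have "cs ! c < k" using h' by auto
      then show ?thesis using h' that by simp
    qed
    ultimately show "val s1 (Reg 23 [*] Reg 1 [+] Reg 24) = e * N + c \<and>
      val s1 ((Reg 24 [<] Reg 30) [*] (Reg 23 [<] Reg 20) [*] Cell 8 (Cell 9 (Reg 24) [*] Reg 20 [+] Reg 23)) =
        bit_code (if c < length cs \<and> e < g then w (cs ! c) e else 0) \<and>
      fits W s1 (Reg 23 [*] Reg 1 [+] Reg 24) \<and>
      fits W s1 ((Reg 24 [<] Reg 30) [*] (Reg 23 [<] Reg 20) [*] Cell 8 (Cell 9 (Reg 24) [*] Reg 20 [+] Reg 23))"
      using r a(2,3) by (auto simp: bit_code_def intro: le_trans[OF le1])
  next
    fix s' t'
    assume a: "agree {23, 24} {3} s s'"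
      "\<And>e c. \<lbrakk>e < N; c < N\<rbrakk> \<Longrightarrow> arr s' 3 (e * N + c) = bit_code (if c < length cs \<and> e < g then w (cs ! c) e else 0)"
      and t': "t' \<le> t + N * (N * (cost (Reg 23 [*] Reg 1 [+] Reg 24) + cost ((Reg 24 [<] Reg 30) [*] (Reg 23 [<] Reg 20) [*]
        Cell 8 (Cell 9 (Reg 24) [*] Reg 20 [+] Reg 23)) + 9) + 14) + 6"
    show "Q s' t'"
    proof (rule Q)
      show "holds_candidates N cs pos s'" using a(1) h' by (auto simp: holds_candidates_def agree_def clean_def)
      show "arr s' 3 (e * N + c) = bit_code (if c < length cs \<and> e < g then w (cs ! c) e else 0)" if "e < N" "c < N" for e c
        by (rule a(2)[OF that])
      have "t' \<le> t + N * (N * 29 + 14) + 6" using t' by simp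
      then have "t' \<le> t + (43 * (N * N) + 6)" by (rule fill_time) (use N1 in simp_all)
      then show "t' \<le> t + 43 * (N * N) + 6" by simp
    qed
  qed (use h' inj_idx[of N N] smallN[of N] smallN[of 1] N1 in auto)
next
  case True
  note h' = h[unfolded holds_candidates_def]
  show ?thesis unfolding fill_candidates_def
    by (rule wp_For_fill[where R = N and S = N and idx = "\<lambda>e c. e * N + c" and v = "\<lambda>_ _. 0"], (use h' True W in simp_all)[8])
       (rule Q, use h' True in \<open>auto simp: holds_candidates_def agree_def clean_def\<close>)
qed

text \<open>Array 9 is compacted in place. The number of entries kept never exceeds the number
  scanned, so no entry is overwritten before it is read.\<close>

lemma wp_select_pivots:
  assumes h: "holds_candidates N cs pos s" and W: "8 * X * X + 10 \<le> W" "2 * N * N + 4 \<le> W"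
    and N: "length cs \<le> N" and piv: "\<And>c. c < N \<Longrightarrow> arr s 4 c \<le> N"
    and Q: "\<And>s' t'. \<lbrakk>holds_candidates N (map ((!) cs) (filter (\<lambda>c. arr s 4 c \<noteq> 0) [0..<length cs])) pos s';
      t' \<le> t + 23 * N + 10\<rbrakk> \<Longrightarrow> Q s' t'"
  shows "wp W select_pivots Q s t"
proof -
  note h' = h[unfolded holds_candidates_def]
  have NN: "N \<le> N * N" by simp
  have smallN: "x \<le> N \<Longrightarrow> x \<le> W" for x using NN W(2) by linarith
  have XX: "X \<le> X * X" by simp
  have kW: "x \<le> k \<Longrightarrow> x \<le> W" for x using bounds(2) W(1) XX by linarith
  have W1: "1 \<le> W" using W by simp
  let ?c = "If (Cell 4 (Reg 23)) (Store 9 (Reg 31) (Cell 9 (Reg 23)) ;; Assign 31 (Reg 31 [+] Const 1)) Skip"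
  let ?s = "s\<lparr>reg := (reg s)(31 := 0)\<rparr>"
  let ?l = "\<lambda>i. map ((!) cs) (filter (\<lambda>c. arr s 4 c \<noteq> 0) [0..<i])"
  have len: "length (?l i) \<le> i" for i using length_filter_le[of "\<lambda>c. arr s 4 c \<noteq> 0" "[0..<i]"] by simp
  have "wp W (For 23 30 ?c ;; Assign 30 (Reg 31)) Q ?s (t + (1 + cost (Const 0)))"
  proof (rule wp_Seq, rule wp_For[where n = "length cs" and B = 15 and I = "\<lambda>i s1. reg s1 31 = length (?l i) \<and>
      (\<forall>c<length (?l i). arr s1 9 c = ?l i ! c) \<and> (\<forall>c. i \<le> c \<longrightarrow> c < length cs \<longrightarrow> arr s1 9 c = cs ! c) \<and> (\<forall>x. arr s1 9 x \<le> k)"])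
    fix i s1 t1
    assume i: "i < length cs" and a: "agree (insert 23 (wregs ?c)) (warrs ?c) ?s s1" "reg s1 23 = i"
      and I: "reg s1 31 = length (?l i) \<and> (\<forall>c<length (?l i). arr s1 9 c = ?l i ! c) \<and>
        (\<forall>c. i \<le> c \<longrightarrow> c < length cs \<longrightarrow> arr s1 9 c = cs ! c) \<and> (\<forall>x. arr s1 9 x \<le> k)"
    have 4: "arr s1 4 = arr s 4" using a by (simp add: agree_def)
    have lS: "?l (Suc i) = ?l i @ (if arr s 4 i \<noteq> 0 then [cs ! i] else [])" by simp
    have iW: "i \<le> W" "length (?l i) \<le> W" "Suc (length (?l i)) \<le> W" "arr s 4 i \<le> W"
      using i N len[of i] piv[of i] by (intro smallN; simp)+
    have csk: "cs ! i \<le> k" "arr s1 9 i = cs ! i" using I i by (metis order_refl)+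
    show "wp W ?c (\<lambda>s2 t2. (reg s2 31 = length (?l (Suc i)) \<and> (\<forall>c<length (?l (Suc i)). arr s2 9 c = ?l (Suc i) ! c) \<and>
        (\<forall>c. Suc i \<le> c \<longrightarrow> c < length cs \<longrightarrow> arr s2 9 c = cs ! c) \<and> (\<forall>x. arr s2 9 x \<le> k)) \<and> t2 \<le> t1 + 15) s1 t1"
    proof (rule wp_If)
      show "fits W s1 (Cell 4 (Reg 23))" using 4 a iW by simp
      assume "val s1 (Cell 4 (Reg 23)) \<noteq> 0"
      then have nz: "arr s 4 i \<noteq> 0" using 4 a by simp
      show "wp W (Store 9 (Reg 31) (Cell 9 (Reg 23)) ;; Assign 31 (Reg 31 [+] Const 1))
        (\<lambda>s2 t2. (reg s2 31 = length (?l (Suc i)) \<and> (\<forall>c<length (?l (Suc i)). arr s2 9 c = ?l (Suc i) ! c) \<and>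
        (\<forall>c. Suc i \<le> c \<longrightarrow> c < length cs \<longrightarrow> arr s2 9 c = cs ! c) \<and> (\<forall>x. arr s2 9 x \<le> k)) \<and> t2 \<le> t1 + 15) s1
        (t1 + (1 + cost (Cell 4 (Reg 23))))"
      proof (rule wp_Seq, rule wp_Store, goal_cases)
        case 3
        let ?s2 = "s1\<lparr>arr := (arr s1)(9 := (arr s1 9)(length (?l i) := cs ! i))\<rparr>"
        have s2: "s1\<lparr>arr := (arr s1)(9 := (arr s1 9)(val s1 (Reg 31) := val s1 (Cell 9 (Reg 23))))\<rparr> = ?s2"
          using I a csk by simp
        have A: "arr ?s2 9 c = (?l i @ [cs ! i]) ! c" if "c < Suc (length (?l i))" for c
          using that I by (cases "c = length (?l i)") (auto simp: nth_append)
        have B: "arr ?s2 9 c = cs ! c" if "Suc i \<le> c" "c < length cs" for c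
          using that I len[of i] by auto
        have C: "arr ?s2 9 x \<le> k" for x using I csk by simp
        have lS': "?l (Suc i) = ?l i @ [cs ! i]" using lS nz by simp
        show ?case unfolding s2 lS'
          by (rule wp_Assign) (use iW I A B C W1 in \<open>simp_all add: fun_upd_same del: fun_upd_apply\<close>)
      qed (use I a iW csk kW in auto)
    next
      assume "val s1 (Cell 4 (Reg 23)) = 0"
      then have "arr s 4 i = 0" using 4 a by simp
      then show "wp W Skip (\<lambda>s2 t2. (reg s2 31 = length (?l (Suc i)) \<and> (\<forall>c<length (?l (Suc i)). arr s2 9 c = ?l (Suc i) ! c) \<and>
        (\<forall>c. Suc i \<le> c \<longrightarrow> c < length cs \<longrightarrow> arr s2 9 c = cs ! c) \<and> (\<forall>x. arr s2 9 x \<le> k)) \<and> t2 \<le> t1 + 15) s1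
        (t1 + (1 + cost (Cell 4 (Reg 23))))"
        using I by (intro wp_Skip) auto
    qed
  next
    show "reg ?s 31 = length (?l 0) \<and> (\<forall>c<length (?l 0). arr ?s 9 c = ?l 0 ! c) \<and>
      (\<forall>c. 0 \<le> c \<longrightarrow> c < length cs \<longrightarrow> arr ?s 9 c = cs ! c) \<and> (\<forall>x. arr ?s 9 x \<le> k)" using h' by simp
    fix s1 t1
    assume a: "agree (insert 23 (wregs ?c)) (warrs ?c) ?s s1"
      and I: "reg s1 31 = length (?l (length cs)) \<and> (\<forall>c<length (?l (length cs)). arr s1 9 c = ?l (length cs) ! c) \<and>
        (\<forall>c. length cs \<le> c \<longrightarrow> c < length cs \<longrightarrow> arr s1 9 c = cs ! c) \<and> (\<forall>x. arr s1 9 x \<le> k)"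
      and t1: "t1 \<le> t + (1 + cost (Const 0)) + length cs * (15 + 8) + 6"
    show "wp W (Assign 30 (Reg 31)) Q s1 t1"
    proof (rule wp_Assign)
      show "fits W s1 (Reg 31)" using I len[of "length cs"] N smallN[of "length (?l (length cs))"] by simp
      show "Q (s1\<lparr>reg := (reg s1)(30 := val s1 (Reg 31))\<rparr>) (t1 + (1 + cost (Reg 31)))"
      proof (rule Q)
        have "set (?l (length cs)) \<subseteq> set cs" by auto
        moreover have "distinct (?l (length cs))"
          using h' by (auto simp: distinct_map inj_on_def nth_eq_iff_index_eq)
        ultimately show "holds_candidates N (?l (length cs)) pos (s1\<lparr>reg := (reg s1)(30 := val s1 (Reg 31))\<rparr>)"
          unfolding holds_candidates_def
          using a I h' by (auto simp: agree_def clean_def)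
        show "t1 + (1 + cost (Reg 31)) \<le> t + 23 * N + 10" using t1 N by simp
      qed
    qed
  qed (use h' N smallN[of "length cs"] W1 in auto)
  then show ?thesis unfolding select_pivots_def by - (rule wp_Seq, rule wp_Assign, simp_all)
qed

end

context mult_program
begin

definition round :: com where
  "round = append_candidates ;; fill_candidates ;; gauss_jordan ;; select_pivots"

text \<open>The case g = 0 is treated apart, since the number of rounds involves a division by g;
  there the empty answer is correct and is already encoded by the zero memory. Otherwise the matrix
  size is a power of two at least 2g, room for a basis and \<open>g\<close> new cycles.\<close>

definition query :: com where
  "query =
     Assign 20 (Cell 1 (Const 0)) ;; Assign 21 (Cell 2 (Const 0)) ;;
     If (Reg 20)
       (sum_annotations ;; Assign 31 (Reg 20 [+] Reg 20) ;; power_of_two 31 ;;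
        Assign 33 (Bin Quo (Reg 21) (Reg 20) [+] Const 1) ;; For 29 33 round ;;
        Store 0 (Const 0) (Reg 30) ;; For 23 30 (Store 0 (Reg 23 [+] Const 1) (Cell 9 (Reg 23))))
       Skip"

definition round_time :: "nat \<Rightarrow> nat \<Rightarrow> nat" where
  "round_time N L = gj_time N L + 200 * (N * N) + 200"

lemma wregs_round: "wregs round \<subseteq> {2..14} \<union> {23, 24, 30, 31, 32, 34} \<union> {100..}"
  and warrs_round: "warrs round \<subseteq> {3..9} \<union> {100..}"
  using wregs_gauss_jordan warrs_gauss_jordan
  by (auto simp: round_def append_candidates_def fill_candidates_def select_pivots_def)

end

context query_program
begin

definition holds_basis :: "nat \<Rightarrow> nat list \<Rightarrow> nat \<Rightarrow> ram \<Rightarrow> bool" where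
  "holds_basis N js pos s \<longleftrightarrow> holds_candidates N js pos s \<and> length js \<le> g \<and> independent js \<and> spans js {..<pos}"

lemma holds_basis_reg: "holds_basis N js pos s \<Longrightarrow> r \<in> {22..29} \<Longrightarrow> holds_basis N js pos (s\<lparr>reg := (reg s)(r := x)\<rparr>)"
  by (auto simp: holds_basis_def holds_candidates_def clean_def)

text \<open>Each earlier cycle is in the span of the old basis, the old basis is among the
  candidates, and the candidates are in the span of the new pivots. So the discarded cycles never
  have to be looked at again.\<close>

lemma wp_round:
  assumes h: "holds_basis N js pos s" and W: "8 * X * X + 10 \<le> W" "word_ok N W"
    and L: "N = 2 ^ L" "2 * g \<le> N" "N < 4 * g"
    and Q: "\<And>s' t' js'. \<lbrakk>holds_basis N js' (min k (pos + g)) s'; t' \<le> t + round_time N L\<rbrakk> \<Longrightarrow> Q s' t'"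
  shows "wp W round Q s t"
proof -
  have W': "2 * N * N + 4 \<le> W" using W by (simp add: word_ok_def)
  have hc: "holds_candidates N js pos s" "length js \<le> g" "independent js" "spans js {..<pos}"
    using h by (auto simp: holds_basis_def)
  have N1: "1 \<le> N" using L by simp
  show ?thesis unfolding round_def
  proof (rule wp_Seq, rule wp_append_candidates[OF hc(1) W(1) hc(2)])
    fix s1 t1 m
    let ?cs = "js @ [pos..<pos + m]"
    assume 1: "holds_candidates N ?cs (pos + m) s1" and m: "pos + m = min k (pos + g)" "m \<le> g"
      and t1: "t1 \<le> t + 15 * g + 40"
    have len: "length ?cs \<le> N" using hc(2) m L by simp
    show "wp W (fill_candidates ;; gauss_jordan ;; select_pivots) Q s1 t1"
    proof (rule wp_Seq, rule wp_fill_candidates[OF 1 W(1) W' len L(3)])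
      fix s2 t2
      assume 2: "holds_candidates N ?cs (pos + m) s2"
        and M2: "\<And>e c. \<lbrakk>e < N; c < N\<rbrakk> \<Longrightarrow> arr s2 3 (e * N + c) =
          bit_code (if c < length ?cs \<and> e < g then w (?cs ! c) e else 0)"
        and t2: "t2 \<le> t1 + 43 * (N * N) + 6"
      note h2 = 2[unfolded holds_candidates_def]
      have b2: "arr s2 3 x \<le> 1" if "x < N * N" for x using M2 bit_code_le that by (metis idx_cases)
      have r2: "reg s2 1 = N" "clean s2" "\<And>x. x \<ge> N \<Longrightarrow> arr s2 4 x = 0" using h2 by blast+
      show "wp W (gauss_jordan ;; select_pivots) Q s2 t2"
      proof (rule wp_Seq, rule wp_gauss_jordan[OF r2(1) L(1) r2(2) b2 r2(3) W(2)])
        fix s3 t3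
        assume a3: "agree ({2..14} \<union> {100..}) ({3..7} \<union> {100..}) s2 s3" and gj: "gj_ok N s3"
          and em: "eliminated_matrix N (mat_of N s2) (mat_of N s3) (arr s3 4) (used_rows N s3)"
          and t3: "t3 \<le> t2 + gj_time N L + 30 * N + 40"
        have same: "reg s3 r = reg s2 r" if "20 \<le> r" "r < 100" for r using a3 that by (simp add: agree_def)
        have same_a: "arr s3 8 = arr s2 8" "arr s3 9 = arr s2 9" using a3 by (simp_all add: agree_def)
        have 3: "holds_candidates N ?cs (pos + m) s3"
          unfolding holds_candidates_def same_a
          using h2 same[of 20] same[of 21] same[of 30] same[of 32] gj eliminated_matrix_piv_outside[OF em]
          by (simp add: gj_ok_def)
        have M: "mat_of N s2 e c = (if c < length ?cs \<and> e < g then w (?cs ! c) e else 0)" if "e < N" "c < N" for e c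
          unfolding mat_of_def M2[OF that] by (rule of_nat_bit_code)
        let ?js = "map ((!) ?cs) (filter (\<lambda>c. arr s3 4 c \<noteq> 0) [0..<length ?cs])"
        have dc: "distinct ?cs" using h2 by blast
        have gN: "g \<le> N" using L by simp
        have pb: "length ?js \<le> g" by (rule pivot_basis(3)[OF em dc len gN M refl])
        have ind: "independent ?js" by (rule pivot_basis(4)[OF em dc len gN M refl])
        have span: "\<exists>T'\<subseteq>set ?js. \<forall>e<g. (\<Sum>j\<in>T. w j e) = (\<Sum>j\<in>T'. w j e)" if "T \<subseteq> set ?cs" for T
          by (rule pivot_basis(5)[OF em dc len gN M refl that])
        have sp: "spans ?js {..<pos + m}"
          unfolding spans_def
        proof
          fix j assume j: "j \<in> {..<pos + m}"
          have "\<exists>T\<subseteq>set ?cs. \<forall>e<g. w j e = (\<Sum>i\<in>T. w i e)"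
          proof (cases "j < pos")
            case True
            then obtain T where "T \<subseteq> set js" "\<forall>e<g. w j e = (\<Sum>i\<in>T. w i e)"
              using bspec[OF hc(4)[unfolded spans_def], of j] by auto
            then show ?thesis by (intro exI[of _ T]) auto
          next
            case False
            then have "{j} \<subseteq> set ?cs" using j by auto
            then show ?thesis by (intro exI[of _ "{j}"]) (simp add: sum_single)
          qed
          then obtain T where T: "T \<subseteq> set ?cs" "\<forall>e<g. w j e = (\<Sum>i\<in>T. w i e)" by blast
          from span[OF T(1)] T(2) show "\<exists>T\<subseteq>set ?js. \<forall>e<g. w j e = (\<Sum>i\<in>T. w i e)" by auto
        qed
        show "wp W select_pivots Q s3 t3"
        proof (rule wp_select_pivots[OF 3 W(1) W' len])
          show "c < N \<Longrightarrow> arr s3 4 c \<le> N" for c using gj by (simp add: gj_ok_def)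
          fix s4 t4
          assume 4: "holds_candidates N ?js (pos + m) s4" and t4: "t4 \<le> t3 + 23 * N + 10"
          show "Q s4 t4"
          proof (rule Q)
            show "holds_basis N ?js (min k (pos + g)) s4"
              unfolding holds_basis_def m(1)[symmetric] using 4 pb ind sp by blast
            have "N \<le> N * N" "1 \<le> N * N" using N1 by simp_all
            moreover have "2 * g \<le> N" by (rule L)
            ultimately show "t4 \<le> t + round_time N L" using t1 t2 t3 t4 le_square[of N]
              unfolding round_time_def by linarith
          qed
        qed
      qed
    qed
  qed
qed

definition query_time :: "nat \<Rightarrow> nat \<Rightarrow> nat" where
  "query_time N L = 60 * (t_size * (g + 1)) + 60 * k + 100 * g + 200 + (k div g + 1) * (round_time N L + 8)"

lemma wp_query:
  assumes s: "s = init [annotation_code g p \<sigma>s a, query_code zs]"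
    and W: "8 * X * X + 10 \<le> W" "\<And>N. N < 4 * g \<Longrightarrow> word_ok N W"
    and Q: "\<And>s' t' js. \<lbrakk>correct_answer K p \<sigma>s zs js; \<And>i. i < length (list_code js) \<Longrightarrow> arr s' 0 i = list_code js ! i;
      (g = 0 \<and> t' \<le> t + 20) \<or> (g \<ge> 1 \<and> (\<exists>L. 2 ^ L < 4 * g \<and> t' \<le> t + query_time (2 ^ L) L))\<rbrakk> \<Longrightarrow> Q s' t'"
  shows "wp W query Q s t"
proof -
  have XX: "X \<le> X * X" by simp
  have small: "x \<le> 4 * X \<Longrightarrow> x \<le> W" for x using W(1) XX by linarith
  have bd: "g \<le> X" "k \<le> X" "1 \<le> X" using bounds by linarith+
  have a1: "arr s 1 0 = g" using nth_annotation_code_simplex(1,2)[OF a g] by (simp add: s init_def)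
  have a2: "arr s 2 0 = k" by (simp add: s init_def query_code_def k)
  let ?s1 = "s\<lparr>reg := (reg s)(20 := g, 21 := k)\<rparr>"
  let ?T = "t + (1 + cost (Cell 1 (Const 0))) + (1 + cost (Cell 2 (Const 0)))"
  let ?B = "sum_annotations ;; Assign 31 (Reg 20 [+] Reg 20) ;; power_of_two 31 ;;
        Assign 33 (Bin Quo (Reg 21) (Reg 20) [+] Const 1) ;; For 29 33 round ;;
        Store 0 (Const 0) (Reg 30) ;; For 23 30 (Store 0 (Reg 23 [+] Const 1) (Cell 9 (Reg 23)))"
  have main: "wp W (If (Reg 20) ?B Skip) Q ?s1 ?T"
  proof (rule wp_If)
    show "fits W ?s1 (Reg 20)" using small[of g] bd by simp
    assume "val ?s1 (Reg 20) = 0"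
    then have g0: "g = 0" by simp
    have "correct_answer K p \<sigma>s zs []"
      by (rule correct_answerI[OF a valid w_def]) (use g0 g in auto)
    then show "wp W Skip Q ?s1 (?T + (1 + cost (Reg 20)))"
      by (intro wp_Skip, rule Q[where js = "[]"]) (use g0 s in \<open>simp_all add: list_code_def init_def\<close>)
  next
    assume "val ?s1 (Reg 20) \<noteq> 0"
    then have g1: "1 \<le> g" by simp
    show "wp W ?B Q ?s1 (?T + (1 + cost (Reg 20)))"
    proof (rule wp_Seq, rule wp_sum_annotations[OF _ _ _ _ _ W(1)])
      fix s2 t2
      assume a2: "agree {22, 23, 24, 26, 27, 28} {8} ?s1 s2"
        and ann: "\<And>i e. \<lbrakk>i < k; e < g\<rbrakk> \<Longrightarrow> arr s2 8 (i * g + e) = bit_code (w i e)" "\<And>x. arr s2 8 x \<le> 1"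
        and t2: "t2 \<le> ?T + (1 + cost (Reg 20)) + 60 * (t_size * (g + 1)) + 60 * k + 60"
      let ?s3 = "s2\<lparr>reg := (reg s2)(31 := g + g)\<rparr>"
      have r2: "reg s2 20 = g" "reg s2 21 = k" using a2 by (simp_all add: agree_def)
      have "wp W (power_of_two 31 ;; Assign 33 (Bin Quo (Reg 21) (Reg 20) [+] Const 1) ;; For 29 33 round ;;
        Store 0 (Const 0) (Reg 30) ;; For 23 30 (Store 0 (Reg 23 [+] Const 1) (Cell 9 (Reg 23)))) Q ?s3
        (t2 + (1 + cost (Reg 20 [+] Reg 20)))"
      proof (rule wp_Seq, rule wp_power_of_two[where m = "g + g"])
        show "2 * (g + g) \<le> W" using small[of "2 * (g + g)"] bd by simp
        fix s4 t4 L
        assume a4: "agree {1, 22} {} ?s3 s4" and L: "reg s4 1 = 2 ^ L" "g + g \<le> 2 ^ L" "2 ^ L < 2 * (g + g)"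
          and t4: "t4 \<le> t2 + (1 + cost (Reg 20 [+] Reg 20)) + 28 * (g + g) + 8"
        define N :: nat where "N = 2 ^ L"
        have N: "N = 2 ^ L" "2 * g \<le> N" "N < 4 * g" using L by (simp_all add: N_def)
        have wok: "word_ok N W" using W(2) N by blast
        define R where "R = k div g + 1"
        \<comment> \<open>\<open>R\<close> exceeds k / g, so \<open>R\<close> rounds of
          \<open>g\<close> cycles exhaust the list.\<close>
        have Rg: "k \<le> R * g"
        proof -
          have "k mod g < g" using g1 by simp
          moreover have "R * g = k div g * g + g" by (simp add: R_def)
          ultimately show ?thesis using div_mult_mod_eq[of k g] by linarith
        qed
        have RX: "R \<le> 2 * X" using bd le_trans[OF div_le_dividend[of k g], of X] by (simp add: R_def)
        let ?s5 = "s4\<lparr>reg := (reg s4)(33 := R)\<rparr>"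
        have r4: "reg s4 20 = g" "reg s4 21 = k" using a4 r2 by (simp_all add: agree_def)
        have z4: "reg s4 r = 0" if "r = 30 \<or> r = 32 \<or> r \<ge> 100" for r
          using a4 a2 that s by (auto simp: agree_def init_def)
        have za: "arr s4 b = (\<lambda>_. 0)" if "b \<noteq> 8" "b > 2" for b using a4 a2 that s by (auto simp: agree_def init_def)
        have hc: "holds_candidates N [] 0 ?s5"
          unfolding holds_candidates_def using L(1) r4 z4 za ann a4 by (auto simp: N_def clean_def agree_def)
        have hb: "holds_basis N [] 0 ?s5"
          unfolding holds_basis_def using hc by (simp add: independent_def spans_def)
        have "wp W (For 29 33 round ;; Store 0 (Const 0) (Reg 30) ;;
          For 23 30 (Store 0 (Reg 23 [+] Const 1) (Cell 9 (Reg 23)))) Q ?s5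
          (t4 + (1 + cost (Bin Quo (Reg 21) (Reg 20) [+] Const 1)))"
        proof (rule wp_Seq, rule wp_For[where n = R and B = "round_time N L" and
              I = "\<lambda>i s6. (\<exists>js. holds_basis N js (min k (i * g)) s6)"])
          show "\<exists>js. holds_basis N js (min k (0 * g)) ?s5" using hb by auto
          show "29 \<notin> wregs round" "33 \<notin> wregs round" using wregs_round by auto
          show "\<exists>js. holds_basis N js (min k (i * g)) (s'\<lparr>reg := (reg s')(29 := x)\<rparr>)"
            if "\<exists>js. holds_basis N js (min k (i * g)) s'" for i s' x
            using that holds_basis_reg[of N _ "min k (i * g)" s' 29 x] by auto
        next
          fix i s6 t6
          assume "\<exists>js. holds_basis N js (min k (i * g)) s6"
          then obtain js where js: "holds_basis N js (min k (i * g)) s6" by blast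
          have e: "min k (min k (i * g) + g) = min k (Suc i * g)" by simp
          show "wp W round (\<lambda>s7 t7. (\<exists>js. holds_basis N js (min k (Suc i * g)) s7) \<and> t7 \<le> t6 + round_time N L) s6 t6"
            by (rule wp_round[OF js W(1) wok N]) (use e in auto)
        next
          fix s6 t6
          assume a6: "agree (insert 29 (wregs round)) (warrs round) ?s5 s6"
            and ex: "\<exists>js. holds_basis N js (min k (R * g)) s6"
            and t6: "t6 \<le> t4 + (1 + cost (Bin Quo (Reg 21) (Reg 20) [+] Const 1)) + R * (round_time N L + 8) + 6"
          have "min k (R * g) = k" using Rg by simp
          then obtain js where hb6: "holds_basis N js k s6" using ex by metis
          have h6: "holds_candidates N js k s6" "length js \<le> g" "independent js" "spans js {..<k}"
            using hb6 by (auto simp: holds_basis_def)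
          note hc6 = h6(1)[unfolded holds_candidates_def]
          have ca: "correct_answer K p \<sigma>s zs js"
          proof (rule correct_answerI[OF a valid w_def])
            show "distinct js" "set js \<subseteq> {..<length zs}" using hc6 k by auto
            show "T = {}" if "T \<subseteq> set js" "\<And>e. e < betti K p \<Longrightarrow> (\<Sum>j\<in>T. w j e) = 0" for T
              using h6(3) that g unfolding independent_def by blast
            show "\<exists>T\<subseteq>set js. \<forall>e<betti K p. w j e = (\<Sum>i\<in>T. w i e)" if "j < length zs" for j
              using h6(4) that g k unfolding spans_def by auto
          qed
          let ?s7 = "s6\<lparr>arr := (arr s6)(0 := (arr s6 0)(0 := length js))\<rparr>"
          have jW: "length js \<le> W" "Suc (length js) \<le> W" using h6(2) bd by (intro small; simp)+
          have "wp W (For 23 30 (Store 0 (Reg 23 [+] Const 1) (Cell 9 (Reg 23)))) Q ?s7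
            (t6 + (1 + cost (Const 0) + cost (Reg 30)))"
          proof (rule wp_For_fill1[where S = "length js" and idx = "\<lambda>c. c + 1" and v = "\<lambda>c. js ! c"])
            fix s8 c assume b: "agree {23} {0} ?s7 s8" "reg s8 23 = c" "c < length js"
            have "js ! c < k" using nth_mem[OF b(3)] hc6 by blast
            moreover have "arr s8 9 c = js ! c" using b hc6 by (simp add: agree_def)
            ultimately show "val s8 (Reg 23 [+] Const 1) = c + 1 \<and> val s8 (Cell 9 (Reg 23)) = js ! c \<and>
                fits W s8 (Reg 23 [+] Const 1) \<and> fits W s8 (Cell 9 (Reg 23))"
              using b jW small[of k] bd by simp
          next
            fix s' :: ram and t'
            assume b: "\<And>c. c < length js \<Longrightarrow> arr s' 0 (c + 1) = js ! c"
              "\<And>x. (\<And>c. c < length js \<Longrightarrow> x \<noteq> c + 1) \<Longrightarrow> arr s' 0 x = arr ?s7 0 x"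
              and t': "t' \<le> t6 + (1 + cost (Const 0) + cost (Reg 30)) + length js * (cost (Reg 23 [+] Const 1) + cost (Cell 9 (Reg 23)) + 9) + 6"
            show "Q s' t'"
            proof (rule Q[OF ca])
              show "arr s' 0 i = list_code js ! i" if "i < length (list_code js)" for i
                using that b(1)[of "i - 1"] b(2)[of 0] by (cases i) (simp_all add: list_code_def)
              have "length js * 14 \<le> g * 14" using h6(2) by simp
              moreover have "t' \<le> t6 + 3 + length js * 14 + 6" using t' by simp
              moreover have "t6 \<le> t4 + 6 + R * (round_time N L + 8) + 6" using t6 by simp
              moreover have "t4 \<le> t2 + 4 + 56 * g + 8" using t4 by simp
              moreover have "t2 \<le> t + 8 + 60 * (t_size * (g + 1)) + 60 * k + 60" using t2 by simp
              moreover have "query_time N L = 60 * (t_size * (g + 1)) + 60 * k + 100 * g + 200 + R * (round_time N L + 8)"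
                by (simp only: query_time_def R_def)
              ultimately have "t' \<le> t + query_time N L" by linarith
              then show "(g = 0 \<and> t' \<le> t + 20) \<or> (g \<ge> 1 \<and> (\<exists>L. 2 ^ L < 4 * g \<and> t' \<le> t + query_time (2 ^ L) L))"
                using g1 N by auto
            qed
          qed (use hc6 jW small[of 1] bd in auto)
          then show "wp W (Store 0 (Const 0) (Reg 30) ;; For 23 30 (Store 0 (Reg 23 [+] Const 1) (Cell 9 (Reg 23)))) Q s6 t6"
            using hc6 jW by - (rule wp_Seq, rule wp_Store, simp_all)
        qed (use RX small[of R] small[of 1] bd in auto)
        then show "wp W (Assign 33 (Bin Quo (Reg 21) (Reg 20) [+] Const 1) ;; For 29 33 round ;;
          Store 0 (Const 0) (Reg 30) ;; For 23 30 (Store 0 (Reg 23 [+] Const 1) (Cell 9 (Reg 23)))) Q s4 t4"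
          using r4 small[of g] small[of k] small[of R] small[of 1] small[of "k div g"] RX bd
          by - (rule wp_Seq, rule wp_Assign, simp_all add: R_def)
      qed (use g1 in simp_all)
      then show "wp W (Assign 31 (Reg 20 [+] Reg 20) ;; power_of_two 31 ;; Assign 33 (Bin Quo (Reg 21) (Reg 20) [+] Const 1) ;;
        For 29 33 round ;; Store 0 (Const 0) (Reg 30) ;; For 23 30 (Store 0 (Reg 23 [+] Const 1) (Cell 9 (Reg 23)))) Q s2 t2"
        using r2 small[of g] small[of "g + g"] bd by - (rule wp_Seq, rule wp_Assign, simp_all)
    qed (use s in \<open>simp_all add: init_def fun_eq_iff\<close>)
  qed
  show ?thesis unfolding query_def
    by (rule wp_Seq, rule wp_Assign, use a1 small[of g] bd in simp, rule wp_Seq, rule wp_Assign,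
        use a2 small[of k] bd in simp, use main a1 a2 in simp)
qed

end

section \<open>Asymptotic bounds for word sizes and running times\<close>

lemma mult_pow_le:
  fixes c X C :: nat
  assumes "c \<le> C" "e \<le> C" "1 \<le> X" shows "c * X ^ e \<le> C * X ^ C"
  using assms by (intro mult_le_mono power_increasing) auto

text \<open>All faces of a simplex belong to the complex, except the empty one, which accounts for
  the + 1.\<close>

lemma two_pow_card_le:
  assumes K: "simplicial_complex K" and \<sigma>: "\<sigma> \<in> K" shows "2 ^ card \<sigma> \<le> card K + 1"
proof -
  have f: "finite K" "finite \<sigma>" using K \<sigma> by (auto simp: simplicial_complex_def)
  have "Pow \<sigma> \<subseteq> insert {} K" using K \<sigma> unfolding simplicial_complex_def by blast
  then have "card (Pow \<sigma>) \<le> card (insert {} K)" using f by (intro card_mono) auto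
  then show ?thesis using f by (simp add: card_Pow card_insert_if split: if_splits)
qed

lemma square_le_powr:
  assumes "(2 :: real) < \<omega>" "1 \<le> x" shows "x * x \<le> x powr \<omega>"
proof -
  have "x * x = x powr 2" using assms by (simp add: power2_eq_square)
  also have "\<dots> \<le> x powr \<omega>" using assms by (intro powr_mono) auto
  finally show ?thesis .
qed

lemma two_pow_powr: "(2 ^ l) powr x = ((2 :: real) powr x) ^ l"
proof -
  have "(2 ^ l) powr x = ((2 :: real) powr real l) powr x" by (simp add: powr_realpow)
  also have "\<dots> = (2 powr x) powr real l" by (simp only: powr_powr mult.commute)
  also have "\<dots> = (2 powr x) ^ l" by (rule powr_realpow) simp
  finally show ?thesis .
qed

context mult_program
begin

text \<open>Sizes up to 4X suffice, since queries use matrices of size below 4g and the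
  preprocessing below 2n. The constant serves both as coefficient and as exponent, so it must
  dominate the coefficient and the degree of each polynomial; \<open>E\<close> rounds \<omega> up to
  a natural exponent.\<close>

lemma word_bound:
  obtains C where "\<And>D X. \<lbrakk>C \<le> D; 1 \<le> X\<rbrakk> \<Longrightarrow> 8 * X * X + 10 \<le> D * X ^ D"
    "\<And>D X N. \<lbrakk>C \<le> D; 1 \<le> X; N \<le> 4 * X\<rbrakk> \<Longrightarrow> word_ok N (D * X ^ D)"
proof -
  define E where "E = nat \<lceil>\<omega>\<rceil>"
  define C where "C = 36 + C0 * 96 ^ C0 + 2 * C0 + C0 * 4 ^ E + E"
  have C: "18 \<le> C" "36 \<le> C" "2 \<le> C" "C0 * 96 ^ C0 \<le> C" "2 * C0 \<le> C" "C0 * 4 ^ E \<le> C" "E \<le> C"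
    by (simp_all add: C_def)
  have "8 * X * X + 10 \<le> D * X ^ D" if D: "C \<le> D" "1 \<le> X" for D X
  proof -
    have "8 * X * X + 10 \<le> 18 * X ^ 2" using le_square[of X] D by (simp add: power2_eq_square)
    also have "\<dots> \<le> D * X ^ D" using C D by (intro mult_pow_le) auto
    finally show ?thesis .
  qed
  moreover have "word_ok N (D * X ^ D)" if D: "C \<le> D" "1 \<le> X" and N: "N \<le> 4 * X" for D X N
  proof -
    have "2 * N * N + 4 \<le> 2 * (4 * X) * (4 * X) + 4" using N by (intro add_mono mult_mono) auto
    also have "\<dots> \<le> 36 * X ^ 2" using D by (simp add: power2_eq_square)
    also have "\<dots> \<le> D * X ^ D" using C D by (intro mult_pow_le) auto
    finally have 1: "2 * N * N + 4 \<le> D * X ^ D" .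
    have "word_need N \<le> word_need (4 * X)" by (rule word_need_mono[OF N])
    also have "\<dots> = C0 * (96 * X ^ 2) ^ C0" by (simp add: word_need_def power2_eq_square)
    also have "\<dots> = C0 * 96 ^ C0 * X ^ (2 * C0)" by (simp add: power_mult_distrib power_mult)
    also have "\<dots> \<le> D * X ^ D" using C D by (intro mult_pow_le) auto
    finally have 2: "word_need N \<le> D * X ^ D" .
    have "real (4 * X) powr \<omega> \<le> real (4 * X) powr real E" using D by (intro powr_mono) (auto simp: E_def real_nat_ceiling_ge)
    also have "\<dots> = real ((4 * X) ^ E)" using D by (simp add: powr_realpow)
    finally have "real C0 * real (4 * X) powr \<omega> \<le> real (C0 * (4 * X) ^ E)" by (simp add: mult_left_mono)
    then have "tm (4 * X) \<le> C0 * (4 * X) ^ E" unfolding tm_def by linarith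
    then have "tm N \<le> C0 * (4 * X) ^ E" using tm_mono[OF N] by linarith
    also have "\<dots> = C0 * 4 ^ E * X ^ E" by (simp add: power_mult_distrib)
    also have "\<dots> \<le> D * X ^ D" using C D by (intro mult_pow_le) auto
    finally have "tm N \<le> D * X ^ D" .
    then show ?thesis using 1 2 by (simp add: word_ok_def)
  qed
  ultimately show ?thesis using that by blast
qed

text \<open>The updates at level l cost of the order (N / 2^l) (2^l)^\<omega>, which is N q^l with q
  = 2^(\<omega>-1). The recurrence T(l+1) = 2 T(l) + c N q^l stays below A N q^l as soon as A q is
  at least 2 A + c; since q > 2, such an A exists. At the top level, N q^L equals
  N^\<omega>.\<close>

lemma gj_time_bound:
  obtains A where "0 \<le> A" "\<And>L. real (gj_time (2 ^ L) L) \<le> A * (2 ^ L) powr \<omega>"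
proof -
  define c where "c = 2 * (real (block_const + 80) * (1 + real C0)) + 100"
  define q where "q = 2 powr (\<omega> - 1)"
  \<comment> \<open>Chosen so that \<open>A * (q - 2)\<close> is at least \<open>c\<close>, for the
    induction step, and \<open>A\<close> at least \<open>c\<close>, for the base case.\<close>
  define A where "A = c + c / (q - 2)"
  have "2 powr 1 < q" unfolding q_def using omega by (intro powr_less_mono) auto
  then have q: "2 < q" by simp
  have c: "100 \<le> c" by (simp add: c_def)
  have cA: "c \<le> A" "0 \<le> A" using c q by (simp_all add: A_def)
  have cA2: "c \<le> A * (q - 2)"
    using c q by (simp add: A_def distrib_right)
  \<comment> \<open>The quadratic overhead of moving blocks and the product itself are both of order
    m^\<omega>. The 100 in \<open>c\<close> is kept back for the constant of the recurrence.\<close>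
  have up: "2 * real (update_time m) \<le> (c - 100) * real m powr \<omega>" if m: "1 \<le> m" for m
  proof -
    have "real (m * m) \<le> real m powr \<omega>" using square_le_powr[OF omega, of "real m"] m by simp
    moreover have "real (tm m) \<le> real C0 * real m powr \<omega>" by (simp add: tm_def)
    ultimately have "real (m * m + tm m) \<le> (1 + real C0) * real m powr \<omega>" by (simp add: distrib_right)
    then have "real (block_const + 80) * real (m * m + tm m) \<le> real (block_const + 80) * ((1 + real C0) * real m powr \<omega>)"
      by (rule mult_left_mono) simp
    moreover have "real (update_time m) = real (block_const + 80) * real (m * m + tm m)"
      by (simp only: update_time_def of_nat_mult)
    ultimately show ?thesis by (simp only: c_def) (simp add: mult.assoc)
  qed
  have "real (gj_time (2 ^ L) l) \<le> A * 2 ^ L * q ^ l" if "l \<le> L" for l L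
    using that
  proof (induction l)
    case 0
    have "real (gj_time (2 ^ L) 0) \<le> 100 * 2 ^ L" by simp
    also have "\<dots> \<le> A * 2 ^ L" using c cA by (intro mult_right_mono) auto
    finally show ?case by simp
  next
    case (Suc l)
    have "(2 ^ L :: nat) = 2 ^ (L - l) * 2 ^ l" using Suc.prems by (simp flip: power_add)
    then have d: "2 ^ L div 2 ^ l = (2 ^ (L - l) :: nat)" by simp
    have e: "2 ^ (L - l) * (2 ^ l) powr \<omega> = 2 ^ L * q ^ l"
    proof -
      have "(2 ^ l) powr \<omega> = (2 powr \<omega>) ^ l" by (rule two_pow_powr)
      also have "2 powr \<omega> = 2 * q" by (simp add: q_def powr_diff)
      finally have "2 ^ (L - l) * (2 ^ l) powr \<omega> = 2 ^ (L - l) * 2 ^ l * q ^ l" by (simp add: power_mult_distrib)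
      then show ?thesis using Suc.prems by (simp flip: power_add)
    qed
    have ql: "1 \<le> q ^ l" using q by simp
    have "2 * real (2 ^ L div 2 ^ l * update_time (2 ^ l)) = 2 ^ (L - l) * (2 * real (update_time (2 ^ l)))"
      unfolding d by simp
    also have "\<dots> \<le> 2 ^ (L - l) * ((c - 100) * real (2 ^ l) powr \<omega>)"
      by (rule mult_left_mono[OF up]) auto
    also have "\<dots> = (c - 100) * (2 ^ L * q ^ l)" using e by (simp add: mult.left_commute)
    finally have 1: "2 * real (2 ^ L div 2 ^ l * update_time (2 ^ l)) \<le> (c - 100) * (2 ^ L * q ^ l)" .
    have 2: "100 \<le> 100 * (2 ^ L * q ^ l)" using mult_mono[OF _ ql, of 1 "2 ^ L"] by simp
    have "real (gj_time (2 ^ L) (Suc l)) =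
        2 * real (gj_time (2 ^ L) l) + 2 * real (2 ^ L div 2 ^ l * update_time (2 ^ l)) + 100"
      by (simp only: gj_time.simps of_nat_add of_nat_mult of_nat_numeral)
    also have "\<dots> \<le> 2 * (A * 2 ^ L * q ^ l) + (c - 100) * (2 ^ L * q ^ l) + 100 * (2 ^ L * q ^ l)"
      using Suc 1 2 by (intro add_mono) auto
    also have "\<dots> = (2 * A + c) * (2 ^ L * q ^ l)" by (simp add: algebra_simps)
    also have "\<dots> \<le> (A * q) * (2 ^ L * q ^ l)"
      using cA2 q by (intro mult_right_mono) (auto simp: algebra_simps)
    finally show ?case by (simp add: mult_ac)
  qed
  from this[OF order_refl] have "real (gj_time (2 ^ L) L) \<le> A * (2 ^ L * q ^ L)" for L by (simp add: mult.assoc)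
  moreover have "2 ^ L * q ^ L = (2 ^ L) powr \<omega>" for L
  proof -
    have "2 * q = 2 powr \<omega>" by (simp add: q_def powr_diff)
    then have "2 ^ L * q ^ L = (2 powr \<omega>) ^ L" by (metis power_mult_distrib)
    then show ?thesis by (simp only: two_pow_powr)
  qed
  ultimately show ?thesis using that cA(2) by metis
qed

lemma gj_time_le:
  obtains A where "0 \<le> A" "\<And>L x. 2 ^ L \<le> x \<Longrightarrow> real (gj_time (2 ^ L) L) \<le> A * x powr \<omega>"
proof -
  obtain A where A: "0 \<le> A" "\<And>L. real (gj_time (2 ^ L) L) \<le> A * (2 ^ L) powr \<omega>"
    by (rule gj_time_bound) blast
  have "real (gj_time (2 ^ L) L) \<le> A * x powr \<omega>" if "2 ^ L \<le> x" for L x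
    using A(2)[of L] mult_left_mono[OF powr_mono2[OF _ _ that, of \<omega>] A(1)] omega by simp
  then show ?thesis using that A(1) by blast
qed

end

context complex_program
begin

text \<open>A simplex has at most log_2 (2n) vertices, and ln x is at most x^e / e. The exponent e =
  \<omega> - 2 is what remains of n^\<omega> after the n^2 entries of the matrices.\<close>

lemma card_simplex_bound:
  assumes "\<sigma> \<in> K"
  shows "real (card \<sigma>) \<le> (2 * real n) powr (\<omega> - 2) / ((\<omega> - 2) * ln 2)"
proof -
  have n: "card K = n" using dist set_s distinct_card by blast
  have n1: "1 \<le> n" using assms set_s by (cases \<sigma>s) auto
  have "2 ^ card \<sigma> \<le> 2 * n" using two_pow_card_le[OF K assms] n n1 by linarith
  then have "real (2 ^ card \<sigma>) \<le> real (2 * n)" by (rule of_nat_mono)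
  then have "ln (real (2 ^ card \<sigma>)) \<le> ln (real (2 * n))" using n1 by (subst ln_le_cancel_iff) auto
  then have "real (card \<sigma>) * ln 2 \<le> ln (real (2 * n))" by (simp add: ln_realpow)
  also have "\<dots> \<le> real (2 * n) powr (\<omega> - 2) / (\<omega> - 2)" using n1 omega by (intro ln_powr_bound) auto
  finally have "real (card \<sigma>) \<le> real (2 * n) powr (\<omega> - 2) / (\<omega> - 2) / ln 2" by (subst pos_le_divide_eq) auto
  then show ?thesis by simp
qed

end

lemma (in mult_program) pre_time_le:
  obtains A where "0 \<le> A"
    "\<And>L n \<kappa>. \<lbrakk>1 \<le> n; 2 ^ L \<le> 2 * n; real \<kappa> \<le> (2 * real n) powr (\<omega> - 2) / ((\<omega> - 2) * ln 2)\<rbrakk> \<Longrightarrow>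
      real (pre_time (2 ^ L) L \<kappa>) \<le> A * real n powr \<omega>"
proof -
  obtain A where A: "0 \<le> A" "\<And>L x. 2 ^ L \<le> x \<Longrightarrow> real (gj_time (2 ^ L) L) \<le> A * x powr \<omega>"
    by (rule gj_time_le) blast
  \<comment> \<open>The first summand pays for \<kappa>, the second for the 1 in \<kappa> +
    1.\<close>
  define B where "B = 1000 / ((\<omega> - 2) * ln 2) + 1000"
  have B0: "0 \<le> B" using omega by (simp add: B_def)
  have "real (pre_time (2 ^ L) L \<kappa>) \<le> ((2 * A + B) * 2 powr \<omega> + 1000) * real n powr \<omega>"
    if n: "1 \<le> n" and L: "2 ^ L \<le> 2 * n" and \<kappa>: "real \<kappa> \<le> (2 * real n) powr (\<omega> - 2) / ((\<omega> - 2) * ln 2)" for L n \<kappa>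
  proof -
    let ?x = "2 * real n"
    have L': "2 ^ L \<le> ?x" using of_nat_mono[OF L, where ?'a = real] by simp
    have NN: "2 ^ L * 2 ^ L \<le> ?x powr 2" using mult_mono[OF L' L'] n by (simp add: power2_eq_square)
    have k1: "1000 * (real \<kappa> + 1) \<le> B * ?x powr (\<omega> - 2)"
      using \<kappa> ge_one_powr_ge_zero[of ?x "\<omega> - 2"] n omega by (simp add: B_def distrib_right)
    have "1000 * (real \<kappa> + 1) * (2 ^ L * 2 ^ L) \<le> B * ?x powr (\<omega> - 2) * ?x powr 2"
      by (rule mult_mono[OF k1 NN]) (use B0 in auto)
    also have "\<dots> = B * ?x powr \<omega>" by (simp only: mult.assoc flip: powr_add) simp
    finally have 1: "1000 * (real \<kappa> + 1) * (2 ^ L * 2 ^ L) \<le> B * ?x powr \<omega>" .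
    have 2: "1000 \<le> 1000 * real n powr \<omega>" using ge_one_powr_ge_zero[of "real n" \<omega>] n omega by simp
    have "real (pre_time (2 ^ L) L \<kappa>) = 2 * real (gj_time (2 ^ L) L) + 1000 * (real \<kappa> + 1) * (2 ^ L * 2 ^ L) + 1000"
      by (simp add: pre_time_def)
    also have "\<dots> \<le> 2 * (A * ?x powr \<omega>) + B * ?x powr \<omega> + 1000 * real n powr \<omega>"
      using A(2)[OF L'] 1 2 by linarith
    also have "\<dots> = ((2 * A + B) * 2 powr \<omega> + 1000) * real n powr \<omega>"
      by (simp add: powr_mult algebra_simps)
    finally show ?thesis .
  qed
  then show ?thesis using that[of "(2 * A + B) * 2 powr \<omega> + 1000"] A(1) B0 by simp
qed

lemma (in mult_program) round_time_le:
  obtains R where "0 \<le> R"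
    "\<And>L g. \<lbrakk>1 \<le> g; 2 ^ L \<le> 4 * g\<rbrakk> \<Longrightarrow> real (round_time (2 ^ L) L + 8) \<le> R * real g powr \<omega>"
proof -
  obtain A where A: "0 \<le> A" "\<And>L x. 2 ^ L \<le> x \<Longrightarrow> real (gj_time (2 ^ L) L) \<le> A * x powr \<omega>"
    by (rule gj_time_le) blast
  \<comment> \<open>The matrix size N is at most 4g, so 200 N^2 is at most 3200 g^2; the remaining
    208 are constants.\<close>
  have "real (round_time (2 ^ L) L + 8) \<le> (A * 4 powr \<omega> + 3408) * real g powr \<omega>"
    if g: "1 \<le> g" and L: "2 ^ L \<le> 4 * g" for L g
  proof -
    let ?x = "4 * real g"
    have L': "2 ^ L \<le> ?x" using of_nat_mono[OF L, where ?'a = real] by simp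
    have "2 ^ L * 2 ^ L \<le> 16 * (real g * real g)" using mult_mono[OF L' L'] g by simp
    moreover have "real g * real g \<le> real g powr \<omega>" using square_le_powr[OF omega, of "real g"] g by simp
    moreover have "1 \<le> real g powr \<omega>" using ge_one_powr_ge_zero[of "real g" \<omega>] g omega by simp
    moreover have "real (round_time (2 ^ L) L + 8) = real (gj_time (2 ^ L) L) + 200 * (2 ^ L * 2 ^ L) + 208"
      by (simp add: round_time_def)
    ultimately have "real (round_time (2 ^ L) L + 8) \<le> A * ?x powr \<omega> + 3408 * real g powr \<omega>"
      using A(2)[OF L'] by linarith
    then show ?thesis by (simp add: powr_mult algebra_simps)
  qed
  then show ?thesis using that[of "A * 4 powr \<omega> + 3408"] A(1) by simp
qed

text \<open>There are at most (g + k) / g rounds of order g^\<omega> each, which gives (g + k)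
  g^(\<omega>-1). As g is at least 1, this term also absorbs the linear and constant parts.\<close>

lemma (in query_program) query_time_le:
  assumes R: "real (round_time N L + 8) \<le> R * real g powr \<omega>" "0 \<le> R" and g: "1 \<le> g"
  shows "real (query_time N L) \<le>
    (R + 500) * (real t_size * real g + (real g + real k) * real g powr (\<omega> - 1))"
proof -
  define S where "S = (real g + real k) * real g powr (\<omega> - 1)"
  have q1: "1 \<le> real g powr (\<omega> - 1)" using ge_one_powr_ge_zero[of "real g" "\<omega> - 1"] g omega by simp
  have gk: "real g + real k \<le> S" using mult_left_mono[OF q1, of "real g + real k"] by (simp add: S_def)
  have "real (k div g + 1) \<le> (real g + real k) / real g"
    using of_nat_div_le_of_nat[of k g] g by (simp add: add_divide_distrib)
  then have "real (k div g + 1) * real (round_time N L + 8) \<le> (real g + real k) / real g * (R * real g powr \<omega>)"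
    using R by (intro mult_mono) auto
  also have "\<dots> = R * S" using g by (simp add: S_def powr_diff)
  finally have 1: "real (k div g + 1) * real (round_time N L + 8) \<le> R * S" .
  have "real t_size * 1 \<le> real t_size * real g" using g by (intro mult_left_mono) auto
  then have 2: "60 * (real t_size * (real g + 1)) \<le> 120 * (real t_size * real g)" by (simp add: algebra_simps)
  have "1 \<le> real g" using g by simp
  then have 3: "60 * real k + 100 * real g + 200 \<le> 300 * S" using gk of_nat_0_le_iff[of k, where ?'a = real] by linarith
  have 4: "0 \<le> R * (real t_size * real g)" "0 \<le> real t_size * real g" using R by simp_all
  have "real (query_time N L) = 60 * (real t_size * (real g + 1)) + (60 * real k + 100 * real g + 200) +
      real (k div g + 1) * real (round_time N L + 8)"
    unfolding query_time_def by (simp only: of_nat_add of_nat_mult of_nat_numeral of_nat_1 add.assoc)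
  also have "\<dots> \<le> 120 * (real t_size * real g) + 300 * S + R * S" by (intro add_mono 1 2 3)
  also have "\<dots> \<le> R * (real t_size * real g) + 500 * (real t_size * real g) + 500 * S + R * S"
    using 4 gk \<open>1 \<le> real g\<close> by linarith
  also have "\<dots> = (R + 500) * (real t_size * real g + S)" by (simp add: algebra_simps)
  finally show ?thesis unfolding S_def .
qed

text \<open>Programs and constant are fixed before the complex, so all bounds are uniform. The
  maximum with 1 matters for g = 0, where the other expression is zero but the query program still
  takes a few steps.\<close>

theorem mainTheorem6:
  fixes \<omega> :: real
  assumes "\<omega> > 2" and "matrix_mult_in_time \<omega>"
  shows "\<exists>(pre :: com) (qry :: com) (C :: nat).
    \<forall>K p \<sigma>s n g.
      simplicial_complex K \<and> connected_complex K \<and> distinct \<sigma>s \<and> set \<sigma>s = K \<and>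
      n = card K \<and> g = betti K p \<longrightarrow>
      (\<exists>a. annotation K p a \<and>
         computes_within pre C (complex_input p \<sigma>s) (real C * real n powr \<omega>)
           (annotation_code g p \<sigma>s a) \<and>
         (\<forall>zs k t. valid_query K p \<sigma>s zs \<and> k = length zs \<and> t = sum_list (map length zs) \<longrightarrow>
            (\<exists>js. correct_answer K p \<sigma>s zs js \<and>
               computes_within qry C [annotation_code g p \<sigma>s a, query_code zs]
                 (real C * max 1 (real t * real g + (real g + real k) * real g powr (\<omega> - 1)))
                 (list_code js))))"
proof -
  obtain c0 C0 where "mult_program c0 C0 \<omega>"
    using assms unfolding matrix_mult_in_time_def mult_program_def by blast
  then interpret mult_program c0 C0 \<omega> .
  obtain C1 where C1: "\<And>D X. \<lbrakk>C1 \<le> D; 1 \<le> X\<rbrakk> \<Longrightarrow> 8 * X * X + 10 \<le> D * X ^ D"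
    "\<And>D X N. \<lbrakk>C1 \<le> D; 1 \<le> X; N \<le> 4 * X\<rbrakk> \<Longrightarrow> word_ok N (D * X ^ D)"
    by (rule word_bound) blast
  obtain A where A: "0 \<le> A"
    "\<And>L n \<kappa>. \<lbrakk>1 \<le> n; 2 ^ L \<le> 2 * n; real \<kappa> \<le> (2 * real n) powr (\<omega> - 2) / ((\<omega> - 2) * ln 2)\<rbrakk> \<Longrightarrow>
      real (pre_time (2 ^ L) L \<kappa>) \<le> A * real n powr \<omega>"
    by (rule pre_time_le) blast
  obtain R where R: "0 \<le> R"
    "\<And>L g. \<lbrakk>1 \<le> g; 2 ^ L \<le> 4 * g\<rbrakk> \<Longrightarrow> real (round_time (2 ^ L) L + 8) \<le> R * real g powr \<omega>"
    by (rule round_time_le) blast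
  \<comment> \<open>One constant for three purposes: the word bounds, the preprocessing time and the
    query time.\<close>
  define C where "C = C1 + nat \<lceil>A\<rceil> + nat \<lceil>R + 500\<rceil>"
  have C: "C1 \<le> C" "A \<le> real C" "R + 500 \<le> real C"
    using real_nat_ceiling_ge[of A] real_nat_ceiling_ge[of "R + 500"] by (simp_all only: C_def of_nat_add)
  show ?thesis
  proof (rule exI[of _ pre], rule exI[of _ query], rule exI[of _ C], intro allI impI, elim conjE)
    fix K p \<sigma>s n g
    assume cx: "simplicial_complex K" "connected_complex K" "distinct \<sigma>s" "set \<sigma>s = K"
      and n: "n = card K" and g: "g = betti K p"
    interpret complex_program c0 C0 \<omega> K p \<sigma>s by unfold_locales (use cx in auto)
    let ?X = "input_size (complex_input p \<sigma>s)"
    \<comment> \<open>Rounding down keeps this a bound, since numbers of vertices are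
      integers.\<close>
    define \<kappa> where "\<kappa> = nat \<lfloor>(2 * real n) powr (\<omega> - 2) / ((\<omega> - 2) * ln 2)\<rfloor>"
    have nl: "n = length \<sigma>s" using distinct_card[OF cx(3)] cx(4) n by simp
    have n1: "1 \<le> n" using cx n nl by (cases \<sigma>s) (auto simp: connected_complex_def)
    have Xn: "Suc n \<le> ?X" by (rule input_size_ge) (simp add: complex_input_def nl)
    have "0 \<le> (2 * real n) powr (\<omega> - 2) / ((\<omega> - 2) * ln 2)" using assms(1) by simp
    then have kap: "real \<kappa> \<le> (2 * real n) powr (\<omega> - 2) / ((\<omega> - 2) * ln 2)" by (simp add: \<kappa>_def)
    have card: "card (\<sigma>s ! j) \<le> \<kappa>" if "j < length \<sigma>s" for j
      unfolding \<kappa>_def nl using card_simplex_bound[of "\<sigma>s ! j"] nth_mem[OF that] cx(4) by (intro le_nat_floor) simp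
    have "8 * ?X * ?X + 10 \<le> C * ?X ^ C" by (rule C1(1)[OF C(1)]) (use Xn in simp)
    then have W: "2 * ?X + 8 \<le> C * ?X ^ C" using le_square[of ?X] by linarith
    have "wp (C * ?X ^ C) pre (\<lambda>s t. \<exists>a. annotation K p a \<and> real t \<le> real C * real n powr \<omega> \<and>
      (\<forall>i<length (annotation_code g p \<sigma>s a). arr s 0 i = annotation_code g p \<sigma>s a ! i)) (init (complex_input p \<sigma>s)) 0"
    proof (rule wp_pre[OF refl _ refl card W])
      show "1 \<le> length \<sigma>s" using n1 nl by simp
      show "word_ok N (C * ?X ^ C)" if "N < 2 * length \<sigma>s" for N
        by (rule C1(2)[OF C(1)]) (use that Xn nl in auto)
      fix s t a N L
      assume a: "annotation K p a" and N: "N = 2 ^ L" "N < 2 * length \<sigma>s" and t: "t \<le> 0 + pre_time N L \<kappa>"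
        and out: "\<And>i. i < length (annotation_code (betti K p) p \<sigma>s a) \<Longrightarrow> arr s 0 i = annotation_code (betti K p) p \<sigma>s a ! i"
      have "real t \<le> real (pre_time N L \<kappa>)" using t by simp
      also have "\<dots> \<le> A * real n powr \<omega>" using A(2)[OF n1 _ kap, of L] N nl by simp
      also have "\<dots> \<le> real C * real n powr \<omega>" by (intro mult_right_mono C(2)) simp
      finally show "\<exists>a. annotation K p a \<and> real t \<le> real C * real n powr \<omega> \<and>
          (\<forall>i<length (annotation_code g p \<sigma>s a). arr s 0 i = annotation_code g p \<sigma>s a ! i)"
        using a out g by blast
    qed
    then obtain a where a: "annotation K p a"
      and pre: "computes_within pre C (complex_input p \<sigma>s) (real C * real n powr \<omega>) (annotation_code g p \<sigma>s a)"
      unfolding wp_def computes_within_def by auto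
    show "\<exists>a. annotation K p a \<and>
         computes_within pre C (complex_input p \<sigma>s) (real C * real n powr \<omega>) (annotation_code g p \<sigma>s a) \<and>
         (\<forall>zs k t. valid_query K p \<sigma>s zs \<and> k = length zs \<and> t = sum_list (map length zs) \<longrightarrow>
            (\<exists>js. correct_answer K p \<sigma>s zs js \<and>
               computes_within query C [annotation_code g p \<sigma>s a, query_code zs]
                 (real C * max 1 (real t * real g + (real g + real k) * real g powr (\<omega> - 1)))
                 (list_code js)))"
    proof (intro exI[of _ a] conjI a pre allI impI, elim conjE)
      fix zs k t
      assume zs: "valid_query K p \<sigma>s zs" and k: "k = length zs" and t: "t = sum_list (map length zs)"
      let ?ins = "[annotation_code g p \<sigma>s a, query_code zs]"
      interpret query_program c0 C0 \<omega> K p \<sigma>s a zs g k "input_size ?ins"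
        by unfold_locales (use a zs g k in auto)
      let ?X = "input_size ?ins"
      let ?T = "real t * real g + (real g + real k) * real g powr (\<omega> - 1)"
      have T: "t_size = t" by (simp add: t_size_def t)
      have gX: "Suc g \<le> ?X" by (rule bounds(1))
      have "wp (C * ?X ^ C) query (\<lambda>s t'. \<exists>js. correct_answer K p \<sigma>s zs js \<and> real t' \<le> real C * max 1 ?T \<and>
        (\<forall>i<length (list_code js). arr s 0 i = list_code js ! i)) (init ?ins) 0"
      proof (rule wp_query[OF refl])
        show "8 * ?X * ?X + 10 \<le> C * ?X ^ C" by (rule C1(1)[OF C(1)]) (use gX in simp)
        show "word_ok N (C * ?X ^ C)" if "N < 4 * g" for N
          by (rule C1(2)[OF C(1)]) (use that gX in auto)
        fix s t' js
        assume js: "correct_answer K p \<sigma>s zs js" and out: "\<And>i. i < length (list_code js) \<Longrightarrow> arr s 0 i = list_code js ! i"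
          and time: "g = 0 \<and> t' \<le> 0 + 20 \<or> g \<ge> 1 \<and> (\<exists>L. 2 ^ L < 4 * g \<and> t' \<le> 0 + query_time (2 ^ L) L)"
        have "real t' \<le> (R + 500) * max 1 ?T" using time
        proof (elim disjE conjE exE)
          assume "t' \<le> 0 + 20"
          then have "real t' \<le> (R + 500) * 1" using R(1) by simp
          also have "\<dots> \<le> (R + 500) * max 1 ?T" using R(1) by (intro mult_left_mono) auto
          finally show ?thesis .
        next
          fix L assume "1 \<le> g" and L: "2 ^ L < 4 * g" "t' \<le> 0 + query_time (2 ^ L) L"
          have "real t' \<le> real (query_time (2 ^ L) L)" using L by simp
          also have "\<dots> \<le> (R + 500) * ?T"
            using query_time_le[OF R(2)[OF \<open>1 \<le> g\<close> less_imp_le[OF L(1)]] R(1) \<open>1 \<le> g\<close>] unfolding T .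
          also have "\<dots> \<le> (R + 500) * max 1 ?T" using R(1) by (intro mult_left_mono) auto
          finally show ?thesis .
        qed
        also have "\<dots> \<le> real C * max 1 ?T" by (intro mult_right_mono C(3)) simp
        finally show "\<exists>js. correct_answer K p \<sigma>s zs js \<and> real t' \<le> real C * max 1 ?T \<and>
            (\<forall>i<length (list_code js). arr s 0 i = list_code js ! i)" using js out by blast
      qed
      then show "\<exists>js. correct_answer K p \<sigma>s zs js \<and> computes_within query C ?ins (real C * max 1 ?T) (list_code js)"
        unfolding wp_def computes_within_def by auto
    qed
  qed
qed

end
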